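(* Let $p$ be a prime and let $G$ be a nonabelian metacyclic $p$-group generated by two elements $\sigma,\tau$ with defining relations $\sigma^{p^a}=1$, $\tau^{p^b}=\sigma^{p^c}$, $\tau^{-1}\sigma\tau=\sigma^{k}$, where $k=\varepsilon+p^r$, $1\leq c\leq a$, $r\leq\min\{b,c\}$, and $\varepsilon=1$ if $p$ is odd, $\varepsilon=\pm1$ if $p=2$. Let $t\ge 0$ be an integer and let $$1\longrightarrow C_{p^t}\longrightarrow\widetilde G\longrightarrow G\longrightarrow 1$$ be a central extension of $G$ by the cyclic group $C_{p^t}$, i.e. $C_{p^t}\leq Z(\widetilde G)$. Assume $a\geq t$ and $b\geq t$, and assume that the pre-image of $\sigma^{-(k-1)}[\sigma,\tau]=\sigma^{-k}\tau^{-1}\sigma\tau$ in $\widetilde G$, that is, the element $\tilde\sigma^{-k}\tilde\tau^{-1}\tilde\sigma\tilde\tau\in C_{p^t}$ where $\tilde\sigma,\tilde\tau\in\widetilde G$ are pre-images of $\sigma,\tau$, has order $p^t$. Let $p^m=\exp(\widetilde G)$ be the exponent of $\widetilde G$ and let $e=\max\{m,r+t\}$. Let $K$ be a field such that either (i) $\operatorname{char}K=p$, or (ii) $\operatorname{char}K\neq p$, $K$ is infinite, and $K$ contains a primitive $p^e$-th root of unity. Then $K(\widetilde G)$ is rational over $K$.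
   Context: For a field $K$ and a finite group $H$, let $H$ act on the rational function field $K(x(g):g\in H)$ (in $|H|$ independent variables) by $K$-automorphisms via $h\cdot x(g)=x(hg)$ for $h,g\in H$; $K(H)$ denotes the fixed field $K(x(g):g\in H)^H$. A field extension $L/K$ is called rational if $L$ is purely transcendental over $K$. A group is metacyclic if it can be generated by two elements one of which generates a normal subgroup. $C_n$ denotes the cyclic group of order $n$, $Z(\cdot)$ the center, and $[\sigma,\tau]=\sigma^{-1}\tau^{-1}\sigma\tau$. The parameters $a,b,c,r$ are non-negative integers, subject to the usual restrictions from the classification of metacyclic $p$-groups; in particular the presentation is consistent: $\sigma$ has order exactly $p^a$ and $|G|=p^{a+b}$. *)

theory Defs
  imports
    "HOL-Algebra.Algebra"
    "HOL-Algebra.Algebraic_Closure_Type"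
    "HOL-Library.Poly_Mapping"
    "HOL-Computational_Algebra.Fraction_Field"
begin

section \<open>Multivariate polynomials\<close>

text \<open>
  A polynomial maps exponent vectors \<^typ>\<open>'v \<Rightarrow>\<^sub>0 nat\<close> to coefficients. The type is a copy of
  \<^typ>\<open>('v \<Rightarrow>\<^sub>0 nat) \<Rightarrow>\<^sub>0 'a\<close> because the library makes the latter an integral domain only for
  linearly ordered \<open>'v\<close>.
\<close>

typedef (overloaded) ('v, 'a) mpoly = "UNIV :: (('v \<Rightarrow>\<^sub>0 nat) \<Rightarrow>\<^sub>0 'a::zero) set"
  morphisms mapping_of MPoly ..

setup_lifting type_definition_mpoly

instantiation mpoly :: (type, comm_ring_1) comm_ring_1
begin

lift_definition zero_mpoly :: "('a, 'b) mpoly" is 0 .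
lift_definition one_mpoly :: "('a, 'b) mpoly" is 1 .
lift_definition plus_mpoly :: "('a, 'b) mpoly \<Rightarrow> ('a, 'b) mpoly \<Rightarrow> ('a, 'b) mpoly" is "(+)" .
lift_definition minus_mpoly :: "('a, 'b) mpoly \<Rightarrow> ('a, 'b) mpoly \<Rightarrow> ('a, 'b) mpoly" is "(-)" .
lift_definition uminus_mpoly :: "('a, 'b) mpoly \<Rightarrow> ('a, 'b) mpoly" is uminus .
lift_definition times_mpoly :: "('a, 'b) mpoly \<Rightarrow> ('a, 'b) mpoly \<Rightarrow> ('a, 'b) mpoly" is "(*)" .

instance
  by (intro_classes; transfer; simp add: algebra_simps)

end

lemma exponents_times_nonzero:
  fixes p q :: "('v \<Rightarrow>\<^sub>0 nat) \<Rightarrow>\<^sub>0 'a::idom"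
  assumes "p \<noteq> 0" "q \<noteq> 0"
  shows "p * q \<noteq> 0"
proof -
  define V where "V = (\<Union>m \<in> Poly_Mapping.keys p \<union> Poly_Mapping.keys q. Poly_Mapping.keys m)"
  have finV: "finite V"
    unfolding V_def by auto
  obtain f :: "'v \<Rightarrow> nat" where inj: "inj_on f V"
    using finite_imp_inj_to_nat_seg[OF finV] by blast
  define h :: "('v \<Rightarrow>\<^sub>0 nat) \<Rightarrow> (nat \<Rightarrow>\<^sub>0 nat)"
    where "h m = (\<Sum>v\<in>V. Poly_Mapping.single (f v) (Poly_Mapping.lookup m v))" for m
  have h_add: "h (m + n) = h m + h n" for m n
    by (simp add: h_def lookup_add single_add sum.distrib)
  have h_lookup: "Poly_Mapping.lookup (h m) (f v) = Poly_Mapping.lookup m v" if "v \<in> V" for m v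
  proof -
    have "Poly_Mapping.lookup (h m) (f v)
        = (\<Sum>w\<in>V. if w = v then Poly_Mapping.lookup m w else 0)"
      unfolding h_def lookup_sum lookup_single
      by (rule sum.cong) (use inj that in \<open>auto simp: when_def inj_on_def\<close>)
    then show ?thesis
      using finV that by simp
  qed
  have h_inj: "m = n"
    if "h m = h n" "m \<in> Poly_Mapping.keys p \<union> Poly_Mapping.keys q"
      "n \<in> Poly_Mapping.keys p \<union> Poly_Mapping.keys q" for m n
  proof (rule poly_mapping_eqI)
    fix v
    show "Poly_Mapping.lookup m v = Poly_Mapping.lookup n v"
    proof (cases "v \<in> V")
      case True
      then show ?thesis using h_lookup that(1) by metis
    next
      case False
      then have "v \<notin> Poly_Mapping.keys m" "v \<notin> Poly_Mapping.keys n"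
        using that unfolding V_def by blast+
      then show ?thesis by (simp add: in_keys_iff)
    qed
  qed
  have max: "\<exists>m \<in> Poly_Mapping.keys r. \<forall>n \<in> Poly_Mapping.keys r. h n \<le> h m"
    if "r \<noteq> 0" for r :: "('v \<Rightarrow>\<^sub>0 nat) \<Rightarrow>\<^sub>0 'a"
  proof -
    have ne: "h ` Poly_Mapping.keys r \<noteq> {}"
      using that by (metis image_is_empty keys_eq_empty poly_mapping_eqI in_keys_iff empty_iff lookup_zero)
    then have "Max (h ` Poly_Mapping.keys r) \<in> h ` Poly_Mapping.keys r"
      by (intro Max_in) auto
    then obtain m where "m \<in> Poly_Mapping.keys r" "h m = Max (h ` Poly_Mapping.keys r)"
      by force
    then show ?thesis
      by (intro bexI[of _ m]) auto
  qed
  obtain m0 where m0: "m0 \<in> Poly_Mapping.keys p" "\<And>n. n \<in> Poly_Mapping.keys p \<Longrightarrow> h n \<le> h m0"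
    using max[OF assms(1)] by blast
  obtain n0 where n0: "n0 \<in> Poly_Mapping.keys q" "\<And>n. n \<in> Poly_Mapping.keys q \<Longrightarrow> h n \<le> h n0"
    using max[OF assms(2)] by blast
  define s where "s = Poly_Mapping.single m0 (Poly_Mapping.lookup p m0)"
  define u where "u = Poly_Mapping.single n0 (Poly_Mapping.lookup q n0)"
  have keys_p': "Poly_Mapping.keys (p - s) \<subseteq> Poly_Mapping.keys p - {m0}"
    by (auto simp: s_def in_keys_iff lookup_minus lookup_single when_def split: if_splits)
  have keys_q': "Poly_Mapping.keys (q - u) \<subseteq> Poly_Mapping.keys q - {n0}"
    by (auto simp: u_def in_keys_iff lookup_minus lookup_single when_def split: if_splits)
  have split: "p * q = s * u + (s * (q - u) + (p - s) * q)"
    by (simp add: algebra_simps)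
  have "m0 + n0 \<notin> Poly_Mapping.keys (s * (q - u))"
  proof
    assume "m0 + n0 \<in> Poly_Mapping.keys (s * (q - u))"
    then obtain m n where mn: "m0 + n0 = m + n" "m \<in> Poly_Mapping.keys s"
      "n \<in> Poly_Mapping.keys (q - u)"
      using keys_mult[of s "q - u"] by blast
    then have "m = m0"
      by (auto simp: s_def split: if_splits)
    then show False
      using mn keys_q' by auto
  qed
  moreover have "m0 + n0 \<notin> Poly_Mapping.keys ((p - s) * q)"
  proof
    assume "m0 + n0 \<in> Poly_Mapping.keys ((p - s) * q)"
    then obtain m n where mn: "m0 + n0 = m + n" "m \<in> Poly_Mapping.keys (p - s)"
      "n \<in> Poly_Mapping.keys q"
      using keys_mult[of "p - s" q] by blast
    have "m \<in> Poly_Mapping.keys p" "m \<noteq> m0"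
      using mn(2) keys_p' by auto
    then have "h m < h m0"
      using m0 h_inj[of m m0] by (metis UnI1 order_le_imp_less_or_eq)
    then have "h (m + n) < h (m0 + n0)"
      using n0(2)[OF mn(3)] by (simp add: h_add add_less_le_mono)
    then show False
      using mn(1) by simp
  qed
  ultimately have "Poly_Mapping.lookup (p * q) (m0 + n0)
      = Poly_Mapping.lookup p m0 * Poly_Mapping.lookup q n0"
    unfolding split lookup_add by (simp add: s_def u_def mult_single in_keys_iff)
  moreover have "Poly_Mapping.lookup p m0 * Poly_Mapping.lookup q n0 \<noteq> 0"
    using m0(1) n0(1) by (simp add: in_keys_iff)
  ultimately show ?thesis
    by (metis lookup_zero)
qed

instance mpoly :: (type, idom) idom
proof
  fix p q :: "('a, 'b) mpoly"
  assume "p \<noteq> 0" "q \<noteq> 0"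
  then show "p * q \<noteq> 0"
    by transfer (rule exponents_times_nonzero)
qed

lift_definition mpoly_const :: "'a::comm_ring_1 \<Rightarrow> ('v, 'a) mpoly"
  is "\<lambda>c. Poly_Mapping.single 0 c" .

lift_definition mpoly_var :: "'v \<Rightarrow> ('v, 'a::comm_ring_1) mpoly"
  is "\<lambda>v. Poly_Mapping.single (Poly_Mapping.single v 1) 1" .

definition mpoly_coeffs :: "('v, 'a::comm_ring_1) mpoly \<Rightarrow> 'a set"
  where "mpoly_coeffs P = Poly_Mapping.range (mapping_of P)"

definition mpoly_vars :: "('v, 'a::comm_ring_1) mpoly \<Rightarrow> 'v set"
  where "mpoly_vars P = (\<Union>m \<in> Poly_Mapping.keys (mapping_of P). Poly_Mapping.keys m)"

definition monom_eval :: "('v \<Rightarrow> 'b::comm_ring_1) \<Rightarrow> ('v \<Rightarrow>\<^sub>0 nat) \<Rightarrow> 'b"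
  where "monom_eval x m = (\<Prod>v \<in> Poly_Mapping.keys m. x v ^ Poly_Mapping.lookup m v)"

text \<open>Apply \<open>f\<close> to the coefficients and substitute \<open>x v\<close> for each variable \<open>v\<close>.\<close>

definition mpoly_eval ::
    "('a::comm_ring_1 \<Rightarrow> 'b::comm_ring_1) \<Rightarrow> ('v \<Rightarrow> 'b) \<Rightarrow> ('v, 'a) mpoly \<Rightarrow> 'b"
  where "mpoly_eval f x P = (\<Sum>m \<in> Poly_Mapping.keys (mapping_of P).
           f (Poly_Mapping.lookup (mapping_of P) m) * monom_eval x m)"

definition mpoly_rename :: "('v \<Rightarrow> 'w) \<Rightarrow> ('v, 'a::comm_ring_1) mpoly \<Rightarrow> ('w, 'a) mpoly"
  where "mpoly_rename \<pi> = mpoly_eval mpoly_const (\<lambda>v. mpoly_var (\<pi> v))"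

locale coeff_hom =
  fixes f :: "'a::comm_ring_1 \<Rightarrow> 'b::comm_ring_1"
  assumes add: "f (u + w) = f u + f w"
    and mult: "f (u * w) = f u * f w"
    and one: "f 1 = 1"
begin

lemma zero: "f 0 = 0"
  using add[of 0 0] by simp

end

lemma monom_eval_superset:
  assumes "finite A" "Poly_Mapping.keys m \<subseteq> A"
  shows "monom_eval x m = (\<Prod>v\<in>A. x v ^ Poly_Mapping.lookup m v)"
  unfolding monom_eval_def
  by (rule prod.mono_neutral_left) (use assms in \<open>auto simp: in_keys_iff\<close>)

lemma monom_eval_add: "monom_eval x (m + n) = monom_eval x m * monom_eval x n"
proof -
  let ?A = "Poly_Mapping.keys m \<union> Poly_Mapping.keys n"
  have "monom_eval x (m + n) = (\<Prod>v\<in>?A. x v ^ Poly_Mapping.lookup (m + n) v)"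
    using keys_add[of m n] by (intro monom_eval_superset) auto
  also have "\<dots> = (\<Prod>v\<in>?A. x v ^ Poly_Mapping.lookup m v) * (\<Prod>v\<in>?A. x v ^ Poly_Mapping.lookup n v)"
    by (simp add: lookup_add power_add prod.distrib)
  also have "\<dots> = monom_eval x m * monom_eval x n"
    by (simp add: monom_eval_superset[of ?A])
  finally show ?thesis .
qed

lemma monom_eval_zero [simp]: "monom_eval x 0 = 1"
  by (simp add: monom_eval_def)

context coeff_hom
begin

lemma eval_superset:
  assumes "finite A" "Poly_Mapping.keys (mapping_of P) \<subseteq> A"
  shows "mpoly_eval f x P = (\<Sum>m\<in>A. f (Poly_Mapping.lookup (mapping_of P) m) * monom_eval x m)"
  unfolding mpoly_eval_def
  by (rule sum.mono_neutral_left) (use assms zero in \<open>auto simp: in_keys_iff\<close>)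

lemma eval_add: "mpoly_eval f x (P + Q) = mpoly_eval f x P + mpoly_eval f x Q"
proof -
  let ?A = "Poly_Mapping.keys (mapping_of P) \<union> Poly_Mapping.keys (mapping_of Q)"
  have "mpoly_eval f x (P + Q)
      = (\<Sum>m\<in>?A. f (Poly_Mapping.lookup (mapping_of (P + Q)) m) * monom_eval x m)"
    using keys_add[of "mapping_of P" "mapping_of Q"]
    by (intro eval_superset) (auto simp: plus_mpoly.rep_eq)
  also have "\<dots> = (\<Sum>m\<in>?A. f (Poly_Mapping.lookup (mapping_of P) m) * monom_eval x m)
      + (\<Sum>m\<in>?A. f (Poly_Mapping.lookup (mapping_of Q) m) * monom_eval x m)"
    by (simp add: plus_mpoly.rep_eq lookup_add add distrib_right sum.distrib)
  also have "\<dots> = mpoly_eval f x P + mpoly_eval f x Q"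
    by (simp add: eval_superset[of ?A])
  finally show ?thesis .
qed

lemma eval_zero: "mpoly_eval f x 0 = 0"
  by (simp add: mpoly_eval_def zero_mpoly.rep_eq)

lemma eval_sum: "mpoly_eval f x (\<Sum>i\<in>I. P i) = (\<Sum>i\<in>I. mpoly_eval f x (P i))"
  by (induction I rule: infinite_finite_induct) (simp_all add: eval_zero eval_add)

lemma eval_single: "mpoly_eval f x (MPoly (Poly_Mapping.single m u)) = f u * monom_eval x m"
  by (simp add: mpoly_eval_def MPoly_inverse zero)

lemma eval_const: "mpoly_eval f x (mpoly_const u) = f u"
  by (simp add: mpoly_const_def eval_single)

lemma eval_var: "mpoly_eval f x (mpoly_var v) = x v"
  by (simp add: mpoly_var_def eval_single one monom_eval_def)

lemma eval_one: "mpoly_eval f x 1 = 1"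
  by (simp add: mpoly_eval_def one_mpoly.rep_eq one)

end

lemma mpoly_expansion:
  "P = (\<Sum>m \<in> Poly_Mapping.keys (mapping_of P).
          MPoly (Poly_Mapping.single m (Poly_Mapping.lookup (mapping_of P) m)))"
proof -
  have sum_rep: "mapping_of (\<Sum>i\<in>I. F i) = (\<Sum>i\<in>I. mapping_of (F i))" for I and F :: "_ \<Rightarrow> ('a, 'b) mpoly"
    by (induction I rule: infinite_finite_induct) (simp_all add: zero_mpoly.rep_eq plus_mpoly.rep_eq)
  show ?thesis
    unfolding mapping_of_inject[symmetric] sum_rep
    by (rule poly_mapping_eqI)
      (simp add: lookup_sum MPoly_inverse lookup_single when_def in_keys_iff)
qed

context coeff_hom
begin

lemma eval_mult: "mpoly_eval f x (P * Q) = mpoly_eval f x P * mpoly_eval f x Q"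
proof -
  let ?S = "\<lambda>P m. MPoly (Poly_Mapping.single m (Poly_Mapping.lookup (mapping_of P) m))"
  let ?K = "\<lambda>P. Poly_Mapping.keys (mapping_of P)"
  have single: "mpoly_eval f x (?S P m * ?S Q n) = mpoly_eval f x (?S P m) * mpoly_eval f x (?S Q n)"
    for m n
    by (simp add: times_mpoly.abs_eq mult_single eval_single mult monom_eval_add algebra_simps
        eq_onp_same_args)
  have "P * Q = (\<Sum>m\<in>?K P. \<Sum>n\<in>?K Q. ?S P m * ?S Q n)"
    by (subst mpoly_expansion[of P], subst mpoly_expansion[of Q]) (simp add: sum_product)
  then have "mpoly_eval f x (P * Q)
      = (\<Sum>m\<in>?K P. mpoly_eval f x (?S P m)) * (\<Sum>n\<in>?K Q. mpoly_eval f x (?S Q n))"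
    by (simp only: eval_sum single sum_product)
  then show ?thesis
    by (simp only: eval_sum[symmetric] mpoly_expansion[symmetric])
qed

end

interpretation mpoly_const: coeff_hom "mpoly_const :: 'a::comm_ring_1 \<Rightarrow> ('v, 'a) mpoly"
proof
  show "mpoly_const (u + w) = (mpoly_const u + mpoly_const w :: ('v, 'a) mpoly)" for u w
    by transfer (simp add: single_add)
  show "mpoly_const (u * w) = (mpoly_const u * mpoly_const w :: ('v, 'a) mpoly)" for u w
    by transfer (simp add: mult_single)
  show "mpoly_const 1 = (1 :: ('v, 'a) mpoly)"
    by transfer simp
qed

lemma mpoly_rename_zero: "mpoly_rename \<pi> 0 = 0"
  and mpoly_rename_one: "mpoly_rename \<pi> 1 = 1"
  and mpoly_rename_add: "mpoly_rename \<pi> (P + Q) = mpoly_rename \<pi> P + mpoly_rename \<pi> Q"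
  and mpoly_rename_mult: "mpoly_rename \<pi> (P * Q) = mpoly_rename \<pi> P * mpoly_rename \<pi> Q"
  and mpoly_rename_const: "mpoly_rename \<pi> (mpoly_const u) = mpoly_const u"
  and mpoly_rename_var: "mpoly_rename \<pi> (mpoly_var v) = mpoly_var (\<pi> v)"
  unfolding mpoly_rename_def
  by (simp_all add: mpoly_const.eval_zero mpoly_const.eval_one mpoly_const.eval_add
      mpoly_const.eval_mult mpoly_const.eval_const mpoly_const.eval_var)

lemma MPoly_single_eq:
  "MPoly (Poly_Mapping.single m u) = mpoly_const u * monom_eval mpoly_var m"
proof (induction "\<Sum>v\<in>Poly_Mapping.keys m. Poly_Mapping.lookup m v" arbitrary: m)
  case 0
  then have "m = 0"
    by (intro poly_mapping_eqI) (auto simp: in_keys_iff)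
  then show ?case by (simp add: mpoly_const_def)
next
  case (Suc n)
  then obtain v where v: "v \<in> Poly_Mapping.keys m"
    by (metis sum.empty equals0I nat.distinct(1))
  define m' where "m' = m - Poly_Mapping.single v 1"
  have m: "m = Poly_Mapping.single v 1 + m'"
    using v by (intro poly_mapping_eqI)
      (auto simp: m'_def lookup_add lookup_minus lookup_single when_def in_keys_iff)
  have "(\<Sum>w\<in>Poly_Mapping.keys m. Poly_Mapping.lookup m w)
      = (\<Sum>w\<in>Poly_Mapping.keys m. (if w = v then 1 else 0) + Poly_Mapping.lookup m' w)"
    by (intro sum.cong) (auto simp: m lookup_add lookup_single when_def)
  also have "\<dots> = Suc (\<Sum>w\<in>Poly_Mapping.keys m. Poly_Mapping.lookup m' w)"
    using v by (simp add: sum.distrib)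
  also have "(\<Sum>w\<in>Poly_Mapping.keys m. Poly_Mapping.lookup m' w)
      = (\<Sum>w\<in>Poly_Mapping.keys m'. Poly_Mapping.lookup m' w)"
    by (rule sum.mono_neutral_right) (auto simp: m in_keys_iff lookup_add)
  finally have "n = (\<Sum>w\<in>Poly_Mapping.keys m'. Poly_Mapping.lookup m' w)"
    using Suc(2) by simp
  then have IH: "MPoly (Poly_Mapping.single m' u) = mpoly_const u * monom_eval mpoly_var m'"
    by (rule Suc(1))
  have "MPoly (Poly_Mapping.single m u) = mpoly_var v * MPoly (Poly_Mapping.single m' u)"
    by (simp add: m mpoly_var_def times_mpoly.abs_eq eq_onp_same_args mult_single)
  also have "\<dots> = mpoly_const u * (monom_eval mpoly_var (Poly_Mapping.single v 1) * monom_eval mpoly_var m')"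
    by (simp add: IH monom_eval_def)
  also have "\<dots> = mpoly_const u * monom_eval mpoly_var m"
    by (simp only: m monom_eval_add)
  finally show ?case .
qed

lemma mpoly_rename_id: "mpoly_rename (\<lambda>v. v) P = P"
  unfolding mpoly_rename_def mpoly_eval_def
  by (subst (3) mpoly_expansion) (simp add: MPoly_single_eq)

lemma mpoly_rename_comp:
  fixes P :: "('v, 'a::comm_ring_1) mpoly" and \<pi> :: "'v \<Rightarrow> 'w"
  shows "mpoly_rename \<rho> (mpoly_rename \<pi> P) = mpoly_rename (\<lambda>v. \<rho> (\<pi> v)) P"
proof -
  have pow: "mpoly_rename \<rho> (Q ^ n) = mpoly_rename \<rho> Q ^ n" for Q :: "('w, 'a) mpoly" and n
    by (induction n) (simp_all add: mpoly_rename_one mpoly_rename_mult)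
  have prod: "mpoly_rename \<rho> (\<Prod>i\<in>I. F i) = (\<Prod>i\<in>I. mpoly_rename \<rho> (F i))"
    for I and F :: "_ \<Rightarrow> ('w, 'a) mpoly"
    by (induction I rule: infinite_finite_induct) (simp_all add: mpoly_rename_one mpoly_rename_mult)
  have sum: "mpoly_rename \<rho> (\<Sum>i\<in>I. F i) = (\<Sum>i\<in>I. mpoly_rename \<rho> (F i))"
    for I and F :: "_ \<Rightarrow> ('w, 'a) mpoly"
    by (induction I rule: infinite_finite_induct) (simp_all add: mpoly_rename_zero mpoly_rename_add)
  show ?thesis
    unfolding mpoly_rename_def[of \<pi>] mpoly_rename_def[of "\<lambda>v. \<rho> (\<pi> v)"] mpoly_eval_def monom_eval_def
    by (simp add: sum prod pow mpoly_rename_mult mpoly_rename_const mpoly_rename_var)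
qed

lemma mpoly_rename_eq_0_iff:
  assumes "inj \<pi>"
  shows "mpoly_rename \<pi> P = 0 \<longleftrightarrow> P = 0"
proof
  assume "mpoly_rename \<pi> P = 0"
  then have "mpoly_rename (inv_into UNIV \<pi>) (mpoly_rename \<pi> P) = 0"
    by (simp add: mpoly_rename_zero)
  then show "P = 0"
    using assms by (simp add: mpoly_rename_comp mpoly_rename_id)
qed (simp add: mpoly_rename_zero)


section \<open>Rational functions and \<open>K(G)\<close>\<close>

type_synonym ('v, 'k) ratfun = "('v, 'k) mpoly fract"

definition ratfun_const :: "'k::field \<Rightarrow> ('v, 'k) ratfun"
  where "ratfun_const c = Fract (mpoly_const c) 1"

definition ratfun_var :: "'v \<Rightarrow> ('v, 'k::field) ratfun"
  where "ratfun_var v = Fract (mpoly_var v) 1"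

text \<open>The automorphism permuting the variables by \<open>\<pi>\<close>; meaningful for injective \<open>\<pi>\<close>.\<close>

definition ratfun_rename :: "('v \<Rightarrow> 'v) \<Rightarrow> ('v, 'k::field) ratfun \<Rightarrow> ('v, 'k) ratfun"
  where "ratfun_rename \<pi> f =
    (THE g. \<exists>P Q. Q \<noteq> 0 \<and> f = Fract P Q \<and> g = Fract (mpoly_rename \<pi> P) (mpoly_rename \<pi> Q))"

lemma ratfun_rename_Fract:
  fixes P Q :: "('v, 'k::field) mpoly"
  assumes "inj \<pi>" "Q \<noteq> 0"
  shows "ratfun_rename \<pi> (Fract P Q) = Fract (mpoly_rename \<pi> P) (mpoly_rename \<pi> Q)"
  unfolding ratfun_rename_def
proof (rule the_equality)
  fix g
  assume "\<exists>P' Q'. Q' \<noteq> 0 \<and> Fract P Q = Fract P' Q' \<and> g = Fract (mpoly_rename \<pi> P') (mpoly_rename \<pi> Q')"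
  then obtain P' Q' where *: "Q' \<noteq> 0" "Fract P Q = Fract P' Q'"
    "g = Fract (mpoly_rename \<pi> P') (mpoly_rename \<pi> Q')"
    by blast
  then have "P' * Q = P * Q'"
    using assms by (simp add: eq_fract)
  then have "mpoly_rename \<pi> P' * mpoly_rename \<pi> Q = mpoly_rename \<pi> P * mpoly_rename \<pi> Q'"
    by (metis mpoly_rename_mult)
  then show "g = Fract (mpoly_rename \<pi> P) (mpoly_rename \<pi> Q)"
    using * assms by (simp add: eq_fract mpoly_rename_eq_0_iff)
qed (use assms in blast)

lemma ratfun_rename_const: "inj \<pi> \<Longrightarrow> ratfun_rename \<pi> (ratfun_const c) = ratfun_const c"
  and ratfun_rename_var: "inj \<pi> \<Longrightarrow> ratfun_rename \<pi> (ratfun_var v) = ratfun_var (\<pi> v)"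
  by (simp_all add: ratfun_const_def ratfun_var_def ratfun_rename_Fract mpoly_rename_one
      mpoly_rename_const mpoly_rename_var)

lemma ratfun_rename_add:
  assumes "inj \<pi>"
  shows "ratfun_rename \<pi> (f + g) = ratfun_rename \<pi> f + ratfun_rename \<pi> g"
  by (cases f; cases g)
    (use assms in \<open>simp add: ratfun_rename_Fract mpoly_rename_add mpoly_rename_mult mpoly_rename_eq_0_iff\<close>)

lemma ratfun_rename_mult:
  assumes "inj \<pi>"
  shows "ratfun_rename \<pi> (f * g) = ratfun_rename \<pi> f * ratfun_rename \<pi> g"
  by (cases f; cases g)
    (use assms in \<open>simp add: ratfun_rename_Fract mpoly_rename_mult mpoly_rename_eq_0_iff\<close>)

text \<open>
  The type \<^typ>\<open>('g, 'k) ratfun\<close> has one variable for each element of the type \<open>'g\<close>, so the field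
  \<open>K(x(g) : g \<in> G)\<close> is the subfield generated by the constants and the variables indexed by
  \<^term>\<open>carrier G\<close>; the variables outside the carrier are left fixed by the action.
\<close>

definition subfield_generated :: "'l::field set \<Rightarrow> 'l set"
  where "subfield_generated S = generate_field ring_of_type_algebra S"

definition group_ratfuns :: "('g, 'm) monoid_scheme \<Rightarrow> ('g, 'k::field) ratfun set"
  where "group_ratfuns G = subfield_generated (range ratfun_const \<union> ratfun_var ` carrier G)"

definition left_translation :: "('g, 'm) monoid_scheme \<Rightarrow> 'g \<Rightarrow> 'g \<Rightarrow> 'g"
  where "left_translation G h g = (if g \<in> carrier G then h \<otimes>\<^bsub>G\<^esub> g else g)"

definition group_act ::
    "('g, 'm) monoid_scheme \<Rightarrow> 'g \<Rightarrow> ('g, 'k::field) ratfun \<Rightarrow> ('g, 'k) ratfun"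
  where "group_act G h = ratfun_rename (left_translation G h)"

definition noether_field :: "('g, 'm) monoid_scheme \<Rightarrow> ('g, 'k::field) ratfun set"
  where "noether_field G = {f \<in> group_ratfuns G. \<forall>h \<in> carrier G. group_act G h f = f}"

lemma inj_left_translation:
  assumes "group G" "h \<in> carrier G"
  shows "inj (left_translation G h)"
proof (rule injI)
  interpret group G by fact
  fix u v
  assume "left_translation G h u = left_translation G h v"
  then show "u = v"
    using assms(2) m_closed[of h u] m_closed[of h v]
    by (auto simp: left_translation_def split: if_splits)
qed

lemma group_act_var:
  assumes "group G" "h \<in> carrier G" "g \<in> carrier G"
  shows "group_act G h (ratfun_var g) = ratfun_var (h \<otimes>\<^bsub>G\<^esub> g)"
  using assms
  by (simp add: group_act_def ratfun_rename_var inj_left_translation) (simp add: left_translation_def)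


section \<open>Purely transcendental extensions\<close>

text \<open>Here \<open>K\<close> and \<open>L\<close> are subfields of an ambient field \<open>'l\<close>.\<close>

definition alg_independent :: "'l::field set \<Rightarrow> 'l set \<Rightarrow> bool"
  where "alg_independent K B \<longleftrightarrow>
    (\<forall>P :: ('l, 'l) mpoly. mpoly_coeffs P \<subseteq> K \<longrightarrow> mpoly_vars P \<subseteq> B \<longrightarrow>
       mpoly_eval (\<lambda>c. c) (\<lambda>b. b) P = 0 \<longrightarrow> P = 0)"

definition purely_transcendental :: "'l::field set \<Rightarrow> 'l set \<Rightarrow> bool"
  where "purely_transcendental K L \<longleftrightarrow>
    (\<exists>B \<subseteq> L. alg_independent K B \<and> L = subfield_generated (K \<union> B))"

definition primitive_root_of_unity :: "nat \<Rightarrow> 'k::field \<Rightarrow> bool"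
  where "primitive_root_of_unity n z \<longleftrightarrow> n > 0 \<and> z ^ n = 1 \<and> (\<forall>j. 0 < j \<and> j < n \<longrightarrow> z ^ j \<noteq> 1)"


section \<open>Groups\<close>

definition group_center :: "('g, 'm) monoid_scheme \<Rightarrow> 'g set"
  where "group_center G = {z \<in> carrier G. \<forall>g \<in> carrier G. z \<otimes>\<^bsub>G\<^esub> g = g \<otimes>\<^bsub>G\<^esub> z}"

definition group_exponent :: "('g, 'm) monoid_scheme \<Rightarrow> nat"
  where "group_exponent G = (LEAST n. n > 0 \<and> (\<forall>g \<in> carrier G. g [^]\<^bsub>G\<^esub> n = \<one>\<^bsub>G\<^esub>))"

definition metacyclic :: "('g, 'm) monoid_scheme \<Rightarrow> bool"
  where "metacyclic G \<longleftrightarrow> group G \<and>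
    (\<exists>u \<in> carrier G. \<exists>v \<in> carrier G. generate G {u, v} = carrier G \<and> generate G {u} \<lhd> G)"

definition central_extension ::
    "('c, 'n) monoid_scheme \<Rightarrow> ('c \<Rightarrow> 'h) \<Rightarrow> ('h, 'q) monoid_scheme \<Rightarrow> ('h \<Rightarrow> 'g) \<Rightarrow> ('g, 'm) monoid_scheme \<Rightarrow> bool"
  where "central_extension C \<iota> E \<pi> G \<longleftrightarrow>
    group C \<and> group E \<and> group G \<and> \<iota> \<in> mon C E \<and> \<pi> \<in> epi E G \<and>
    \<iota> ` carrier C = kernel E G \<pi> \<and> \<iota> ` carrier C \<subseteq> group_center E"

definition metacyclic_relations ::
    "nat \<Rightarrow> nat \<Rightarrow> nat \<Rightarrow> nat \<Rightarrow> int \<Rightarrow> ('g, 'm) monoid_scheme \<Rightarrow> 'g \<Rightarrow> 'g \<Rightarrow> bool"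
  where "metacyclic_relations p a b c k G \<sigma> \<tau> \<longleftrightarrow>
    \<sigma> [^]\<^bsub>G\<^esub> (p ^ a) = \<one>\<^bsub>G\<^esub> \<and>
    \<tau> [^]\<^bsub>G\<^esub> (p ^ b) = \<sigma> [^]\<^bsub>G\<^esub> (p ^ c) \<and>
    inv\<^bsub>G\<^esub> \<tau> \<otimes>\<^bsub>G\<^esub> \<sigma> \<otimes>\<^bsub>G\<^esub> \<tau> = \<sigma> [^]\<^bsub>G\<^esub> k"

text \<open>
  The relations are defining when \<open>G\<close> has the universal property of the presented group. A group
  generated by two elements is countable, so it suffices to test against groups with carrier in
  \<^typ>\<open>nat\<close>.
\<close>

definition metacyclic_presentation ::
    "nat \<Rightarrow> nat \<Rightarrow> nat \<Rightarrow> nat \<Rightarrow> int \<Rightarrow> ('g, 'm) monoid_scheme \<Rightarrow> 'g \<Rightarrow> 'g \<Rightarrow> bool"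
  where "metacyclic_presentation p a b c k G \<sigma> \<tau> \<longleftrightarrow>
    group G \<and> \<sigma> \<in> carrier G \<and> \<tau> \<in> carrier G \<and> generate G {\<sigma>, \<tau>} = carrier G \<and>
    metacyclic_relations p a b c k G \<sigma> \<tau> \<and>
    (\<forall>(H :: nat monoid) s u. group H \<and> s \<in> carrier H \<and> u \<in> carrier H \<and>
       metacyclic_relations p a b c k H s u \<longrightarrow>
       (\<exists>\<phi> \<in> hom G H. \<phi> \<sigma> = s \<and> \<phi> \<tau> = u))"

end

theory Submission
  imports Defs "HOL-Computational_Algebra.Polynomial_Factorial"
begin

text \<open>
  Only the following is used of the extension group, which we call \<open>G\<close> here: it is a \<open>p\<close>-group generated
  by \<open>\<sigma>\<close> and \<open>\<tau>\<close>, and \<open>\<theta> = [\<sigma>, \<tau>]\<close> commutes with \<open>\<sigma>\<close> and satisfies \<open>\<tau>\<inverse>\<theta>\<tau> = \<theta>\<^sup>k\<close>. Since the transcendence degree is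
  \<open>|G|\<close>, it suffices to generate the fixed field by at most \<open>|G|\<close> elements.

  In characteristic \<open>p\<close> the group acts unipotently on the span of the variables, so the variables can be
  adjoined along a stable flag, and each step adds one invariant polynomial of least degree.

  Otherwise let \<open>x\<^sub>0\<close> be a joint eigenvector of \<open>\<sigma>\<close>, \<open>\<theta>\<close> and \<open>\<tau>\<^sup>n\<close> on which \<open>\<theta>\<close> acts with the full order \<open>p\<^sup>d\<close>, where
  \<open>n\<close> is the least exponent with \<open>\<sigma>\<tau>\<^sup>n = \<tau>\<^sup>n\<sigma>\<close>, and \<open>x\<^sub>i\<close> its translate by \<open>\<tau>\<^sup>i\<close>. Together with an element \<open>s\<close> fixed by \<open>\<sigma>\<close> and
  scaled by \<open>\<tau>\<close> and some further joint eigenvectors, the \<open>x\<^sub>i\<close> generate a field on which \<open>G\<close> acts faithfully, so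
  that the no-name lemma replaces the remaining variables by invariants; the joint eigenvectors and \<open>x\<^sub>0\<close>
  contribute one invariant each. What is left are the ratios \<open>y\<^sub>i = x\<^sub>i\<^sub>+\<^sub>1 / x\<^sub>i\<close>, which \<open>\<tau>\<close> permutes cyclically,
  with product \<open>1\<close>. For \<open>f \<in> \<int>[x]\<close> let \<open>\<beta> f\<close> be the monomial \<open>y\<^sub>0\<^sup>f\<close>, where \<open>x\<close> acts as \<open>\<tau>\<close>. It is fixed by \<open>\<sigma>\<close> iff
  \<open>p\<^sup>d\<close> divides \<open>f(k)\<close>. The lattice of these monomials is lowered from period \<open>n\<close> to \<open>n/p\<close>, then \<open>n/p\<^sup>2\<close> and so on:
  an element \<open>q\<close> with \<open>\<tau>\<^sup>m q = q \<cdot> \<beta>(x\<^sup>m - 1)\<close>, \<open>m = n/p\<close>, splits off a permutation part, on which \<open>\<tau>\<close> becomes trivial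
  after a Fourier transform corrected by powers of \<open>s\<close>.
\<close>

section \<open>Generated subfields\<close>

text \<open>The obstacle is the lattice of monomials in the \<open>y\<close> that
  \<open>\<sigma>\<close> fixes. It is the ideal generated by \<open>p^d\<close> and
  \<open>x - k\<close> modulo the norm of period \<open>n\<close>; in general it has no basis
  permuted by \<open>\<tau>\<close>, so no Fourier transform applies to it. But an extension of the
  permutation module of period \<open>n/p\<close> by this ideal is also the sum of the permutation
  module of period \<open>n\<close> and the analogous ideal for \<open>n/p\<close>. On the level of
  fields the extension comes for free by Hilbert 90: \<open>n/p\<close> invariants found earlier are
  bundled into one element of period \<open>n/p\<close>, which is corrected to \<open>q\<close>, and
  \<open>n\<close> new invariants come out. Hence a stock of invariants must exist before the
  descent starts; the no-name lemma and the joint eigenvectors provide it.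

  Fourier components are only scaled by \<open>\<tau>\<close>; division by powers of
  \<open>s\<close> makes them invariant. The splitting requires the value at \<open>k\<close> of the
  norm of period \<open>n/p\<close> to be the next smaller modulus times a number prime to
  \<open>p\<close>. Except for \<open>p = 2\<close> and \<open>k \<equiv> 3 (mod 4)\<close>, this
  holds all the way down from \<open>n = p^d\<close>; in the exceptional case the valuations of the
  norms jump at period \<open>2\<close>.\<close>

abbreviation gen :: "'a::field set \<Rightarrow> 'a set" where "gen \<equiv> subfield_generated"

text \<open>Elementwise counterpart of the library's \<open>subfield\<close>. Closure under
  \<open>inverse\<close> can be stated without excluding \<open>0\<close>, as
  \<open>inverse 0 = 0\<close>.\<close>

definition subfld :: "'a::field set \<Rightarrow> bool" where
  "subfld E \<longleftrightarrow> 1 \<in> E \<and> (\<forall>x\<in>E. \<forall>y\<in>E. x + y \<in> E \<and> x * y \<in> E) \<and> (\<forall>x\<in>E. - x \<in> E \<and> inverse x \<in> E)"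

abbreviation RR :: "'a::field ring" where "RR \<equiv> ring_of_type_algebra"

lemma RR_simps [simp]:
  "carrier RR = UNIV" "x \<otimes>\<^bsub>RR\<^esub> y = x * y" "x \<oplus>\<^bsub>RR\<^esub> y = x + y" "\<one>\<^bsub>RR\<^esub> = 1" "\<zero>\<^bsub>RR\<^esub> = 0"
  by (simp_all add: ring_of_type_algebra_def)

lemma RR_minus [simp]: "\<ominus>\<^bsub>RR\<^esub> x = - (x::'a::field)"
proof -
  interpret RRf: field "RR :: 'a ring" by (rule field_from_type_algebra)
  show ?thesis by (rule RRf.minus_equality) simp_all
qed

lemma RR_inv: "x \<noteq> 0 \<Longrightarrow> inv\<^bsub>RR\<^esub> x = inverse (x::'a::field)"
proof -
  interpret RRf: field "RR :: 'a ring" by (rule field_from_type_algebra)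
  show "x \<noteq> 0 \<Longrightarrow> inv\<^bsub>RR\<^esub> x = inverse x" by (rule RRf.inv_unique'[symmetric]) simp_all
qed

lemma RR_pow [simp]: "x [^]\<^bsub>RR\<^esub> (n::nat) = x ^ n"
  by (induction n) (simp_all add: nat_pow_def mult.commute)

lemma subfld_zero: "subfld E \<Longrightarrow> 0 \<in> E"
  unfolding subfld_def by (metis add.right_inverse)

lemma subfldI:
  assumes "1 \<in> E" "\<And>x y. x \<in> E \<Longrightarrow> y \<in> E \<Longrightarrow> x + y \<in> E"
    "\<And>x y. x \<in> E \<Longrightarrow> y \<in> E \<Longrightarrow> x * y \<in> E" "\<And>x. x \<in> E \<Longrightarrow> - x \<in> E"
    "\<And>x. x \<in> E \<Longrightarrow> x \<noteq> 0 \<Longrightarrow> inverse x \<in> E"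
  shows "subfld E"
proof -
  have "0 \<in> E" using assms(1,2,4) by (metis add.right_inverse)
  then show ?thesis using assms unfolding subfld_def by (metis inverse_zero)
qed

lemma subfld_iff: "subfld E \<longleftrightarrow> subfield (E::'a::field set) RR"
proof -
  interpret RRf: field "RR :: 'a ring" by (rule field_from_type_algebra)
  show ?thesis
proof
  assume E: "subfld E"
  show "subfield E RR"
  proof (rule RRf.subfieldI')
    show "subring E RR"
      by (rule RRf.subringI) (use E in \<open>auto simp: subfld_def\<close>)
  next
    fix k assume "k \<in> E - {\<zero>\<^bsub>RR\<^esub>}"
    then show "inv\<^bsub>RR\<^esub> k \<in> E" using E by (auto simp: subfld_def RR_inv)
  qed
next
  assume E: "subfield E RR"
  note s = subfieldE(1)[OF E]
  show "subfld E"
  proof (rule subfldI)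
    show "1 \<in> E" using subringE(3)[OF s] by simp
    fix x y assume xy: "x \<in> E" "y \<in> E"
    show "x + y \<in> E" using subringE(7)[OF s] xy by simp
    show "x * y \<in> E" using subringE(6)[OF s] xy by simp
  next
    fix x assume x: "x \<in> E"
    show "- x \<in> E" using subringE(5)[OF s] x by simp
    assume "x \<noteq> 0"
    then show "inverse x \<in> E" using RRf.subfield_m_inv(1)[OF E, of x] x by (simp add: RR_inv)
  qed
qed
qed

lemma gen_subfld [simp]: "subfld (gen S)"
  unfolding subfld_iff subfield_generated_def
  by (rule field.generate_field_is_subfield[OF field_from_type_algebra]) simp

lemma gen_base: "x \<in> S \<Longrightarrow> x \<in> gen S"
  unfolding subfield_generated_def by (rule generate_field.incl)

lemma gen_incl: "S \<subseteq> gen S"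
  by (auto intro: gen_base)

lemma gen_least: "subfld E \<Longrightarrow> S \<subseteq> E \<Longrightarrow> gen S \<subseteq> E"
  unfolding subfield_generated_def subfld_iff
  by (rule field.generate_field_min_subfield1[OF field_from_type_algebra]) simp_all

lemma gen_mono: "S \<subseteq> T \<Longrightarrow> gen S \<subseteq> gen T"
  by (rule gen_least) (auto intro: gen_base)

lemma gen_eqI: "S \<subseteq> gen T \<Longrightarrow> T \<subseteq> gen S \<Longrightarrow> gen S = gen T"
  by (simp add: gen_least subset_antisym)

lemma gen_gen_Un [simp]: "gen (gen S \<union> T) = gen (S \<union> T)"
  by (rule gen_eqI) (use gen_mono[of S "S \<union> T"] gen_incl in \<open>auto intro: gen_base\<close>)

lemma gen_self: "subfld E \<Longrightarrow> gen E = E"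
  by (simp add: gen_incl gen_least subset_antisym)

context
  fixes E :: "'a::field set" assumes E: "subfld E"
begin
lemma sf_0: "0 \<in> E" and sf_1: "1 \<in> E" using E subfld_zero by (auto simp: subfld_def)
lemma sf_add: "x \<in> E \<Longrightarrow> y \<in> E \<Longrightarrow> x + y \<in> E"
  and sf_mult: "x \<in> E \<Longrightarrow> y \<in> E \<Longrightarrow> x * y \<in> E"
  and sf_uminus: "x \<in> E \<Longrightarrow> - x \<in> E"
  and sf_inverse: "x \<in> E \<Longrightarrow> inverse x \<in> E"
  using E by (auto simp: subfld_def)
lemma sf_diff: "x \<in> E \<Longrightarrow> y \<in> E \<Longrightarrow> x - y \<in> E"
  using sf_add[of x "- y"] sf_uminus by simp
lemma sf_divide: "x \<in> E \<Longrightarrow> y \<in> E \<Longrightarrow> x / y \<in> E"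
  using sf_mult[of x "inverse y"] sf_inverse by (simp add: field_simps)
lemma sf_power: "x \<in> E \<Longrightarrow> x ^ n \<in> E"
  by (induction n) (auto intro: sf_1 sf_mult)
lemma sf_powi: "x \<in> E \<Longrightarrow> x powi n \<in> E"
  by (auto simp: power_int_def intro: sf_power sf_inverse)
lemma sf_sum: "(\<And>i. i \<in> I \<Longrightarrow> f i \<in> E) \<Longrightarrow> sum f I \<in> E"
  by (induction I rule: infinite_finite_induct) (auto intro: sf_0 sf_add)
lemma sf_prod: "(\<And>i. i \<in> I \<Longrightarrow> f i \<in> E) \<Longrightarrow> prod f I \<in> E"
  by (induction I rule: infinite_finite_induct) (auto intro: sf_1 sf_mult)
lemma sf_of_nat: "of_nat n \<in> E"
  by (induction n) (auto intro: sf_0 sf_1 sf_add)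
end

lemmas sf_intros = sf_0 sf_1 sf_add sf_mult sf_uminus sf_inverse sf_diff sf_divide sf_power sf_powi
  sf_sum sf_prod sf_of_nat

lemmas gen_intros =
  sf_0[OF gen_subfld] sf_1[OF gen_subfld] sf_add[OF gen_subfld] sf_mult[OF gen_subfld]
  sf_uminus[OF gen_subfld] sf_inverse[OF gen_subfld] sf_diff[OF gen_subfld] sf_divide[OF gen_subfld]
  sf_power[OF gen_subfld] sf_powi[OF gen_subfld] sf_sum[OF gen_subfld] sf_prod[OF gen_subfld]
  sf_of_nat[OF gen_subfld]

section \<open>Algebraic dependence\<close>

definition alg_over :: "'a::field set \<Rightarrow> 'a \<Rightarrow> bool" where
  "alg_over E x \<longleftrightarrow> (\<exists>P. P \<noteq> 0 \<and> (\<forall>i. poly.coeff P i \<in> E) \<and> poly P x = 0)"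

text \<open>The library's polynomials over a ring are coefficient lists with the leading coefficient
  first, hence the \<open>rev\<close>. The translation gives access to its theory of algebraic
  elements.\<close>

lemma eval_Poly: "ring.eval RR p x = poly (Poly (rev p)) (x::'a::field)"
proof (induction p)
  case Nil
  interpret RRf: field "RR :: 'a ring" by (rule field_from_type_algebra)
  show ?case by simp
next
  case (Cons a p)
  interpret RRf: field "RR :: 'a ring" by (rule field_from_type_algebra)
  have "poly (Poly (xs @ ys)) x = poly (Poly xs) x + x ^ length xs * poly (Poly ys) x" for xs ys :: "'a list"
    by (induction xs) (simp_all add: algebra_simps)
  then show ?case using Cons by (simp add: mult.commute)
qed

lemma alg_over_iff:
  fixes x :: "'a::field"
  assumes E: "subfld E"
  shows "alg_over E x \<longleftrightarrow> (ring.algebraic RR over E) x"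
proof -
  interpret RRf: field "RR :: 'a ring" by (rule field_from_type_algebra)
  show ?thesis
proof
  assume "alg_over E x"
  then obtain P where P: "P \<noteq> 0" "\<And>i. poly.coeff P i \<in> E" "poly P x = 0" unfolding alg_over_def by blast
  define l where "l = rev (coeffs P)"
  have l: "l \<noteq> []" "set l \<subseteq> E" "hd l \<noteq> 0"
  proof -
    show "l \<noteq> []" using P(1) by (simp add: l_def)
    show "set l \<subseteq> E" using P(2) by (auto simp: l_def coeffs_def)
    show "hd l \<noteq> 0" using P(1) by (simp add: l_def hd_rev last_coeffs_eq_coeff_degree)
  qed
  have "polynomial\<^bsub>RR\<^esub> E l"
    using l by (auto simp: polynomial_def)
  then have "l \<in> carrier (univ_poly RR E)" by (simp add: univ_poly_def)
  moreover have "RRf.eval l x = 0" by (simp add: eval_Poly l_def P)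
  ultimately show "(RRf.algebraic over E) x"
    using l(1) by (intro RRf.algebraicI) auto
next
  assume "(RRf.algebraic over E) x"
  then obtain l where l: "l \<in> carrier (univ_poly RR E)" "l \<noteq> []" "RRf.eval l x = 0"
    using RRf.algebraicE[of E x] E by (auto simp: subfld_iff dest: subfieldE(1))
  then have l': "set l \<subseteq> E" "hd l \<noteq> 0" by (auto simp: univ_poly_def polynomial_def)
  define P where "P = Poly (rev l)"
  have "poly.coeff P (length l - 1) = hd l"
    using l(2) by (cases l) (simp_all add: P_def coeff_Poly_eq nth_default_def nth_append)
  then have "P \<noteq> 0" using l'(2) by auto
  moreover have "poly.coeff P i \<in> E" for i
    using l' sf_0[OF E] by (auto simp: P_def coeff_Poly_eq nth_default_def rev_nth)
  ultimately show "alg_over E x" using l(3) unfolding alg_over_def eval_Poly P_def by blast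
qed
qed

lemma alg_over_mono: "alg_over E x \<Longrightarrow> E \<subseteq> E' \<Longrightarrow> alg_over E' x"
  unfolding alg_over_def by blast

lemma alg_over_self: "subfld E \<Longrightarrow> x \<in> E \<Longrightarrow> alg_over E x"
  unfolding alg_over_def by (rule exI[of _ "[:-x, 1:]"]) (auto simp: coeff_pCons sf_intros split: nat.splits)

lemma subfld_alg_over:
  fixes E :: "'a::field set"
  assumes "subfld E" shows "subfld {x. alg_over E x}"
proof -
  interpret RRf: field "RR :: 'a ring" by (rule field_from_type_algebra)
  have "subfield {x. (RRf.algebraic over E) x} RR"
    using RRf.subfield_of_algebraics[of E] assms by (simp add: subfld_iff)
  then show ?thesis using alg_over_iff[OF assms] by (simp add: subfld_iff)
qed

text \<open>A relation for \<open>x\<close> involves finitely many coefficients. Adjoining these to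
  \<open>E\<close> is a finite extension, adjoining \<open>x\<close> after that another, and
  elements of a finite extension are algebraic.\<close>

lemma alg_over_trans:
  fixes E :: "'a::field set"
  assumes E: "subfld E" and x: "alg_over E' x" and E': "\<And>y. y \<in> E' \<Longrightarrow> alg_over E y"
  shows "alg_over E x"
proof -
  interpret RRf: field "RR :: 'a ring" by (rule field_from_type_algebra)
  obtain P where P: "P \<noteq> 0" "\<And>i. poly.coeff P i \<in> E'" "poly P x = 0" using x unfolding alg_over_def by blast
  define Fx where "Fx = RRf.finite_extension E (coeffs P)"
  have algc: "(RRf.algebraic over E) y" if "y \<in> set (coeffs P)" for y
    using that E' P(2) alg_over_iff[OF E] by (auto simp: coeffs_def split: if_splits)
  have Er: "subfield E RR" using E by (simp add: subfld_iff)
  have Fs: "subfield Fx RR"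
    unfolding Fx_def by (rule RRf.finite_extension_is_subfield[OF Er]) (use algc in auto)
  have Fd: "RRf.finite_dimension E Fx"
    unfolding Fx_def by (rule RRf.finite_extension_finite_dimension(1)[OF Er]) (use algc in auto)
  have c: "set (coeffs P) \<subseteq> Fx"
    unfolding Fx_def by (rule RRf.finite_extension_mem[OF subfieldE(1)[OF Er]]) simp
  have Fs': "subfld Fx" using Fs by (simp add: subfld_iff)
  have "poly.coeff P i \<in> Fx" for i
  proof (cases "i \<le> degree P")
    case True then show ?thesis using c P(1) by (auto simp: coeffs_def simp del: upt_Suc)
  next
    case False then show ?thesis using sf_0[OF Fs'] by (simp add: coeff_eq_0)
  qed
  then have "alg_over Fx x" unfolding alg_over_def using P by blast
  then have xa: "(RRf.algebraic over Fx) x" using alg_over_iff[OF Fs'] by simp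
  have "RRf.finite_dimension Fx (RRf.simple_extension Fx x)"
    using RRf.finite_dimension_simple_extension[OF Fs, of x] xa by simp
  then have "RRf.finite_dimension E (RRf.simple_extension Fx x)"
    by (rule RRf.telescopic_base_dim(1)[OF Er Fs Fd])
  moreover have "subring (RRf.simple_extension Fx x) RR"
    by (rule RRf.simple_extension_is_subring[OF subfieldE(1)[OF Fs]]) simp
  moreover have "x \<in> RRf.simple_extension Fx x"
    by (rule RRf.simple_extension_mem[OF subfieldE(1)[OF Fs]]) simp
  ultimately have "(RRf.algebraic over E) x"
    using RRf.finite_dimension_imp_algebraic[OF Er] by blast
  then show ?thesis using alg_over_iff[OF E] by simp
qed

definition subrng :: "'a::field set \<Rightarrow> bool" where
  "subrng R \<longleftrightarrow> 1 \<in> R \<and> (\<forall>x\<in>R. \<forall>y\<in>R. x + y \<in> R \<and> x * y \<in> R) \<and> (\<forall>x\<in>R. - x \<in> R)"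

lemma subrng_0: "subrng R \<Longrightarrow> 0 \<in> R"
  unfolding subrng_def by (metis add.right_inverse)

lemma subrng_prod: "subrng R \<Longrightarrow> (\<And>i. i \<in> I \<Longrightarrow> f i \<in> R) \<Longrightarrow> prod f I \<in> R"
  by (induction I rule: infinite_finite_induct) (auto simp: subrng_def)

lemma subrng_sum: "subrng R \<Longrightarrow> (\<And>i. i \<in> I \<Longrightarrow> f i \<in> R) \<Longrightarrow> sum f I \<in> R"
  by (induction I rule: infinite_finite_induct) (auto simp: subrng_0 subrng_def)

lemma gen_subrng:
  fixes R :: "'a::field set"
  assumes R: "subrng R"
  shows "gen R = {a / b |a b. a \<in> R \<and> b \<in> R \<and> b \<noteq> 0}" (is "_ = ?Q")
proof
  have "subfld ?Q"
  proof (rule subfldI)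
    show "1 \<in> ?Q" using R by (auto simp: subrng_def intro!: exI[of _ 1])
    fix x y assume x: "x \<in> ?Q" and y: "y \<in> ?Q"
    obtain a b where ab: "x = a / b" "a \<in> R" "b \<in> R" "b \<noteq> 0" using x by blast
    obtain c d where cd: "y = c / d" "c \<in> R" "d \<in> R" "d \<noteq> 0" using y by blast
    have "x + y = (a * d + c * b) / (b * d)" using ab cd by (simp add: field_simps)
    moreover have "a * d + c * b \<in> R" "b * d \<in> R" "b * d \<noteq> 0" using R ab cd by (auto simp: subrng_def)
    ultimately show "x + y \<in> ?Q" by blast
    have "x * y = (a * c) / (b * d)" using ab cd by simp
    moreover have "a * c \<in> R" using R ab cd by (auto simp: subrng_def)
    ultimately show "x * y \<in> ?Q" using \<open>b * d \<in> R\<close> \<open>b * d \<noteq> 0\<close> by blast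
  next
    fix x assume x: "x \<in> ?Q"
    obtain a b where ab: "x = a / b" "a \<in> R" "b \<in> R" "b \<noteq> 0" using x by blast
    have "- x = (- a) / b" "- a \<in> R" using ab R by (auto simp: subrng_def)
    then show "- x \<in> ?Q" using ab by blast
    assume "x \<noteq> 0"
    then have "inverse x = b / a" "a \<noteq> 0" using ab by auto
    then show "inverse x \<in> ?Q" using ab by blast
  qed
  moreover have "R \<subseteq> ?Q"
  proof
    fix x assume "x \<in> R"
    moreover have "x = x / 1" "1 \<in> R" "(1::'a) \<noteq> 0" using R by (simp_all add: subrng_def)
    ultimately show "x \<in> ?Q" by blast
  qed
  ultimately show "gen R \<subseteq> ?Q" by (rule gen_least)
  show "?Q \<subseteq> gen R" using gen_base[of _ R] by (auto intro!: gen_intros)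
qed

lemma common_denominator:
  assumes R: "subrng R" and "finite I" and "\<And>i. i \<in> I \<Longrightarrow> c i \<in> gen R"
  shows "\<exists>q\<in>R. q \<noteq> 0 \<and> (\<forall>i\<in>I. q * c i \<in> R)"
  using assms(2,3)
proof (induction I)
  case empty
  then show ?case using R by (auto simp: subrng_def intro!: bexI[of _ 1])
next
  case (insert j I)
  then obtain q where q: "q \<in> R" "q \<noteq> 0" "\<forall>i\<in>I. q * c i \<in> R" by auto
  obtain a b where ab: "c j = a / b" "a \<in> R" "b \<in> R" "b \<noteq> 0"
    using insert.prems[of j] gen_subrng[OF R] by auto
  have "b * q * c i \<in> R" if "i \<in> insert j I" for i
  proof (cases "i = j")
    case True
    then have e: "b * q * c i = q * a" using ab by simp
    show ?thesis unfolding e using R ab q by (auto simp: subrng_def)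
  next
    case False
    then have "q * c i \<in> R" using that q by auto
    then show ?thesis using R ab by (auto simp: subrng_def mult.assoc)
  qed
  then show ?case using q ab R by (intro bexI[of _ "b * q"]) (auto simp: subrng_def)
qed

lemma clear_denominators:
  assumes R: "subrng R" and x: "alg_over (gen R) x"
  shows "\<exists>P. P \<noteq> 0 \<and> (\<forall>i. poly.coeff P i \<in> R) \<and> poly P x = 0"
proof -
  obtain P where P: "P \<noteq> 0" "\<And>i. poly.coeff P i \<in> gen R" "poly P x = 0" using x unfolding alg_over_def by blast
  obtain q where q: "q \<in> R" "q \<noteq> 0" "\<forall>i\<in>{..Polynomial.degree P}. q * poly.coeff P i \<in> R"
    using common_denominator[OF R, of "{..Polynomial.degree P}" "poly.coeff P"] P(2) by auto
  have "poly.coeff (Polynomial.smult q P) i \<in> R" for i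
    using q subrng_0[OF R] by (cases "i \<le> Polynomial.degree P") (auto simp: coeff_eq_0)
  then show ?thesis using P q by (intro exI[of _ "Polynomial.smult q P"]) auto
qed

lemma poly_over_mult:
  assumes "subrng E" "\<And>i. poly.coeff P i \<in> E" "\<And>i. poly.coeff Q i \<in> E"
  shows "poly.coeff (P * Q) i \<in> E"
  unfolding coeff_mult by (rule subrng_sum[OF assms(1)]) (use assms in \<open>auto simp: subrng_def\<close>)

lemma subfld_subrng: "subfld E \<Longrightarrow> subrng E"
  by (auto simp: subfld_def subrng_def)

lemma subrng_poly_values:
  assumes E: "subfld E"
  shows "subrng {poly P x |P. \<forall>i. poly.coeff P i \<in> E}" (is "subrng ?R")
  unfolding subrng_def
proof (intro conjI ballI)
  show "1 \<in> ?R" by (auto intro!: exI[of _ 1] simp: coeff_pCons one_pCons sf_intros[OF E] split: nat.splits)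
  fix a assume "a \<in> ?R"
  then obtain P where P: "a = poly P x" "\<forall>i. poly.coeff P i \<in> E" by blast
  show "- a \<in> ?R" using P by (auto intro!: exI[of _ "- P"] sf_intros[OF E])
  fix b assume "b \<in> ?R"
  then obtain Q where Q: "b = poly Q x" "\<forall>i. poly.coeff Q i \<in> E" by blast
  show "a + b \<in> ?R" using P Q by (auto intro!: exI[of _ "P + Q"] sf_intros[OF E])
  show "a * b \<in> ?R" using P Q by (auto intro!: exI[of _ "P * Q"] poly_over_mult subfld_subrng[OF E])
qed

lemma gen_insert_poly:
  assumes E: "subfld E"
  shows "gen (insert x E) = gen {poly P x |P. \<forall>i. poly.coeff P i \<in> E}"
proof (rule gen_eqI)
  have "x \<in> {poly P x |P. \<forall>i. poly.coeff P i \<in> E}"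
    by (auto intro!: exI[of _ "[:0,1:]"] simp: coeff_pCons sf_intros[OF E] split: nat.splits)
  moreover have "c \<in> {poly P x |P. \<forall>i. poly.coeff P i \<in> E}" if "c \<in> E" for c
    using that by (auto intro!: exI[of _ "[:c:]"] simp: coeff_pCons sf_intros[OF E] split: nat.splits)
  ultimately show "insert x E \<subseteq> gen {poly P x |P. \<forall>i. poly.coeff P i \<in> E}"
    by (auto intro!: gen_base)
  show "{poly P x |P. \<forall>i. poly.coeff P i \<in> E} \<subseteq> gen (insert x E)"
    using gen_base[of x "insert x E"] gen_base[of _ "insert x E"]
    by (auto simp: poly_altdef intro!: gen_intros)
qed

text \<open>After clearing denominators, a relation for \<open>y\<close> has coefficients polynomial
  in \<open>x\<close>. Reordered by powers of \<open>x\<close> it is a relation \<open>V\<close> for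
  \<open>x\<close> with coefficients polynomial in \<open>y\<close>, and \<open>V = 0\<close> would
  make \<open>y\<close> algebraic over \<open>gen S\<close>.\<close>

lemma alg_over_exchange:
  assumes y: "alg_over (gen (insert x S)) y" and ny: "\<not> alg_over (gen S) y"
  shows "alg_over (gen (insert y S)) x"
proof -
  define E where "E = gen S"
  have E: "subfld E" by (simp add: E_def)
  define R where "R = {poly P x |P. \<forall>i. poly.coeff P i \<in> E}"
  have R: "subrng R" unfolding R_def by (rule subrng_poly_values[OF E])
  have "gen (insert x S) = gen R"
    using gen_insert_poly[OF E, of x] gen_gen_Un[of S "{x}"] by (simp add: R_def E_def)
  then obtain P where P: "P \<noteq> 0" "\<And>i. poly.coeff P i \<in> R" "poly P y = 0"
    using clear_denominators[OF R] y by metis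
  have "\<exists>Q. \<forall>j. poly.coeff P i = poly Q x \<and> poly.coeff Q j \<in> E" for i using P(2)[of i] unfolding R_def by blast
  then obtain Q where Q: "\<And>i. poly.coeff P i = poly (Q i) x" "\<And>i j. poly.coeff (Q i) j \<in> E" by metis
  define d where "d = Polynomial.degree P"
  define V where "V = (\<Sum>i\<le>d. Polynomial.smult (y ^ i) (Q i))"
  have "poly V x = poly P y"
    unfolding V_def poly_sum poly_altdef[of P] d_def by (simp add: Q mult.commute)
  then have V0: "poly V x = 0" using P by simp
  have cV: "poly.coeff V j = (\<Sum>i\<le>d. poly.coeff (Q i) j * y ^ i)" for j
    by (simp add: V_def coeff_sum mult.commute)
  have "V \<noteq> 0"
  proof
    assume "V = 0"
    have "poly.coeff (Q i) j = 0" if "i \<le> d" for i j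
    proof -
      define W where "W = (\<Sum>i\<le>d. Polynomial.monom (poly.coeff (Q i) j) i)"
      have "poly.coeff W k = (if k \<le> d then poly.coeff (Q k) j else 0)" for k
        by (auto simp: W_def coeff_sum)
      moreover have "poly W y = 0"
        using cV[of j] \<open>V = 0\<close> by (simp add: W_def poly_sum poly_monom)
      ultimately have "W = 0"
        using ny Q(2) sf_0[OF E] unfolding alg_over_def E_def by (metis (full_types))
      then show ?thesis using \<open>\<And>k. poly.coeff W k = _\<close>[of i] that by simp
    qed
    then have "Q d = 0" by (intro poly_eqI) auto
    then have "poly.coeff P d = 0" using Q(1) by simp
    then show False using P(1) by (simp add: d_def)
  qed
  moreover have "poly.coeff V j \<in> gen (insert y S)" for j
  proof -
    have "poly.coeff (Q i) j \<in> gen (insert y S)" for i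
      using Q(2)[of i j] gen_mono[of S "insert y S"] by (auto simp: E_def)
    then show ?thesis
      unfolding cV using gen_base[of y "insert y S"] by (auto intro!: gen_intros)
  qed
  ultimately show ?thesis using V0 unfolding alg_over_def by blast
qed

text \<open>Exchange relative to \<open>K\<close>: while \<open>J\<close> grows inside
  \<open>I\<close>, one element of \<open>U\<close> is given up for each of its members, and all of
  \<open>U\<close> stays algebraic over \<open>J\<close> together with the remaining
  \<open>W\<close>.\<close>

lemma steinitz:
  assumes fin: "finite U" "finite I"
    and indep: "\<And>x. x \<in> I \<Longrightarrow> \<not> alg_over (gen (K \<union> (I - {x}))) x"
    and span: "\<And>x. x \<in> I \<Longrightarrow> alg_over (gen (K \<union> U)) x"
  shows "card I \<le> card U"
proof -
  have "\<exists>W\<subseteq>U. card W + card J \<le> card U \<and> (\<forall>u\<in>U. alg_over (gen (K \<union> J \<union> W)) u)"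
    if "finite J" "J \<subseteq> I" for J
    using that
  proof (induction J)
    case empty
    then show ?case by (intro exI[of _ U]) (auto intro!: alg_over_self gen_base)
  next
    case (insert x J)
    then obtain W where W: "W \<subseteq> U" "card W + card J \<le> card U" "\<forall>u\<in>U. alg_over (gen (K \<union> J \<union> W)) u" by auto
    have finW: "finite W" using W fin finite_subset by blast
    have tr: "alg_over (gen T) z" if z: "alg_over (gen T') z" and T: "\<And>t. t \<in> T' \<Longrightarrow> alg_over (gen T) t" for z T T'
    proof (rule alg_over_trans[OF _ z])
      fix w assume "w \<in> gen T'"
      moreover have "gen T' \<subseteq> {x. alg_over (gen T) x}"
        by (rule gen_least) (use T in \<open>auto intro!: subfld_alg_over\<close>)
      ultimately show "alg_over (gen T) w" by auto
    qed simp
    have self: "alg_over (gen T) t" if "t \<in> T" for t T using that by (auto intro!: alg_over_self gen_base)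
    have "x \<in> I" using insert by auto
    have xW: "alg_over (gen (K \<union> J \<union> W)) x"
    proof (rule tr[OF span[OF \<open>x \<in> I\<close>]])
      fix t assume "t \<in> K \<union> U"
      then show "alg_over (gen (K \<union> J \<union> W)) t" using W(3) self[of t "K \<union> J \<union> W"] by auto
    qed
    \<comment> \<open>\<open>W'\<close> will be a smallest part of \<open>W\<close> such that
      \<open>x\<close> depends on it over \<open>K \<union> J\<close>. Leaving out any
      \<open>w\<close> breaks the dependence, which is what the exchange of \<open>w\<close> for
      \<open>x\<close> requires.\<close>
    define p where "p n \<longleftrightarrow> (\<exists>W'\<subseteq>W. card W' = n \<and> alg_over (gen (K \<union> J \<union> W')) x)" for n
    define n where "n = (LEAST n. p n)"
    have "p (card W)" unfolding p_def using xW by blast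
    then have "p n" unfolding n_def by (rule LeastI)
    then obtain W' where W': "W' \<subseteq> W" "card W' = n" "alg_over (gen (K \<union> J \<union> W')) x" unfolding p_def by blast
    have "W' \<noteq> {}"
    proof
      assume "W' = {}"
      then have "alg_over (gen (K \<union> J)) x" using W' by simp
      then have "alg_over (gen (K \<union> (I - {x}))) x"
        by (rule alg_over_mono) (use insert in \<open>auto intro!: gen_mono\<close>)
      then show False using indep \<open>x \<in> I\<close> by blast
    qed
    then obtain w where w: "w \<in> W'" by blast
    have finW': "finite W'" using W' finW finite_subset by blast
    have "\<not> alg_over (gen (K \<union> J \<union> (W' - {w}))) x"
    proof
      assume "alg_over (gen (K \<union> J \<union> (W' - {w}))) x"
      then have "p (card (W' - {w}))" unfolding p_def using W' by blast
      moreover have "card (W' - {w}) < n" using w finW' W' by (metis card_Diff1_less)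
      ultimately show False unfolding n_def using not_less_Least by blast
    qed
    moreover have "insert w (K \<union> J \<union> (W' - {w})) = K \<union> J \<union> W'" using w by auto
    ultimately have "alg_over (gen (insert x (K \<union> J \<union> (W' - {w})))) w"
      using alg_over_exchange[of w "K \<union> J \<union> (W' - {w})" x] W' by simp
    then have wx: "alg_over (gen (K \<union> insert x J \<union> (W - {w}))) w"
      by (rule alg_over_mono) (use W' in \<open>auto intro!: gen_mono\<close>)
    show ?case
    proof (intro exI[of _ "W - {w}"] conjI ballI)
      show "W - {w} \<subseteq> U" using W by auto
      have "w \<in> W" using w W' by auto
      then have "card (W - {w}) + 1 = card W" using finW by (metis Suc_eq_plus1 card_Suc_Diff1)
      then show "card (W - {w}) + card (insert x J) \<le> card U"
        using W(2) insert.hyps by simp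
      fix u assume "u \<in> U"
      then have "alg_over (gen (K \<union> J \<union> W)) u" using W by auto
      then show "alg_over (gen (K \<union> insert x J \<union> (W - {w}))) u"
      proof (rule tr)
        fix t assume "t \<in> K \<union> J \<union> W"
        then show "alg_over (gen (K \<union> insert x J \<union> (W - {w}))) t"
          using wx self[of t "K \<union> insert x J \<union> (W - {w})"] by auto
      qed
    qed
  qed
  from this[OF fin(2) order.refl] show ?thesis by fastforce
qed

text \<open>Monomials are exponent functions vanishing off \<open>U\<close>. Sorted by powers of a
  variable \<open>v\<close>, the relation either makes \<open>v\<close> algebraic over the others or
  has all coefficients zero; in the second case one of these coefficients is a nontrivial relation
  in fewer variables.\<close>

lemma monomial_relation:
  fixes c :: "('a::field \<Rightarrow> nat) \<Rightarrow> 'a"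
  assumes "finite U" "finite M" "M \<noteq> {}" "\<And>m w. m \<in> M \<Longrightarrow> w \<notin> U \<Longrightarrow> m w = 0"
    "\<And>m. m \<in> M \<Longrightarrow> c m \<in> K \<and> c m \<noteq> 0" "(\<Sum>m\<in>M. c m * (\<Prod>w\<in>U. w ^ m w)) = 0"
  shows "\<exists>u\<in>U. alg_over (gen (K \<union> (U - {u}))) u"
  using assms
proof (induction U arbitrary: M c)
  case empty
  obtain m0 where "m0 \<in> M" using empty by blast
  moreover have "m = (\<lambda>_. 0)" if "m \<in> M" for m using empty that by auto
  ultimately have "M = {\<lambda>_. 0}" by blast
  then show ?case using empty by auto
next
  case (insert v U)
  define P where "P = (\<Sum>m\<in>M. Polynomial.monom (c m * (\<Prod>w\<in>U. w ^ m w)) (m v))"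
  have "poly P v = (\<Sum>m\<in>M. c m * (\<Prod>w\<in>insert v U. w ^ m w))"
    using insert.hyps by (simp add: P_def poly_sum poly_monom mult_ac)
  then have P0: "poly P v = 0" using insert.prems by simp
  have cP: "poly.coeff P i = (\<Sum>m\<in>{m\<in>M. m v = i}. c m * (\<Prod>w\<in>U. w ^ m w))" for i
    unfolding P_def coeff_sum using insert.prems(1)
    by (simp add: sum.inter_filter)
  show ?case
  proof (cases "P = 0")
    case False
    have "poly.coeff P i \<in> gen (K \<union> U)" for i
      unfolding cP using insert.prems(4) by (intro gen_intros) (auto intro: gen_base)
    then have "alg_over (gen (K \<union> U)) v" unfolding alg_over_def using False P0 by blast
    moreover have "insert v U - {v} = U" using insert.hyps by auto
    ultimately show ?thesis by (metis insertI1)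
  next
    case True
    obtain m0 where m0: "m0 \<in> M" using insert.prems by blast
    define i where "i = m0 v"
    define M' where "M' = (\<lambda>m. m(v := 0)) ` {m\<in>M. m v = i}"
    have inj: "inj_on (\<lambda>m. m(v := 0)) {m\<in>M. m v = i}"
      by (rule inj_onI) (metis (mono_tags, lifting) fun_upd_triv fun_upd_upd mem_Collect_eq)
    define c' where "c' m = c (m(v := i))" for m
    have "(\<Sum>m\<in>M'. c' m * (\<Prod>w\<in>U. w ^ m w)) = (\<Sum>m\<in>{m\<in>M. m v = i}. c m * (\<Prod>w\<in>U. w ^ m w))"
      unfolding M'_def sum.reindex[OF inj]
    proof (rule sum.cong[OF refl])
      fix m assume m: "m \<in> {m\<in>M. m v = i}"
      then have "m(v := i) = m" by auto
      moreover have "(\<Prod>w\<in>U. w ^ (m(v := 0)) w) = (\<Prod>w\<in>U. w ^ m w)"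
        by (rule prod.cong) (use insert.hyps in auto)
      ultimately show "((\<lambda>m. c' m * (\<Prod>w\<in>U. w ^ m w)) \<circ> (\<lambda>m. m(v := 0))) m = c m * (\<Prod>w\<in>U. w ^ m w)"
        by (simp add: c'_def)
    qed
    then have "(\<Sum>m\<in>M'. c' m * (\<Prod>w\<in>U. w ^ m w)) = 0" using cP[of i] True by simp
    moreover have "finite M'" "M' \<noteq> {}" using insert.prems(1) m0 by (auto simp: M'_def i_def)
    moreover have "m w = 0" if "m \<in> M'" "w \<notin> U" for m w
      using that insert.prems(3) by (auto simp: M'_def)
    moreover have "c' m \<in> K \<and> c' m \<noteq> 0" if m: "m \<in> M'" for m
    proof -
      obtain m1 where "m1 \<in> M" "m1 v = i" "m = m1(v := 0)" using m by (auto simp: M'_def)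
      moreover from this have "m(v := i) = m1" by auto
      ultimately show ?thesis using insert.prems(4) by (simp add: c'_def)
    qed
    ultimately obtain u where u: "u \<in> U" "alg_over (gen (K \<union> (U - {u}))) u"
      using insert.IH[of M' c'] by blast
    then have "alg_over (gen (K \<union> (insert v U - {u}))) u"
      by (elim alg_over_mono) (auto intro!: gen_mono)
    then show ?thesis using u by blast
  qed
qed

lemma alg_independentI:
  assumes fin: "finite U" and indep: "\<And>u. u \<in> U \<Longrightarrow> \<not> alg_over (gen (K \<union> (U - {u}))) u"
  shows "alg_independent K U"
  unfolding alg_independent_def
proof (intro allI impI, rule ccontr)
  fix P :: "('a, 'a) mpoly"
  assume P: "mpoly_coeffs P \<subseteq> K" "mpoly_vars P \<subseteq> U" "mpoly_eval (\<lambda>c. c) (\<lambda>b. b) P = 0" "P \<noteq> 0"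
  let ?k = "Poly_Mapping.keys (mapping_of P)"
  let ?l = "Poly_Mapping.lookup :: ('a \<Rightarrow>\<^sub>0 nat) \<Rightarrow> 'a \<Rightarrow> nat"
  have kU: "Poly_Mapping.keys m \<subseteq> U" if "m \<in> ?k" for m using P(2) that by (auto simp: mpoly_vars_def)
  have inj: "inj_on ?l ?k" by (auto intro: inj_onI poly_mapping_eqI)
  define c where "c f = Poly_Mapping.lookup (mapping_of P) (the_inv_into ?k ?l f)" for f
  have c: "c (?l m) = Poly_Mapping.lookup (mapping_of P) m" if "m \<in> ?k" for m
    unfolding c_def by (simp add: the_inv_into_f_f[OF inj that])
  have "(\<Sum>f\<in>?l ` ?k. c f * (\<Prod>w\<in>U. w ^ f w)) = (\<Sum>m\<in>?k. Poly_Mapping.lookup (mapping_of P) m * monom_eval (\<lambda>b. b) m)"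
    unfolding sum.reindex[OF inj] by (rule sum.cong) (use kU c fin in \<open>auto simp: monom_eval_superset\<close>)
  also have "\<dots> = 0" using P(3) by (simp add: mpoly_eval_def)
  finally have r: "(\<Sum>f\<in>?l ` ?k. c f * (\<Prod>w\<in>U. w ^ f w)) = 0" .
  have ne: "?l ` ?k \<noteq> {}"
  proof
    assume "?l ` ?k = {}"
    then have "mapping_of P = 0" by simp
    then show False using P(4) by (metis mapping_of_inverse zero_mpoly.abs_eq)
  qed
  have z: "f w = 0" if "f \<in> ?l ` ?k" "w \<notin> U" for f w
    using that kU by (force simp: in_keys_iff)
  have cc: "c f \<in> K \<and> c f \<noteq> 0" if "f \<in> ?l ` ?k" for f
    using that c P(1) by (auto simp: mpoly_coeffs_def in_keys_iff Poly_Mapping.range.rep_eq)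
  have "finite (?l ` ?k)" by simp
  from monomial_relation[where c = c and K = K, OF fin this ne _ _ r] z cc have "\<exists>u\<in>U. alg_over (gen (K \<union> (U - {u}))) u" by blast
  then show False using indep by blast
qed

lemma Fract_hom: "Fract (P + Q) 1 = Fract P 1 + Fract Q 1" "Fract (P * Q) 1 = Fract P 1 * Fract Q 1"
    "Fract (- P) 1 = - Fract P 1"
  by simp_all

text \<open>Substituting a fresh indeterminate for the variable \<open>g\<close> turns a relation
  with coefficients free of \<open>g\<close> into a vanishing univariate polynomial with those same
  coefficients.\<close>

lemma ratfun_var_independent:
  fixes g :: 'v
  shows "\<not> alg_over (gen (range ratfun_const \<union> ratfun_var ` (- {g}))) (ratfun_var g :: ('v, 'k::field) ratfun)"
proof
  let ?f = "\<lambda>c::'k. [:mpoly_const c :: ('v, 'k) mpoly:]"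
  let ?x = "\<lambda>v. if v = g then [:0, 1:] else [:mpoly_var v :: ('v, 'k) mpoly:]"
  interpret F: coeff_hom ?f
    by unfold_locales (auto simp: mpoly_const.add mpoly_const.mult mpoly_const.one one_pCons)
  let ?E = "mpoly_eval ?f ?x"
  \<comment> \<open>The polynomials free of the variable \<open>g\<close>, recognised by the
    substitution sending them to constants.\<close>
  define C where "C = {P. ?E P = [:P:]}"
  define R where "R = (\<lambda>P. Fract P 1) ` C"
  have R: "subrng R"
    unfolding subrng_def
  proof (intro conjI ballI)
    have "1 \<in> C" by (simp add: C_def F.eval_one one_pCons)
    then show "1 \<in> R" unfolding R_def by (force simp: One_fract_def)
    have um: "?E (- P) = - ?E P" for P
    proof -
      have "?E P + ?E (- P) = 0"
        unfolding F.eval_add[symmetric] by (simp add: F.eval_zero)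
      then show ?thesis by (simp only: add_eq_0_iff)
    qed
    fix a assume "a \<in> R"
    then obtain P where P: "a = Fract P 1" "P \<in> C" by (auto simp: R_def)
    then have "- P \<in> C" by (simp add: C_def um)
    moreover have "- a = Fract (- P) 1" by (simp add: P)
    ultimately show "- a \<in> R" unfolding R_def by blast
    fix b assume "b \<in> R"
    then obtain Q where Q: "b = Fract Q 1" "Q \<in> C" by (auto simp: R_def)
    have "P + Q \<in> C" "P * Q \<in> C" using P Q by (simp_all add: C_def F.eval_add F.eval_mult)
    moreover have "a + b = Fract (P + Q) 1" "a * b = Fract (P * Q) 1" by (simp_all add: P Q)
    ultimately show "a + b \<in> R" "a * b \<in> R" unfolding R_def by blast+
  qed
  have sub: "range ratfun_const \<union> ratfun_var ` (- {g}) \<subseteq> R"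
    by (auto simp: R_def C_def ratfun_const_def ratfun_var_def F.eval_const F.eval_var)
  assume "alg_over (gen (range ratfun_const \<union> ratfun_var ` (- {g}))) (ratfun_var g :: ('v, 'k) ratfun)"
  then have "alg_over (gen R) (ratfun_var g :: ('v, 'k) ratfun)"
    by (rule alg_over_mono) (rule gen_mono[OF sub])
  then obtain p where p: "p \<noteq> 0" "\<And>i. poly.coeff p i \<in> R" "poly p (ratfun_var g :: ('v, 'k) ratfun) = 0"
    using clear_denominators[OF R] by blast
  have "\<exists>Q. poly.coeff p i = Fract Q 1 \<and> Q \<in> C" for i using p(2)[of i] by (auto simp: R_def)
  then obtain Q where Q: "\<And>i. poly.coeff p i = Fract (Q i) 1" "\<And>i. Q i \<in> C" by metis
  define d where "d = Polynomial.degree p"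
  have pw: "Fract (a ^ i) 1 = (Fract a 1) ^ i" for a :: "('v, 'k) mpoly" and i
    by (induction i) (simp_all add: One_fract_def Fract_hom(2) del: mult_fract)
  have sm: "Fract (\<Sum>i\<in>I. h i) 1 = (\<Sum>i\<in>I. Fract (h i) 1)" for h :: "nat \<Rightarrow> ('v, 'k) mpoly" and I
    by (induction I rule: infinite_finite_induct) (simp_all add: Zero_fract_def Fract_hom(1) del: add_fract)
  have "Fract (\<Sum>i\<le>d. Q i * mpoly_var g ^ i) 1 = poly p (ratfun_var g)"
    unfolding poly_altdef d_def by (simp add: sm Fract_hom pw Q ratfun_var_def del: add_fract mult_fract)
  then have "(\<Sum>i\<le>d. Q i * mpoly_var g ^ i) = 0"
    using p(3) by (simp add: eq_fract Zero_fract_def)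
  then have "?E (\<Sum>i\<le>d. Q i * mpoly_var g ^ i) = 0" by (simp only: F.eval_zero)
  moreover have "?E (P ^ i) = ?E P ^ i" for P i
    by (induction i) (simp_all add: F.eval_one F.eval_mult)
  ultimately have "(\<Sum>i\<le>d. [:Q i:] * [:0, 1:] ^ i) = 0"
    using Q(2) by (simp add: F.eval_sum F.eval_mult F.eval_var C_def)
  moreover have "[:Q i:] * [:0, 1:] ^ i = Polynomial.monom (Q i) i" for i
    by (simp add: monom_altdef)
  ultimately have "(\<Sum>i\<le>d. Polynomial.monom (Q i) i) = 0" by simp
  then have "poly.coeff (\<Sum>i\<le>d. Polynomial.monom (Q i) i) d = 0" by simp
  then have "Q d = 0" by (simp add: coeff_sum)
  then have "poly.coeff p d = 0" using Q(1) by (simp add: Zero_fract_def)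
  then show False using p(1) by (simp add: d_def)
qed

section \<open>Finite groups of field automorphisms\<close>

definition fhom :: "('a::field \<Rightarrow> 'a) \<Rightarrow> bool" where
  "fhom f \<longleftrightarrow> f 1 = 1 \<and> (\<forall>x y. f (x + y) = f x + f y \<and> f (x * y) = f x * f y)"

lemma fhomD:
  assumes "fhom f"
  shows fhom_1: "f 1 = 1" and fhom_add: "f (x + y) = f x + f y" and fhom_mult: "f (x * y) = f x * f y"
  using assms by (auto simp: fhom_def)

lemma fhom_0: "fhom f \<Longrightarrow> f 0 = 0"
  using fhom_add[of f 0 0] by (metis add_cancel_right_right add_0)

lemma fhom_uminus: "fhom f \<Longrightarrow> f (- x) = - f x"
  using fhom_add[of f x "- x"] by (simp add: fhom_0 eq_neg_iff_add_eq_0 add.commute)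

lemma fhom_diff: "fhom f \<Longrightarrow> f (x - y) = f x - f y"
  using fhom_add[of f x "- y"] by (simp add: fhom_uminus)

lemma fhom_eq_0_iff: "fhom f \<Longrightarrow> f x = 0 \<longleftrightarrow> x = 0"
  by (metis fhom_0 fhom_1 fhom_mult mult_zero_left right_inverse zero_neq_one)

lemma fhom_inj: "fhom f \<Longrightarrow> inj f"
  by (rule injI) (metis eq_iff_diff_eq_0 fhom_diff fhom_eq_0_iff)

lemma fhom_inverse: "fhom f \<Longrightarrow> f (inverse x) = inverse (f x)"
  by (cases "x = 0") (simp_all add: fhom_0, metis fhom_1 fhom_mult inverse_unique right_inverse)

lemma fhom_divide: "fhom f \<Longrightarrow> f (x / y) = f x / f y"
  by (simp add: divide_inverse fhom_mult fhom_inverse)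

lemma fhom_power: "fhom f \<Longrightarrow> f (x ^ n) = f x ^ n"
  by (induction n) (simp_all add: fhom_1 fhom_mult)

lemma fhom_powi: "fhom f \<Longrightarrow> f (x powi n) = f x powi n"
  by (simp add: power_int_def fhom_power fhom_inverse)

lemma fhom_sum: "fhom f \<Longrightarrow> f (sum h I) = (\<Sum>i\<in>I. f (h i))"
  by (induction I rule: infinite_finite_induct) (simp_all add: fhom_0 fhom_add)

lemma fhom_prod: "fhom f \<Longrightarrow> f (prod h I) = (\<Prod>i\<in>I. f (h i))"
  by (induction I rule: infinite_finite_induct) (simp_all add: fhom_1 fhom_mult)

lemma fhom_sum_list: "fhom f \<Longrightarrow> f (sum_list xs) = sum_list (map f xs)"
  by (induction xs) (simp_all add: fhom_0 fhom_add)

lemma fhom_of_nat: "fhom f \<Longrightarrow> f (of_nat n) = of_nat n"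
  by (induction n) (simp_all add: fhom_0 fhom_1 fhom_add)

lemma fhom_comp: "fhom f \<Longrightarrow> fhom g \<Longrightarrow> fhom (f \<circ> g)"
  by (simp add: fhom_def)

lemma fhom_id: "fhom id" by (simp add: fhom_def)

lemma fhom_funpow: "fhom f \<Longrightarrow> fhom (f ^^ n)"
  by (induction n) (simp_all add: fhom_id[unfolded id_def] fhom_comp fhom_id)

lemmas fhom_simps = fhom_0 fhom_1 fhom_add fhom_mult fhom_uminus fhom_diff fhom_inverse fhom_divide
  fhom_power fhom_powi fhom_sum fhom_prod fhom_of_nat

lemma subfld_vimage:
  assumes f: "fhom f" and E: "subfld E" shows "subfld {x. f x \<in> E}"
  by (rule subfldI) (use sf_intros[OF E] in \<open>auto simp: fhom_simps[OF f]\<close>)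

lemma fhom_gen:
  assumes f: "fhom f" and S: "\<And>x. x \<in> S \<Longrightarrow> f x \<in> gen T" and x: "x \<in> gen S"
  shows "f x \<in> gen T"
proof -
  have "gen S \<subseteq> {x. f x \<in> gen T}"
    by (rule gen_least) (use S in \<open>auto intro: subfld_vimage[OF f]\<close>)
  then show ?thesis using x by auto
qed

lemma subfld_fixed: "fhom f \<Longrightarrow> subfld {x. f x = x}"
  by (rule subfldI) (auto simp: fhom_simps)

lemma gen_fixed:
  assumes f: "fhom f" and S: "\<And>x. x \<in> S \<Longrightarrow> f x = x" and x: "x \<in> gen S"
  shows "f x = x"
proof -
  have "gen S \<subseteq> {x. f x = x}"
    by (rule gen_least) (use S in \<open>auto intro: subfld_fixed[OF f]\<close>)
  then show ?thesis using x by auto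
qed

definition autgrp :: "('a::field \<Rightarrow> 'a) set \<Rightarrow> bool" where
  "autgrp \<Gamma> \<longleftrightarrow> finite \<Gamma> \<and> id \<in> \<Gamma> \<and> (\<forall>g\<in>\<Gamma>. fhom g) \<and> (\<forall>g\<in>\<Gamma>. \<forall>h\<in>\<Gamma>. g \<circ> h \<in> \<Gamma>)"

definition Fix :: "('a \<Rightarrow> 'a) set \<Rightarrow> 'a set \<Rightarrow> 'a set" where
  "Fix \<Gamma> E = {x \<in> E. \<forall>g\<in>\<Gamma>. g x = x}"

definition orbit_sum :: "('a::field \<Rightarrow> 'a) set \<Rightarrow> 'a \<Rightarrow> 'a" where
  "orbit_sum \<Gamma> x = (\<Sum>g\<in>\<Gamma>. g x)"

context
  fixes \<Gamma> :: "('a::field \<Rightarrow> 'a) set" assumes \<Gamma>: "autgrp \<Gamma>"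
begin

lemma autgrp_facts: "finite \<Gamma>" "id \<in> \<Gamma>" "g \<in> \<Gamma> \<Longrightarrow> fhom g" "g \<in> \<Gamma> \<Longrightarrow> h \<in> \<Gamma> \<Longrightarrow> g \<circ> h \<in> \<Gamma>"
  using \<Gamma> by (auto simp: autgrp_def)

lemma autgrp_translate:
  assumes g: "g \<in> \<Gamma>" shows "bij_betw (\<lambda>h. g \<circ> h) \<Gamma> \<Gamma>"
proof -
  have "inj_on (\<lambda>h. g \<circ> h) \<Gamma>"
    by (rule inj_onI) (metis autgrp_facts(3) fhom_inj fun.inj_map g injD)
  moreover have "(\<lambda>h. g \<circ> h) ` \<Gamma> \<subseteq> \<Gamma>" using g autgrp_facts by auto
  ultimately show ?thesis
    using autgrp_facts(1) by (simp add: bij_betw_def endo_inj_surj)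
qed

lemma fixed_orbit_sum:
  assumes g: "g \<in> \<Gamma>" shows "g (orbit_sum \<Gamma> x) = orbit_sum \<Gamma> x"
proof -
  have "g (orbit_sum \<Gamma> x) = (\<Sum>h\<in>\<Gamma>. (g \<circ> h) x)"
    by (simp add: orbit_sum_def fhom_sum autgrp_facts(3)[OF g])
  also have "\<dots> = orbit_sum \<Gamma> x"
    unfolding orbit_sum_def by (rule sum.reindex_bij_betw[OF autgrp_translate[OF g]])
  finally show ?thesis .
qed

lemma fixed_orbit_prod:
  assumes g: "g \<in> \<Gamma>" shows "g (\<Prod>h\<in>\<Gamma>. h x) = (\<Prod>h\<in>\<Gamma>. h x)"
proof -
  have "g (\<Prod>h\<in>\<Gamma>. h x) = (\<Prod>h\<in>\<Gamma>. (g \<circ> h) x)"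
    by (simp add: fhom_prod autgrp_facts(3)[OF g])
  also have "\<dots> = (\<Prod>h\<in>\<Gamma>. h x)"
    by (rule prod.reindex_bij_betw[OF autgrp_translate[OF g]])
  finally show ?thesis .
qed

lemma subfld_Fix: "subfld E \<Longrightarrow> subfld (Fix \<Gamma> E)"
  unfolding Fix_def by (rule subfldI) (auto simp: sf_intros autgrp_facts fhom_simps)

text \<open>The polynomial with the roots \<open>g x\<close> has coefficients invariant under
  \<open>\<Gamma>\<close>.\<close>

lemma alg_over_Fix:
  assumes E: "subfld E" and st: "\<And>g x. g \<in> \<Gamma> \<Longrightarrow> x \<in> E \<Longrightarrow> g x \<in> E" and x: "x \<in> E"
  shows "alg_over (Fix \<Gamma> E) x"
proof -
  define P where "P = (\<Prod>g\<in>\<Gamma>. [:- g x, 1:])"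
  have "P \<noteq> 0" using autgrp_facts(1) by (simp add: P_def)
  moreover have "poly P x = 0"
    unfolding P_def poly_prod using autgrp_facts(1,2) by (intro prod_zero bexI[of _ id]) auto
  moreover have "poly.coeff P i \<in> E" for i
  proof -
    have "\<forall>i. poly.coeff (\<Prod>g\<in>D. [:- g x, 1:]) i \<in> E" if "D \<subseteq> \<Gamma>" for D
      using finite_subset[OF that autgrp_facts(1)] that
    proof (induction D)
      case empty then show ?case using E by (auto simp: one_pCons coeff_pCons sf_intros split: nat.splits)
    next
      case (insert g D)
      have "poly.coeff [:- g x, 1:] i \<in> E" for i
        using insert st x by (auto simp: coeff_pCons sf_intros[OF E] split: nat.splits)
      then have "poly.coeff ([:- g x, 1:] * (\<Prod>g\<in>D. [:- g x, 1:])) i \<in> E" for i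
        by (rule poly_over_mult[OF subfld_subrng[OF E]]) (use insert in auto)
      then show ?case using insert.hyps by (metis (no_types, lifting) prod.insert)
    qed
    then show ?thesis by (auto simp: P_def)
  qed
  moreover have "h (poly.coeff P i) = poly.coeff P i" if h: "h \<in> \<Gamma>" for h i
  proof -
    note hh = autgrp_facts(3)[OF h]
    have m: "map_poly h (p * q) = map_poly h p * map_poly h q" for p q
      by (rule poly_eqI) (simp add: coeff_map_poly coeff_mult fhom_simps[OF hh])
    have pr: "map_poly h (prod f D) = (\<Prod>d\<in>D. map_poly h (f d))" for f and D :: "('a \<Rightarrow> 'a) set"
    proof (induction D rule: infinite_finite_induct)
      case (insert x F) then show ?case by (simp add: m)
    qed (auto intro!: poly_eqI simp: coeff_map_poly one_pCons coeff_pCons fhom_simps[OF hh] split: nat.splits)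
    have "map_poly h P = (\<Prod>g\<in>\<Gamma>. [:- (h \<circ> g) x, 1:])"
      unfolding P_def pr by (rule prod.cong) (simp_all add: map_poly_pCons fhom_simps[OF hh])
    also have "\<dots> = P"
      unfolding P_def by (rule prod.reindex_bij_betw[OF autgrp_translate[OF h], of "\<lambda>g. [:- g x, 1:]"])
    finally show ?thesis by (metis coeff_map_poly fhom_0 hh)
  qed
  ultimately show ?thesis unfolding alg_over_def Fix_def by blast
qed

end

text \<open>Sums of elements of \<open>S\<close> form a ring \<open>R\<close>. An invariant fraction
  over \<open>R\<close> becomes, on multiplying through by the other conjugates of its denominator,
  a quotient of two invariants in \<open>R\<close>, and averaging over \<open>\<Gamma>\<close>
  writes these in terms of orbit sums of elements of \<open>S\<close>. The averaging needs
  \<open>card \<Gamma>\<close> to be invertible.\<close>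

lemma Fix_gen_mult_closed:
  assumes \<Gamma>: "autgrp \<Gamma>" and c: "of_nat (card \<Gamma>) \<noteq> (0::'a::field)"
    and S: "1 \<in> S" "\<And>x y. x \<in> S \<Longrightarrow> y \<in> S \<Longrightarrow> x * y \<in> S" "\<And>x. x \<in> S \<Longrightarrow> - x \<in> (S::'a set)"
    and st: "\<And>g x. g \<in> \<Gamma> \<Longrightarrow> x \<in> S \<Longrightarrow> g x \<in> S"
    and z: "z \<in> gen S" "\<And>g. g \<in> \<Gamma> \<Longrightarrow> g z = z"
  shows "z \<in> gen (orbit_sum \<Gamma> ` S)"
proof -
  note G = autgrp_facts[OF \<Gamma>]
  define R where "R = {sum_list l |l. set l \<subseteq> S}"
  have R: "subrng R"
    unfolding subrng_def
  proof (intro conjI ballI)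
    show "1 \<in> R" unfolding R_def using S(1) by (auto intro!: exI[of _ "[1]"])
    fix x assume "x \<in> R" then obtain l where l: "x = sum_list l" "set l \<subseteq> S" by (auto simp: R_def)
    have "- x = sum_list (map uminus l)" unfolding l by (induction l) auto
    moreover have "set (map uminus l) \<subseteq> S" using l S(3) by auto
    ultimately show "- x \<in> R" unfolding R_def by blast
    fix y assume "y \<in> R" then obtain l' where l': "y = sum_list l'" "set l' \<subseteq> S" by (auto simp: R_def)
    show "x + y \<in> R" unfolding R_def using l l' by (auto intro!: exI[of _ "l @ l'"])
    have "sum_list l * sum_list l' = sum_list (concat (map (\<lambda>a. map (\<lambda>b. a * b) l') l))"
      by (induction l) (auto simp: distrib_right sum_list_const_mult)
    moreover have "set (concat (map (\<lambda>a. map (\<lambda>b. a * b) l') l)) \<subseteq> S"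
      using l(2) l'(2) by (auto intro!: S(2))
    ultimately show "x * y \<in> R" unfolding R_def l(1) l'(1) by blast
  qed
  have SR: "S \<subseteq> R"
  proof
    fix x assume "x \<in> S"
    then have "sum_list [x] \<in> R" unfolding R_def by (intro CollectI exI[of _ "[x]"]) auto
    then show "x \<in> R" by simp
  qed
  have Rst: "g x \<in> R" if a: "g \<in> \<Gamma>" "x \<in> R" for g x
  proof -
    obtain l where l: "x = sum_list l" "set l \<subseteq> S" using a(2) unfolding R_def by blast
    then have "g x = sum_list (map g l)" using G(3)[OF a(1)] by (simp add: fhom_sum_list)
    moreover have "set (map g l) \<subseteq> S" using l st a by auto
    ultimately show ?thesis unfolding R_def by blast
  qed
  obtain a b where ab: "z = a / b" "a \<in> R" "b \<in> R" "b \<noteq> 0"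
    using z(1) gen_mono[OF SR] gen_subrng[OF R] by blast
  define n where "n = (\<Prod>g\<in>\<Gamma>. g b)"
  define b' where "b' = (\<Prod>g\<in>\<Gamma> - {id}. g b)"
  have n: "n = b * b'" unfolding n_def b'_def using prod.remove[OF G(1,2), of "\<lambda>g. g b"] by simp
  have n0: "n \<noteq> 0" unfolding n_def using G ab by (auto simp: fhom_eq_0_iff)
  have b'R: "b' \<in> R" unfolding b'_def by (rule subrng_prod[OF R]) (use Rst ab in auto)
  have z': "z = (a * b') / n" using ab n n0 by (simp add: field_simps)
  have nR: "n \<in> R" using n b'R ab R by (auto simp: subrng_def)
  have nf: "g n = n" if "g \<in> \<Gamma>" for g unfolding n_def by (rule fixed_orbit_prod[OF \<Gamma> that])
  have af: "g (a * b') = a * b'" if "g \<in> \<Gamma>" for g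
  proof -
    have "a * b' = z * n" using z' n0 by simp
    then show ?thesis using z(2)[OF that] nf[OF that] by (simp add: fhom_mult[OF G(3)[OF that]])
  qed
  have key: "r \<in> gen (orbit_sum \<Gamma> ` S)" if r: "r \<in> R" "\<And>g. g \<in> \<Gamma> \<Longrightarrow> g r = r" for r
  proof -
    obtain l where l: "r = sum_list l" "set l \<subseteq> S" using r(1) unfolding R_def by blast
    have "of_nat (card \<Gamma>) * r = (\<Sum>g\<in>\<Gamma>. g r)"
    proof -
      have "(\<Sum>g\<in>\<Gamma>. g r) = (\<Sum>g\<in>\<Gamma>. r)" by (rule sum.cong) (auto intro: r(2))
      then show ?thesis by simp
    qed
    also have "\<dots> = (\<Sum>g\<in>\<Gamma>. sum_list (map g l))"
      by (rule sum.cong) (simp_all add: l(1) fhom_sum_list G(3))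
    also have "\<dots> = sum_list (map (orbit_sum \<Gamma>) l)"
      by (induction l) (simp_all add: sum.distrib orbit_sum_def)
    finally have e: "r = sum_list (map (orbit_sum \<Gamma>) l) / of_nat (card \<Gamma>)" using c by (simp add: field_simps)
    have "sum_list (map (orbit_sum \<Gamma>) l) \<in> gen (orbit_sum \<Gamma> ` S)"
      using l(2) by (induction l) (auto intro!: gen_intros intro: gen_base)
    then show ?thesis unfolding e by (intro gen_intros)
  qed
  have "a * b' \<in> R" using ab b'R R by (auto simp: subrng_def)
  then show ?thesis unfolding z' using key[of n] key[of "a * b'"] nR nf af by (auto intro!: gen_intros)
qed

text \<open>Orbit sums of terms \<open>e * x powi i\<close> are again of this shape, so only those
  exponents \<open>i\<close> matter for which some such term with \<open>e \<noteq> 0\<close> is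
  invariant. They form a group \<open>I\<close>, nonzero because of the product of all conjugates of
  \<open>x\<close>; a term \<open>z\<close> belonging to its positive generator \<open>d\<close>
  accounts for all invariants.\<close>

lemma Fix_gen_semiinvariant:
  assumes \<Gamma>: "autgrp \<Gamma>" and c: "of_nat (card \<Gamma>) \<noteq> (0::'a::field)"
    and E: "subfld E" and st: "\<And>g y. g \<in> \<Gamma> \<Longrightarrow> y \<in> E \<Longrightarrow> g y \<in> E"
    and x: "x \<noteq> 0" "\<And>g. g \<in> \<Gamma> \<Longrightarrow> \<exists>a\<in>E. g x = a * (x::'a)"
  shows "\<exists>z. z \<noteq> 0 \<and> z \<in> gen (insert x E) \<and> (\<forall>g\<in>\<Gamma>. g z = z) \<and> Fix \<Gamma> (gen (insert x E)) = gen (insert z (Fix \<Gamma> E))"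
proof -
  note G = autgrp_facts[OF \<Gamma>]
  define S where "S = {e * x powi i |e i. e \<in> E}"
  define I where "I = {i. \<exists>e\<in>E. e \<noteq> 0 \<and> (\<forall>g\<in>\<Gamma>. g (e * x powi i) = e * x powi i)}"
  have "\<exists>\<chi>. \<forall>g\<in>\<Gamma>. \<chi> g \<in> E \<and> g x = \<chi> g * x" using x(2) by metis
  then obtain \<chi> where \<chi>: "\<And>g. g \<in> \<Gamma> \<Longrightarrow> \<chi> g \<in> E \<and> g x = \<chi> g * x" by blast
  have \<chi>i: "g (x powi i) = \<chi> g powi i * x powi i" if "g \<in> \<Gamma>" for g i
    using \<chi>[OF that] by (simp add: fhom_powi[OF G(3)[OF that]] power_int_mult_distrib)
  have tr: "\<exists>e'\<in>E. orbit_sum \<Gamma> (e * x powi i) = e' * x powi i" if e: "e \<in> E" for e i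
  proof
    show "orbit_sum \<Gamma> (e * x powi i) = (\<Sum>g\<in>\<Gamma>. g e * \<chi> g powi i) * x powi i"
      unfolding orbit_sum_def sum_distrib_right by (rule sum.cong) (simp_all add: \<chi>i fhom_mult[OF G(3)])
    show "(\<Sum>g\<in>\<Gamma>. g e * \<chi> g powi i) \<in> E" using \<chi> st e by (intro sf_intros[OF E]) auto
  qed
  have I_diff: "i - j \<in> I" if ij: "i \<in> I" "j \<in> I" for i j
  proof -
    obtain e where e: "e \<in> E" "e \<noteq> 0" "\<forall>g\<in>\<Gamma>. g (e * x powi i) = e * x powi i" using ij unfolding I_def by blast
    obtain f where f: "f \<in> E" "f \<noteq> 0" "\<forall>g\<in>\<Gamma>. g (f * x powi j) = f * x powi j" using ij unfolding I_def by blast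
    have eq: "(e / f) * x powi (i - j) = (e * x powi i) / (f * x powi j)"
      using x(1) by (simp add: power_int_diff)
    have "g ((e / f) * x powi (i - j)) = (e / f) * x powi (i - j)" if "g \<in> \<Gamma>" for g
      unfolding eq fhom_divide[OF G(3)[OF that]] using e f that by auto
    moreover have "e / f \<in> E" "e / f \<noteq> 0" using e f by (auto intro: sf_intros[OF E])
    ultimately show ?thesis unfolding I_def by blast
  qed
  have I0: "0 \<in> I" unfolding I_def using G(3) by (auto intro!: bexI[of _ 1] sf_intros[OF E] simp: fhom_1)
  have I_add: "i + j \<in> I" if "i \<in> I" "j \<in> I" for i j
    using I_diff[OF that(1) I_diff[OF I0 that(2)]] by simp
  have cI: "int (card \<Gamma>) \<in> I"
  proof -
    have "(\<Prod>h\<in>\<Gamma>. h x) = (\<Prod>h\<in>\<Gamma>. \<chi> h * x)" by (rule prod.cong) (use \<chi> in auto)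
    then have e: "(\<Prod>h\<in>\<Gamma>. h x) = (\<Prod>h\<in>\<Gamma>. \<chi> h) * x powi int (card \<Gamma>)"
      by (simp add: prod.distrib)
    have "(\<Prod>h\<in>\<Gamma>. \<chi> h) \<in> E" by (rule sf_prod[OF E]) (use \<chi> in auto)
    moreover have "(\<Prod>h\<in>\<Gamma>. \<chi> h) \<noteq> 0"
    proof -
      have "\<chi> h \<noteq> 0" if "h \<in> \<Gamma>" for h
        using \<chi>[OF that] x(1) fhom_eq_0_iff[OF G(3)[OF that], of x] by auto
      then show ?thesis using G(1) by simp
    qed
    ultimately show ?thesis unfolding I_def e[symmetric] using fixed_orbit_prod[OF \<Gamma>, of _ x] e by auto
  qed
  define d where "d = (LEAST n. n > 0 \<and> int n \<in> I)"
  have dmin: "\<not> (n > 0 \<and> int n \<in> I)" if "n < d" for n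
    using that unfolding d_def by (rule not_less_Least)
  have c0: "card \<Gamma> > 0" using G(1,2) by (auto simp: card_gt_0_iff)
  have "d > 0 \<and> int d \<in> I"
    unfolding d_def by (rule LeastI[of _ "card \<Gamma>"]) (use c0 cI in auto)
  then have d: "d > 0" "int d \<in> I" by auto
  have I_mult: "int d * q \<in> I" for q
  proof (induction q rule: int_induct[where k = 0])
    case base show ?case using I0 by simp
  next
    case (step1 i) then show ?case using I_add[OF _ d(2)] by (simp add: distrib_left)
  next
    case (step2 i) then show ?case using I_diff[OF _ d(2)] by (simp add: right_diff_distrib)
  qed
  have I_dvd: "int d dvd i" if "i \<in> I" for i
  proof -
    have "i mod int d \<in> I" using I_diff[OF that I_mult[of "i div int d"]] by (simp add: minus_mult_div_eq_mod)
    then have a1: "int (nat (i mod int d)) \<in> I" using d(1) by simp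
    have a2: "nat (i mod int d) < d" using d(1) by (simp add: nat_less_iff)
    have "\<not> nat (i mod int d) > 0" using dmin[OF a2] a1 by metis
    have "i mod int d \<ge> 0" using d(1) by simp
    with \<open>\<not> nat (i mod int d) > 0\<close> have "i mod int d = 0" by linarith
    then show ?thesis by (simp add: dvd_eq_mod_eq_0)
  qed
  obtain e where e: "e \<in> E" "e \<noteq> 0" "\<forall>g\<in>\<Gamma>. g (e * x powi int d) = e * x powi int d" using d(2) unfolding I_def by blast
  define z where "z = e * x powi int d"
  have z0: "z \<noteq> 0" using e x by (simp add: z_def)
  have zin: "z \<in> gen (insert x E)"
    unfolding z_def using e gen_base[of x "insert x E"] gen_base[of e "insert x E"] by (intro gen_intros) auto
  have zf: "g z = z" if "g \<in> \<Gamma>" for g using e that by (simp add: z_def)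
  have "Fix \<Gamma> (gen (insert x E)) \<subseteq> gen (insert z (Fix \<Gamma> E))"
  proof
    fix w assume w: "w \<in> Fix \<Gamma> (gen (insert x E))"
    have "x \<in> S" unfolding S_def using sf_1[OF E] by (auto intro!: exI[of _ 1])
    moreover have "E \<subseteq> S"
    proof
      fix a assume "a \<in> E"
      moreover have "a = a * x powi 0" by simp
      ultimately show "a \<in> S" unfolding S_def by blast
    qed
    ultimately have "w \<in> gen S" using w gen_mono[of "insert x E" S] by (auto simp: Fix_def)
    then have "w \<in> gen (orbit_sum \<Gamma> ` S)"
    proof (rule Fix_gen_mult_closed[OF \<Gamma> c, rotated -2])
      show "1 \<in> S" using \<open>E \<subseteq> S\<close> sf_1[OF E] by blast
      show "g w = w" if "g \<in> \<Gamma>" for g using w that by (simp add: Fix_def)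
      fix u assume "u \<in> S"
      then obtain a i where u: "u = a * x powi i" "a \<in> E" unfolding S_def by blast
      show "- u \<in> S" unfolding S_def using u sf_uminus[OF E u(2)] by (auto intro!: exI[of _ "- a"])
      show "g u \<in> S" if "g \<in> \<Gamma>" for g
        unfolding S_def u(1) fhom_mult[OF G(3)[OF that]] \<chi>i[OF that]
        using st[OF that u(2)] \<chi>[OF that] by (intro CollectI exI[of _ "g a * \<chi> g powi i"] exI[of _ i]) (auto intro!: sf_intros[OF E])
      fix v assume "v \<in> S"
      then obtain b j where v: "v = b * x powi j" "b \<in> E" unfolding S_def by blast
      have "u * v = (a * b) * x powi (i + j)" using x u v by (simp add: power_int_add)
      then show "u * v \<in> S" unfolding S_def using sf_mult[OF E u(2) v(2)] by blast
    qed
    moreover have "orbit_sum \<Gamma> ` S \<subseteq> gen (insert z (Fix \<Gamma> E))"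
    proof
      fix m assume "m \<in> orbit_sum \<Gamma> ` S"
      then obtain a i where m: "m = orbit_sum \<Gamma> (a * x powi i)" "a \<in> E" unfolding S_def by blast
      obtain e' where e': "e' \<in> E" "m = e' * x powi i" using tr[OF m(2)] m(1) by blast
      have mf: "g m = m" if "g \<in> \<Gamma>" for g unfolding m by (rule fixed_orbit_sum[OF \<Gamma> that])
      show "m \<in> gen (insert z (Fix \<Gamma> E))"
      proof (cases "e' = 0")
        case True then show ?thesis using e' by (simp add: gen_intros)
      next
        case False
        then have "i \<in> I" unfolding I_def using e' mf by auto
        then obtain q where q: "i = int d * q" using I_dvd by (auto simp: dvd_def)
        define f where "f = e' * e powi (- q)"
        have "z powi q = e powi q * x powi i"
          by (simp only: z_def q power_int_mult_distrib power_int_mult)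
        then have mz: "m = f * z powi q" using e e' by (simp add: f_def power_int_minus field_simps)
        then have "f = m / z powi q" using z0 by simp
        then have "g f = f" if "g \<in> \<Gamma>" for g
          using mf[OF that] zf[OF that] by (simp add: fhom_divide fhom_powi G(3)[OF that])
        moreover have "f \<in> E" unfolding f_def using e e' by (intro sf_intros[OF E])
        ultimately have "f \<in> Fix \<Gamma> E" by (simp add: Fix_def)
        then show ?thesis unfolding mz by (intro gen_intros gen_base) auto
      qed
    qed
    ultimately show "w \<in> gen (insert z (Fix \<Gamma> E))" using gen_least[OF gen_subfld] by blast
  qed
  moreover have "gen (insert z (Fix \<Gamma> E)) \<subseteq> Fix \<Gamma> (gen (insert x E))"
    by (rule gen_least) (use subfld_Fix[OF \<Gamma>] zin zf in \<open>auto simp: Fix_def intro: gen_base\<close>)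
  ultimately show ?thesis using z0 zin zf by (intro exI[of _ z]) auto
qed

lemma sum_list_product_mult:
  fixes f :: "'b \<Rightarrow> 'a::semiring_0"
  shows "(\<Sum>x\<leftarrow>xs. f x) * (\<Sum>y\<leftarrow>ys. g y) = (\<Sum>z\<leftarrow>List.product xs ys. f (fst z) * g (snd z))"
  by (induction xs) (simp_all add: distrib_right sum_list_const_mult comp_def)

text \<open>A function \<open>h \<mapsto> \<Sum> a\<^sub>i h(c\<^sub>i)\<close> that vanishes on \<open>\<Gamma> - {id}\<close> plays the role of the inverse of
  the matrix \<open>h(c\<^sub>i)\<close>; such functions are closed under products, so one can separate one \<open>h\<close> at a time.\<close>

lemma separating_combination:
  assumes \<Gamma>: "autgrp \<Gamma>" and L: "subfld L" and st: "\<And>g x. g \<in> \<Gamma> \<Longrightarrow> x \<in> L \<Longrightarrow> g x \<in> L"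
    and faithful: "\<And>g. g \<in> \<Gamma> \<Longrightarrow> g \<noteq> id \<Longrightarrow> \<exists>c\<in>L. g c \<noteq> c"
  shows "\<exists>ps. set ps \<subseteq> L \<times> L \<and> (\<forall>h\<in>\<Gamma>. (\<Sum>q\<leftarrow>ps. fst q * h (snd q)) = (if h = id then 1 else 0))"
proof -
  note G = autgrp_facts[OF \<Gamma>]
  have "\<exists>ps. set ps \<subseteq> L \<times> L \<and> (\<Sum>q\<leftarrow>ps. fst q * snd q) = 1 \<and> (\<forall>h\<in>D. (\<Sum>q\<leftarrow>ps. fst q * h (snd q)) = 0)"
    if "D \<subseteq> \<Gamma> - {id}" for D
    using finite_subset[OF that] G(1) that
  proof (induction D rule: infinite_finite_induct)
    case (infinite A) then show ?case using infinite_super by (metis finite_Diff finite_subset)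
  next
    case empty
    then show ?case using sf_1[OF L] by (intro exI[of _ "[(1,1)]"]) auto
  next
    case (insert g D)
    then obtain ps where ps: "set ps \<subseteq> L \<times> L" "(\<Sum>q\<leftarrow>ps. fst q * snd q) = 1"
      "\<forall>h\<in>D. (\<Sum>q\<leftarrow>ps. fst q * h (snd q)) = 0" by blast
    have g: "g \<in> \<Gamma>" "g \<noteq> id" using insert by auto
    obtain c where c: "c \<in> L" "g c \<noteq> c" using faithful[OF g] by blast
    define k where "k = inverse (c - g c)"
    \<comment> \<open>Encodes the function sending \<open>h\<close> to
      \<open>(h c - g c) / (c - g c)\<close>, which is \<open>1\<close> at the identity and
      \<open>0\<close> at \<open>g\<close>. Multiplying it into \<open>ps\<close> adds
      \<open>g\<close> to the zeros.\<close>
    define qs where "qs = [(k, c), (- k * g c, 1)]"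
    have k: "k \<in> L" unfolding k_def using c st g by (intro sf_intros[OF L]) auto
    have "g c \<in> L" using st g c by blast
    then have qsL: "set qs \<subseteq> L \<times> L" unfolding qs_def using c(1) k sf_1[OF L] by (auto intro!: sf_intros[OF L])
    have qs1: "(\<Sum>q\<leftarrow>qs. fst q * h (snd q)) = k * (h c - g c)" if "fhom h" for h
      using that by (simp add: qs_def fhom_1 algebra_simps)
    define rs where "rs = map (\<lambda>z. (fst (fst z) * fst (snd z), snd (fst z) * snd (snd z))) (List.product ps qs)"
    have rs: "(\<Sum>q\<leftarrow>rs. fst q * h (snd q)) = (\<Sum>q\<leftarrow>ps. fst q * h (snd q)) * (k * (h c - g c))" if "fhom h" for h
    proof -
      have "(\<Sum>q\<leftarrow>ps. fst q * h (snd q)) * (\<Sum>q\<leftarrow>qs. fst q * h (snd q))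
         = (\<Sum>z\<leftarrow>List.product ps qs. (fst (fst z) * h (snd (fst z))) * (fst (snd z) * h (snd (snd z))))"
        by (rule sum_list_product_mult)
      also have "\<dots> = (\<Sum>q\<leftarrow>rs. fst q * h (snd q))"
        by (simp add: rs_def comp_def fhom_mult[OF that] mult_ac)
      finally show ?thesis by (simp add: qs1[OF that])
    qed
    show ?case
    proof (intro exI[of _ rs] conjI ballI)
      show "set rs \<subseteq> L \<times> L" using ps(1) qsL unfolding rs_def by (auto intro!: sf_mult[OF L])
      show "(\<Sum>q\<leftarrow>rs. fst q * snd q) = 1"
        using rs[OF fhom_id] ps(2) c by (simp add: k_def)
      fix h assume h: "h \<in> insert g D"
      then have fh: "fhom h" using insert.prems G(3) by auto
      show "(\<Sum>q\<leftarrow>rs. fst q * h (snd q)) = 0"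
        using h ps(3) by (auto simp: rs[OF fh])
    qed
  qed
  from this[of "\<Gamma> - {id}"] obtain ps where "set ps \<subseteq> L \<times> L" "(\<Sum>q\<leftarrow>ps. fst q * snd q) = 1"
    "\<forall>h\<in>\<Gamma> - {id}. (\<Sum>q\<leftarrow>ps. fst q * h (snd q)) = 0" by blast
  then show ?thesis by (intro exI[of _ ps]) auto
qed

definition affspan :: "'a::field set \<Rightarrow> 'a set \<Rightarrow> 'a set" where
  "affspan L W = {c + (\<Sum>w\<in>W. f w * w) |c f. c \<in> L \<and> (\<forall>w\<in>W. f w \<in> L)}"

context
  fixes L :: "'a::field set" assumes L: "subfld L"
begin

lemma affspan_base: "c \<in> L \<Longrightarrow> c \<in> affspan L W"
  unfolding affspan_def using sf_0[OF L] by (intro CollectI exI[of _ c] exI[of _ "\<lambda>_. 0"]) auto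

lemma affspan_gen: "finite W \<Longrightarrow> w \<in> W \<Longrightarrow> w \<in> affspan L W"
  unfolding affspan_def using sf_0[OF L] sf_1[OF L]
  by (intro CollectI exI[of _ 0] exI[of _ "\<lambda>v. if v = w then 1 else 0"]) (auto simp: if_distrib[of "\<lambda>x. x * _"] cong: if_cong)

lemma affspan_add: "x \<in> affspan L W \<Longrightarrow> y \<in> affspan L W \<Longrightarrow> x + y \<in> affspan L W"
proof -
  assume "x \<in> affspan L W" "y \<in> affspan L W"
  then obtain c f d g where *: "x = c + (\<Sum>w\<in>W. f w * w)" "c \<in> L" "\<forall>w\<in>W. f w \<in> L"
    "y = d + (\<Sum>w\<in>W. g w * w)" "d \<in> L" "\<forall>w\<in>W. g w \<in> L" unfolding affspan_def by blast
  then have "x + y = (c + d) + (\<Sum>w\<in>W. (f w + g w) * w)" by (simp add: sum.distrib distrib_right)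
  then show ?thesis unfolding affspan_def using *
    by (intro CollectI exI[of _ "c + d"] exI[of _ "\<lambda>w. f w + g w"]) (auto intro: sf_add[OF L])
qed

lemma affspan_mult: "x \<in> affspan L W \<Longrightarrow> a \<in> L \<Longrightarrow> a * x \<in> affspan L W"
proof -
  assume "x \<in> affspan L W" and a: "a \<in> L"
  then obtain c f where *: "x = c + (\<Sum>w\<in>W. f w * w)" "c \<in> L" "\<forall>w\<in>W. f w \<in> L"
    unfolding affspan_def by blast
  then have "a * x = (a * c) + (\<Sum>w\<in>W. (a * f w) * w)" by (simp add: sum_distrib_left distrib_left mult.assoc)
  then show ?thesis unfolding affspan_def using * a
    by (intro CollectI exI[of _ "a * c"] exI[of _ "\<lambda>w. a * f w"]) (auto intro: sf_mult[OF L])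
qed

lemma affspan_sum: "(\<And>i. i \<in> I \<Longrightarrow> f i \<in> affspan L W) \<Longrightarrow> sum f I \<in> affspan L W"
  by (induction I rule: infinite_finite_induct) (auto intro: affspan_add affspan_base sf_0[OF L])

end

lemma affspan_gen_field: "affspan L W \<subseteq> gen (L \<union> W)"
  unfolding affspan_def by (auto intro!: gen_intros intro: gen_base)

text \<open>A separating combination recovers each \<open>w\<close> from the orbit sums of its
  multiples \<open>c * w\<close>. If all of these lie in \<open>L\<close>, so does \<open>W\<close>.
  Otherwise one of them involves some \<open>w0\<close> with nonzero coefficient and can replace it
  as a generator; being invariant, it can be adjoined to the base field without disturbing the
  hypotheses.\<close>

lemma no_name_lemma:
  assumes \<Gamma>: "autgrp \<Gamma>" and "finite W" and L: "subfld L"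
    and st: "\<And>g x. g \<in> \<Gamma> \<Longrightarrow> x \<in> L \<Longrightarrow> g x \<in> L"
    and faithful: "\<And>g. g \<in> \<Gamma> \<Longrightarrow> g \<noteq> id \<Longrightarrow> \<exists>c\<in>L. g c \<noteq> c"
    and W: "\<And>g w. g \<in> \<Gamma> \<Longrightarrow> w \<in> W \<Longrightarrow> g w \<in> affspan L W"
  shows "\<exists>T. finite T \<and> card T \<le> card W \<and> (\<forall>t\<in>T. \<forall>g\<in>\<Gamma>. g t = t) \<and> gen (L \<union> W) = gen (L \<union> T)"
  using assms(2-)
proof (induction "card W" arbitrary: W L)
  case 0
  then show ?case by (intro exI[of _ "{}"]) auto
next
  case (Suc n)
  note G = autgrp_facts[OF \<Gamma>]
  note L = \<open>subfld L\<close>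
  note st = \<open>\<And>g x. g \<in> \<Gamma> \<Longrightarrow> x \<in> L \<Longrightarrow> g x \<in> L\<close>
  note faithful = \<open>\<And>g. g \<in> \<Gamma> \<Longrightarrow> g \<noteq> id \<Longrightarrow> \<exists>c\<in>L. g c \<noteq> c\<close>
  note W = \<open>\<And>g w. g \<in> \<Gamma> \<Longrightarrow> w \<in> W \<Longrightarrow> g w \<in> affspan L W\<close>
  note fW = \<open>finite W\<close>
  have "\<exists>ps. set ps \<subseteq> L \<times> L \<and> (\<forall>h\<in>\<Gamma>. (\<Sum>q\<leftarrow>ps. fst q * h (snd q)) = (if h = id then 1 else 0))"
    by (rule separating_combination[OF \<Gamma> L]) (use st faithful in blast)+
  then obtain ps where ps: "set ps \<subseteq> L \<times> L"
    "\<And>h. h \<in> \<Gamma> \<Longrightarrow> (\<Sum>q\<leftarrow>ps. fst q * h (snd q)) = (if h = id then 1 else 0)"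
    by blast
  have os: "orbit_sum \<Gamma> (c * w) \<in> affspan L W" if "c \<in> L" "w \<in> W" for c w
    unfolding orbit_sum_def
    by (rule affspan_sum[OF L]) (use that W st G in \<open>auto simp: fhom_mult intro!: affspan_mult[OF L]\<close>)
  have expand: "w = (\<Sum>q\<leftarrow>ps. fst q * orbit_sum \<Gamma> (snd q * w))" for w
  proof -
    have "(\<Sum>q\<leftarrow>ps. fst q * orbit_sum \<Gamma> (snd q * w)) = (\<Sum>q\<leftarrow>ps. \<Sum>h\<in>\<Gamma>. fst q * h (snd q) * h w)"
      unfolding orbit_sum_def sum_distrib_left
      by (intro arg_cong[of _ _ sum_list] map_cong refl sum.cong) (simp add: fhom_mult[OF G(3)] mult.assoc)
    also have "\<dots> = (\<Sum>h\<in>\<Gamma>. (\<Sum>q\<leftarrow>ps. fst q * h (snd q)) * h w)"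
      by (induction ps) (simp_all add: sum.distrib distrib_right)
    also have "\<dots> = (\<Sum>h\<in>\<Gamma>. if h = id then w else 0)"
      by (rule sum.cong) (simp_all add: ps(2))
    also have "\<dots> = w" using G(1,2) by simp
    finally show ?thesis by simp
  qed
  show ?case
  proof (cases "\<forall>c\<in>L. \<forall>w\<in>W. orbit_sum \<Gamma> (c * w) \<in> L")
    case True
    have "w \<in> L" if "w \<in> W" for w
    proof -
      have "(\<Sum>q\<leftarrow>qs. fst q * orbit_sum \<Gamma> (snd q * w)) \<in> L" if "set qs \<subseteq> L \<times> L" for qs
        using that by (induction qs) (use True \<open>w \<in> W\<close> in \<open>auto intro!: sf_intros[OF L]\<close>)
      from this[OF ps(1)] show ?thesis by (subst expand)
    qed
    then show ?thesis by (intro exI[of _ "{}"]) (auto simp: Un_absorb2 subset_iff)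
  next
    case False
    then obtain c w1 where cw: "c \<in> L" "w1 \<in> W" "orbit_sum \<Gamma> (c * w1) \<notin> L" by blast
    define t where "t = orbit_sum \<Gamma> (c * w1)"
    have tf: "g t = t" if "g \<in> \<Gamma>" for g unfolding t_def by (rule fixed_orbit_sum[OF \<Gamma> that])
    obtain a f where af: "t = a + (\<Sum>w\<in>W. f w * w)" "a \<in> L" "\<forall>w\<in>W. f w \<in> L"
      using os[OF cw(1,2)] unfolding t_def affspan_def by blast
    have "\<exists>w0\<in>W. f w0 \<noteq> 0"
    proof (rule ccontr)
      assume "\<not> ?thesis"
      then have "t = a" using af by simp
      then show False using cw(3) af(2) by (simp add: t_def)
    qed
    then obtain w0 where w0: "w0 \<in> W" "f w0 \<noteq> 0" by blast
    define W' where "W' = W - {w0}"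
    define L' where "L' = gen (insert t L)"
    have L': "subfld L'" by (simp add: L'_def)
    have LL': "L \<subseteq> L'" using gen_incl[of "insert t L"] by (auto simp: L'_def)
    have tL': "t \<in> L'" by (auto simp: L'_def intro: gen_base)
    have W'f: "finite W'" "card W' = n" using fW w0 Suc(2) by (simp_all add: W'_def)
    have t_eq: "t = a + (f w0 * w0 + (\<Sum>w\<in>W'. f w * w))"
      unfolding af(1) W'_def using sum.remove[OF fW w0(1), of "\<lambda>w. f w * w"] by simp
    have w0e: "w0 = (t - a) / f w0 + (\<Sum>w\<in>W'. (- f w / f w0) * w)"
    proof -
      have "(\<Sum>w\<in>W'. (- f w / f w0) * w) = - (\<Sum>w\<in>W'. f w * w) / f w0"
        by (simp add: sum_negf sum_divide_distrib)
      then show ?thesis using t_eq w0(2) by (simp add: field_simps)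
    qed
    have w0in: "w0 \<in> affspan L' W'"
      by (subst w0e, unfold affspan_def)
        (use af w0 LL' tL' in \<open>auto simp: W'_def intro!: exI[of _ "(t - a) / f w0"] exI[of _ "\<lambda>w. - f w / f w0"] sf_intros[OF L']\<close>)
    have inc: "affspan L W \<subseteq> affspan L' W'"
    proof
      fix x assume "x \<in> affspan L W"
      then obtain c h where x: "x = c + (\<Sum>w\<in>W. h w * w)" "c \<in> L" "\<forall>w\<in>W. h w \<in> L" unfolding affspan_def by blast
      show "x \<in> affspan L' W'"
        unfolding x(1)
      proof (intro affspan_add[OF L'] affspan_sum[OF L'] affspan_mult[OF L'])
        show "c \<in> affspan L' W'" using x LL' by (intro affspan_base[OF L']) auto
        fix w assume w: "w \<in> W"
        then show "h w \<in> L'" using x LL' by auto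
        show "w \<in> affspan L' W'"
          using w0in affspan_gen[OF L' W'f(1), of w] w by (cases "w = w0") (auto simp: W'_def)
      qed
    qed
    have "\<exists>T. finite T \<and> card T \<le> card W' \<and> (\<forall>t\<in>T. \<forall>g\<in>\<Gamma>. g t = t) \<and> gen (L' \<union> W') = gen (L' \<union> T)"
    proof (rule Suc(1)[OF W'f(2)[symmetric] W'f(1) L'])
      fix g x assume g: "g \<in> \<Gamma>" and "x \<in> L'"
      show "g x \<in> L'"
        unfolding L'_def
        by (rule fhom_gen[OF G(3)[OF g], of "insert t L"])
          (use \<open>x \<in> L'\<close> g tf st in \<open>auto simp: L'_def intro: gen_base\<close>)
    next
      fix g assume "g \<in> \<Gamma>" "g \<noteq> id"
      then show "\<exists>c\<in>L'. g c \<noteq> c" using faithful LL' by blast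
    next
      fix g w assume "g \<in> \<Gamma>" "w \<in> W'"
      then show "g w \<in> affspan L' W'" using W inc by (auto simp: W'_def)
    qed
    then obtain T where T: "finite T" "card T \<le> n" "\<forall>t\<in>T. \<forall>g\<in>\<Gamma>. g t = t" "gen (L' \<union> W') = gen (L' \<union> T)"
      using W'f by auto
    have "gen (L \<union> W) = gen (L' \<union> W')"
    proof (rule gen_eqI)
      show "L \<union> W \<subseteq> gen (L' \<union> W')"
      proof
        fix x assume "x \<in> L \<union> W"
        then consider "x \<in> L" | "x = w0" | "x \<in> W'" by (auto simp: W'_def)
        then show "x \<in> gen (L' \<union> W')"
        proof cases
          case 2 then show ?thesis using w0in affspan_gen_field by blast
        qed (use LL' in \<open>auto intro: gen_base\<close>)
      qed
      have "t \<in> gen (L \<union> W)" using os[OF cw(1,2)] affspan_gen_field unfolding t_def by blast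
      then have "L' \<subseteq> gen (L \<union> W)" unfolding L'_def by (intro gen_least) (auto intro: gen_base)
      then show "L' \<union> W' \<subseteq> gen (L \<union> W)" by (auto simp: W'_def intro: gen_base)
    qed
    also note T(4)
    also have "gen (L' \<union> T) = gen (L \<union> insert t T)"
      using gen_gen_Un[of "insert t L" T] by (simp add: L'_def)
    finally have "gen (L \<union> W) = gen (L \<union> insert t T)" .
    moreover have "card (insert t T) \<le> card W" using T(1,2) Suc(2) by (simp add: card_insert_if)
    ultimately show ?thesis using T(1,3) tf by (intro exI[of _ "insert t T"]) auto
  qed
qed

section \<open>Multiplicative modules over \<open>\<int>[x]\<close>\<close>

text \<open>\<open>pexp \<tau> u h\<close> is the power \<open>u\<^sup>h\<close> for \<open>h \<in> \<int>[x]\<close>, where \<open>x\<close> acts as \<open>\<tau>\<close>.\<close>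

definition pexp :: "('a::field \<Rightarrow> 'a) \<Rightarrow> 'a \<Rightarrow> int poly \<Rightarrow> 'a" where
  "pexp \<tau> u h = fold_coeffs (\<lambda>a r. u powi a * \<tau> r) h 1"

context
  fixes \<tau> :: "'a::field \<Rightarrow> 'a" assumes \<tau>: "fhom \<tau>"
begin

lemma pexp_0 [simp]: "pexp \<tau> u 0 = 1"
  by (simp add: pexp_def)

lemma pexp_pCons [simp]: "pexp \<tau> u (pCons a h) = u powi a * \<tau> (pexp \<tau> u h)"
proof (cases "a = 0 \<and> h = 0")
  case True then show ?thesis by (simp add: fhom_1[OF \<tau>])
next
  case False then show ?thesis
    by (cases "a = 0") (simp_all add: pexp_def fold_coeffs_pCons_coeff_not_0_eq fold_coeffs_pCons_not_0_0_eq)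
qed

lemma pexp_nz: "u \<noteq> 0 \<Longrightarrow> pexp \<tau> u h \<noteq> 0"
  by (induction h) (simp_all add: fhom_eq_0_iff[OF \<tau>])

lemma pexp_add: "u \<noteq> 0 \<Longrightarrow> pexp \<tau> u (g + h) = pexp \<tau> u g * pexp \<tau> u h"
  by (induction g h rule: poly_induct2) (simp_all add: power_int_add fhom_mult[OF \<tau>] mult_ac)

lemma pexp_uminus: "u \<noteq> 0 \<Longrightarrow> pexp \<tau> u (- h) = inverse (pexp \<tau> u h)"
  using pexp_add[of u h "- h"] by (simp add: inverse_unique)

lemma pexp_diff: "u \<noteq> 0 \<Longrightarrow> pexp \<tau> u (g - h) = pexp \<tau> u g / pexp \<tau> u h"
  using pexp_add[of u g "- h"] by (simp add: pexp_uminus divide_inverse)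

lemma pexp_smult: "u \<noteq> 0 \<Longrightarrow> pexp \<tau> u (Polynomial.smult b h) = pexp \<tau> u h powi b"
  by (induction h) (simp_all add: fhom_powi[OF \<tau>] power_int_mult_distrib mult.commute[of b] power_int_mult)

lemma pexp_pexp: "u \<noteq> 0 \<Longrightarrow> pexp \<tau> (pexp \<tau> u h) g = pexp \<tau> u (h * g)"
  by (induction g) (simp_all add: pexp_add pexp_smult)

lemma pexp_one_base: "pexp \<tau> 1 h = 1"
  by (induction h) (simp_all add: fhom_1[OF \<tau>])

lemma pexp_1 [simp]: "pexp \<tau> u 1 = u"
  by (simp add: one_pCons fhom_1[OF \<tau>])

lemma pexp_monom_mult: "pexp \<tau> u (Polynomial.monom 1 j * h) = (\<tau> ^^ j) (pexp \<tau> u h)"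
proof (induction j)
  case (Suc j)
  have "Polynomial.monom 1 (Suc j) * h = pCons 0 (Polynomial.monom 1 j * h)"
    by (simp add: monom_Suc)
  then show ?case using Suc by simp
qed (simp add: monom_0)

lemma pexp_monom: "pexp \<tau> u (Polynomial.monom 1 j) = (\<tau> ^^ j) u"
  using pexp_monom_mult[of u j 1] by simp

lemma pexp_in_gen: "(\<And>i. (\<tau> ^^ i) u \<in> gen S) \<Longrightarrow> pexp \<tau> u h \<in> gen S"
proof -
  assume *: "\<And>i. (\<tau> ^^ i) u \<in> gen S"
  have "(\<tau> ^^ j) (pexp \<tau> u h) \<in> gen S" for j
  proof (induction h arbitrary: j)
    case 0 then show ?case using fhom_1[OF fhom_funpow[OF \<tau>]] by (simp add: gen_intros)
  next
    case (pCons a h)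
    have "(\<tau> ^^ j) (pexp \<tau> u (pCons a h)) = ((\<tau> ^^ j) u) powi a * (\<tau> ^^ Suc j) (pexp \<tau> u h)"
      by (simp add: fhom_simps[OF fhom_funpow[OF \<tau>]] funpow_swap1)
    then show ?case using * pCons(2) by (simp only: gen_intros)
  qed
  from this[of 0] show ?thesis by simp
qed

end

lemma funpow_fixed: "\<tau> x = x \<Longrightarrow> (\<tau> ^^ j) x = x"
  by (induction j) simp_all

definition Norm :: "nat \<Rightarrow> int poly" where
  "Norm n = (\<Sum>i<n. Polynomial.monom 1 i)"

lemma Norm_mult: "Polynomial.monom 1 n - 1 = Norm n * [:-1, 1:]"
proof (induction n)
  case (Suc n)
  have "Norm (Suc n) * [:-1, 1:] = Norm n * [:-1, 1:] + Polynomial.monom 1 n * [:-1, 1:]"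
    by (simp add: Norm_def distrib_right)
  also have "Polynomial.monom 1 n * [:-1, 1:] = Polynomial.monom (1::int) (Suc n) - Polynomial.monom 1 n"
    by (simp add: monom_Suc)
  finally show ?case using Suc by simp
qed (simp add: Norm_def monom_0)

text \<open>On the ideal \<open>{f. N dvd f(k)}\<close> the map \<open>\<beta>\<close> turns addition into multiplication and \<open>x\<close> into \<open>\<tau>\<close>.\<close>

definition mulmod :: "('a::field \<Rightarrow> 'a) \<Rightarrow> int \<Rightarrow> int \<Rightarrow> (int poly \<Rightarrow> 'a) \<Rightarrow> bool" where
  "mulmod \<tau> N k \<beta> \<longleftrightarrow>
    (\<forall>f g. N dvd poly f k \<longrightarrow> N dvd poly g k \<longrightarrow> \<beta> (f + g) = \<beta> f * \<beta> g) \<and>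
    (\<forall>f. N dvd poly f k \<longrightarrow> \<beta> (pCons 0 f) = \<tau> (\<beta> f) \<and> \<beta> f \<noteq> 0)"

context
  fixes \<tau> :: "'a::field \<Rightarrow> 'a" and N k :: int and \<beta> :: "int poly \<Rightarrow> 'a"
  assumes \<tau>: "fhom \<tau>" and \<beta>: "mulmod \<tau> N k \<beta>"
begin

lemma mm_add: "N dvd poly f k \<Longrightarrow> N dvd poly g k \<Longrightarrow> \<beta> (f + g) = \<beta> f * \<beta> g"
  and mm_shift: "N dvd poly f k \<Longrightarrow> \<beta> (pCons 0 f) = \<tau> (\<beta> f)"
  and mm_nz: "N dvd poly f k \<Longrightarrow> \<beta> f \<noteq> 0"
  using \<beta> unfolding mulmod_def by blast+

lemma mm_0: "\<beta> 0 = 1"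
  using mm_add[of 0 0] mm_nz[of 0] by simp

lemma mm_uminus: "N dvd poly f k \<Longrightarrow> \<beta> (- f) = inverse (\<beta> f)"
  using mm_add[of f "- f"] mm_0 by (simp add: inverse_unique)

lemma mm_diff: "N dvd poly f k \<Longrightarrow> N dvd poly g k \<Longrightarrow> \<beta> (f - g) = \<beta> f / \<beta> g"
  using mm_add[of f "- g"] mm_uminus[of g] by (simp add: divide_inverse)

lemma mm_smult: "N dvd poly f k \<Longrightarrow> \<beta> (Polynomial.smult a f) = \<beta> f powi a"
proof (induction a rule: int_induct[where k = 0])
  case (step1 i)
  then show ?case using mm_add[of "Polynomial.smult i f" f] mm_nz[of f]
    by (simp add: smult_add_left power_int_add)
next
  case (step2 i)
  then show ?case using mm_diff[of "Polynomial.smult i f" f] mm_nz[of f]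
    by (simp add: smult_diff_left power_int_diff)
qed (simp add: mm_0)

lemma mm_mult: "N dvd poly f k \<Longrightarrow> \<beta> (f * h) = pexp \<tau> (\<beta> f) h"
proof (induction h)
  case (pCons a h)
  then show ?case
    using mm_add[of "Polynomial.smult a f" "pCons 0 (f * h)"] mm_shift[of "f * h"] mm_smult[of f a]
    by (simp add: pexp_pCons[OF \<tau>])
qed (simp add: mm_0 pexp_0[OF \<tau>])

lemma mm_mult_one: "N dvd poly f k \<Longrightarrow> \<beta> f = 1 \<Longrightarrow> \<beta> (f * h) = 1"
  by (simp add: mm_mult pexp_one_base[OF \<tau>])

end

text \<open>Gauss's lemma: \<open>N\<close> divides the content of \<open>m * w\<close>, which is
  that of \<open>w\<close>, so it can be cancelled from \<open>w\<close>.\<close>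

lemma monic_dvd_smult:
  fixes m w y :: "int poly"
  assumes "content m = 1" "m * w = Polynomial.smult N y"
  shows "N = 0 \<or> (\<exists>w'. y = m * w')"
proof (cases "N = 0")
  case False
  have "content (m * w) = content w" using assms(1) by (simp add: content_mult)
  moreover have "N dvd content (m * w)" unfolding assms(2) by simp
  ultimately have "[:N:] dvd w" by (simp add: const_poly_dvd_iff_dvd_content)
  then obtain w' where w': "w = Polynomial.smult N w'" by (auto simp: dvd_def)
  then have "Polynomial.smult N (m * w') = Polynomial.smult N y" using assms(2) by simp
  then have "y = m * w'" using False by (metis smult_cancel)
  then show ?thesis by blast
qed simp

lemma content_cyclic: "n > 0 \<Longrightarrow> content (Polynomial.monom 1 n - 1 :: int poly) = 1"
proof -
  assume n: "n > 0"
  have "content (Polynomial.monom 1 n - 1 :: int poly) dvd poly.coeff (Polynomial.monom 1 n - 1 :: int poly) n"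
    by (rule content_dvd_coeff)
  also have "poly.coeff (Polynomial.monom 1 n - 1 :: int poly) n = 1" using n by simp
  finally show ?thesis unfolding is_unit_content_iff .
qed

section \<open>Discrete Fourier transform with an eigenvector\<close>

abbreviation prim_root :: "'a::field \<Rightarrow> nat \<Rightarrow> bool" where
  "prim_root z n \<equiv> primitive_root_of_unity n z"

lemma prim_root_nz: "prim_root z n \<Longrightarrow> z \<noteq> 0"
  by (auto simp: primitive_root_of_unity_def power_0_left)

lemma prim_root_power:
  assumes "prim_root z P" "m dvd P" shows "prim_root (z ^ (P div m)) m"
proof -
  obtain q where q: "P = m * q" using assms(2) by (auto simp: dvd_def)
  then have mq: "m > 0" "q > 0" "P div m = q" using assms(1) by (auto simp: primitive_root_of_unity_def)
  show ?thesis unfolding primitive_root_of_unity_def mq(3)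
  proof (intro conjI allI impI)
    show "(z ^ q) ^ m = 1" using assms(1) by (simp add: power_mult[symmetric] q mult.commute primitive_root_of_unity_def)
    fix j assume "0 < j \<and> j < m"
    then have "0 < q * j" "q * j < P" using mq q by auto
    then show "(z ^ q) ^ j \<noteq> 1" using assms(1) by (simp add: power_mult[symmetric] primitive_root_of_unity_def)
  qed (use mq in simp)
qed

lemma sum_geometric_0:
  fixes q :: "'a::field"
  assumes "q ^ m = 1" "q \<noteq> 1" shows "(\<Sum>j<m. q ^ j) = 0"
  using geometric_sum[OF assms(2), of m] assms by simp

lemma prim_root_power_inj:
  assumes z: "prim_root z m" and "i < m" "j < m" "z ^ i = z ^ j" shows "i = j"
proof -
  have False if "i < j" "j < m" "z ^ i = z ^ j" for i j
  proof -
    have "z ^ j = z ^ i * z ^ (j - i)" using that(1) by (simp flip: power_add)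
    then have "z ^ i * z ^ (j - i) = z ^ i * 1" using that(3) by simp
    then have "z ^ (j - i) = 1" using prim_root_nz[OF z] by simp
    then show False using z that by (auto simp: primitive_root_of_unity_def)
  qed
  then show ?thesis using assms by (metis linorder_neqE_nat)
qed

lemma prim_root_orthogonal:
  assumes z: "prim_root z m" and e: "e < m" "e' < m"
  shows "(\<Sum>j<m. (z ^ e) ^ j / (z ^ e') ^ j) = (if e = e' then of_nat m else 0)"
proof (cases "e = e'")
  case True then show ?thesis using prim_root_nz[OF z] by simp
next
  case False
  define q where "q = z ^ e / z ^ e'"
  have "q \<noteq> 1" using False prim_root_power_inj[OF z e] prim_root_nz[OF z] by (auto simp: q_def)
  moreover have "(z ^ i) ^ m = 1" for i
  proof -
    have "(z ^ i) ^ m = (z ^ m) ^ i" by (simp add: power_mult[symmetric] mult.commute)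
    then show ?thesis using z by (simp add: primitive_root_of_unity_def)
  qed
  then have "q ^ m = 1" by (simp add: q_def power_divide)
  ultimately show ?thesis using sum_geometric_0[of q m] False by (simp add: q_def power_divide)
qed

context
  fixes \<tau> :: "'a::field \<Rightarrow> 'a" and s z :: 'a and m :: nat
  assumes \<tau>: "fhom \<tau>" and s: "\<tau> s = z * s" "s \<noteq> 0" and z: "\<tau> z = z" "prim_root z m" and m0: "of_nat m \<noteq> (0::'a)"
begin

lemma dft_iter:
  assumes t: "\<And>e. e < m \<Longrightarrow> \<tau> (t e) = t e"
  shows "(\<tau> ^^ j) (\<Sum>e<m. s ^ e * t e) = (\<Sum>e<m. (z ^ e) ^ j * s ^ e * t e)"
proof (induction j)
  case (Suc j)
  have "\<tau> (\<Sum>e<m. (z ^ e) ^ j * s ^ e * t e) = (\<Sum>e<m. (z ^ e) ^ Suc j * s ^ e * t e)"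
    unfolding fhom_sum[OF \<tau>]
    by (rule sum.cong) (simp_all add: fhom_simps[OF \<tau>] t s z power_mult_distrib)
  then show ?case using Suc by simp
qed simp

lemma dft_inverse:
  assumes t: "\<And>e. e < m \<Longrightarrow> \<tau> (t e) = t e" and e: "e < m"
  shows "t e = (\<Sum>j<m. (\<tau> ^^ j) (\<Sum>e<m. s ^ e * t e) / (z ^ e) ^ j) / (of_nat m * s ^ e)"
proof -
  have "(\<Sum>j<m. (\<tau> ^^ j) (\<Sum>e<m. s ^ e * t e) / (z ^ e) ^ j)
      = (\<Sum>j<m. \<Sum>i<m. (z ^ i) ^ j / (z ^ e) ^ j * (s ^ i * t i))"
    by (simp add: dft_iter[OF t] sum_divide_distrib mult.assoc)
  also have "\<dots> = (\<Sum>i<m. (\<Sum>j<m. (z ^ i) ^ j / (z ^ e) ^ j) * (s ^ i * t i))"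
    by (subst sum.swap) (simp add: sum_distrib_right)
  also have "\<dots> = (\<Sum>i<m. if i = e then of_nat m * (s ^ e * t e) else 0)"
    by (rule sum.cong) (use e in \<open>auto simp: prim_root_orthogonal[OF z(2)]\<close>)
  also have "\<dots> = of_nat m * (s ^ e * t e)" using e by simp
  finally show ?thesis using m0 s(2) by simp
qed

text \<open>The component of \<open>v\<close> with eigenvalue \<open>z^e\<close> under
  \<open>\<tau>\<close> is divided by \<open>s^e\<close>, which has the same eigenvalue; the
  quotient \<open>t e\<close> is then invariant.\<close>

lemma dft_exists:
  assumes v: "(\<tau> ^^ m) v = v"
  shows "\<exists>t. (\<forall>e<m. \<tau> (t e) = t e) \<and> v = (\<Sum>e<m. s ^ e * t e)"
proof -
  define t where "t e = (\<Sum>j<m. (\<tau> ^^ j) v / (z ^ e) ^ j) / (of_nat m * s ^ e)" for e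
  have mp: "m > 0" using z(2) by (simp add: primitive_root_of_unity_def)
  have zm: "z ^ m = 1" using z(2) by (simp add: primitive_root_of_unity_def)
  have "\<tau> (t e) = t e" for e
  proof -
    define g where "g j = (\<tau> ^^ j) v / (z ^ e) ^ j" for j
    have gm: "g m = g 0" using v zm by (simp add: g_def power_mult[symmetric] mult.commute[of e]) (simp add: power_mult)
    have "\<tau> (g j) = z ^ e * g (Suc j)" for j
      using prim_root_nz[OF z(2)] by (simp add: g_def fhom_simps[OF \<tau>] z)
    then have "\<tau> (\<Sum>j<m. g j) = z ^ e * (\<Sum>j<m. g (Suc j))"
      by (simp add: fhom_sum[OF \<tau>] sum_distrib_left)
    also have "(\<Sum>j<m. g (Suc j)) = (\<Sum>j<m. g j)"
      using sum.lessThan_Suc_shift[of g m] sum.lessThan_Suc[of g m] gm by simp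
    finally show ?thesis
      using prim_root_nz[OF z(2)] s(2) by (simp add: t_def g_def[symmetric] fhom_simps[OF \<tau>] s z power_mult_distrib)
  qed
  moreover have "v = (\<Sum>e<m. s ^ e * t e)"
  proof -
    have "(\<Sum>e<m. s ^ e * t e) = (\<Sum>e<m. \<Sum>j<m. (\<tau> ^^ j) v / (z ^ e) ^ j / of_nat m)"
    proof (rule sum.cong)
      fix e
      have "s ^ e * t e = (\<Sum>j<m. (\<tau> ^^ j) v / (z ^ e) ^ j) / of_nat m" using s(2) by (simp add: t_def)
      then show "s ^ e * t e = (\<Sum>j<m. (\<tau> ^^ j) v / (z ^ e) ^ j / of_nat m)" by (simp add: sum_divide_distrib)
    qed simp
    also have "\<dots> = (\<Sum>j<m. (\<tau> ^^ j) v / of_nat m * (\<Sum>e<m. (z ^ 0) ^ e / (z ^ j) ^ e))"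
      by (subst sum.swap) (simp add: sum_distrib_left power_mult[symmetric] mult.commute)
    also have "\<dots> = (\<Sum>j<m. if j = 0 then v else 0)"
      by (rule sum.cong) (use m0 mp in \<open>auto simp: prim_root_orthogonal[OF z(2) mp] simp del: power_0\<close>)
    also have "\<dots> = v" using mp by simp
    finally show ?thesis by simp
  qed
  ultimately show ?thesis by (intro exI[of _ t] conjI) auto
qed

end

text \<open>Passage from modulus \<open>N\<close> and period \<open>n\<close> to
  \<open>N' = N / p\<close> and \<open>n' = n / p\<close>. The assumption on \<open>w\<close> says
  that \<open>N\<close> divides \<open>N' + w * poly (Norm n') k\<close>; such a \<open>w\<close>
  exists when the cofactor of \<open>N'\<close> in this norm is prime to \<open>p\<close>. By the
  last equation for \<open>q\<close>, its power with exponent \<open>x^n' - 1\<close> is the value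
  of \<open>\<beta>\<close> there.\<close>

locale lattice_step =
  fixes \<tau> :: "'a::field \<Rightarrow> 'a" and p n n' :: nat and k N N' w :: int and \<beta> :: "int poly \<Rightarrow> 'a" and q :: 'a
  assumes \<tau>: "fhom \<tau>" and p: "Factorial_Ring.prime p" and pk: "int p dvd k - 1"
    and n': "n' > 0" "n = p * n'" and N': "N' > 0" "N = int p * N'"
    and kn': "N dvd k ^ n' - 1" and N's: "N' dvd poly (Norm n') k"
    and w: "int p dvd 1 + w * (poly (Norm n') k div N')"
    and \<beta>: "mulmod \<tau> N k \<beta>" and \<beta>Norm: "\<beta> (Norm n) = 1"
    and q: "q \<noteq> 0" "(\<tau> ^^ n) q = q" "(\<tau> ^^ n') q = q * \<beta> (Polynomial.monom 1 n' - 1)"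
begin

text \<open>
  Dividing \<open>\<beta> f\<close> by \<open>q\<^sup>f\<close> trivialises \<open>\<beta>\<close> on \<open>x\<^bsup>n'\<^esup> - 1\<close>. The identity \<open>f \<cdot> gg = N \<cdot> hh f\<close> modulo \<open>x\<^bsup>n'\<^esup> - 1\<close> makes the
  correction in \<open>\<beta>1\<close> trivial on \<open>p \<cdot> Norm n'\<close> as well, and the shift in \<open>\<beta>2\<close>, which maps the larger ideal
  \<open>{f. N' dvd f(k)}\<close> into \<open>{f. N dvd f(k)}\<close>, makes it trivial on \<open>Norm n'\<close>.
\<close>

definition "cyc = (Polynomial.monom 1 n' - 1 :: int poly)"
definition "Om = (\<Sum>l<p. (Polynomial.monom 1 n' :: int poly) ^ l)"
definition "j = (N' + w * poly (Norm n') k) div N"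
definition "Psi = (\<Sum>i<n'. [:k:] ^ (n' - Suc i) * [:0, 1::int:] ^ i)"
definition "gg = Polynomial.smult (- w) Psi + [:j * N:]"
definition "r1 = [:- w * ((1 - k ^ n') div N):] + Polynomial.smult j [:- k, 1:]"
definition "hh f = synthetic_div f k * r1 + Polynomial.smult (poly f k div N) gg"
definition "\<beta>1 f = \<beta> f / pexp \<tau> q f * pexp \<tau> q (hh f * Om)"
definition "\<beta>2 f = \<beta>1 (f + Polynomial.smult (w * (poly f k div N')) (Norm n'))"

lemma N0: "N > 0" "N \<noteq> 0" using N' p prime_gt_0_nat[OF p] by auto

lemma poly_cyc: "poly cyc k = k ^ n' - 1"
  by (simp add: cyc_def poly_monom)

lemma cyc_mem: "N dvd poly (cyc * g) k"
  using kn' by (simp add: poly_cyc)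

lemma cyc_Norm: "cyc = Norm n' * [:-1, 1:]"
  unfolding cyc_def by (rule Norm_mult)

lemma cyc_Om: "cyc * Om = Polynomial.monom 1 n - 1"
proof -
  have "cyc * Om = (Polynomial.monom 1 n') ^ p - 1"
    unfolding cyc_def Om_def by (rule power_diff_1_eq[symmetric])
  then show ?thesis by (simp add: monom_power n'(2) mult.commute)
qed

lemma Norm_n: "Norm n = Norm n' * Om"
proof -
  have "Norm n * [:-1, 1:] = cyc * Om" by (simp only: Norm_mult[symmetric] cyc_Om)
  also have "\<dots> = (Norm n' * Om) * [:-1, 1:]" by (simp only: cyc_Norm mult_ac)
  finally show ?thesis by (metis mult_cancel_right pCons_eq_0_iff zero_neq_one)
qed

lemma Om_p: "\<exists>y. Om = [:int p:] + cyc * y"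
proof -
  have "Om - [:int p:] = (\<Sum>l<p. (Polynomial.monom 1 n') ^ l - 1)"
    by (simp add: Om_def sum_subtractf of_nat_poly)
  also have "\<dots> = (\<Sum>l<p. cyc * (\<Sum>i<l. (Polynomial.monom 1 n') ^ i))"
    unfolding cyc_def by (rule sum.cong) (simp_all add: power_diff_1_eq)
  also have "\<dots> = cyc * (\<Sum>l<p. \<Sum>i<l. (Polynomial.monom 1 n') ^ i)" by (simp add: sum_distrib_left)
  finally show ?thesis by (metis add.commute diff_eq_eq)
qed

lemma p_dvd_N: "int p dvd N" using N' by simp

lemma Om_k: "int p dvd poly Om k"
proof -
  obtain y where "Om = [:int p:] + cyc * y" using Om_p by blast
  then have "poly Om k = int p + poly (cyc * y) k" by simp
  then show ?thesis using cyc_mem[of y] p_dvd_N by (metis dvd_add dvd_refl dvd_trans)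
qed

lemma Norm_n_mem: "N dvd poly (Norm n) k"
  using N's Om_k unfolding N'(2) Norm_n by (simp add: mult_dvd_mono mult.commute)

lemma poly_minus_eval: "\<exists>y. f = [:poly f a:] + [:- a, 1:] * y" for f :: "int poly"
  using synthetic_div_correct'[of a f] by (metis add.commute)

lemma j: "N' + w * poly (Norm n') k = N * j"
proof -
  define u where "u = poly (Norm n') k div N'"
  have "N' + w * poly (Norm n') k = N' * (1 + w * u)" using N's by (simp add: u_def algebra_simps)
  then have "N dvd N' + w * poly (Norm n') k" using w by (simp add: N'(2) u_def mult.commute[of "int p"])
  then show ?thesis by (simp add: j_def)
qed

text \<open>The constant \<open>j * N\<close> in \<open>gg\<close> is there to give this value, on
  which \<open>\<beta>1_Norm\<close> rests. That it can be a multiple of \<open>N\<close> is due to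
  the choice of \<open>w\<close>.\<close>

lemma gg_1: "poly gg 1 = N'"
proof -
  have "poly Psi 1 = (\<Sum>i<n'. k ^ (n' - Suc i))" by (simp add: Psi_def poly_sum)
  also have "\<dots> = (\<Sum>i<n'. k ^ i)" by (rule sum.nat_diff_reindex)
  also have "\<dots> = poly (Norm n') k" by (simp add: Norm_def poly_sum poly_monom)
  finally show ?thesis using j by (simp add: gg_def algebra_simps)
qed

text \<open>\<open>Psi\<close> is the quotient of \<open>x^n' - k^n'\<close> by
  \<open>x - k\<close>, and \<open>k^n'\<close> is \<open>1\<close> modulo \<open>N\<close>; the
  constant part of \<open>gg\<close> is a multiple of \<open>N\<close> anyway. So the product with
  \<open>x - k\<close> is divisible by \<open>N\<close> modulo \<open>cyc\<close>.\<close>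

lemma gg_r1: "[:- k, 1:] * gg = Polynomial.smult N r1 + Polynomial.smult (- w) cyc"
proof -
  have x: "[:- k, 1:] = [:0, 1:] - [:k:]" by simp
  have "[:- k, 1:] * Psi = [:0, 1:] ^ n' - [:k:] ^ n'"
    unfolding Psi_def x by (rule power_diff_sumr2[symmetric])
  also have "\<dots> = cyc + [:1 - k ^ n':]"
    by (simp add: cyc_def monom_altdef poly_const_pow one_pCons)
  finally have P: "[:- k, 1:] * Psi = cyc + [:1 - k ^ n':]" .
  have "N dvd 1 - k ^ n'" using kn' by (simp add: dvd_diff_commute)
  then have e: "N * ((1 - k ^ n') div N) = 1 - k ^ n'" by simp
  have "Polynomial.smult N r1 = [:- w * (N * ((1 - k ^ n') div N)):] + Polynomial.smult (j * N) [:- k, 1:]"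
    by (simp add: r1_def smult_add_right algebra_simps)
  then have 1: "Polynomial.smult N r1 = Polynomial.smult (- w) [:1 - k ^ n':] + Polynomial.smult (j * N) [:- k, 1:]"
    unfolding e by simp
  have "[:- k, 1:] * gg = Polynomial.smult (- w) ([:- k, 1:] * Psi) + Polynomial.smult (j * N) [:- k, 1:]"
    unfolding gg_def distrib_left mult_smult_right by (simp add: mult.commute)
  then show ?thesis unfolding P 1 smult_add_right by (simp only: add_ac)
qed

text \<open>The ideal is generated by \<open>x - k\<close> and \<open>N\<close>. The first generator
  is covered by \<open>gg_r1\<close>, and the second is divisible by \<open>N\<close>
  itself.\<close>

lemma hh_eq:
  assumes "N dvd poly f k"
  shows "f * gg = Polynomial.smult N (hh f) + cyc * Polynomial.smult (- w) (synthetic_div f k)"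
proof -
  define a where "a = synthetic_div f k"
  have f: "f = [:- k, 1:] * a + [:poly f k:]" using synthetic_div_correct'[of k f] by (simp add: a_def)
  have "f * gg = a * ([:- k, 1:] * gg) + [:poly f k:] * gg"
    by (subst f) (simp only: distrib_left distrib_right mult_ac)
  also have "[:poly f k:] * gg = Polynomial.smult N (Polynomial.smult (poly f k div N) gg)"
    using assms by simp
  also have "a * ([:- k, 1:] * gg) = Polynomial.smult N (a * r1) + cyc * Polynomial.smult (- w) a"
    unfolding gg_r1 distrib_left mult_smult_right by (simp only: mult.commute)
  finally show ?thesis by (simp add: hh_def a_def smult_add_right)
qed

lemma pexp_kill: "pexp \<tau> q (cyc * (Om * y)) = 1"
proof -
  have "pexp \<tau> q (cyc * Om) = 1"
    unfolding cyc_Om using q by (simp add: pexp_diff[OF \<tau>] pexp_monom[OF \<tau>] pexp_1[OF \<tau>])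
  then show ?thesis
    using pexp_pexp[OF \<tau> q(1), of "cyc * Om" y] by (simp add: pexp_one_base[OF \<tau>] mult.assoc)
qed

text \<open>\<open>hh f\<close> is one choice of \<open>f * gg / N\<close> modulo
  \<open>cyc\<close>. As \<open>cyc\<close> has content \<open>1\<close>, any other choice
  \<open>y\<close> differs from it by a multiple of \<open>cyc\<close>, and
  \<open>cyc * Om = x^n - 1\<close> annihilates \<open>q\<close>.\<close>

lemma delta_eq:
  assumes f: "N dvd poly f k" and e: "f * gg = Polynomial.smult N y + cyc * z"
  shows "pexp \<tau> q (hh f * Om) = pexp \<tau> q (y * Om)"
proof -
  have "cyc * (z - Polynomial.smult (- w) (synthetic_div f k)) = Polynomial.smult N (hh f - y)"
    using hh_eq[OF f] e by (simp add: right_diff_distrib smult_diff_right algebra_simps)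
  then obtain v where "hh f - y = cyc * v"
    using monic_dvd_smult[of cyc] content_cyclic[OF n'(1)] N0 unfolding cyc_def by blast
  then have "hh f * Om = y * Om + cyc * (Om * v)" by (simp add: algebra_simps)
  then show ?thesis using pexp_kill q(1) by (simp add: pexp_add[OF \<tau>])
qed

lemma mulmod_\<beta>1: "mulmod \<tau> N k \<beta>1"
  unfolding mulmod_def
proof (intro conjI allI impI)
  note qs = pexp_add[OF \<tau> q(1)]
  fix f assume f: "N dvd poly f k"
  note hf = hh_eq[OF f]
  show "\<beta>1 f \<noteq> 0" using mm_nz[OF \<tau> \<beta> f] pexp_nz[OF \<tau> q(1)] by (simp add: \<beta>1_def)
  have "pCons 0 f * gg = Polynomial.smult N (pCons 0 (hh f)) + cyc * pCons 0 (Polynomial.smult (- w) (synthetic_div f k))"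
    using arg_cong[OF hf, of "pCons 0"] by simp
  then have "pexp \<tau> q (hh (pCons 0 f) * Om) = pexp \<tau> q (pCons 0 (hh f) * Om)"
    by (rule delta_eq[rotated]) (use f in simp)
  then show "\<beta>1 (pCons 0 f) = \<tau> (\<beta>1 f)"
    using mm_shift[OF \<tau> \<beta> f] by (simp add: \<beta>1_def pexp_pCons[OF \<tau>] fhom_simps[OF \<tau>])
  fix g assume g: "N dvd poly g k"
  have "(f + g) * gg = Polynomial.smult N (hh f + hh g) + cyc * (Polynomial.smult (- w) (synthetic_div f k) + Polynomial.smult (- w) (synthetic_div g k))"
    unfolding distrib_right hf hh_eq[OF g] smult_add_right distrib_left by (simp only: add_ac)
  then have "pexp \<tau> q (hh (f + g) * Om) = pexp \<tau> q ((hh f + hh g) * Om)"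
    by (rule delta_eq[rotated]) (use f g in simp)
  then show "\<beta>1 (f + g) = \<beta>1 f * \<beta>1 g"
    using mm_add[OF \<tau> \<beta> f g] by (simp add: \<beta>1_def qs distrib_right)
qed

lemma \<beta>1_cyc: "\<beta>1 (cyc * g) = 1"
proof -
  have "pexp \<tau> q cyc = \<beta> cyc"
    unfolding cyc_def using q(1,3) by (simp add: pexp_diff[OF \<tau>] pexp_monom[OF \<tau>] pexp_1[OF \<tau>])
  then have "pexp \<tau> q (cyc * g) = \<beta> (cyc * g)"
    using pexp_pexp[OF \<tau> q(1), of cyc g] mm_mult[OF \<tau> \<beta>, of cyc g] cyc_mem[of 1] by simp
  moreover have "pexp \<tau> q (hh (cyc * g) * Om) = pexp \<tau> q (0 * Om)"
    by (rule delta_eq[OF cyc_mem, of _ _ "g * gg"]) (simp add: mult_ac)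
  ultimately show ?thesis using mm_nz[OF \<tau> \<beta> cyc_mem[of g]] by (simp add: \<beta>1_def pexp_0[OF \<tau>])
qed

text \<open>Modulo \<open>cyc\<close> one may replace \<open>Om\<close> by \<open>p\<close> and, in
  a product with \<open>Norm n'\<close>, \<open>gg\<close> by its value \<open>N'\<close> at
  \<open>1\<close>. So \<open>Norm n'\<close> can serve as \<open>hh (Norm n)\<close>, and the two
  powers of \<open>q\<close> in \<open>\<beta>1\<close> cancel, as
  \<open>Norm n = Norm n' * Om\<close>.\<close>

lemma \<beta>1_Norm: "\<beta>1 (Norm n) = 1"
proof -
  obtain g3 where g3: "gg = [:N':] + [:-1, 1:] * g3" using poly_minus_eval[of gg 1] gg_1 by auto
  obtain y where y: "Om = [:int p:] + cyc * y" using Om_p by blast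
  have "Norm n * gg = Norm n' * Om * [:N':] + cyc * (Om * g3)"
    unfolding Norm_n g3 cyc_Norm by (simp only: distrib_left mult_ac)
  also have "Norm n' * Om * [:N':] = Norm n' * [:int p:] * [:N':] + cyc * (y * Norm n' * [:N':])"
    unfolding y by (simp only: distrib_left distrib_right mult_ac)
  also have "Norm n' * [:int p:] * [:N':] = Polynomial.smult N (Norm n')"
    by (simp add: N'(2) mult.commute)
  finally have "Norm n * gg = Polynomial.smult N (Norm n') + cyc * (y * Norm n' * [:N':] + Om * g3)"
    by (simp only: distrib_left add.assoc)
  then have "pexp \<tau> q (hh (Norm n) * Om) = pexp \<tau> q (Norm n' * Om)"
    by (rule delta_eq[OF Norm_n_mem])
  then show ?thesis
    using \<beta>Norm pexp_nz[OF \<tau> q(1)] by (simp add: \<beta>1_def Norm_n)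
qed

lemma pNorm_mem: "N dvd poly (Polynomial.smult (int p) (Norm n') * g) k"
proof -
  have "N dvd int p * poly (Norm n') k" using N's unfolding N'(2) by (intro mult_dvd_mono) auto
  moreover have "poly (Polynomial.smult (int p) (Norm n') * g) k = int p * poly (Norm n') k * poly g k" by simp
  ultimately show ?thesis by (metis dvd_mult2)
qed

lemma \<beta>1_pNorm: "\<beta>1 (Polynomial.smult (int p) (Norm n') * g) = 1"
proof -
  obtain y where y: "Om = [:int p:] + cyc * y" using Om_p by blast
  have e: "Norm n = Polynomial.smult (int p) (Norm n') * 1 + cyc * (Norm n' * y)"
    unfolding Norm_n y by (simp add: algebra_simps)
  have "\<beta>1 (Polynomial.smult (int p) (Norm n') * 1) = 1"
    using mm_add[OF \<tau> mulmod_\<beta>1 pNorm_mem[of 1] cyc_mem[of "Norm n' * y"]] \<beta>1_Norm \<beta>1_cyc[of "Norm n' * y"] e by simp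
  then show ?thesis
    using mm_mult_one[OF \<tau> mulmod_\<beta>1, of "Polynomial.smult (int p) (Norm n')" g] pNorm_mem[of 1] by simp
qed

lemma \<beta>2_mem:
  assumes "N' dvd poly f k"
  shows "N dvd poly (f + Polynomial.smult (w * (poly f k div N')) (Norm n')) k"
proof -
  obtain y where y: "poly f k = N' * y" using assms by (auto simp: dvd_def)
  have "poly (f + Polynomial.smult (w * (poly f k div N')) (Norm n')) k = (N' + w * poly (Norm n') k) * y"
    using N' by (simp add: y algebra_simps)
  then show ?thesis unfolding j by simp
qed

lemma \<beta>2_eq_\<beta>1:
  assumes "N dvd poly f k" shows "\<beta>2 f = \<beta>1 f"
proof -
  obtain y where y: "poly f k = N * y" using assms by (auto simp: dvd_def)
  have "Polynomial.smult (w * (poly f k div N')) (Norm n') = Polynomial.smult (int p) (Norm n') * [:w * y:]"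
    using N' by (simp add: y mult_ac)
  then show ?thesis
    unfolding \<beta>2_def by (simp only: mm_add[OF \<tau> mulmod_\<beta>1 assms pNorm_mem[of "[:w * y:]"]] \<beta>1_pNorm mult_1_right)
qed

text \<open>Passing from \<open>f\<close> to \<open>x * f\<close> multiplies the shift
  \<open>z\<close> by \<open>k\<close>. Since \<open>k\<close> is \<open>1\<close> modulo
  \<open>p\<close> and \<open>x\<close> acts as \<open>1\<close> on \<open>Norm n'\<close> modulo
  \<open>cyc\<close>, the discrepancy consists of multiples of \<open>p * Norm n'\<close> and of
  \<open>cyc\<close>, where \<open>\<beta>1\<close> is trivial.\<close>

lemma mulmod_\<beta>2: "mulmod \<tau> N' k \<beta>2"
  unfolding mulmod_def
proof (intro conjI allI impI)
  fix f assume f: "N' dvd poly f k"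
  define z where "z = w * (poly f k div N')"
  show "\<beta>2 f \<noteq> 0" unfolding \<beta>2_def by (rule mm_nz[OF \<tau> mulmod_\<beta>1 \<beta>2_mem[OF f]])
  obtain y where y: "k - 1 = int p * y" using pk by (auto simp: dvd_def)
  have z': "w * (poly (pCons 0 f) k div N') = k * z"
    using f by (simp add: z_def div_mult_swap algebra_simps)
  have k1: "k = 1 + int p * y" using y by simp
  have "pCons 0 f + Polynomial.smult (k * z) (Norm n')
      = pCons 0 (f + Polynomial.smult z (Norm n')) + (Polynomial.smult (int p) (Norm n') * [:z * y:] + cyc * [:- z:])"
  proof -
    have c: "cyc * [:- z:] = Polynomial.smult z (Norm n') - pCons 0 (Polynomial.smult z (Norm n'))"
      unfolding cyc_Norm by (simp add: algebra_simps)
    have "Polynomial.smult (k * z) (Norm n') = Polynomial.smult z (Norm n') + Polynomial.smult (int p) (Norm n') * [:z * y:]"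
      by (simp add: k1 smult_add_left[symmetric] algebra_simps)
    then show ?thesis unfolding c by simp
  qed
  moreover have "\<beta>1 (Polynomial.smult (int p) (Norm n') * [:z * y:] + cyc * [:- z:]) = 1"
    by (simp only: mm_add[OF \<tau> mulmod_\<beta>1 pNorm_mem cyc_mem] \<beta>1_pNorm \<beta>1_cyc mult_1_right)
  moreover have "N dvd poly (Polynomial.smult (int p) (Norm n') * [:z * y:] + cyc * [:- z:]) k"
    using pNorm_mem[of "[:z * y:]"] cyc_mem[of "[:- z:]"] unfolding poly_add by (rule dvd_add)
  moreover have m: "N dvd poly (f + Polynomial.smult z (Norm n')) k" unfolding z_def by (rule \<beta>2_mem[OF f])
  moreover have "N dvd poly (pCons 0 (f + Polynomial.smult z (Norm n'))) k" using m by simp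
  ultimately have "\<beta>1 (pCons 0 f + Polynomial.smult (k * z) (Norm n')) = \<tau> (\<beta>1 (f + Polynomial.smult z (Norm n')))"
    using mm_add[OF \<tau> mulmod_\<beta>1] mm_shift[OF \<tau> mulmod_\<beta>1] by (metis mult.right_neutral)
  then show "\<beta>2 (pCons 0 f) = \<tau> (\<beta>2 f)" by (simp only: \<beta>2_def z' z_def)
  fix g assume g: "N' dvd poly g k"
  have "f + g + Polynomial.smult (w * (poly (f + g) k div N')) (Norm n')
     = (f + Polynomial.smult (w * (poly f k div N')) (Norm n')) + (g + Polynomial.smult (w * (poly g k div N')) (Norm n'))"
    using f by (simp add: div_plus_div_distrib_dvd_left distrib_left smult_add_left)
  then show "\<beta>2 (f + g) = \<beta>2 f * \<beta>2 g"
    unfolding \<beta>2_def by (simp only: mm_add[OF \<tau> mulmod_\<beta>1 \<beta>2_mem[OF f] \<beta>2_mem[OF g]])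
qed

text \<open>The shift multiplies \<open>Norm n'\<close> by \<open>1 + w * u\<close>, which
  \<open>p\<close> divides by the choice of \<open>w\<close>.\<close>

lemma \<beta>2_Norm: "\<beta>2 (Norm n') = 1"
proof -
  define u where "u = poly (Norm n') k div N'"
  obtain y where y: "1 + w * u = int p * y" using w by (auto simp: u_def dvd_def)
  have "Norm n' + Polynomial.smult (w * u) (Norm n') = Polynomial.smult (1 + w * u) (Norm n')"
    by (simp add: smult_add_left)
  also have "\<dots> = Polynomial.smult (int p) (Norm n') * [:y:]" unfolding y by (simp add: mult.commute)
  finally show ?thesis unfolding \<beta>2_def u_def[symmetric] by (simp only: \<beta>1_pNorm)
qed

text \<open>In the presence of the translates of \<open>q\<close>, the smaller ideal thus yields the
  same field as \<open>\<beta>\<close>.\<close>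

lemma \<beta>_from_\<beta>2:
  assumes "N dvd poly f k"
  shows "\<beta> f = \<beta>2 f * pexp \<tau> q f / pexp \<tau> q (hh f * Om)"
  using assms pexp_nz[OF \<tau> q(1)] by (simp add: \<beta>2_eq_\<beta>1 \<beta>1_def)

end

lemma mm_funpow:
  assumes "fhom \<tau>" "mulmod \<tau> N k \<beta>" "N dvd poly f k"
  shows "(\<tau> ^^ j) (\<beta> f) = \<beta> (Polynomial.monom 1 j * f)"
  using mm_mult[OF assms, of "Polynomial.monom 1 j"] by (simp add: mult.commute pexp_monom[OF assms(1)])

lemma poly_diff_dvd: "a - b dvd poly f a - poly f (b::'b::comm_ring_1)"
proof -
  have "poly f a = poly ([:- b, 1:] * synthetic_div f b + [:poly f b:]) a"
    by (simp only: synthetic_div_correct')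
  then show ?thesis by (simp flip: left_diff_distrib)
qed

text \<open>
  The second alternative serves \<open>p = 2\<close>, \<open>k \<equiv> 3 (mod 4)\<close>, where the norm \<open>1 + k\<close> may be divisible by a higher
  power of \<open>2\<close>; there \<open>N\<close> can be replaced by \<open>2\<close> in one step.
\<close>

fun chain_good :: "nat \<Rightarrow> int \<Rightarrow> nat \<Rightarrow> int \<Rightarrow> bool" where
  "chain_good p k 0 N \<longleftrightarrow> N = 1"
| "chain_good p k (Suc D) N \<longleftrightarrow>
    (\<exists>N'. N' > 0 \<and> N = int p * N' \<and> N dvd k ^ (p ^ D) - 1 \<and> N' dvd poly (Norm (p ^ D)) k
      \<and> coprime (poly (Norm (p ^ D)) k div N') (int p) \<and> chain_good p k D N')
    \<or> (p = 2 \<and> D = 0 \<and> N > 0 \<and> even N \<and> N dvd k + 1)"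

locale chain =
  fixes \<tau> :: "'a::field \<Rightarrow> 'a" and K :: "'a set" and \<Gamma> and p :: nat and k :: int and \<xi> :: 'a and P :: nat and s :: 'a
  assumes \<tau>: "fhom \<tau>" and K: "subfld K" and Kfix: "\<And>x. x \<in> K \<Longrightarrow> \<tau> x = x"
    and p: "Factorial_Ring.prime p" and p0: "of_nat p \<noteq> (0::'a)" and pk: "int p dvd k - 1"
    and \<Gamma>: "autgrp \<Gamma>" "\<Gamma> = range (\<lambda>i. \<tau> ^^ i)" "of_nat (card \<Gamma>) \<noteq> (0::'a)"
    and \<xi>: "\<xi> \<in> K" "prim_root \<xi> P" and s: "\<tau> s = \<xi> * s" "s \<noteq> 0"
begin

text \<open>The power of \<open>s\<close> whose eigenvalue \<open>zP m\<close> under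
  \<open>\<tau>\<close> is a primitive \<open>m\<close>-th root of unity, provided \<open>m\<close>
  divides \<open>P\<close>.\<close>

definition "sP m = s ^ (P div m)"
definition "zP m = \<xi> ^ (P div m)"

lemma sP: "\<tau> (sP m) = zP m * sP m" "sP m \<noteq> 0" "\<tau> (zP m) = zP m" "zP m \<in> K"
  using s \<xi> Kfix by (simp_all add: sP_def zP_def fhom_simps[OF \<tau>] power_mult_distrib sf_power[OF K])

lemma zP_prim_root: "m dvd P \<Longrightarrow> prim_root (zP m) m"
  unfolding zP_def by (rule prim_root_power[OF \<xi>(2)])

lemma sP_funpow: "(\<tau> ^^ j) (sP m) = zP m ^ j * sP m"
  by (induction j) (simp_all add: fhom_simps[OF \<tau>] sP mult_ac)

lemma sP_gen: "s \<in> S \<Longrightarrow> sP m \<in> gen S"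
  unfolding sP_def by (intro gen_intros gen_base)

text \<open>In the presence of \<open>s\<close>, the translates of one element of period
  \<open>m\<close> and its \<open>m\<close> invariant Fourier coefficients are interchangeable. The
  descent uses this in both directions: to bundle \<open>n'\<close> invariants into
  \<open>v\<close>, and to split \<open>q\<close> into \<open>n\<close> of them.\<close>

lemma dft_gen:
  assumes m: "m dvd P" "of_nat m \<noteq> (0::'a)" and t: "\<And>e. e < m \<Longrightarrow> \<tau> (t e) = t e"
    and v: "v = (\<Sum>e<m. sP m ^ e * t e)"
  shows "gen (K \<union> {s} \<union> range (\<lambda>j. (\<tau> ^^ j) v)) = gen (K \<union> {s} \<union> t ` {..<m})" (is "gen ?A = gen ?B")
proof (rule gen_eqI)
  note dft = \<tau> sP(1,2,3)[of m] zP_prim_root[OF m(1)] m(2)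
  have sA: "sP m \<in> gen ?A" "sP m \<in> gen ?B" by (auto intro: sP_gen)
  have zA: "zP m \<in> gen ?A" "zP m \<in> gen ?B" using sP(4) by (auto intro: gen_base)
  have it: "(\<tau> ^^ j) v = (\<Sum>e<m. (zP m ^ e) ^ j * sP m ^ e * t e)" for j
    unfolding v by (rule dft_iter[OF dft]) (rule t)
  have "(\<tau> ^^ j) v \<in> gen ?B" for j
    unfolding it using sA zA by (intro gen_intros) (auto intro: gen_base)
  then show "?A \<subseteq> gen ?B" by (auto intro: gen_base)
  have "t e \<in> gen ?A" if e: "e < m" for e
  proof -
    have "t e = (\<Sum>j<m. (\<tau> ^^ j) v / (zP m ^ e) ^ j) / (of_nat m * sP m ^ e)"
      unfolding v by (rule dft_inverse[OF dft _ e]) (rule t)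
    then show ?thesis using sA zA by (simp only:) (intro gen_intros, auto intro: gen_base)
  qed
  then show "?B \<subseteq> gen ?A" by (auto intro: gen_base)
qed

text \<open>The resolvent of \<open>sP n ^ e\<close> is \<open>sP n ^ e\<close> times a Fourier
  coefficient of \<open>c\<close>. If all these coefficients vanished, so would their sum over
  \<open>e\<close>, which is \<open>p * c 0\<close>.\<close>

lemma resolvent_nz:
  assumes n: "n = p * n'" "n dvd P" and c: "c 0 = (1::'a)"
  shows "\<exists>e<p. (\<Sum>l<p. c l * (\<tau> ^^ (l * n')) (sP n ^ e)) \<noteq> 0"
proof (rule ccontr)
  assume a: "\<not> ?thesis"
  define z where "z = zP n ^ n'"
  have pp: "p > 0" using p by (simp add: prime_gt_0_nat)
  have "z = zP n ^ (n div p)" using n pp by (simp add: z_def)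
  then have z: "prim_root z p" using prim_root_power[OF zP_prim_root[OF n(2)], of p] n by simp
  have e: "(\<tau> ^^ (l * n')) (sP n ^ e) = (z ^ l) ^ e * sP n ^ e" for l e
    by (simp add: fhom_power[OF fhom_funpow[OF \<tau>]] sP_funpow power_mult_distrib z_def mult.commute[of l] power_mult)
  have "(\<Sum>l<p. c l * (z ^ l) ^ e) = 0" if "e < p" for e
  proof -
    have "(\<Sum>l<p. c l * (z ^ l) ^ e) * sP n ^ e = 0"
      using a that by (simp add: e sum_distrib_right mult.assoc)
    then show ?thesis using sP(2) by simp
  qed
  then have "(\<Sum>e<p. \<Sum>l<p. c l * (z ^ l) ^ e) = 0" by simp
  moreover have "(\<Sum>e<p. \<Sum>l<p. c l * (z ^ l) ^ e) = (\<Sum>l<p. c l * (\<Sum>e<p. (z ^ l) ^ e / (z ^ 0) ^ e))"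
    by (subst sum.swap) (simp add: sum_distrib_left)
  also have "\<dots> = (\<Sum>l<p. if l = 0 then of_nat p else 0)"
    by (rule sum.cong) (use c pp in \<open>auto simp: prim_root_orthogonal[OF z _ pp] simp del: power_0\<close>)
  also have "\<dots> = of_nat p" using pp by simp
  ultimately show False using p0 by simp
qed

text \<open>The first \<open>n'\<close> of the \<open>c\<close> invariants are used up and
  \<open>n\<close> others are gained. The lattice has rank \<open>n - 1\<close> before and
  \<open>n' - 1\<close> after, so with \<open>s\<close> the count is \<open>n + c\<close> on both
  sides.\<close>

lemma lattice_descent:
  assumes n': "n' = p ^ D" "n = p * n'" "n dvd P"
    and N: "N' > 0" "N = int p * N'" "N dvd k ^ n' - 1" "N' dvd poly (Norm n') k"
      "coprime (poly (Norm n') k div N') (int p)"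
    and \<beta>: "mulmod \<tau> N k \<beta>" "\<beta> (Norm n) = 1"
    and t: "\<And>e. e < c \<Longrightarrow> \<tau> (t e) = t e" "t 0 \<noteq> 0" "n' \<le> c"
  shows "\<exists>\<beta>' t'. mulmod \<tau> N' k \<beta>' \<and> \<beta>' (Norm n') = 1 \<and> (\<forall>e<n + (c - n'). \<tau> (t' e) = t' e) \<and> t' 0 \<noteq> (0::'a) \<and>
    gen (K \<union> \<beta> ` {f. N dvd poly f k} \<union> {s} \<union> t ` {..<c}) =
    gen (K \<union> \<beta>' ` {f. N' dvd poly f k} \<union> {s} \<union> t' ` {..<n + (c - n')})"
proof -
  have pp: "p > 0" using p by (simp add: prime_gt_0_nat)
  have n0: "n' > 0" "n > 0" using n' pp by auto
  have n'P: "n' dvd P" using n' dvd_trans dvd_triv_right by blast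
  have nn0: "of_nat n \<noteq> (0::'a)" "of_nat n' \<noteq> (0::'a)" using p0 n' by auto
  define u where "u = poly (Norm n') k div N'"
  obtain x y where "x * u + y * int p = gcd u (int p)" using bezout_int by blast
  then have xy: "x * u + y * int p = 1" using N(5) by (simp add: u_def)
  define w where "w = - x"
  have "1 + w * u = int p * y" using xy by (simp add: w_def algebra_simps)
  then have w: "int p dvd 1 + w * u" by simp
  define cyc where "cyc = (Polynomial.monom 1 n' - 1 :: int poly)"
  have mem: "N dvd poly (Polynomial.monom 1 (l * n') - 1) k" for l
  proof -
    have "k ^ n' - 1 dvd (k ^ n') ^ l - 1" by (metis power_diff_1_eq dvd_triv_left)
    moreover have "poly (Polynomial.monom 1 (l * n') - 1) k = (k ^ n') ^ l - 1"
      by (simp add: poly_monom power_mult[symmetric] mult.commute)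
    ultimately show ?thesis using N(3) by (metis dvd_trans)
  qed
  have cmem: "N dvd poly cyc k" using mem[of 1] by (simp add: cyc_def)
  \<comment> \<open>The cocycle of the powers of \<open>\<tau>^n'\<close> with values in the
    lattice. It closes up, \<open>cc p = 1\<close>, because
    \<open>\<beta> (Norm n) = 1\<close>.\<close>
  define cc where "cc l = \<beta> (Polynomial.monom 1 (l * n') - 1)" for l
  have cc0: "cc 0 = 1" by (simp add: cc_def mm_0[OF \<tau> \<beta>(1)] monom_0 one_pCons)
  have Nn: "N dvd poly (Norm n) k"
  proof -
    have "Norm n * [:-1, 1:] = Norm n' * (\<Sum>l<p. (Polynomial.monom 1 n') ^ l) * [:-1, 1:]"
    proof -
      have "Norm n * [:-1, 1:] = (Polynomial.monom 1 n') ^ p - 1"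
        by (simp only: Norm_mult[symmetric] n'(2) monom_power mult.commute) simp
      also have "\<dots> = (Polynomial.monom 1 n' - 1) * (\<Sum>l<p. (Polynomial.monom 1 n') ^ l)" by (rule power_diff_1_eq)
      finally show ?thesis by (simp only: Norm_mult mult_ac)
    qed
    then have e: "Norm n = Norm n' * (\<Sum>l<p. (Polynomial.monom 1 n') ^ l)"
      by (metis mult_cancel_right pCons_eq_0_iff zero_neq_one)
    have "int p dvd (\<Sum>l<p. (k ^ n') ^ l)"
    proof -
      have "int p dvd (k ^ n') ^ l - 1" for l
      proof -
        have "k ^ n' - 1 dvd (k ^ n') ^ l - 1" by (metis power_diff_1_eq dvd_triv_left)
        moreover have "int p dvd k ^ n' - 1" using N(2,3) by (metis dvd_mult_left)
        ultimately show ?thesis by (rule dvd_trans[rotated])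
      qed
      then have "int p dvd (\<Sum>l<p. (k ^ n') ^ l - 1) + int p" by (intro dvd_add dvd_sum) auto
      then show ?thesis by (simp add: sum_subtractf)
    qed
    then show ?thesis
      unfolding e using N(2,4) by (simp add: poly_sum poly_monom mult_dvd_mono mult.commute)
  qed
  have ccp: "cc p = 1"
    using mm_mult_one[OF \<tau> \<beta>(1) Nn \<beta>(2), of "[:-1,1:]"] by (simp only: cc_def Norm_mult[symmetric] n'(2))
  have bcyc: "\<beta> cyc \<noteq> 0" by (rule mm_nz[OF \<tau> \<beta>(1) cmem])
  have cc_shift: "(\<tau> ^^ n') (cc l) = cc (Suc l) / \<beta> cyc" for l
  proof -
    have "Polynomial.monom 1 n' * (Polynomial.monom 1 (l * n') - 1) = (Polynomial.monom 1 (Suc l * n') - 1) - cyc"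
      by (simp add: cyc_def right_diff_distrib mult_monom)
    then show ?thesis unfolding cc_def mm_funpow[OF \<tau> \<beta>(1) mem] by (simp only: mm_diff[OF \<tau> \<beta>(1) mem cmem])
  qed
  obtain e where e: "e < p" "(\<Sum>l<p. cc l * (\<tau> ^^ (l * n')) (sP n ^ e)) \<noteq> 0"
    using resolvent_nz[where c = cc, OF n'(2,3) cc0] by blast
  define a where "a = sP n ^ e"
  \<comment> \<open>Hilbert 90: the resolvent of \<open>cc\<close> is divided by
    \<open>\<beta> cyc\<close> under \<open>\<tau>^n'\<close>. As \<open>a\<close> is a power of
    \<open>s\<close>, it lies in the field generated by \<open>K\<close>, \<open>s\<close> and the
    values of \<open>\<beta>\<close>.\<close>
  define B0 where "B0 = (\<Sum>l<p. cc l * (\<tau> ^^ (l * n')) a)"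
  have B0: "B0 \<noteq> 0" using e by (simp add: B0_def a_def)
  have an: "(\<tau> ^^ n) a = a"
    using zP_prim_root[OF n'(3)] by (simp add: a_def fhom_power[OF fhom_funpow[OF \<tau>]] sP_funpow primitive_root_of_unity_def)
  note ft = fhom_funpow[OF \<tau>, of n']
  have B0s: "(\<tau> ^^ n') B0 = B0 / \<beta> cyc"
  proof -
    define g where "g l = cc l * (\<tau> ^^ (l * n')) a" for l
    have gp: "g p = g 0" using an by (simp add: g_def cc0 ccp n'(2))
    have "(\<tau> ^^ n') (g l) = g (Suc l) / \<beta> cyc" for l
      by (simp add: g_def fhom_mult[OF ft] cc_shift funpow_add)
    then have "(\<tau> ^^ n') (\<Sum>l<p. g l) = (\<Sum>l<p. g (Suc l)) / \<beta> cyc"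
      by (simp add: fhom_sum[OF ft] sum_divide_distrib)
    also have "(\<Sum>l<p. g (Suc l)) = (\<Sum>l<p. g l)"
      using sum.lessThan_Suc_shift[of g p] sum.lessThan_Suc[of g p] gp by simp
    finally show ?thesis by (simp add: B0_def g_def)
  qed
  \<comment> \<open>An element of period \<open>n'\<close> carrying the first \<open>n'\<close>
    invariants. It is nonzero because of \<open>t 0 \<noteq> 0\<close>, and division by
    \<open>B0\<close> gives it the transformation law required of \<open>q\<close>.\<close>
  define v where "v = (\<Sum>e<n'. sP n' ^ e * t e)"
  have tn': "\<tau> (t e) = t e" if "e < n'" for e using t that by simp
  note dft' = \<tau> sP(1,2,3)[of n'] zP_prim_root[OF n'P] nn0(2)
  have vn: "(\<tau> ^^ n') v = v"
  proof -
    have "(\<tau> ^^ n') v = (\<Sum>e<n'. (zP n' ^ e) ^ n' * sP n' ^ e * t e)"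
      unfolding v_def by (rule dft_iter[OF dft']) (rule tn')
    also have "\<dots> = v" unfolding v_def
    proof (rule sum.cong)
      fix e
      have "(zP n' ^ e) ^ n' = (zP n' ^ n') ^ e" by (simp add: power_mult[symmetric] mult.commute)
      then show "(zP n' ^ e) ^ n' * sP n' ^ e * t e = sP n' ^ e * t e"
        using zP_prim_root[OF n'P] by (simp add: primitive_root_of_unity_def)
    qed simp
    finally show ?thesis .
  qed
  have v0: "v \<noteq> 0"
  proof
    assume "v = 0"
    then have "(\<tau> ^^ j) v = 0" for j using fhom_0[OF fhom_funpow[OF \<tau>]] by simp
    then have "t 0 = 0" using dft_inverse[where t = t, OF dft' _ n0(1)] tn' by (simp add: v_def)
    then show False using t by simp
  qed
  define q where "q = v / B0"
  have q0: "q \<noteq> 0" using v0 B0 by (simp add: q_def)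
  have qs: "(\<tau> ^^ n') q = q * \<beta> cyc"
    using B0 bcyc by (simp add: q_def fhom_divide[OF ft] vn B0s)
  have "(\<tau> ^^ (l * n')) q = q * cc l" for l
  proof (induction l)
    case (Suc l)
    have "(\<tau> ^^ (Suc l * n')) q = (\<tau> ^^ n') ((\<tau> ^^ (l * n')) q)" by (simp add: funpow_add)
    then show ?case using Suc bcyc by (simp add: fhom_mult[OF ft] qs cc_shift)
  qed (simp add: cc0)
  from this[of p] have qn: "(\<tau> ^^ n) q = q" using ccp n'(2) by simp
  interpret L: lattice_step \<tau> p n n' k N N' w \<beta> q
    by unfold_locales (use \<tau> p pk n0 n' N w \<beta> q0 qn qs in \<open>simp_all add: u_def cyc_def\<close>)
  note dft = \<tau> sP(1,2,3)[of n] zP_prim_root[OF n'(3)] nn0(1)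
  obtain t1 where t1: "\<forall>e<n. \<tau> (t1 e) = t1 e" "q = (\<Sum>e<n. sP n ^ e * t1 e)"
    using dft_exists[OF dft qn] by blast
  have "\<exists>e<n. t1 e \<noteq> 0"
  proof (rule ccontr)
    assume "\<not> ?thesis"
    then have "q = 0" unfolding t1(2) by (intro sum.neutral) auto
    then show False using q0 by simp
  qed
  then obtain e0 where e0: "e0 < n" "t1 e0 \<noteq> 0" by blast
  define t2 where "t2 e = (if e < n then t1 e else t (n' + (e - n)))" for e
  \<comment> \<open>The next descent again wants a nonzero invariant at index \<open>0\<close>, so a
    nonzero coefficient of \<open>q\<close> is swapped to that place.\<close>
  define t' where "t' = t2 \<circ> Transposition.transpose 0 e0"
  have tr: "Transposition.transpose 0 e0 ` {..<n + (c - n')} = {..<n + (c - n')}"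
    using e0 n0 by (intro transpose_image_eq) auto
  have im: "t' ` {..<n + (c - n')} = t1 ` {..<n} \<union> t ` {n'..<c}"
  proof -
    have "t' ` {..<n + (c - n')} = t2 ` {..<n + (c - n')}"
      unfolding t'_def image_comp[symmetric] tr ..
    also have "t2 ` {..<n + (c - n')} = t2 ` ({..<n} \<union> {n..<n + (c - n')})" by (rule arg_cong[of _ _ "(`) t2"]) auto
    also have "t2 ` ({..<n} \<union> {n..<n + (c - n')}) = t1 ` {..<n} \<union> t ` {n'..<c}"
    proof -
      have "t2 ` {..<n} = t1 ` {..<n}" by (simp add: t2_def)
      moreover have "t2 ` {n..<n + (c - n')} = t ` {n'..<c}"
      proof -
        have "t2 ` {n..<n + (c - n')} = t ` ((\<lambda>e. n' + (e - n)) ` {n..<n + (c - n')})"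
          unfolding image_comp by (rule image_cong) (auto simp: t2_def)
        also have "(\<lambda>e. n' + (e - n)) ` {n..<n + (c - n')} = {n'..<c}"
        proof (intro equalityI subsetI)
          fix x assume "x \<in> {n'..<c}"
          then show "x \<in> (\<lambda>e. n' + (e - n)) ` {n..<n + (c - n')}"
            by (intro image_eqI[of _ _ "n + (x - n')"]) auto
        qed auto
        finally show ?thesis .
      qed
      ultimately show ?thesis by (simp add: image_Un)
    qed
    finally show ?thesis .
  qed
  have t'f: "\<tau> (t' e) = t' e" if "e < n + (c - n')" for e
  proof -
    have "t' e \<in> t1 ` {..<n} \<union> t ` {n'..<c}" using im that by blast
    then show ?thesis using t1(1) t(1) by auto
  qed
  have t'0: "t' 0 \<noteq> 0" using e0 by (simp add: t'_def t2_def)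
  let ?A = "K \<union> \<beta> ` {f. N dvd poly f k} \<union> {s} \<union> t ` {..<c}"
  let ?B = "K \<union> L.\<beta>2 ` {f. N' dvd poly f k} \<union> {s} \<union> (t1 ` {..<n} \<union> t ` {n'..<c})"
  have Q: "gen (K \<union> {s} \<union> range (\<lambda>j. (\<tau> ^^ j) q)) = gen (K \<union> {s} \<union> t1 ` {..<n})"
    by (rule dft_gen[OF n'(3) nn0(1)]) (use t1 in auto)
  have V: "gen (K \<union> {s} \<union> range (\<lambda>j. (\<tau> ^^ j) v)) = gen (K \<union> {s} \<union> t ` {..<n'})"
    by (rule dft_gen[OF n'P nn0(2)]) (use tn' v_def in auto)
  have Bgen: "(\<tau> ^^ j) B0 \<in> gen S" if S: "K \<subseteq> gen S" "s \<in> gen S" "\<And>f. N dvd poly f k \<Longrightarrow> \<beta> f \<in> gen S" for j S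
  proof -
    have 1: "(\<tau> ^^ j) (cc l) \<in> gen S" for l
      unfolding cc_def mm_funpow[OF \<tau> \<beta>(1) mem] by (rule S(3)) (use mem in simp)
    have "sP n \<in> gen S" unfolding sP_def using S(2) by (intro gen_intros)
    then have 2: "(\<tau> ^^ i) a \<in> gen S" for i
      unfolding a_def fhom_power[OF fhom_funpow[OF \<tau>]] sP_funpow using S(1) sP(4) by (intro gen_intros) auto
    show ?thesis
      unfolding B0_def fhom_sum[OF fhom_funpow[OF \<tau>]] fhom_mult[OF fhom_funpow[OF \<tau>]]
      using 1 2 by (intro gen_intros) (simp_all add: funpow_add[unfolded comp_def fun_eq_iff, rule_format, symmetric])
  qed
  have vq: "(\<tau> ^^ j) v = (\<tau> ^^ j) q * (\<tau> ^^ j) B0" for j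
    using B0 by (simp add: q_def fhom_mult[OF fhom_funpow[OF \<tau>], symmetric])
  have "gen ?A = gen ?B"
  proof (rule gen_eqI)
    have Bb: "K \<subseteq> gen ?B" "s \<in> gen ?B" by (auto intro: gen_base)
    have Qb: "(\<tau> ^^ j) q \<in> gen ?B" for j
    proof -
      have "(\<tau> ^^ j) q \<in> gen (K \<union> {s} \<union> t1 ` {..<n})" unfolding Q[symmetric] by (rule gen_base) auto
      then show ?thesis using gen_mono[of "K \<union> {s} \<union> t1 ` {..<n}" ?B] by auto
    qed
    have bb: "\<beta> f \<in> gen ?B" if f: "N dvd poly f k" for f
    proof -
      have "N' dvd poly f k" using f N(2) by (metis dvd_mult_right)
      then have "L.\<beta>2 f \<in> gen ?B" by (auto intro: gen_base)
      then show ?thesis unfolding L.\<beta>_from_\<beta>2[OF f]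
        by (intro gen_intros pexp_in_gen[OF \<tau>] Qb)
    qed
    have Vb: "(\<tau> ^^ j) v \<in> gen ?B" for j
      unfolding vq using Qb Bgen[OF Bb bb] by (intro gen_intros)
    have "t e \<in> gen ?B" if "e < c" for e
    proof (cases "e < n'")
      case True
      then have "t e \<in> gen (K \<union> {s} \<union> range (\<lambda>j. (\<tau> ^^ j) v))" unfolding V by (auto intro: gen_base)
      moreover have "gen (K \<union> {s} \<union> range (\<lambda>j. (\<tau> ^^ j) v)) \<subseteq> gen ?B"
        by (rule gen_least) (use Bb Vb in auto)
      ultimately show ?thesis by blast
    next
      case False then show ?thesis using that by (auto intro: gen_base)
    qed
    then show "?A \<subseteq> gen ?B" using Bb bb by auto
    have Ab: "K \<subseteq> gen ?A" "s \<in> gen ?A" by (auto intro: gen_base)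
    have ba: "\<beta> f \<in> gen ?A" if "N dvd poly f k" for f using that by (auto intro: gen_base)
    have Va: "(\<tau> ^^ j) v \<in> gen ?A" for j
    proof -
      have "(\<tau> ^^ j) v \<in> gen (K \<union> {s} \<union> t ` {..<n'})" unfolding V[symmetric] by (rule gen_base) auto
      moreover have "t ` {..<n'} \<subseteq> t ` {..<c}" using t(3) by (intro image_mono) auto
      then have "gen (K \<union> {s} \<union> t ` {..<n'}) \<subseteq> gen ?A" by (intro gen_mono) blast
      ultimately show ?thesis by blast
    qed
    have B0j: "(\<tau> ^^ j) B0 \<noteq> 0" for j using B0 by (simp add: fhom_eq_0_iff[OF fhom_funpow[OF \<tau>]])
    have Qa: "(\<tau> ^^ j) q \<in> gen ?A" for j
    proof -
      have "(\<tau> ^^ j) q = (\<tau> ^^ j) v / (\<tau> ^^ j) B0" using vq B0j by simp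
      then show ?thesis using Va Bgen[OF Ab ba] by (simp only: gen_intros)
    qed
    have "L.\<beta>2 f \<in> gen ?A" if f: "N' dvd poly f k" for f
      unfolding L.\<beta>2_def L.\<beta>1_def using ba[OF L.\<beta>2_mem[OF f]] Qa by (intro gen_intros pexp_in_gen[OF \<tau>])
    moreover have "t1 e \<in> gen ?A" if "e < n" for e
    proof -
      have "t1 e \<in> gen (K \<union> {s} \<union> range (\<lambda>j. (\<tau> ^^ j) q))" unfolding Q using that by (auto intro: gen_base)
      moreover have "gen (K \<union> {s} \<union> range (\<lambda>j. (\<tau> ^^ j) q)) \<subseteq> gen ?A"
        by (rule gen_least) (use Ab Qa in auto)
      ultimately show ?thesis by blast
    qed
    ultimately show "?B \<subseteq> gen ?A" using Ab by (auto intro: gen_base)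
  qed
  then have "gen ?A = gen (K \<union> L.\<beta>2 ` {f. N' dvd poly f k} \<union> {s} \<union> t' ` {..<n + (c - n')})"
    unfolding im .
  then show ?thesis
    using L.mulmod_\<beta>2 L.\<beta>2_Norm t'f t'0 by (intro exI[of _ L.\<beta>2] exI[of _ t'] conjI allI impI)
qed

text \<open>\<open>Norm 1 = 1\<close> makes \<open>\<beta>\<close> trivial. What remains is
  generated over invariant elements by \<open>s\<close>, a semi-invariant that contributes one
  generator.\<close>

lemma chain_base:
  assumes t: "\<And>e. e < c \<Longrightarrow> \<tau> (t e) = t e" and \<beta>: "mulmod \<tau> 1 k \<beta>" "\<beta> (Norm 1) = 1"
  shows "\<exists>U. finite U \<and> card U \<le> 1 + c \<and>
    {x \<in> gen (K \<union> range \<beta> \<union> {s} \<union> t ` {..<c}). \<tau> x = x} = gen (K \<union> U)"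
proof -
  have b1: "\<beta> f = 1" for f
    using mm_mult_one[OF \<tau> \<beta>(1) _ \<beta>(2), of f] by (simp add: Norm_def monom_0)
  define E where "E = gen (K \<union> t ` {..<c})"
  have E: "subfld E" by (simp add: E_def)
  have Ef: "\<tau> x = x" if "x \<in> E" for x
    by (rule gen_fixed[OF \<tau>, of "K \<union> t ` {..<c}"]) (use that t Kfix in \<open>auto simp: E_def\<close>)
  have pow: "(\<forall>g\<in>\<Gamma>. g x = x) \<longleftrightarrow> \<tau> x = x" for x
  proof
    have "\<tau> \<in> \<Gamma>" unfolding \<Gamma>(2) by (rule range_eqI[of _ _ 1]) simp
    then show "\<forall>g\<in>\<Gamma>. g x = x \<Longrightarrow> \<tau> x = x" by blast
    show "\<tau> x = x \<Longrightarrow> \<forall>g\<in>\<Gamma>. g x = x" unfolding \<Gamma>(2) by (auto intro: funpow_fixed)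
  qed
  have KE: "K \<subseteq> E" by (auto simp: E_def intro: gen_base)
  have gE: "g y = y" if "g \<in> \<Gamma>" "y \<in> E" for g y using that Ef[of y] pow[of y] by blast
  have gs: "\<exists>a\<in>E. g s = a * s" if g: "g \<in> \<Gamma>" for g
  proof -
    obtain i where i: "g = \<tau> ^^ i" using g unfolding \<Gamma>(2) by blast
    have "(\<tau> ^^ i) s = \<xi> ^ i * s"
      by (induction i) (use \<xi>(1) in \<open>simp_all add: s fhom_simps[OF \<tau>] Kfix mult_ac\<close>)
    moreover have "\<xi> ^ i \<in> E" using \<xi>(1) KE by (intro sf_intros[OF E]) auto
    ultimately show ?thesis using i by blast
  qed
  have "\<exists>z. z \<noteq> 0 \<and> z \<in> gen (insert s E) \<and> (\<forall>g\<in>\<Gamma>. g z = z) \<and> Fix \<Gamma> (gen (insert s E)) = gen (insert z (Fix \<Gamma> E))"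
    by (rule Fix_gen_semiinvariant[OF \<Gamma>(1,3) E _ s(2)]) (use gE gs in metis)+
  then obtain z where z: "Fix \<Gamma> (gen (insert s E)) = gen (insert z (Fix \<Gamma> E))" by blast
  have "Fix \<Gamma> E = E" using gE by (auto simp: Fix_def)
  then have 1: "Fix \<Gamma> (gen (insert s E)) = gen (K \<union> insert z (t ` {..<c}))"
    using z gen_gen_Un[of "K \<union> t ` {..<c}" "{z}"] by (simp add: E_def)
  have 2: "gen (K \<union> range \<beta> \<union> {s} \<union> t ` {..<c}) = gen (insert s E)"
  proof (rule gen_eqI)
    have "1 \<in> gen (insert s E)" by (rule sf_1) simp
    then show "K \<union> range \<beta> \<union> {s} \<union> t ` {..<c} \<subseteq> gen (insert s E)"
      using KE by (auto simp: b1 E_def intro: gen_base)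
    have "E \<subseteq> gen (K \<union> range \<beta> \<union> {s} \<union> t ` {..<c})" unfolding E_def by (rule gen_mono) auto
    then show "insert s E \<subseteq> gen (K \<union> range \<beta> \<union> {s} \<union> t ` {..<c})" by (auto intro: gen_base)
  qed
  show ?thesis
  proof (intro exI[of _ "insert z (t ` {..<c})"] conjI)
    show "card (insert z (t ` {..<c})) \<le> 1 + c"
      by (rule order_trans[OF card_insert_le_m1]) (auto intro: order_trans[OF card_image_le])
    show "{x \<in> gen (K \<union> range \<beta> \<union> {s} \<union> t ` {..<c}). \<tau> x = x} = gen (K \<union> insert z (t ` {..<c}))"
      unfolding 2 1[symmetric] Fix_def pow ..
  qed simp
qed

text \<open>\<open>\<beta>\<close> is trivial on the multiples of \<open>Norm 2 = 1 + x\<close>, so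
  \<open>\<beta> f\<close> depends only on the integer \<open>poly f (-1)\<close>. As
  \<open>k\<close> is \<open>-1\<close> modulo \<open>N\<close>, the ideal corresponds to the
  multiples of \<open>N\<close>. These are identified with the multiples of \<open>2\<close> through
  the factor \<open>M = N / 2\<close>, compatibly with \<open>x\<close> acting as
  \<open>-1\<close>.\<close>

lemma twist_to_two:
  assumes p2: "p = 2" and N: "N > 0" "even N" "N dvd k + 1"
    and \<beta>: "mulmod \<tau> N k \<beta>" "\<beta> (Norm 2) = 1"
  shows "\<exists>\<beta>'. mulmod \<tau> 2 k \<beta>' \<and> \<beta>' (Norm 2) = 1 \<and> \<beta>' ` {f. 2 dvd poly f k} = \<beta> ` {f. N dvd poly f k}"
proof -
  obtain M where M: "N = 2 * M" using N(2) by blast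
  define \<beta>' where "\<beta>' f = \<beta> [:M * poly f (-1):]" for f
  have k1: "2 dvd k + 1" using N(2,3) by (metis dvd_trans)
  have par: "2 dvd poly f (-1) \<longleftrightarrow> 2 dvd poly f k" for f :: "int poly"
  proof -
    have "k + 1 dvd poly f k - poly f (-1)"
      using poly_diff_dvd[of k "-1" f] by simp
    then have "2 dvd poly f k - poly f (-1)" using k1 by (rule dvd_trans[rotated])
    then show ?thesis by presburger
  qed
  have n2: "Norm 2 = [:1, 1:]" by (simp add: Norm_def numeral_2_eq_2 monom_0 monom_Suc one_pCons)
  have mem: "N dvd poly [:M * poly f (-1):] k" if "2 dvd poly f k" for f
    using that unfolding M par[symmetric] by (auto simp: mult.commute)
  have sgn: "\<beta> ([:1, 1:] * g) = 1" for g
    using mm_mult_one[OF \<tau> \<beta>(1) _ \<beta>(2)] N(3) by (simp add: n2 add.commute)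
  have "mulmod \<tau> 2 k \<beta>'"
    unfolding mulmod_def
  proof (intro conjI allI impI)
    fix f assume f: "2 dvd poly f k"
    show "\<beta>' f \<noteq> 0" unfolding \<beta>'_def by (rule mm_nz[OF \<tau> \<beta>(1) mem[OF f]])
    define c where "c = M * poly f (-1)"
    have c: "N dvd poly [:c:] k" using mem[OF f] by (simp add: c_def)
    have "pCons 0 [:c:] = [:1, 1:] * [:c:] - [:c:]" by simp
    then have "\<beta> (pCons 0 [:c:]) = \<beta> ([:1, 1:] * [:c:]) / \<beta> [:c:]"
      using c by (simp only:) (rule mm_diff[OF \<tau> \<beta>(1)], use N(3) in \<open>simp_all add: add.commute distrib_left[symmetric]\<close>)
    then have "\<tau> (\<beta> [:c:]) = inverse (\<beta> [:c:])"
      using mm_shift[OF \<tau> \<beta>(1) c] sgn[of "[:c:]"] by (simp add: inverse_eq_divide)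
    also have "\<dots> = \<beta> (- [:c:])" by (rule mm_uminus[OF \<tau> \<beta>(1) c, symmetric])
    finally show "\<beta>' (pCons 0 f) = \<tau> (\<beta>' f)" by (simp add: \<beta>'_def c_def)
    fix g assume g: "2 dvd poly g k"
    show "\<beta>' (f + g) = \<beta>' f * \<beta>' g"
      unfolding \<beta>'_def using mm_add[OF \<tau> \<beta>(1) mem[OF f] mem[OF g]] by (simp add: distrib_left)
  qed
  moreover have "\<beta>' (Norm 2) = 1" by (simp add: \<beta>'_def n2 mm_0[OF \<tau> \<beta>(1)])
  moreover have "\<beta>' ` {f. 2 dvd poly f k} = \<beta> ` {f. N dvd poly f k}"
  proof (intro equalityI subsetI)
    fix y assume "y \<in> \<beta>' ` {f. 2 dvd poly f k}"
    then show "y \<in> \<beta> ` {f. N dvd poly f k}" unfolding \<beta>'_def using mem by blast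
  next
    fix y assume "y \<in> \<beta> ` {f. N dvd poly f k}"
    then obtain f where f: "y = \<beta> f" "N dvd poly f k" by blast
    have "k + 1 dvd poly f k - poly f (-1)" using poly_diff_dvd[of k "-1" f] by simp
    then have m1: "N dvd poly f (-1)" using N(3) f(2) by (meson dvd_diff_right_iff dvd_trans)
    then obtain x where x: "poly f (-1) = N * x" by (auto simp: dvd_def)
    have "f = [:1, 1:] * synthetic_div f (-1) + [:poly f (-1):]"
      using synthetic_div_correct'[of "-1" f] by simp
    moreover have "N dvd poly ([:1, 1:] * synthetic_div f (-1)) k"
      using dvd_mult2[OF N(3), of "poly (synthetic_div f (-1)) k"] by (simp add: algebra_simps)
    moreover have "N dvd poly [:poly f (-1):] k" using m1 by simp
    ultimately have "\<beta> f = \<beta> [:poly f (-1):]"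
      using mm_add[OF \<tau> \<beta>(1)] sgn by (metis mult_1)
    also have "\<dots> = \<beta>' [:2 * x:]" by (simp add: \<beta>'_def x M mult_ac)
    finally show "y \<in> \<beta>' ` {f. 2 dvd poly f k}" using f(1) by auto
  qed
  ultimately show ?thesis by blast
qed

text \<open>The bound counts a lattice of rank \<open>p^D - 1\<close>, the element \<open>s\<close>
  and \<open>c\<close> invariants. The last hypothesis guarantees that there are enough invariants
  to bundle in the first descent; every descent increases their number.\<close>

theorem chain:
  assumes "chain_good p k D N" "p ^ D dvd P" "mulmod \<tau> N k \<beta>" "\<beta> (Norm (p ^ D)) = 1"
    and "\<And>e. e < c \<Longrightarrow> \<tau> (t e) = t e" "t 0 \<noteq> 0" "p ^ D \<le> p * c"
  shows "\<exists>U. finite U \<and> card U \<le> p ^ D + c \<and>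
    {x \<in> gen (K \<union> \<beta> ` {f. N dvd poly f k} \<union> {s} \<union> t ` {..<c}). \<tau> x = x} = gen (K \<union> U)"
  using assms
proof (induction D arbitrary: N \<beta> c t)
  case 0
  then have "N = 1" by simp
  then show ?case using chain_base[of c t \<beta>] 0 by simp
next
  case (Suc D)
  have pp: "p > 0" using p by (simp add: prime_gt_0_nat)
  have step: "\<exists>U. finite U \<and> card U \<le> p ^ Suc D + c \<and>
    {x \<in> gen (K \<union> \<beta> ` {f. N dvd poly f k} \<union> {s} \<union> t ` {..<c}). \<tau> x = x} = gen (K \<union> U)"
    if N: "N' > 0" "N = int p * N'" "N dvd k ^ (p ^ D) - 1" "N' dvd poly (Norm (p ^ D)) k"
      "coprime (poly (Norm (p ^ D)) k div N') (int p)" "chain_good p k D N'"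
      and \<beta>: "mulmod \<tau> N k \<beta>" "\<beta> (Norm (p ^ Suc D)) = 1" for N N' \<beta>
  proof -
    have c: "p ^ D \<le> c" using Suc.prems(7) pp by simp
    have P: "p * p ^ D dvd P" using Suc.prems(2) by simp
    from lattice_descent[where t = t and c = c, OF refl refl P N(1-5) \<beta>(1) \<beta>(2)[unfolded power_Suc] _ Suc.prems(6) c] Suc.prems(5)
    obtain \<beta>' t' where *: "mulmod \<tau> N' k \<beta>'" "\<beta>' (Norm (p ^ D)) = 1"
      "\<forall>e<p * p ^ D + (c - p ^ D). \<tau> (t' e) = t' e" "t' 0 \<noteq> 0"
      "gen (K \<union> \<beta> ` {f. N dvd poly f k} \<union> {s} \<union> t ` {..<c}) =
       gen (K \<union> \<beta>' ` {f. N' dvd poly f k} \<union> {s} \<union> t' ` {..<p * p ^ D + (c - p ^ D)})"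
      by blast
    have P': "p ^ D dvd P" using P by (rule dvd_mult_right)
    have c': "p ^ D \<le> p * (p * p ^ D + (c - p ^ D))"
    proof -
      have "p ^ D \<le> p * p ^ D" using pp by simp
      also have "\<dots> \<le> p * (p * p ^ D + (c - p ^ D))" using pp by (simp add: trans_le_add1)
      finally show ?thesis .
    qed
    have "\<exists>U. finite U \<and> card U \<le> p ^ D + (p * p ^ D + (c - p ^ D)) \<and>
      {x \<in> gen (K \<union> \<beta>' ` {f. N' dvd poly f k} \<union> {s} \<union> t' ` {..<p * p ^ D + (c - p ^ D)}). \<tau> x = x} = gen (K \<union> U)"
      by (rule Suc.IH[where t = t', OF N(6) P' *(1,2) _ *(4) c']) (use *(3) in blast)
    moreover have "p ^ D + (p * p ^ D + (c - p ^ D)) = p ^ Suc D + c" using c by simp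
    ultimately show ?thesis unfolding *(5) by simp
  qed
  from Suc.prems(1) consider
    (1) "\<exists>N'. N' > 0 \<and> N = int p * N' \<and> N dvd k ^ (p ^ D) - 1 \<and> N' dvd poly (Norm (p ^ D)) k
      \<and> coprime (poly (Norm (p ^ D)) k div N') (int p) \<and> chain_good p k D N'"
    | (2) "p = 2" "D = 0" "N > 0" "even N" "N dvd k + 1" by auto
  then show ?case
  proof cases
    case 1
    then obtain N' where "N' > 0" "N = int p * N'" "N dvd k ^ (p ^ D) - 1" "N' dvd poly (Norm (p ^ D)) k"
      "coprime (poly (Norm (p ^ D)) k div N') (int p)" "chain_good p k D N'" by blast
    from step[OF this Suc.prems(3,4)] show ?thesis .
  next
    case 2
    \<comment> \<open>In the exceptional case the modulus is replaced by \<open>2\<close> without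
      changing the field, and then the ordinary step with \<open>N' = 1\<close> applies.\<close>
    have "\<beta> (Norm 2) = 1" using Suc.prems(4) 2 by simp
    then obtain \<beta>' where b: "mulmod \<tau> 2 k \<beta>'" "\<beta>' (Norm 2) = 1"
      "\<beta>' ` {f. 2 dvd poly f k} = \<beta> ` {f. N dvd poly f k}"
      using twist_to_two[OF 2(1,3,4,5) Suc.prems(3)] by blast
    have n1: "Norm 1 = 1" by (simp add: Norm_def monom_0 one_pCons)
    have "\<exists>U. finite U \<and> card U \<le> p ^ Suc D + c \<and>
      {x \<in> gen (K \<union> \<beta>' ` {f. 2 dvd poly f k} \<union> {s} \<union> t ` {..<c}). \<tau> x = x} = gen (K \<union> U)"
      by (rule step[of 1]) (use 2 b pk n1 in \<open>simp_all\<close>)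
    then show ?thesis unfolding b(3) .
  qed
qed

end

section \<open>Existence of a lattice chain\<close>

lemma poly_Norm: "poly (Norm n) k = (\<Sum>i<n. k ^ i)"
  by (simp add: Norm_def poly_sum poly_monom)

lemma pow_minus_1: "k ^ n - 1 = (k - 1) * poly (Norm n) (k::int)"
  unfolding poly_Norm by (rule power_diff_1_eq)

lemma sum_lessThan_plus: "(\<Sum>i<a + b. f i) = (\<Sum>i<a. f i) + (\<Sum>i<(b::nat). (f (a + i) :: 'b::comm_monoid_add))"
  by (induction b) (simp_all add: add.assoc)

lemma poly_Norm_mult: "poly (Norm (m * n)) (k::int) = poly (Norm n) k * (\<Sum>l<m. (k ^ n) ^ l)"
proof (induction m)
  case (Suc m)
  have "poly (Norm (Suc m * n)) k = (\<Sum>i<m * n + n. k ^ i)" by (simp add: poly_Norm add.commute)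
  also have "\<dots> = (\<Sum>i<m * n. k ^ i) + (\<Sum>i<n. k ^ (m * n + i))" by (rule sum_lessThan_plus)
  finally show ?case using Suc
    by (simp add: poly_Norm distrib_left sum_distrib_right power_add power_mult[symmetric] mult.commute)
qed (simp add: poly_Norm)

text \<open>Modulo \<open>p^2\<close>, \<open>(1 + p * x)^l\<close> is \<open>1 + l * p * x\<close>,
  and the sum of all \<open>l < p\<close> is divisible by \<open>p\<close> when \<open>p\<close> is
  odd.\<close>

lemma sum_powers_cong:
  fixes x :: int
  assumes "odd p"
  shows "int p ^ 2 dvd (\<Sum>l<p. (1 + int p * x) ^ l) - int p"
proof -
  have b: "int p ^ 2 dvd (1 + int p * x) ^ l - (1 + int l * int p * x)" for l
  proof (induction l)
    case (Suc l)
    have "(1 + int p * x) ^ Suc l - (1 + int (Suc l) * int p * x)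
        = (1 + int p * x) * ((1 + int p * x) ^ l - (1 + int l * int p * x)) + int p ^ 2 * (int l * x * x)"
      by (simp add: algebra_simps power2_eq_square)
    then show ?case using Suc by simp
  qed simp
  obtain h where h: "p = 2 * h + 1" using assms by (elim oddE)
  have g: "(\<Sum>l<p. int l) = int p * int h"
  proof -
    have "2 * (\<Sum>l<m. int l) = int m * (int m - 1)" for m by (induction m) (simp_all add: algebra_simps)
    from this[of p] show ?thesis by (simp add: h)
  qed
  have "(\<Sum>l<p. (1 + int p * x) ^ l) - int p
      = (\<Sum>l<p. (1 + int p * x) ^ l - (1 + int l * int p * x)) + (\<Sum>l<p. int l) * int p * x"
    by (simp add: sum_subtractf sum.distrib sum_distrib_right mult.assoc)
  also have "\<dots> = (\<Sum>l<p. (1 + int p * x) ^ l - (1 + int l * int p * x)) + int p ^ 2 * (int h * x)"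
    by (simp add: g power2_eq_square)
  finally show ?thesis using b by (simp add: dvd_sum)
qed

lemma coprime_prime_int:
  assumes p: "Factorial_Ring.prime p"
  shows "coprime (u::int) (int p) \<longleftrightarrow> \<not> int p dvd u"
proof -
  have ip: "Factorial_Ring.prime (int p)" using p by simp
  show "coprime u (int p) \<longleftrightarrow> \<not> int p dvd u"
  proof
    assume "coprime u (int p)"
    then show "\<not> int p dvd u"
      using ip by (metis coprime_common_divisor dvd_refl not_prime_unit)
  next
    assume "\<not> int p dvd u"
    then show "coprime u (int p)"
      using ip prime_imp_coprime coprime_commute by blast
  qed
qed

text \<open>The norm of period \<open>p^(j+1)\<close> is that of period \<open>p^j\<close> times the
  sum of the powers \<open>y^l\<close> with \<open>l < p\<close>, where \<open>y = k^(p^j)\<close>.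
  This factor is \<open>p\<close> modulo \<open>p^2\<close>; for \<open>p = 2\<close> it is
  \<open>1 + y\<close>, and \<open>4 dvd k - 1\<close> is needed.\<close>

lemma norm_valuation:
  assumes p: "Factorial_Ring.prime p" and k: "int p dvd k - 1" and k4: "p = 2 \<Longrightarrow> 4 dvd k - 1"
  shows "\<exists>u. poly (Norm (p ^ j)) k = int p ^ j * u \<and> \<not> int p dvd u"
proof (induction j)
  case 0
  then show ?case using prime_gt_1_nat[OF p] by (simp add: poly_Norm)
next
  case (Suc j)
  then obtain u where u: "poly (Norm (p ^ j)) k = int p ^ j * u" "\<not> int p dvd u" by blast
  have pp: "p > 1" by (rule prime_gt_1_nat[OF p])
  define y where "y = k ^ (p ^ j)"
  have dy: "m dvd y - 1" if "m dvd k - 1" for m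
    unfolding y_def pow_minus_1 using that by simp
  have "\<exists>v. (\<Sum>l<p. y ^ l) = int p * v \<and> \<not> int p dvd v"
  proof (cases "p = 2")
    case True
    obtain x where x: "y - 1 = 4 * x" using dy[OF k4[OF True]] by blast
    have "(\<Sum>l<p. y ^ l) = 1 + y" by (simp add: True numeral_2_eq_2)
    also have "\<dots> = int p * (1 + 2 * x)" using x True by simp
    finally show ?thesis using True by (intro exI[of _ "1 + 2 * x"]) simp
  next
    case False
    then have odd: "odd p" using p prime_odd_nat pp by (metis One_nat_def Suc_lessI numeral_2_eq_2)
    obtain x where "y - 1 = int p * x" using dy[OF k] by blast
    then have y: "y = 1 + int p * x" by simp
    obtain z where z: "(\<Sum>l<p. y ^ l) - int p = int p ^ 2 * z" using sum_powers_cong[OF odd, of x] y by blast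
    then have "(\<Sum>l<p. y ^ l) = int p * (1 + int p * z)" by (simp add: power2_eq_square algebra_simps)
    moreover have "\<not> int p dvd 1 + int p * z"
    proof
      assume "int p dvd 1 + int p * z"
      then have "int p dvd 1" by (metis dvd_add_left_iff dvd_triv_left)
      then show False using pp by simp
    qed
    ultimately show ?thesis by blast
  qed
  then obtain v where v: "(\<Sum>l<p. y ^ l) = int p * v" "\<not> int p dvd v" by blast
  have "poly (Norm (p ^ Suc j)) k = int p ^ Suc j * (u * v)"
    using poly_Norm_mult[of p "p ^ j" k] u(1) v(1) by (simp add: y_def)
  moreover have "\<not> int p dvd u * v" using u(2) v(2) p by (simp add: prime_dvd_mult_iff)
  ultimately show ?case by blast
qed

lemma chain_good_step:
  assumes p: "Factorial_Ring.prime p" and k: "int p dvd k - 1"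
    and s: "poly (Norm (p ^ D)) k = int p ^ e * u" "\<not> int p dvd u" and g: "chain_good p k D (int p ^ e)"
  shows "chain_good p k (Suc D) (int p ^ Suc e)"
proof -
  have pp: "int p ^ e > 0" using p by (simp add: prime_gt_0_nat)
  have "int p ^ Suc e dvd k ^ (p ^ D) - 1"
    unfolding pow_minus_1 s(1) power_Suc using k by (intro mult_dvd_mono) auto
  moreover have "poly (Norm (p ^ D)) k div int p ^ e = u" using s(1) pp by simp
  moreover have "coprime u (int p)" using s(2) p by (simp add: coprime_prime_int)
  ultimately show ?thesis using pp s(1) g by (auto intro!: exI[of _ "int p ^ e"])
qed

text \<open>Ordinarily the norm of period \<open>p^j\<close> has valuation exactly \<open>j\<close>
  at \<open>k\<close>, so modulus and period run through the same powers. For \<open>p = 2\<close>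
  and \<open>k \<equiv> 3 (mod 4)\<close>, let \<open>f\<close> be the valuation of
  \<open>k + 1\<close>, the norm of period \<open>2\<close>. If \<open>2^d\<close> divides
  \<open>k + 1\<close>, the twist at period \<open>2\<close> is the whole chain; otherwise the twist
  handles \<open>2^f\<close>, and ordinary steps lead up from there to \<open>2^d\<close>.\<close>

lemma chain_good_exists:
  assumes p: "Factorial_Ring.prime p" and k: "int p dvd k - 1" and d: "d > 0"
  shows "\<exists>D. chain_good p k (Suc D) (int p ^ d)"
proof (cases "p = 2 \<and> \<not> 4 dvd k - 1")
  case False
  then have k4: "p = 2 \<Longrightarrow> 4 dvd k - 1" by blast
  have "chain_good p k D (int p ^ D)" for D
  proof (induction D)
    case (Suc D)
    obtain u where "poly (Norm (p ^ D)) k = int p ^ D * u" "\<not> int p dvd u"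
      using norm_valuation[OF p k k4] by blast
    from chain_good_step[OF p k this Suc] show ?case .
  qed simp
  then show ?thesis using d by (metis Suc_pred)
next
  case True
  then have p2: "p = 2" and n4: "\<not> 4 dvd k - 1" by auto
  have k2: "2 dvd k - 1" using k p2 by simp
  have k14: "4 dvd k + 1" using k2 n4 by presburger
  show ?thesis
  proof (cases "2 ^ d dvd k + 1")
    case True
    then have "chain_good p k (Suc 0) (int p ^ d)" using p2 d by simp
    then show ?thesis by blast
  next
    case False
    then have k0: "k + 1 \<noteq> 0" by auto
    define f where "f = multiplicity 2 (k + 1)"
    obtain z where z: "k + 1 = 2 ^ f * z" "\<not> 2 dvd z"
      unfolding f_def by (rule multiplicity_decompose'[OF k0, of 2]) simp_all
    have f: "f < d"
    proof (rule ccontr)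
      assume "\<not> f < d"
      then have "(2::int) ^ d dvd 2 ^ f" by (simp add: le_imp_power_dvd)
      then show False using False z by (metis dvd_mult2)
    qed
    have f0: "f > 0" using z k14 by (metis dvd_trans gr0I even_numeral mult_1 power_0 dvd_triv_left numeral_Bit0_eq_double)
    \<comment> \<open>Beyond period \<open>2\<close> each doubling contributes a factor
      \<open>1 + y^2\<close> with \<open>y\<close> odd, which is \<open>2\<close> modulo
      \<open>4\<close>, so the valuation grows by one each time.\<close>
    have s: "\<exists>u. poly (Norm (2 ^ Suc j)) k = 2 ^ (f + j) * u \<and> \<not> 2 dvd u" for j
    proof (induction j)
      case 0
      have "poly (Norm (2 ^ Suc 0)) k = k + 1" by (simp add: poly_Norm numeral_2_eq_2)
      then show ?case using z by auto
    next
      case (Suc j)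
      then obtain u where u: "poly (Norm (2 ^ Suc j)) k = 2 ^ (f + j) * u" "\<not> 2 dvd u" by blast
      define y where "y = k ^ (2 ^ j)"
      have "odd y" using k2 by (simp add: y_def)
      then have "4 dvd y ^ 2 - 1"
      proof -
        obtain h where "y = 2 * h + 1" using \<open>odd y\<close> by (elim oddE)
        then have "y ^ 2 - 1 = 4 * (h * h + h)" by (simp add: power2_eq_square algebra_simps)
        then show ?thesis by simp
      qed
      then obtain h where h: "y ^ 2 - 1 = 4 * h" by blast
      have "poly (Norm (2 ^ Suc (Suc j))) k = poly (Norm (2 ^ Suc j)) k * (1 + k ^ (2 ^ Suc j))"
        using poly_Norm_mult[of 2 "2 ^ Suc j" k] by (simp add: numeral_2_eq_2)
      also have "k ^ (2 ^ Suc j) = y ^ 2" by (simp add: y_def power_mult[symmetric] mult.commute)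
      also have "1 + y ^ 2 = 2 * (1 + 2 * h)" using h by simp
      finally have "poly (Norm (2 ^ Suc (Suc j))) k = 2 ^ (f + Suc j) * (u * (1 + 2 * h))" using u by simp
      moreover have "\<not> 2 dvd u * (1 + 2 * h)" using u(2) by simp
      ultimately show ?case by blast
    qed
    have g: "chain_good p k (Suc j) (int p ^ (f + j))" for j
    proof (induction j)
      case 0 then show ?case using p2 f0 z by simp
    next
      case (Suc j)
      obtain u where "poly (Norm (2 ^ Suc j)) k = 2 ^ (f + j) * u" "\<not> 2 dvd u" using s by blast
      then show ?case using chain_good_step[OF p k, of "Suc j" "f + j" u] Suc p2 by simp
    qed
    show ?thesis using g[of "d - f"] f by auto
  qed
qed

text \<open>The norm of period \<open>j\<close> at \<open>k\<close> will appear as the exponent of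
  \<open>\<theta>\<close> by which \<open>\<sigma>\<close> and \<open>\<tau>^j\<close> fail to
  commute. So, with \<open>N\<close> the order of \<open>\<theta>\<close>, \<open>\<tau>\<close> to
  the power \<open>p^(D+1)\<close> commutes with \<open>\<sigma>\<close> and \<open>\<tau>\<close>
  to the power \<open>p^D\<close> does not.\<close>

lemma chain_good_Norm:
  assumes p: "Factorial_Ring.prime p" and g: "chain_good p k (Suc D) N"
  shows "\<not> N dvd poly (Norm (p ^ D)) k" "N dvd poly (Norm (p ^ Suc D)) k"
proof -
  from g consider
    (1) N' where "N' > 0" "N = int p * N'" "N dvd k ^ (p ^ D) - 1" "N' dvd poly (Norm (p ^ D)) k"
      "coprime (poly (Norm (p ^ D)) k div N') (int p)"
    | (2) "p = 2" "D = 0" "N > 0" "even N" "N dvd k + 1" by auto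
  then have "\<not> N dvd poly (Norm (p ^ D)) k \<and> N dvd poly (Norm (p ^ Suc D)) k"
  proof cases
    case 1
    obtain u where u: "poly (Norm (p ^ D)) k = N' * u" using 1 by blast
    have nu: "\<not> int p dvd u" using 1 u p by (simp add: coprime_prime_int)
    have "int p dvd (k ^ p ^ D) ^ l - 1" for l
    proof -
      have "k ^ p ^ D - 1 dvd (k ^ p ^ D) ^ l - 1" by (metis power_diff_1_eq dvd_triv_left)
      moreover have "int p dvd k ^ p ^ D - 1" using 1(2,3) by (metis dvd_mult_left)
      ultimately show ?thesis by (rule dvd_trans[rotated])
    qed
    then have "int p dvd (\<Sum>l<p. (k ^ p ^ D) ^ l - 1) + int p" by (intro dvd_add dvd_sum) auto
    then have "int p dvd (\<Sum>l<p. (k ^ p ^ D) ^ l)" by (simp add: sum_subtractf)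
    then have "N' * int p dvd poly (Norm (p ^ D)) k * (\<Sum>l<p. (k ^ p ^ D) ^ l)"
      using 1(4) by (rule mult_dvd_mono[rotated])
    then have "N dvd poly (Norm (p ^ Suc D)) k"
      using poly_Norm_mult[of p "p ^ D" k] 1(2) by (simp add: mult.commute)
    moreover have "\<not> N dvd poly (Norm (p ^ D)) k" using nu 1(1) by (simp add: 1(2) u mult.commute[of "int p"])
    ultimately show ?thesis by blast
  next
    case 2
    have "\<not> N dvd 1" using 2 by (metis dvd_trans odd_one)
    moreover have "poly (Norm (2 ^ Suc 0)) k = k + 1" by (simp add: poly_Norm numeral_2_eq_2)
    ultimately show ?thesis using 2 by (simp add: poly_Norm)
  qed
  then show "\<not> N dvd poly (Norm (p ^ D)) k" "N dvd poly (Norm (p ^ Suc D)) k" by auto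
qed

section \<open>Unipotent actions\<close>

lemma poly_division_over:
  fixes f P :: "'a::field poly"
  assumes E: "subfld E" and f: "\<And>i. poly.coeff f i \<in> E" "Polynomial.degree f > 0"
    and P: "\<And>i. poly.coeff P i \<in> E"
  shows "\<exists>q r. (\<forall>i. poly.coeff q i \<in> E) \<and> (\<forall>i. poly.coeff r i \<in> E) \<and> P = f * q + r \<and> Polynomial.degree r < Polynomial.degree f"
  using P
proof (induction "Polynomial.degree P" arbitrary: P rule: less_induct)
  case less
  note E0 = sf_0[OF E]
  show ?case
  proof (cases "Polynomial.degree P < Polynomial.degree f")
    case True
    then show ?thesis using less.prems E0 by (intro exI[of _ 0] exI[of _ P]) auto
  next
    case False
    define a where "a = Polynomial.lead_coeff P / Polynomial.lead_coeff f"
    define m where "m = Polynomial.monom a (Polynomial.degree P - Polynomial.degree f)"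
    define P1 where "P1 = P - m * f"
    have f0: "f \<noteq> 0" using f(2) by auto
    have a: "a \<in> E" unfolding a_def using less.prems f(1) by (intro sf_intros[OF E])
    have mE: "poly.coeff m i \<in> E" for i using a E0 by (simp add: m_def)
    have P1E: "poly.coeff P1 i \<in> E" for i
      unfolding P1_def using less.prems poly_over_mult[OF subfld_subrng[OF E] mE f(1)] by (simp add: sf_intros[OF E])
    have "poly.coeff (m * f) (Polynomial.degree P) = a * Polynomial.lead_coeff f"
      unfolding m_def coeff_monom_mult using False by simp
    then have "poly.coeff P1 (Polynomial.degree P) = 0" using f0 by (simp add: P1_def a_def)
    moreover have "Polynomial.degree P1 \<le> Polynomial.degree P"
    proof -
      have "Polynomial.degree m \<le> Polynomial.degree P - Polynomial.degree f"
        unfolding m_def by (rule degree_monom_le)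
      then have "Polynomial.degree (m * f) \<le> Polynomial.degree P"
        using degree_mult_le[of m f] False by linarith
      then show ?thesis unfolding P1_def by (rule degree_diff_le[OF order.refl])
    qed
    moreover have "Polynomial.degree P > 0" using False f(2) by simp
    ultimately have "Polynomial.degree P1 < Polynomial.degree P"
      by (metis le_neq_implies_less leading_coeff_0_iff degree_0)
    from less.hyps[OF this P1E] obtain q r where
      "\<forall>i. poly.coeff q i \<in> E" "\<forall>i. poly.coeff r i \<in> E" "P1 = f * q + r" "Polynomial.degree r < Polynomial.degree f" by blast
    then show ?thesis using mE
      by (intro exI[of _ "q + m"] exI[of _ r]) (auto simp: P1_def algebra_simps intro: sf_add[OF E])
  qed
qed

lemma poly_division_unique:
  fixes f :: "'a::field poly"
  assumes "f * q + r = f * q' + r'" "Polynomial.degree r < Polynomial.degree f" "Polynomial.degree r' < Polynomial.degree f"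
  shows "q = q' \<and> r = r'"
proof -
  have e: "f * (q - q') = r' - r" using assms(1) by (simp add: algebra_simps)
  have "q - q' = 0"
  proof (rule ccontr)
    assume n: "q - q' \<noteq> 0"
    have "f \<noteq> 0" using assms(2) by auto
    then have "Polynomial.degree (r' - r) \<ge> Polynomial.degree f" unfolding e[symmetric] using n by (simp add: degree_mult_eq)
    moreover have "Polynomial.degree (r' - r) < Polynomial.degree f" using assms(2,3) by (rule degree_diff_less[rotated])
    ultimately show False by simp
  qed
  then show ?thesis using e by simp
qed

text \<open>The action of an automorphism \<open>g\<close> with \<open>g v = b + v\<close> on polynomials in \<open>v\<close>.\<close>

definition semisub :: "('a::field \<Rightarrow> 'a) \<Rightarrow> 'a \<Rightarrow> 'a poly \<Rightarrow> 'a poly" where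
  "semisub g b P = pcompose (map_poly g P) [:b, 1:]"

context
  fixes g :: "'a::field \<Rightarrow> 'a" and b :: 'a assumes g: "fhom g"
begin

lemma semisub_add: "semisub g b (P + Q) = semisub g b P + semisub g b Q"
proof -
  have "map_poly g (P + Q) = map_poly g P + map_poly g Q"
    by (rule poly_eqI) (simp add: coeff_map_poly fhom_simps[OF g])
  then show ?thesis by (simp add: semisub_def pcompose_add)
qed

lemma semisub_mult: "semisub g b (P * Q) = semisub g b P * semisub g b Q"
proof -
  have "map_poly g (P * Q) = map_poly g P * map_poly g Q"
    by (rule poly_eqI) (simp add: coeff_map_poly coeff_mult fhom_simps[OF g])
  then show ?thesis by (simp add: semisub_def pcompose_mult)
qed

lemma degree_semisub: "Polynomial.degree (semisub g b P) = Polynomial.degree P"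
proof -
  have "Polynomial.degree (map_poly g P) = Polynomial.degree P"
    by (rule degree_map_poly) (simp add: fhom_eq_0_iff[OF g])
  then show ?thesis by (simp add: semisub_def degree_pcompose)
qed

lemma poly_semisub: "poly (semisub g b P) v = g (poly P v)" if "g v = b + v"
proof -
  have "poly (map_poly g P) (g x) = g (poly P x)" for x
    by (induction P) (simp_all add: map_poly_pCons fhom_simps[OF g])
  moreover have "poly (semisub g b P) v = poly (map_poly g P) (b + v)"
    by (simp add: semisub_def poly_pcompose)
  ultimately show ?thesis unfolding that[symmetric] by simp
qed

lemma semisub_over:
  assumes E: "subfld E" and st: "\<And>x. x \<in> E \<Longrightarrow> g x \<in> E" and b: "b \<in> E" and P: "\<And>i. poly.coeff P i \<in> E"
  shows "poly.coeff (semisub g b P) i \<in> E"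
  using P
proof (induction P arbitrary: i)
  case 0 then show ?case by (simp add: semisub_def sf_0[OF E])
next
  case (pCons a P)
  have P: "poly.coeff P i \<in> E" for i using pCons.prems[of "Suc i"] by simp
  have a: "a \<in> E" using pCons.prems[of 0] by simp
  have lin: "poly.coeff [:b, 1:] i \<in> E" for i
    using b by (auto simp: coeff_pCons sf_intros[OF E] split: nat.splits)
  have "semisub g b (pCons a P) = [:g a:] + [:b, 1:] * semisub g b P"
    by (simp add: semisub_def map_poly_pCons fhom_0[OF g] pcompose_pCons)
  moreover have "poly.coeff ([:b, 1:] * semisub g b P) i \<in> E"
    by (rule poly_over_mult[OF subfld_subrng[OF E] lin pCons.IH[OF P]])
  moreover have "poly.coeff [:g a:] i \<in> E" using st[OF a] by (auto simp: coeff_pCons sf_intros[OF E] split: nat.splits)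
  ultimately show ?case by (simp add: sf_add[OF E])
qed

end

text \<open>The action preserves the degree of polynomials in \<open>v\<close>. Let \<open>F\<close>
  be an invariant polynomial of least positive degree. By uniqueness, quotient and remainder of an
  invariant on division by \<open>F\<close> are again invariant, and the remainder is a constant by
  minimality. Invariant fractions become quotients of invariant polynomials through the norm of the
  denominator; nothing is averaged, so the characteristic may divide the order of the group.\<close>

lemma Fix_gen_unipotent:
  fixes v :: "'a::field"
  assumes \<Gamma>: "autgrp \<Gamma>" and E: "subfld E" and st: "\<And>g y. g \<in> \<Gamma> \<Longrightarrow> y \<in> E \<Longrightarrow> g y \<in> E"
    and v: "\<And>g. g \<in> \<Gamma> \<Longrightarrow> g v - v \<in> E" and tr: "\<not> alg_over E v"
  shows "\<exists>f. Fix \<Gamma> (gen (insert v E)) = gen (insert f (Fix \<Gamma> E))"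
proof -
  note G = autgrp_facts[OF \<Gamma>]
  define b where "b g = g v - v" for g
  have gv: "g v = b g + v" for g by (simp add: b_def)
  have bE: "b g \<in> E" if "g \<in> \<Gamma>" for g using v that by (simp add: b_def)
  define ov where "ov P \<longleftrightarrow> (\<forall>i. poly.coeff P i \<in> E)" for P
  have inj: "P = Q" if "ov P" "ov Q" "poly P v = poly Q v" for P Q
  proof (rule ccontr)
    assume "P \<noteq> Q"
    then have "P - Q \<noteq> 0" by simp
    moreover have "\<forall>i. poly.coeff (P - Q) i \<in> E" using that by (simp add: ov_def sf_diff[OF E])
    moreover have "poly (P - Q) v = 0" using that by simp
    ultimately show False using tr unfolding alg_over_def by blast
  qed
  define T where "T g = semisub g (b g)" for g
  have Tv: "poly (T g P) v = g (poly P v)" if "g \<in> \<Gamma>" for g P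
    unfolding T_def by (rule poly_semisub[OF G(3)[OF that]]) (rule gv)
  have Tov: "ov (T g P)" if "g \<in> \<Gamma>" "ov P" for g P
    unfolding ov_def T_def using that st bE by (intro allI semisub_over[OF G(3)[OF that(1)] E]) (auto simp: ov_def)
  define A where "A = {P. ov P \<and> (\<forall>g\<in>\<Gamma>. g (poly P v) = poly P v)}"
  have AT: "T g P = P" if "P \<in> A" "g \<in> \<Gamma>" for P g
    using that Tov[of g P] Tv[of g P] inj[of "T g P" P] by (auto simp: A_def)
  define R where "R = {poly P v |P. ov P}"
  have R: "subrng R" unfolding R_def ov_def by (rule subrng_poly_values[OF E])
  have Rst: "g x \<in> R" if "g \<in> \<Gamma>" "x \<in> R" for g x
    using that Tov Tv unfolding R_def by (auto, metis)
  define P0 where "P0 = (\<Prod>g\<in>\<Gamma>. [:b g, 1:])"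
  have "ov (\<Prod>g\<in>D. [:b g, 1:])" if "D \<subseteq> \<Gamma>" for D
    using finite_subset[OF that G(1)] that
  proof (induction D)
    case empty show ?case using E by (auto simp: ov_def one_pCons coeff_pCons sf_intros split: nat.splits)
  next
    case (insert g D)
    have "poly.coeff [:b g, 1:] i \<in> E" for i
      using bE[of g] insert.prems by (auto simp: coeff_pCons sf_intros[OF E] split: nat.splits)
    then have "poly.coeff ([:b g, 1:] * (\<Prod>g\<in>D. [:b g, 1:])) i \<in> E" for i
      by (rule poly_over_mult[OF subfld_subrng[OF E]]) (use insert in \<open>auto simp: ov_def\<close>)
    then show ?case using insert.hyps by (simp add: ov_def)
  qed
  then have P0o: "ov P0" by (simp add: P0_def)
  have P0v: "poly P0 v = (\<Prod>g\<in>\<Gamma>. g v)"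
    unfolding P0_def poly_prod by (rule prod.cong) (simp_all add: b_def)
  have P0A: "P0 \<in> A" using P0o P0v fixed_orbit_prod[OF \<Gamma>] by (simp add: A_def)
  have "Polynomial.degree P0 = card \<Gamma>"
    unfolding P0_def by (subst degree_prod_eq_sum_degree) auto
  then have "Polynomial.degree P0 > 0" using G(1,2) by (auto simp: card_gt_0_iff)
  define dmin where "dmin n \<longleftrightarrow> n > 0 \<and> (\<exists>P\<in>A. Polynomial.degree P = n)" for n
  have "dmin (LEAST n. dmin n)" by (rule LeastI[of _ "Polynomial.degree P0"]) (use P0A \<open>Polynomial.degree P0 > 0\<close> in \<open>auto simp: dmin_def\<close>)
  then obtain F where F: "F \<in> A" "Polynomial.degree F = (LEAST n. dmin n)" "Polynomial.degree F > 0" by (auto simp: dmin_def)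
  have Fmin: "Polynomial.degree P = 0" if "P \<in> A" "Polynomial.degree P < Polynomial.degree F" for P
    using not_less_Least[of "Polynomial.degree P" dmin] that F(2) by (auto simp: dmin_def)
  define f where "f = poly F v"
  have key: "poly P v \<in> gen (insert f (Fix \<Gamma> E))" if "P \<in> A" for P
    using that
  proof (induction "Polynomial.degree P" arbitrary: P rule: less_induct)
    case less
    have const: "poly Q v \<in> gen (insert f (Fix \<Gamma> E))" if Q: "Q \<in> A" "Polynomial.degree Q = 0" for Q
    proof -
      obtain c where c: "Q = [:c:]" using Q(2) by (metis degree_eq_zeroE)
      then have "c \<in> E" using Q(1) by (auto simp: A_def ov_def dest: spec[of _ 0])
      then have "c \<in> Fix \<Gamma> E" using Q(1) c by (auto simp: Fix_def A_def)
      then show ?thesis using c by (auto intro: gen_base)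
    qed
    have Fo: "\<And>i. poly.coeff F i \<in> E" and Po: "\<And>i. poly.coeff P i \<in> E" using F(1) less.prems by (auto simp: A_def ov_def)
    obtain q r where qr: "\<forall>i. poly.coeff q i \<in> E" "\<forall>i. poly.coeff r i \<in> E" "P = F * q + r" "Polynomial.degree r < Polynomial.degree F"
      using poly_division_over[OF E Fo F(3) Po] by blast
    have "T g q = q \<and> T g r = r" if g: "g \<in> \<Gamma>" for g
    proof (rule poly_division_unique)
      have "T g P = T g F * T g q + T g r"
        unfolding T_def qr(3) by (simp add: semisub_add[OF G(3)[OF g]] semisub_mult[OF G(3)[OF g]])
      then show "F * T g q + T g r = F * q + r" using AT[OF F(1) g] AT[OF less.prems g] qr(3) by simp
      show "Polynomial.degree (T g r) < Polynomial.degree F"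
        unfolding T_def degree_semisub[OF G(3)[OF g]] by (rule qr(4))
    qed (rule qr(4))
    then have qA: "q \<in> A" and rA: "r \<in> A" using Tv qr(1,2) by (auto simp: A_def ov_def) (metis, metis)
    have r: "poly r v \<in> gen (insert f (Fix \<Gamma> E))" by (rule const[OF rA Fmin[OF rA qr(4)]])
    have q: "poly q v \<in> gen (insert f (Fix \<Gamma> E))"
    proof (cases "q = 0")
      case False
      have "Polynomial.degree (F * q) = Polynomial.degree F + Polynomial.degree q"
        using False F(3) by (intro degree_mult_eq) auto
      then have "Polynomial.degree P = Polynomial.degree F + Polynomial.degree q"
        unfolding qr(3) using qr(4) by (subst degree_add_eq_left) auto
      then show ?thesis using less.hyps[OF _ qA] F(3) by simp
    qed (simp add: gen_intros)
    have "f \<in> gen (insert f (Fix \<Gamma> E))" by (auto intro: gen_base)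
    then show ?case unfolding qr(3) using q r by (simp add: f_def[symmetric] gen_intros)
  qed
  have "Fix \<Gamma> (gen (insert v E)) \<subseteq> gen (insert f (Fix \<Gamma> E))"
  proof
    fix z assume z: "z \<in> Fix \<Gamma> (gen (insert v E))"
    have "gen (insert v E) = gen R" unfolding R_def ov_def by (rule gen_insert_poly[OF E])
    then obtain x y where xy: "z = x / y" "x \<in> R" "y \<in> R" "y \<noteq> 0"
      using z gen_subrng[OF R] unfolding Fix_def by blast
    define n where "n = (\<Prod>g\<in>\<Gamma>. g y)"
    define y' where "y' = (\<Prod>g\<in>\<Gamma> - {id}. g y)"
    have n: "n = y * y'" unfolding n_def y'_def using prod.remove[OF G(1,2), of "\<lambda>g. g y"] by simp
    have n0: "n \<noteq> 0" unfolding n_def using G xy by (auto simp: fhom_eq_0_iff)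
    have y'R: "y' \<in> R" unfolding y'_def by (rule subrng_prod[OF R]) (use Rst xy in auto)
    have nR: "n \<in> R" "x * y' \<in> R" using n y'R xy R by (auto simp: subrng_def)
    have z': "z = (x * y') / n" using xy n n0 by (simp add: field_simps)
    have nf: "g n = n" if "g \<in> \<Gamma>" for g unfolding n_def by (rule fixed_orbit_prod[OF \<Gamma> that])
    have xf: "g (x * y') = x * y'" if "g \<in> \<Gamma>" for g
    proof -
      have e: "x * y' = z * n" using z' n0 by simp
      have "g z = z" using z that by (simp add: Fix_def)
      then show ?thesis unfolding e using nf[OF that] by (simp add: fhom_mult[OF G(3)[OF that]])
    qed
    obtain P where P: "x * y' = poly P v" "ov P" using nR(2) unfolding R_def by blast
    obtain Q where Q: "n = poly Q v" "ov Q" using nR(1) unfolding R_def by blast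
    have "P \<in> A" "Q \<in> A" unfolding A_def using P Q xf nf by auto
    then show "z \<in> gen (insert f (Fix \<Gamma> E))"
      unfolding z' P(1) Q(1) by (intro gen_intros key)
  qed
  moreover have "gen (insert f (Fix \<Gamma> E)) \<subseteq> Fix \<Gamma> (gen (insert v E))"
  proof (rule gen_least[OF subfld_Fix[OF \<Gamma> gen_subfld]])
    have "f \<in> R" unfolding f_def R_def using F(1) by (auto simp: A_def)
    then have "f \<in> gen (insert v E)" unfolding gen_insert_poly[OF E] R_def ov_def by (rule gen_base)
    then show "insert f (Fix \<Gamma> E) \<subseteq> Fix \<Gamma> (gen (insert v E))"
      using F(1) by (auto simp: Fix_def f_def A_def intro: gen_base)
  qed
  ultimately show ?thesis by blast
qed

section \<open>The permutation action on rational functions\<close>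

abbreviation KK :: "('v, 'k::field) ratfun set" where "KK \<equiv> range ratfun_const"

lemma ratfun_const_hom:
  "ratfun_const (a + b) = ratfun_const a + (ratfun_const b :: ('v, 'k::field) ratfun)"
  "ratfun_const (a * b) = ratfun_const a * (ratfun_const b :: ('v, 'k::field) ratfun)"
  "ratfun_const 0 = (0 :: ('v, 'k::field) ratfun)" "ratfun_const 1 = (1 :: ('v, 'k::field) ratfun)"
  by (simp_all add: ratfun_const_def mpoly_const.add mpoly_const.mult mpoly_const.one mpoly_const.zero
      One_fract_def Zero_fract_def)

lemma ratfun_const_uminus: "ratfun_const (- a) = - (ratfun_const a :: ('v, 'k::field) ratfun)"
  using ratfun_const_hom(1)[of a "- a"] by (simp add: ratfun_const_hom eq_neg_iff_add_eq_0 add.commute)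

lemma ratfun_const_inverse: "ratfun_const (inverse a) = inverse (ratfun_const a :: ('v, 'k::field) ratfun)"
proof (cases "a = 0")
  case False
  then have "ratfun_const a * ratfun_const (inverse a) = (1 :: ('v, 'k) ratfun)"
    by (simp add: ratfun_const_hom(2)[symmetric] ratfun_const_hom(4))
  then show ?thesis by (metis inverse_unique)
qed (simp add: ratfun_const_hom)

lemma ratfun_const_power: "ratfun_const (a ^ n) = (ratfun_const a :: ('v, 'k::field) ratfun) ^ n"
  by (induction n) (simp_all add: ratfun_const_hom)

lemma ratfun_const_of_nat: "ratfun_const (of_nat n) = (of_nat n :: ('v, 'k::field) ratfun)"
  by (induction n) (simp_all add: ratfun_const_hom)

lemma ratfun_const_eq_0_iff: "ratfun_const a = (0 :: ('v, 'k::field) ratfun) \<longleftrightarrow> a = 0"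
proof
  assume a: "ratfun_const a = (0 :: ('v, 'k) ratfun)"
  show "a = 0"
  proof (rule ccontr)
    assume "a \<noteq> 0"
    then have "ratfun_const (inverse a) * ratfun_const a = (1 :: ('v, 'k) ratfun)"
      by (simp add: ratfun_const_hom(2)[symmetric] ratfun_const_hom(4))
    then show False using a by simp
  qed
qed (simp add: ratfun_const_hom)

lemma subfld_KK: "subfld (KK :: ('v, 'k::field) ratfun set)"
proof (rule subfldI)
  show "1 \<in> (KK :: ('v, 'k) ratfun set)" by (metis ratfun_const_hom(4) rangeI)
qed (auto simp: ratfun_const_hom[symmetric] ratfun_const_uminus[symmetric] ratfun_const_inverse[symmetric])

lemma inj_ratfun_var: "inj (ratfun_var :: 'v \<Rightarrow> ('v, 'k::field) ratfun)"
proof (rule injI)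
  fix u v assume "ratfun_var u = (ratfun_var v :: ('v, 'k) ratfun)"
  then have "(mpoly_var u :: ('v, 'k) mpoly) = mpoly_var v" by (simp add: ratfun_var_def eq_fract)
  then have "Poly_Mapping.single (Poly_Mapping.single u (1::nat)) (1::'k) = Poly_Mapping.single (Poly_Mapping.single v 1) 1"
    by (simp add: mpoly_var_def MPoly_inject)
  then have "Poly_Mapping.keys (Poly_Mapping.single (Poly_Mapping.single u (1::nat)) (1::'k))
    = Poly_Mapping.keys (Poly_Mapping.single (Poly_Mapping.single v (1::nat)) (1::'k))" by simp
  then have "Poly_Mapping.single u (1::nat) = Poly_Mapping.single v 1" by simp
  then have "Poly_Mapping.keys (Poly_Mapping.single u (1::nat)) = Poly_Mapping.keys (Poly_Mapping.single v (1::nat))" by simp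
  then show "u = v" by simp
qed

lemma ratfun_rename_comp:
  fixes f :: "('v, 'k::field) ratfun"
  assumes "inj \<pi>" "inj \<rho>"
  shows "ratfun_rename \<rho> (ratfun_rename \<pi> f) = ratfun_rename (\<lambda>v. \<rho> (\<pi> v)) f"
proof -
  obtain P Q where f: "f = Fract P Q" "Q \<noteq> 0" by (cases f)
  have i: "inj (\<lambda>v. \<rho> (\<pi> v))" using inj_compose[OF assms(2,1)] by (simp add: comp_def)
  have nz: "mpoly_rename \<pi> Q \<noteq> 0" using f(2) mpoly_rename_eq_0_iff[OF assms(1)] by blast
  show ?thesis
    unfolding f(1) ratfun_rename_Fract[OF assms(1) f(2)] ratfun_rename_Fract[OF i f(2)]
    by (simp only: ratfun_rename_Fract[OF assms(2) nz] mpoly_rename_comp)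
qed

lemma ratfun_rename_id: "ratfun_rename (\<lambda>v. v) f = (f :: ('v, 'k::field) ratfun)"
proof -
  obtain P Q where f: "f = Fract P Q" "Q \<noteq> 0" by (cases f)
  have i: "inj (\<lambda>v::'v. v)" by (simp add: inj_def)
  show ?thesis unfolding f(1) by (simp only: ratfun_rename_Fract[OF i f(2)] mpoly_rename_id)
qed

interpretation RV: vector_space "\<lambda>(c::'k::field) (v::('v, 'k) ratfun). ratfun_const c * v"
  by unfold_locales (simp_all add: ratfun_const_hom algebra_simps)

definition klin :: "(('v, 'k::field) ratfun \<Rightarrow> ('v, 'k) ratfun) \<Rightarrow> bool" where
  "klin f \<longleftrightarrow> (\<forall>x y. f (x + y) = f x + f y) \<and> (\<forall>c x. f (ratfun_const c * x) = ratfun_const c * f x)"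

lemma klin_add: "klin f \<Longrightarrow> f (x + y) = f x + f y" and klin_scale: "klin f \<Longrightarrow> f (ratfun_const c * x) = ratfun_const c * f x"
  by (simp_all add: klin_def)

lemma klin_0: "klin f \<Longrightarrow> f 0 = 0"
  unfolding klin_def by (metis mult_zero_left ratfun_const_hom(3))

lemma klin_span:
  assumes f: "klin f" and S: "\<And>s. s \<in> S \<Longrightarrow> f s \<in> RV.span T" and x: "x \<in> RV.span S"
  shows "f x \<in> RV.span T"
  using x
proof (induction rule: RV.span_induct_alt)
  case base then show ?case by (simp add: klin_0[OF f] RV.span_zero)
next
  case (step c s y)
  then show ?case using f S by (auto simp: klin_def intro: RV.span_add RV.span_scale)
qed

lemma span_subset_gen: "RV.span S \<subseteq> gen (KK \<union> S)"
proof
  fix x assume "x \<in> RV.span S"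
  then show "x \<in> gen (KK \<union> S)"
    by (induction rule: RV.span_induct_alt) (auto intro!: gen_intros intro: gen_base)
qed

lemma gen_span_eq: "RV.span S = RV.span T \<Longrightarrow> gen (KK \<union> S) = gen (KK \<union> T)"
  using span_subset_gen[of S] span_subset_gen[of T] RV.span_superset[of S] RV.span_superset[of T]
  by (intro gen_eqI) (auto intro: gen_base)

locale noether = group G for G (structure) +
  assumes fin: "finite (carrier G)"
begin

lemma left_translation_mult:
  "g \<in> carrier G \<Longrightarrow> h \<in> carrier G \<Longrightarrow> left_translation G g (left_translation G h v) = left_translation G (g \<otimes> h) v"
  by (simp add: left_translation_def m_assoc)

lemma act_mult:
  "g \<in> carrier G \<Longrightarrow> h \<in> carrier G \<Longrightarrow> group_act G (g \<otimes> h) x = group_act G g (group_act G h (x :: (_, 'k::field) ratfun))"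
  by (simp add: group_act_def ratfun_rename_comp inj_left_translation[OF is_group] left_translation_mult)

lemma act_one: "group_act G \<one> x = (x :: (_, 'k::field) ratfun)"
proof -
  have "left_translation G \<one> = (\<lambda>v. v)" by (auto simp: left_translation_def)
  then show ?thesis by (simp add: group_act_def ratfun_rename_id)
qed

lemma act_const: "g \<in> carrier G \<Longrightarrow> group_act G g (ratfun_const c) = (ratfun_const c :: (_, 'k::field) ratfun)"
  by (simp add: group_act_def ratfun_rename_const inj_left_translation[OF is_group])

lemma act_var: "g \<in> carrier G \<Longrightarrow> h \<in> carrier G \<Longrightarrow> group_act G g (ratfun_var h) = (ratfun_var (g \<otimes> h) :: (_, 'k::field) ratfun)"
  by (rule group_act_var[OF is_group])

lemma act_fhom: "g \<in> carrier G \<Longrightarrow> fhom (group_act G g :: (_, 'k::field) ratfun \<Rightarrow> _)"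
  unfolding fhom_def using act_const[of g 1]
  by (simp add: group_act_def ratfun_rename_add ratfun_rename_mult inj_left_translation[OF is_group] ratfun_const_hom)

lemma act_klin: "g \<in> carrier G \<Longrightarrow> klin (group_act G g :: (_, 'k::field) ratfun \<Rightarrow> _)"
  by (simp add: klin_def fhom_simps[OF act_fhom] act_const)

lemma act_pow: "g \<in> carrier G \<Longrightarrow> (group_act G g ^^ n) x = group_act G (g [^] (n::nat)) (x :: (_, 'k::field) ratfun)"
proof (induction n)
  case (Suc n)
  have "g [^] Suc n = g \<otimes> g [^] n" using Suc.prems by (metis nat_pow_Suc nat_pow_Suc2)
  then show ?case using Suc by (simp add: act_mult)
qed (simp add: act_one)

lemma act_inj:
  assumes "g \<in> carrier G" "h \<in> carrier G" "group_act G g (ratfun_var \<one>) = (group_act G h (ratfun_var \<one>) :: (_, 'k::field) ratfun)"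
  shows "g = h"
proof -
  have "ratfun_var g = (ratfun_var h :: (_, 'k) ratfun)"
    using assms act_var[of g \<one>, where 'k = 'k] act_var[of h \<one>, where 'k = 'k] by simp
  then show ?thesis by (rule injD[OF inj_ratfun_var])
qed

lemma autgrp_sub:
  assumes H: "subgroup H G" shows "autgrp (group_act G ` H :: ((_, 'k::field) ratfun \<Rightarrow> _) set)"
  unfolding autgrp_def
proof (intro conjI ballI)
  have HG: "H \<subseteq> carrier G" by (rule subgroup.subset[OF H])
  show "finite (group_act G ` H :: ((_, 'k) ratfun \<Rightarrow> _) set)" using HG fin by (simp add: finite_subset)
  show "id \<in> (group_act G ` H :: ((_, 'k) ratfun \<Rightarrow> _) set)"
    by (rule image_eqI[of _ _ \<one>]) (auto simp: act_one subgroup.one_closed[OF H])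
  fix g assume "g \<in> (group_act G ` H :: ((_, 'k) ratfun \<Rightarrow> _) set)"
  then obtain a where a: "g = group_act G a" "a \<in> H" by blast
  then show "fhom g" using HG act_fhom by blast
  fix h assume "h \<in> (group_act G ` H :: ((_, 'k) ratfun \<Rightarrow> _) set)"
  then obtain b where b: "h = group_act G b" "b \<in> H" by blast
  have "g \<circ> h = group_act G (a \<otimes> b)"
    unfolding a(1) b(1) using subsetD[OF HG a(2)] subsetD[OF HG b(2)] by (auto simp: act_mult fun_eq_iff)
  then show "g \<circ> h \<in> (group_act G ` H :: ((_, 'k) ratfun \<Rightarrow> _) set)"
    using subgroup.m_closed[OF H a(2) b(2)] by blast
qed

lemma card_autgrp_sub:
  assumes H: "subgroup H G" shows "card (group_act G ` H :: ((_, 'k::field) ratfun \<Rightarrow> _) set) = card H"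
proof (rule card_image, rule inj_onI)
  fix g h assume "g \<in> H" "h \<in> H" "group_act G g = (group_act G h :: (_, 'k) ratfun \<Rightarrow> _)"
  then show "g = h" using act_inj[of g h, where 'k = 'k] subgroup.subset[OF H] by auto
qed

abbreviation "GG \<equiv> group_act G ` carrier G"
abbreviation "XX \<equiv> ratfun_var ` carrier G"

lemma autgrp_GG: "autgrp (GG :: ((_, 'k::field) ratfun \<Rightarrow> _) set)"
  by (rule autgrp_sub[OF subgroup_self])

lemma noether_field_eq: "(noether_field G :: (_, 'k::field) ratfun set) = Fix GG (gen (KK \<union> XX))"
  by (auto simp: noether_field_def group_ratfuns_def Fix_def)

text \<open>If \<open>u\<close> depended on the rest of \<open>U\<close>, all
  \<open>card (carrier G)\<close> variables would be algebraic over fewer elements, against their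
  independence.\<close>

lemma gens_independent:
  fixes U :: "('a, 'k::field) ratfun set"
  assumes U: "finite U" "card U \<le> card (carrier G)" and al: "\<And>g. g \<in> carrier G \<Longrightarrow> alg_over (gen (KK \<union> U)) (ratfun_var g)" and u: "u \<in> U"
  shows "\<not> alg_over (gen (KK \<union> (U - {u}))) u"
proof
  assume a: "alg_over (gen (KK \<union> (U - {u}))) u"
  have "card (XX :: ('a, 'k) ratfun set) \<le> card (U - {u})"
  proof (rule steinitz[where K = KK])
    fix x assume "x \<in> (XX :: ('a, 'k) ratfun set)"
    then obtain g where g: "g \<in> carrier G" "x = ratfun_var g" by blast
    show "\<not> alg_over (gen (KK \<union> (XX - {x}))) x"
    proof
      assume "alg_over (gen (KK \<union> (XX - {x}))) x"
      then have "alg_over (gen (KK \<union> ratfun_var ` (- {g}))) x"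
        by (rule alg_over_mono) (use g in \<open>auto intro!: gen_mono\<close>)
      then show False using ratfun_var_independent[of g, where 'k = 'k] g by simp
    qed
    show "alg_over (gen (KK \<union> (U - {u}))) x"
    proof (rule alg_over_trans)
      show "alg_over (gen (KK \<union> U)) x" using al g by simp
      fix y assume "y \<in> gen (KK \<union> U)"
      moreover have "gen (KK \<union> U) \<subseteq> {y. alg_over (gen (KK \<union> (U - {u}))) y}"
      proof (rule gen_least)
        show "KK \<union> U \<subseteq> {y. alg_over (gen (KK \<union> (U - {u}))) y}"
        proof
          fix y assume "y \<in> KK \<union> U"
          then consider "y = u" | "y \<in> KK \<union> (U - {u})" by auto
          then show "y \<in> {y. alg_over (gen (KK \<union> (U - {u}))) y}"
          proof cases
            case 2
            show ?thesis by (rule CollectI, rule alg_over_self[OF gen_subfld gen_base[OF 2]])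
          qed (use a in simp)
        qed
      qed (simp add: subfld_alg_over)
      ultimately show "alg_over (gen (KK \<union> (U - {u}))) y" by blast
    qed simp
  qed (use U fin in auto)
  moreover have "card (XX :: ('a, 'k) ratfun set) = card (carrier G)"
    by (rule card_image) (use inj_ratfun_var in \<open>auto simp: inj_def inj_on_def\<close>)
  moreover have "card (U - {u}) < card U" using U(1) u by (rule card_Diff1_less)
  ultimately show False using U(2) by simp
qed

text \<open>The variables are algebraic over the fixed field, hence over \<open>U\<close>, and so
  the bound on \<open>card U\<close> forces algebraic independence.\<close>

lemma noether_rationalI:
  fixes U :: "('a, 'k::field) ratfun set"
  assumes U: "finite U" "card U \<le> card (carrier G)" and F: "Fix GG (gen (KK \<union> XX)) = gen (KK \<union> U)"
  shows "purely_transcendental KK (noether_field G :: ('a, 'k) ratfun set)"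
  unfolding purely_transcendental_def noether_field_eq
proof (intro exI[of _ U] conjI)
  show "U \<subseteq> Fix GG (gen (KK \<union> XX))" unfolding F by (auto intro: gen_base)
  have "alg_over (gen (KK \<union> U)) (ratfun_var g)" if "g \<in> carrier G" for g
    unfolding F[symmetric]
  proof (rule alg_over_Fix[OF autgrp_GG])
    fix h :: "('a, 'k) ratfun \<Rightarrow> ('a, 'k) ratfun" and x assume h: "h \<in> GG" and x: "x \<in> gen (KK \<union> (XX :: ('a, 'k) ratfun set))"
    then obtain a where a: "a \<in> carrier G" "h = group_act G a" by blast
    show "h x \<in> gen (KK \<union> XX)" unfolding a(2)
      by (rule fhom_gen[OF act_fhom[OF a(1)] _ x]) (use a in \<open>auto simp: act_const act_var intro: gen_base\<close>)
  qed (use that in \<open>auto intro: gen_base\<close>)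
  then show "alg_independent KK U"
    using gens_independent[OF U] by (intro alg_independentI[OF U(1)]) auto
qed (rule F)

end

text \<open>Horner's scheme for \<open>P(f) v\<close>. It makes the space a module over univariate
  polynomials, where identities between operators can be read off.\<close>

definition kact :: "(('v, 'k::field) ratfun \<Rightarrow> ('v, 'k) ratfun) \<Rightarrow> 'k poly \<Rightarrow> ('v, 'k) ratfun \<Rightarrow> ('v, 'k) ratfun" where
  "kact f P v = fold_coeffs (\<lambda>c w. ratfun_const c * v + f w) P 0"

context
  fixes f :: "('v, 'k::field) ratfun \<Rightarrow> ('v, 'k) ratfun" assumes f: "klin f"
begin

lemma kact_0 [simp]: "kact f 0 v = 0"
  by (simp add: kact_def)

lemma kact_pCons [simp]: "kact f (pCons c P) v = ratfun_const c * v + f (kact f P v)"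
proof (cases "c = 0 \<and> P = 0")
  case True then show ?thesis by (simp add: klin_0[OF f] ratfun_const_hom)
next
  case False then show ?thesis
    by (cases "c = 0") (simp_all add: kact_def fold_coeffs_pCons_coeff_not_0_eq fold_coeffs_pCons_not_0_0_eq)
qed

lemma kact_add: "kact f (P + Q) v = kact f P v + kact f Q v"
proof (induction P Q rule: poly_induct2)
  case 0
  show ?case by (simp only: kact_0 add_0)
next
  case (pCons a p b q)
  show ?case
    unfolding add_pCons kact_pCons pCons.IH klin_add[OF f] ratfun_const_hom(1) distrib_right by (simp only: add_ac)
qed

lemma kact_smult: "kact f (Polynomial.smult c P) v = ratfun_const c * kact f P v"
proof (induction P)
  case 0
  show ?case by (simp only: smult_0_right kact_0 mult_zero_right)
next
  case (pCons a P)
  show ?case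
    unfolding smult_pCons kact_pCons pCons.IH klin_scale[OF f] ratfun_const_hom(2) distrib_left by (simp only: mult.assoc)
qed

lemma kact_mult: "kact f (P * Q) v = kact f P (kact f Q v)"
proof (induction P)
  case 0
  show ?case by (simp only: mult_zero_left kact_0)
next
  case (pCons a P)
  show ?case
    unfolding mult_pCons_left kact_add kact_smult kact_pCons pCons.IH ratfun_const_hom(3) by (simp only: mult_zero_left add_0)
qed

lemma kact_1: "kact f 1 v = v"
  unfolding one_pCons kact_pCons kact_0 klin_0[OF f] ratfun_const_hom(4) by (simp only: mult_1_left add_0_right)

lemma kact_monom: "kact f (Polynomial.monom 1 n) v = (f ^^ n) v"
proof (induction n)
  case 0
  show ?case by (simp only: monom_0 one_pCons[symmetric] kact_1 funpow_0)
next
  case (Suc n)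
  show ?case
    unfolding monom_Suc kact_pCons Suc.IH ratfun_const_hom(3) by (simp only: mult_zero_left add_0 funpow.simps comp_apply)
qed

text \<open>In characteristic \<open>p\<close> one has
  \<open>(X - 1)^(p^m) = X^(p^m) - 1\<close>.\<close>

lemma unipotent_nilpotent:
  assumes p: "Factorial_Ring.prime p" "CHAR('k) = p" and v: "(f ^^ (p ^ m)) v = v"
  shows "((\<lambda>w. f w - w) ^^ (p ^ m)) v = 0"
proof -
  have ch: "CHAR('k poly) = p"
  proof (rule CHAR_eqI)
    show "of_nat p = (0 :: 'k poly)" using p(2) by (auto simp: of_nat_poly)
    fix x assume "of_nat x = (0 :: 'k poly)"
    then show "p dvd x" using p by (simp add: of_nat_poly of_nat_eq_0_iff_char_dvd)
  qed
  have mo: "([:-1, 1:] :: 'k poly) ^ (p ^ m) = Polynomial.monom 1 (p ^ m) - 1"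
  proof -
    have "([:0, 1:] :: 'k poly) ^ (p ^ m) = ([:-1, 1:] + 1) ^ (p ^ m)" by (simp add: one_pCons)
    also have "\<dots> = [:-1, 1:] ^ (p ^ m) + 1 ^ (p ^ m)"
      by (rule freshmans_dream') (use p ch in auto)
    finally show ?thesis by (simp add: monom_altdef)
  qed
  have "kact f ([:-1, 1:] ^ n) v = ((\<lambda>w. f w - w) ^^ n) v" for n
  proof (induction n)
    case 0 then show ?case by (simp add: one_pCons klin_0[OF f] ratfun_const_hom)
  next
    case (Suc n)
    have "kact f ([:-1, 1:] ^ Suc n) v = kact f [:-1, 1:] (kact f ([:-1, 1:] ^ n) v)"
      unfolding power_Suc by (rule kact_mult)
    then show ?case using Suc by (simp add: klin_0[OF f] ratfun_const_hom ratfun_const_uminus)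
  qed
  moreover have "kact f (Polynomial.monom 1 (p ^ m) - 1) v = 0"
  proof -
    have e: "Polynomial.monom (1::'k) (p ^ m) - 1 = Polynomial.monom 1 (p ^ m) + [:-1:]" by (simp add: one_pCons)
    show ?thesis
      unfolding e kact_add kact_monom v kact_pCons kact_0 klin_0[OF f] ratfun_const_uminus ratfun_const_hom(4) by simp
  qed
  ultimately show ?thesis using mo by metis
qed

end

lemma last_outside:
  assumes v: "v \<in> S" "v \<notin> W" and N: "(N ^^ n) v \<in> W" and S: "\<And>w. w \<in> S \<Longrightarrow> N w \<in> S"
  shows "\<exists>w\<in>S. w \<notin> W \<and> N w \<in> W"
  using v N
proof (induction n arbitrary: v)
  case (Suc n)
  show ?case
  proof (cases "N v \<in> W")
    case False
    then show ?thesis using Suc.IH[of "N v"] Suc.prems S by (simp add: funpow_swap1)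
  qed (use Suc.prems in blast)
qed simp

section \<open>Groups with a cyclic commutator: characteristic \<open>p\<close>\<close>

locale cyclic_commutator = noether +
  fixes \<sigma> \<tau> \<theta> :: 'a and k :: int and p m \<nu> :: nat
  assumes mem [simp]: "\<sigma> \<in> carrier G" "\<tau> \<in> carrier G" "\<theta> \<in> carrier G"
    and gens: "generate G {\<sigma>, \<tau>} = carrier G"
    and comm_st: "\<sigma> \<otimes> \<tau> = \<tau> \<otimes> \<sigma> \<otimes> \<theta>"
    and comm_s\<theta>: "\<sigma> \<otimes> \<theta> = \<theta> \<otimes> \<sigma>"
    and conj_\<theta>: "\<theta> \<otimes> \<tau> = \<tau> \<otimes> \<theta> [^] k"
    and p: "Factorial_Ring.prime p" and card: "card (carrier G) = p ^ \<nu>"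
    and exponent: "g \<in> carrier G \<Longrightarrow> g [^] (p ^ m) = \<one>"
begin

text \<open>The finite exponent makes inverses into powers, so the induction has no case for
  them.\<close>

lemma gen_induct [consumes 1, case_names one mult s t]:
  assumes g: "g \<in> carrier G" and 1: "Q \<one>" "\<And>g h. g \<in> carrier G \<Longrightarrow> h \<in> carrier G \<Longrightarrow> Q g \<Longrightarrow> Q h \<Longrightarrow> Q (g \<otimes> h)" "Q \<sigma>" "Q \<tau>"
  shows "Q g"
proof -
  have sub: "generate G {\<sigma>, \<tau>} \<subseteq> carrier G" using gens by simp
  have "g \<in> generate G {\<sigma>, \<tau>}" using g gens by simp
  then show ?thesis
  proof (induction rule: generate.induct)
    case one then show ?case by (rule 1)
  next
    case (incl h) then show ?case using 1 by auto
  next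
    case (inv h)
    then have h: "h \<in> carrier G" "Q h" using 1 by auto
    have pow: "Q (h [^] (n::nat))" for n
      by (induction n) (use h 1 in auto)
    have pm: "p ^ m > 0" using p by (simp add: prime_gt_0_nat)
    have "h [^] (p ^ m - 1) \<otimes> h = \<one>"
      using exponent[OF h(1)] pm by (metis Suc_diff_1 nat_pow_Suc)
    then have "inv h = h [^] (p ^ m - 1)" using h by (intro inv_equality) auto
    then show ?case using pow by simp
  next
    case (eng h1 h2) then show ?case using 1 sub by auto
  qed
qed

lemma act_fix_all:
  assumes "group_act G \<sigma> x = (x :: ('a, 'k::field) ratfun)" "group_act G \<tau> x = x" "g \<in> carrier G"
  shows "group_act G g x = x"
  using assms(3) by (induction rule: gen_induct) (simp_all add: act_one act_mult assms)

lemma V_stable: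
  assumes "g \<in> carrier G" "x \<in> RV.span (XX :: ('a, 'k::field) ratfun set)" shows "group_act G g x \<in> RV.span XX"
  by (rule klin_span[OF act_klin[OF assms(1)] _ assms(2)]) (use assms(1) in \<open>auto simp: act_var intro: RV.span_base\<close>)

text \<open>A vector fixed modulo \<open>W\<close> is found for \<open>\<theta>\<close>, then for
  \<open>\<sigma>\<close>, then for \<open>\<tau>\<close>, each time as the last iterate of a
  nilpotent operator outside \<open>W\<close>. The order matters: \<open>\<sigma>\<close> commutes
  with \<open>\<theta>\<close> and so preserves the vectors fixed by \<open>\<theta>\<close> modulo
  \<open>W\<close>, while \<open>\<tau>\<close> is only known to preserve those fixed by both, as
  \<open>\<sigma>\<tau> = \<tau>\<sigma>\<theta>\<close>.\<close>

lemma unipotent_step: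
  fixes v :: "('a, 'k::field) ratfun"
  assumes ch: "CHAR('k) = p" and W: "RV.subspace W" and Wst: "\<And>g w. g \<in> carrier G \<Longrightarrow> w \<in> W \<Longrightarrow> group_act G g w \<in> W"
    and v: "v \<in> RV.span XX" "v \<notin> W"
  shows "\<exists>w\<in>RV.span XX. w \<notin> W \<and> (\<forall>g\<in>carrier G. group_act G g w - w \<in> W)"
proof -
  define N where "N a w = group_act G a w - w" for a and w :: "('a, 'k) ratfun"
  define Z where "Z = RV.span (XX :: ('a, 'k) ratfun set)"
  note W0 = RV.subspace_0[OF W]
  have nil: "(N a ^^ (p ^ m)) w = 0" if "a \<in> carrier G" for a w
  proof -
    have "(group_act G a ^^ (p ^ m)) w = w" by (simp only: act_pow[OF that] exponent[OF that] act_one)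
    from unipotent_nilpotent[OF act_klin[OF that] p ch this] show ?thesis unfolding N_def .
  qed
  have NZ: "N a w \<in> Z" if "a \<in> carrier G" "w \<in> Z" for a w
    using that V_stable unfolding N_def Z_def by (intro RV.span_diff) auto
  have NW: "N a w \<in> W" if "a \<in> carrier G" "w \<in> W" for a w
    using that Wst unfolding N_def by (intro RV.subspace_diff[OF W]) auto
  have Nd: "N a (x - y) = N a x - N a y" if "a \<in> carrier G" for a x y
    by (simp add: N_def fhom_diff[OF act_fhom[OF that]])
  have "(N \<theta> ^^ (p ^ m)) v \<in> W" using nil W0 by simp
  then obtain w1 where w1: "w1 \<in> Z" "w1 \<notin> W" "N \<theta> w1 \<in> W"
    using last_outside[where v = v and S = Z and W = W and N = "N \<theta>" and n = "p ^ m"] v NZ[OF mem(3)] by (auto simp: Z_def)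
  define S1 where "S1 = {w \<in> Z. N \<theta> w \<in> W}"
  have s1: "N \<sigma> w \<in> S1" if w: "w \<in> S1" for w
  proof -
    have "N \<theta> (N \<sigma> w) = N \<sigma> (N \<theta> w)"
      using comm_s\<theta> by (simp add: N_def fhom_diff[OF act_fhom] act_mult[symmetric])
    then show ?thesis using w NZ[OF mem(1)] NW[OF mem(1)] by (simp add: S1_def)
  qed
  have "(N \<sigma> ^^ (p ^ m)) w1 \<in> W" using nil W0 by simp
  then obtain w2 where w2: "w2 \<in> S1" "w2 \<notin> W" "N \<sigma> w2 \<in> W"
    using last_outside[where v = w1 and S = S1 and W = W and N = "N \<sigma>" and n = "p ^ m"] w1 s1 by (auto simp: S1_def)
  define S2 where "S2 = {w \<in> S1. N \<sigma> w \<in> W}"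
  have modW: "x - y \<in> W \<Longrightarrow> y - z \<in> W \<Longrightarrow> x - z \<in> W" for x y z
    using RV.subspace_add[OF W, of "x - y" "y - z"] by simp
  have actW: "x - y \<in> W \<Longrightarrow> g \<in> carrier G \<Longrightarrow> group_act G g x - group_act G g y \<in> W" for x y g
    using Wst[of g "x - y"] by (simp add: fhom_diff[OF act_fhom])
  have \<theta>k: "group_act G (\<theta> [^] i) w - w \<in> W" if "N \<theta> w \<in> W" for i :: int and w
  proof -
    have nat: "group_act G (\<theta> [^] n) w - w \<in> W" for n :: nat
    proof (induction n)
      case 0 then show ?case using W0 by (simp add: act_one)
    next
      case (Suc n)
      have "group_act G (\<theta> [^] Suc n) w = group_act G (\<theta> [^] n) (group_act G \<theta> w)" by (simp add: act_mult)
      then show ?case using actW[of "group_act G \<theta> w" w "\<theta> [^] n"] that Suc modW by (simp add: N_def)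
    qed
    have pm: "int (p ^ m) > 0" using p by (simp add: prime_gt_0_nat)
    have "\<theta> [^] i = \<theta> [^] (i mod int (p ^ m))"
    proof -
      have "\<theta> [^] i = \<theta> [^] (int (p ^ m) * (i div int (p ^ m)) + i mod int (p ^ m))" by simp
      also have "\<dots> = (\<theta> [^] int (p ^ m)) [^] (i div int (p ^ m)) \<otimes> \<theta> [^] (i mod int (p ^ m))"
        by (simp only: int_pow_mult[OF mem(3)] int_pow_pow[OF mem(3)])
      also have "\<theta> [^] int (p ^ m) = \<one>" using exponent[OF mem(3)] by (simp only: int_pow_int)
      finally show ?thesis by simp
    qed
    also have "\<dots> = \<theta> [^] nat (i mod int (p ^ m))" using pm by (metis int_pow_int nat_0_le pos_mod_sign)
    finally show ?thesis using nat by simp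
  qed
  have s2: "N \<tau> w \<in> S2" if w: "w \<in> S2" for w
  proof -
    have wZ: "w \<in> Z" "N \<theta> w \<in> W" "N \<sigma> w \<in> W" using w by (auto simp: S2_def S1_def)
    have "group_act G \<theta> (group_act G \<tau> w) - group_act G \<tau> w \<in> W"
      using actW[OF \<theta>k[OF wZ(2), of k] mem(2)] by (simp add: act_mult[symmetric] conj_\<theta>)
    then have 1: "N \<theta> (N \<tau> w) \<in> W"
      using RV.subspace_diff[OF W _ wZ(2)] Nd[OF mem(3)] by (simp add: N_def[of \<tau>]) (simp add: N_def)
    have "group_act G \<sigma> (group_act G \<tau> w) = group_act G \<tau> (group_act G \<sigma> (group_act G \<theta> w))"
      by (simp add: act_mult[symmetric] comm_st m_assoc)
    moreover have "group_act G \<sigma> (group_act G \<theta> w) - w \<in> W"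
      using modW[OF actW[of "group_act G \<theta> w" w \<sigma>], of w] wZ(2,3) by (simp add: N_def)
    ultimately have "group_act G \<sigma> (group_act G \<tau> w) - group_act G \<tau> w \<in> W" using actW mem(2) by metis
    then have 2: "N \<sigma> (N \<tau> w) \<in> W"
      using RV.subspace_diff[OF W _ wZ(3)] Nd[OF mem(1)] by (simp add: N_def[of \<tau>]) (simp add: N_def)
    show ?thesis using 1 2 NZ[OF mem(2) wZ(1)] by (simp add: S2_def S1_def)
  qed
  have "(N \<tau> ^^ (p ^ m)) w2 \<in> W" using nil W0 by simp
  then obtain w where w: "w \<in> S2" "w \<notin> W" "N \<tau> w \<in> W"
    using last_outside[where v = w2 and S = S2 and W = W and N = "N \<tau>" and n = "p ^ m"] w2 s2 by (auto simp: S2_def)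
  have "group_act G g w - w \<in> W" if "g \<in> carrier G" for g
    using that
  proof (induction rule: gen_induct)
    case one then show ?case using W0 by (simp add: act_one)
  next
    case (mult g h)
    then show ?case using modW[OF actW[of "group_act G h w" w g]] by (simp add: act_mult)
  qed (use w in \<open>auto simp: S2_def N_def\<close>)
  then show ?thesis using w by (auto simp: S2_def S1_def Z_def)
qed

theorem rational_char_p:
  assumes ch: "CHAR('k::field) = p"
  shows "purely_transcendental KK (noether_field G :: ('a, 'k) ratfun set)"
proof -
  let ?X = "XX :: ('a, 'k) ratfun set"
  let ?GG = "GG :: (('a, 'k) ratfun \<Rightarrow> ('a, 'k) ratfun) set"
  have finX: "finite ?X" using fin by simp
  have cX: "card ?X \<le> card (carrier G)" using fin by (rule card_image_le)
  have indep_card: "finite S \<and> card S \<le> card (carrier G)" if "RV.independent S" "S \<subseteq> RV.span ?X" for S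
    using RV.independent_span_bound[OF finX that] cX by auto
  have "\<exists>S. RV.independent S \<and> S \<subseteq> RV.span ?X \<and> card S = j \<and> (\<forall>g\<in>carrier G. \<forall>w\<in>RV.span S. group_act G g w \<in> RV.span S) \<and>
      (\<exists>U. finite U \<and> card U \<le> j \<and> Fix ?GG (gen (KK \<union> S)) = gen (KK \<union> U))" if "j \<le> RV.dim ?X" for j
    using that
  proof (induction j)
    case 0
    have "Fix ?GG (gen KK) = gen KK"
      unfolding gen_self[OF subfld_KK] Fix_def using act_const by fastforce
    then have a: "\<exists>U. finite U \<and> card U \<le> 0 \<and> Fix ?GG (gen (KK \<union> {})) = gen (KK \<union> U)"
      by (intro exI[of _ "{}"] conjI) simp_all
    have b: "\<forall>g\<in>carrier G. \<forall>w\<in>RV.span {}. group_act G g w \<in> RV.span ({} :: ('a, 'k) ratfun set)"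
      by (simp add: klin_0[OF act_klin])
    show ?case
      by (rule exI[of _ "{}"], intro conjI, simp add: RV.independent_empty, simp, simp, rule b, rule a)
  next
    case (Suc j)
    then obtain S U where S: "RV.independent S" "S \<subseteq> RV.span ?X" "card S = j"
      "\<forall>g\<in>carrier G. \<forall>w\<in>RV.span S. group_act G g w \<in> RV.span S"
      "finite U" "card U \<le> j" "Fix ?GG (gen (KK \<union> S)) = gen (KK \<union> U)" by auto
    have finS: "finite S" using indep_card S by blast
    have "\<exists>v\<in>RV.span ?X. v \<notin> RV.span S"
    proof (rule ccontr)
      assume "\<not> ?thesis"
      then have "RV.span S = RV.span ?X" using S(2) by (metis RV.span_mono RV.span_span subsetI subset_antisym)
      then have "RV.dim ?X = card S" using S(1) RV.dim_eq_card by metis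
      then show False using S(3) Suc.prems by simp
    qed
    then obtain v where v: "v \<in> RV.span ?X" "v \<notin> RV.span S" by blast
    obtain w where w: "w \<in> RV.span ?X" "w \<notin> RV.span S" "\<forall>g\<in>carrier G. group_act G g w - w \<in> RV.span S"
      using unipotent_step[OF ch RV.subspace_span _ v] S(4) by blast
    define S' where "S' = insert w S"
    have wS: "w \<notin> S" using w(2) RV.span_base by blast
    have S'i: "RV.independent S'" unfolding S'_def by (rule RV.independent_insertI[OF w(2) S(1)])
    have S'X: "S' \<subseteq> RV.span ?X" using S(2) w(1) by (simp add: S'_def)
    obtain B where B: "S' \<subseteq> B" "B \<subseteq> RV.span ?X" "RV.independent B" "RV.span ?X \<subseteq> RV.span B"
      using RV.maximal_independent_subset_extend[OF S'X S'i] by blast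
    have spB: "RV.span B = RV.span ?X"
      using B(2,4) by (metis RV.span_mono RV.span_span subset_antisym)
    have gB: "gen (KK \<union> B) = gen (KK \<union> ?X)" by (rule gen_span_eq[OF spB])
    have cB: "finite B" "card B \<le> card (carrier G)" using indep_card B by auto
    \<comment> \<open>A basis of the space containing \<open>w\<close> generates the whole field and
      has at most \<open>card (carrier G)\<close> elements, so none of them is algebraic over the
      others.\<close>
    have "\<not> alg_over (gen (KK \<union> (B - {w}))) w"
    proof (rule gens_independent[OF cB])
      fix g assume "g \<in> carrier G"
      then have "ratfun_var g \<in> gen (KK \<union> B)" unfolding gB by (intro gen_base) auto
      then show "alg_over (gen (KK \<union> B)) (ratfun_var g)" by (intro alg_over_self) simp_all
    qed (use B S'_def in auto)
    then have ntr: "\<not> alg_over (gen (KK \<union> S)) w"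
    proof (rule contrapos_nn)
      assume "alg_over (gen (KK \<union> S)) w"
      then show "alg_over (gen (KK \<union> (B - {w}))) w"
        by (rule alg_over_mono) (use B(1) wS in \<open>auto simp: S'_def intro!: gen_mono\<close>)
    qed
    have stE: "h y \<in> gen (KK \<union> S)" if h: "h \<in> ?GG" and y: "y \<in> gen (KK \<union> S)" for h y
    proof -
      obtain g where g: "g \<in> carrier G" "h = group_act G g" using h by blast
      have "group_act G g x \<in> gen (KK \<union> S)" if "x \<in> KK \<union> S" for x
      proof (cases "x \<in> KK")
        case True then show ?thesis using g by (auto simp: act_const intro: gen_base)
      next
        case False
        then have "group_act G g x \<in> RV.span S" using that S(4) g RV.span_base by blast
        then show ?thesis using span_subset_gen by blast
      qed
      then show ?thesis unfolding g(2) by (rule fhom_gen[OF act_fhom[OF g(1)] _ y])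
    qed
    have "h w - w \<in> gen (KK \<union> S)" if "h \<in> ?GG" for h
      using that w(3) span_subset_gen by blast
    then have "\<exists>f. Fix ?GG (gen (insert w (gen (KK \<union> S)))) = gen (insert f (Fix ?GG (gen (KK \<union> S))))"
      using stE by (intro Fix_gen_unipotent[OF autgrp_GG gen_subfld _ _ ntr])
    then obtain f where f: "Fix ?GG (gen (insert w (gen (KK \<union> S)))) = gen (insert f (Fix ?GG (gen (KK \<union> S))))" by blast
    have e1: "gen (insert w (gen (KK \<union> S))) = gen (KK \<union> S')"
      using gen_gen_Un[of "KK \<union> S" "{w}"] by (simp add: S'_def)
    have e2: "gen (insert f (gen (KK \<union> U))) = gen (KK \<union> insert f U)"
      using gen_gen_Un[of "KK \<union> U" "{f}"] by simp
    have "Fix ?GG (gen (KK \<union> S')) = gen (KK \<union> insert f U)"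
      using f unfolding e1 S(7) e2 .
    moreover have "card (insert f U) \<le> Suc j" using card_insert_le_m1[of "Suc j" U f] S(6) by simp
    moreover have "card S' = Suc j" using S(3) finS wS by (simp add: S'_def)
    moreover have "group_act G g x \<in> RV.span S'" if g: "g \<in> carrier G" and x: "x \<in> RV.span S'" for g x
    proof (rule klin_span[OF act_klin[OF g] _ x])
      fix s assume "s \<in> S'"
      have mono: "RV.span S \<subseteq> RV.span S'" by (rule RV.span_mono) (auto simp: S'_def)
      show "group_act G g s \<in> RV.span S'"
      proof (cases "s = w")
        case True
        have "group_act G g w - w \<in> RV.span S'" using w(3) g mono by blast
        moreover have "w \<in> RV.span S'" by (rule RV.span_base) (simp add: S'_def)
        ultimately have "(group_act G g w - w) + w \<in> RV.span S'" by (rule RV.span_add)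
        then show ?thesis using True by simp
      next
        case False
        then have "s \<in> S" using \<open>s \<in> S'\<close> by (simp add: S'_def)
        then show ?thesis using S(4) g mono RV.span_base by blast
      qed
    qed
    ultimately show ?case using S'i S'X S(5) by (intro exI[of _ S']) (auto intro!: exI[of _ "insert f U"])
  qed
  from this[of "RV.dim ?X"] obtain S U where S: "RV.independent S" "S \<subseteq> RV.span ?X" "card S = RV.dim ?X"
    "finite U" "card U \<le> RV.dim ?X" "Fix ?GG (gen (KK \<union> S)) = gen (KK \<union> U)" by blast
  obtain B where B: "S \<subseteq> B" "B \<subseteq> RV.span ?X" "RV.independent B" "RV.span ?X \<subseteq> RV.span B"
    using RV.maximal_independent_subset_extend[OF S(2,1)] by blast
  have spB: "RV.span B = RV.span ?X"
    using B(2,4) by (metis RV.span_mono RV.span_span subset_antisym)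
  have cB: "finite B" "card B \<le> card (carrier G)" using indep_card B by auto
  have dB: "card B = RV.dim ?X" using RV.dim_eq_card[OF spB B(3)] by simp
  have "S = B" using B(1) cB(1) dB S(3) by (metis card_subset_eq)
  then have "gen (KK \<union> S) = gen (KK \<union> ?X)" using gen_span_eq[OF spB] by simp
  then have F: "Fix ?GG (gen (KK \<union> ?X)) = gen (KK \<union> U)" using S(6) by simp
  have "card U \<le> card (carrier G)" using S(5) cB(2) dB by simp
  from noether_rationalI[OF S(4) this F] show ?thesis .
qed

end

section \<open>Eigenvectors away from characteristic \<open>p\<close>\<close>

lemma prim_root_exists:
  fixes z :: "'a::field"
  assumes "z ^ n = 1" "n > 0" shows "\<exists>r. prim_root z r"
proof -
  define r where "r = (LEAST r. r > 0 \<and> z ^ r = 1)"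
  have "r > 0 \<and> z ^ r = 1" unfolding r_def by (rule LeastI[of _ n]) (use assms in auto)
  moreover have "z ^ j \<noteq> 1" if "0 < j" "j < r" for j
    using not_less_Least[OF that(2)[unfolded r_def]] that(1) by auto
  ultimately show ?thesis unfolding primitive_root_of_unity_def by blast
qed

lemma prim_root_dvd: "prim_root z r \<Longrightarrow> z ^ j = 1 \<longleftrightarrow> r dvd j"
proof
  assume r: "prim_root z r"
  { assume "r dvd j" then show "z ^ j = 1" using r by (auto simp: primitive_root_of_unity_def power_mult dvd_def) }
  assume z: "z ^ j = 1"
  have "z ^ j = z ^ (r * (j div r) + j mod r)" by simp
  also have "\<dots> = (z ^ r) ^ (j div r) * z ^ (j mod r)" by (simp only: power_add power_mult)
  finally have "z ^ (j mod r) = 1" using z r by (simp add: primitive_root_of_unity_def)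
  moreover have "j mod r < r" using r by (simp add: primitive_root_of_unity_def)
  ultimately show "r dvd j" using r unfolding primitive_root_of_unity_def by (metis gr0I mod_eq_0_iff_dvd)
qed

lemma prim_root_primepow:
  fixes z :: "'a::field"
  assumes p: "Factorial_Ring.prime (p::nat)" and "z ^ (p ^ e) = 1" "z ^ (p ^ f) \<noteq> 1"
  shows "\<exists>i. prim_root z (p ^ i) \<and> i > f"
proof -
  have "p ^ e > 0" using p by (simp add: prime_gt_0_nat)
  then obtain r where r: "prim_root z r" using prim_root_exists assms(2) by blast
  have "r dvd p ^ e" using prim_root_dvd[OF r] assms(2) by simp
  then obtain i where i: "r = p ^ i" using p by (auto simp: divides_primepow_nat)
  have "\<not> p ^ i dvd p ^ f" using prim_root_dvd[OF r] assms(3) i by simp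
  then have "i > f" using le_imp_power_dvd linorder_not_le by blast
  then show ?thesis using r i by blast
qed

lemma ratfun_const_eq_1_iff: "ratfun_const a = (1 :: ('v, 'k::field) ratfun) \<longleftrightarrow> a = 1"
proof -
  have "ratfun_const (a + - 1) = (ratfun_const a + - 1 :: ('v, 'k) ratfun)"
    by (simp only: ratfun_const_hom(1,4) ratfun_const_uminus)
  then show ?thesis using ratfun_const_eq_0_iff[of "a + - 1", where 'v = 'v] by simp
qed

lemma (in group) conj_hom: "t \<in> carrier G \<Longrightarrow> (\<lambda>g. inv t \<otimes> g \<otimes> t) \<in> hom G G"
  by (auto simp: hom_def m_assoc) (simp add: m_assoc[symmetric])

lemma (in group) int_pow_swap:
  fixes i k :: int
  assumes q: "q \<in> carrier G" and t: "t \<in> carrier G" and swap: "q \<otimes> t = t \<otimes> q [^] k"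
  shows "q [^] i \<otimes> t = t \<otimes> q [^] (k * i)"
proof -
  interpret c: group_hom G G "\<lambda>g. inv t \<otimes> g \<otimes> t" by unfold_locales (rule conj_hom[OF t])
  have "inv t \<otimes> q \<otimes> t = q [^] k" using q t swap by (simp add: m_assoc inv_solve_left')
  then have "inv t \<otimes> q [^] i \<otimes> t = q [^] (k * i)" using c.hom_int_pow[OF q, of i] int_pow_pow[OF q] by simp
  then have "t \<otimes> (inv t \<otimes> q [^] i \<otimes> t) = t \<otimes> q [^] (k * i)" by simp
  then show ?thesis using q t by (simp add: m_assoc[symmetric])
qed

lemma (in group) int_pow_swap_pow:
  fixes i k :: int
  assumes q: "q \<in> carrier G" and t: "t \<in> carrier G" and swap: "q \<otimes> t = t \<otimes> q [^] k"
  shows "q [^] i \<otimes> t [^] (j::nat) = t [^] j \<otimes> q [^] (k ^ j * i)"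
proof (induction j)
  case 0 then show ?case using q by simp
next
  case (Suc j)
  have "q [^] i \<otimes> t [^] Suc j = t [^] j \<otimes> (q [^] (k ^ j * i) \<otimes> t)"
    using Suc q t by (simp add: m_assoc[symmetric])
  also have "\<dots> = t [^] Suc j \<otimes> q [^] (k ^ Suc j * i)"
    unfolding int_pow_swap[OF assms] using q t by (simp add: m_assoc mult.assoc)
  finally show ?case .
qed

locale tame = cyclic_commutator +
  fixes z0 :: "'k::field" and d D :: nat
  assumes z0: "prim_root z0 (p ^ m)" and p0: "of_nat p \<noteq> (0::'k)"
    and ord_\<theta>: "\<theta> [^] (i::int) = \<one> \<longleftrightarrow> int (p ^ d) dvd i" and d0: "d > 0"
    and pk: "int p dvd k - 1" and good: "chain_good p k (Suc D) (int p ^ d)"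
begin

abbreviation act :: "'a \<Rightarrow> ('a, 'k) ratfun \<Rightarrow> ('a, 'k) ratfun" where "act \<equiv> group_act G"
abbreviation KF :: "('a, 'k) ratfun set" where "KF \<equiv> KK"
abbreviation Vg :: "('a, 'k) ratfun set" where "Vg \<equiv> XX"
definition "M = p ^ m"
definition "n' = p ^ D"
definition "n = p ^ Suc D"
definition z :: "('a, 'k) ratfun" where "z = ratfun_const z0"

lemma pp: "p > 1" using p by (rule prime_gt_1_nat)
lemma Mpos: "M > 0" using pp by (simp add: M_def)
lemma npos: "n > 0" "n' > 0" "n = p * n'" "n' < n" using pp by (auto simp: n_def n'_def)

lemma l_p0: "of_nat p \<noteq> (0 :: ('a, 'k) ratfun)"
  using p0 ratfun_const_of_nat[of p] ratfun_const_eq_0_iff by metis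
lemma M0: "of_nat M \<noteq> (0 :: ('a, 'k) ratfun)" using l_p0 by (simp add: M_def)
lemma zK: "z \<in> KF" by (simp add: z_def)
lemma z: "prim_root z M"
  using z0 unfolding primitive_root_of_unity_def z_def ratfun_const_power[symmetric] M_def
  by (simp add: ratfun_const_eq_1_iff)
lemma zM: "z ^ M = 1" "(z ^ i) ^ M = 1" using z by (auto simp: primitive_root_of_unity_def power_mult[symmetric] mult.commute[of i]) (simp add: power_mult)
lemma exponent': "g \<in> carrier G \<Longrightarrow> g [^] M = \<one>" using exponent by (simp add: M_def)

lemma act_K: "g \<in> carrier G \<Longrightarrow> c \<in> KF \<Longrightarrow> act g c = c" by (auto simp: act_const)
lemmas fh = act_fhom[where 'k = 'k]
lemma act_pow_eigen:
  assumes "a \<in> carrier G" "c \<in> KF" "act a v = c * v" shows "act (a [^] (j::nat)) v = c ^ j * v"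
proof (induction j)
  case (Suc j)
  have "act (a [^] Suc j) v = act (a [^] j) (act a v)" using assms by (simp add: act_mult)
  then show ?case using assms Suc by (simp add: fhom_mult[OF fh] act_K)
qed (simp add: act_one)

text \<open>\<open>M\<close> times the projection to the eigenspace of \<open>a\<close> for the
  eigenvalue \<open>c\<close>, where \<open>c^M = 1\<close>.\<close>

definition "pr a c v = (\<Sum>l<M. act (a [^] l) v / c ^ l)" for a :: 'a and c v :: "('a, 'k) ratfun"

lemma pr_eigen:
  assumes a: "a \<in> carrier G" and c: "c \<in> KF" "c ^ M = 1" shows "act a (pr a c v) = c * pr a c v"
proof -
  have c0: "c \<noteq> 0" using c(2) Mpos by (auto simp: power_0_left)
  define g where "g l = act (a [^] l) v / c ^ l" for l :: nat
  have gM: "g M = g 0" using c by (simp add: g_def exponent'[OF a] act_one)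
  have "act a (g l) = c * g (Suc l)" for l
  proof -
    have "a [^] Suc l = a \<otimes> a [^] l" using a by (metis nat_pow_Suc2)
    then show ?thesis using a c c0 by (simp add: g_def fhom_simps[OF fh] act_K act_mult)
  qed
  then have "act a (\<Sum>l<M. g l) = c * (\<Sum>l<M. g (Suc l))"
    using a by (simp add: fhom_sum[OF fh] sum_distrib_left)
  also have "(\<Sum>l<M. g (Suc l)) = (\<Sum>l<M. g l)"
    using sum.lessThan_Suc_shift[of g M] sum.lessThan_Suc[of g M] gM by simp
  finally show ?thesis by (simp add: pr_def g_def)
qed

lemma pr_commute:
  assumes a: "a \<in> carrier G" "b \<in> carrier G" and c: "c \<in> KF" and ab: "\<And>l. act b (act (a [^] (l::nat)) v) = act (a [^] l) (act b v)"
  shows "act b (pr a c v) = pr a c (act b v)"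
  using a c by (simp add: pr_def fhom_sum[OF fh] fhom_divide[OF fh] fhom_power[OF fh] ab act_K)

lemma pr_scale: assumes "a \<in> carrier G" "b \<in> KF" shows "pr a c (b * v) = b * pr a c v"
  using assms by (simp add: pr_def fhom_mult[OF fh] act_K sum_distrib_left)

lemma pr_klin: "a \<in> carrier G \<Longrightarrow> klin (pr a c)"
  unfolding klin_def using pr_scale[of a] by (auto simp: pr_def fhom_add[OF fh] add_divide_distrib sum.distrib)

lemma pr_of_eigen:
  assumes a: "a \<in> carrier G" and b: "b \<in> KF" "b ^ M = 1" "c ^ M = 1" "act a v = b * v"
  shows "pr a c v = (if b = c then of_nat M * v else 0)"
proof -
  have c0: "c \<noteq> 0" using b(3) Mpos by (auto simp: power_0_left)
  have e: "pr a c v = (\<Sum>l<M. (b / c) ^ l) * v"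
    unfolding pr_def sum_distrib_right by (rule sum.cong) (simp_all add: act_pow_eigen[OF a b(1,4)] power_divide)
  show ?thesis
  proof (cases "b = c")
    case False
    then have "(\<Sum>l<M. (b / c) ^ l) = 0" using b c0 by (intro sum_geometric_0) (auto simp: power_divide)
    then show ?thesis using False e by simp
  qed (use c0 e in simp)
qed

lemma pr_total:
  assumes a: "a \<in> carrier G" shows "(\<Sum>i<M. pr a (z ^ i) v) = of_nat M * v"
proof -
  have "(\<Sum>i<M. pr a (z ^ i) v) = (\<Sum>l<M. act (a [^] l) v * (\<Sum>i<M. (z ^ 0) ^ i / (z ^ l) ^ i))"
    unfolding pr_def by (subst sum.swap) (simp add: sum_distrib_left power_mult[symmetric] mult.commute)
  also have "\<dots> = (\<Sum>l<M. if l = 0 then of_nat M * v else 0)"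
    by (rule sum.cong) (use Mpos in \<open>auto simp: prim_root_orthogonal[OF z Mpos] act_one simp del: power_0\<close>)
  also have "\<dots> = of_nat M * v" using Mpos by simp
  finally show ?thesis .
qed

lemma pr_nonzero:
  assumes a: "a \<in> carrier G" "v \<noteq> 0" shows "\<exists>i<M. pr a (z ^ i) v \<noteq> 0"
proof (rule ccontr)
  assume "\<not> ?thesis"
  then have "(\<Sum>i<M. pr a (z ^ i) v) = 0" by (intro sum.neutral) auto
  then show False using pr_total[OF a(1), of v] M0 a(2) by simp
qed

text \<open>If only eigenvalues with \<open>j\<close>-th power \<open>1\<close> occurred in
  \<open>v\<close>, then \<open>a^j\<close> would fix \<open>v\<close>. This is how eigenvalues of
  large order are found.\<close>

lemma pr_moved:
  assumes a: "a \<in> carrier G" "act (a [^] (j::nat)) v \<noteq> v"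
  shows "\<exists>i<M. pr a (z ^ i) v \<noteq> 0 \<and> (z ^ i) ^ j \<noteq> 1"
proof (rule ccontr)
  assume n: "\<not> ?thesis"
  have zi: "z ^ i \<in> KF" for i using zK by (intro sf_power[OF subfld_KK])
  have "act (a [^] j) (pr a (z ^ i) v) = pr a (z ^ i) v" if "i < M" for i
  proof (cases "pr a (z ^ i) v = 0")
    case False
    then have "(z ^ i) ^ j = 1" using n that by blast
    then show ?thesis using act_pow_eigen[OF a(1) zi pr_eigen[OF a(1) zi zM(2)]] by simp
  qed (use a fhom_0[OF fh] in simp)
  then have "act (a [^] j) (\<Sum>i<M. pr a (z ^ i) v) = (\<Sum>i<M. pr a (z ^ i) v)"
    using a by (simp add: fhom_sum[OF fh])
  then have "of_nat M * act (a [^] j) v = of_nat M * v"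
    using a by (simp add: pr_total fhom_mult[OF fh] fhom_of_nat[OF fh])
  then show False using M0 a(2) by simp
qed

lemma zi_K: "z ^ i \<in> KF" using zK by (intro sf_power[OF subfld_KK])

lemma pr_V: assumes "a \<in> carrier G" "v \<in> RV.span Vg" shows "pr a (z ^ i) v \<in> RV.span Vg"
  unfolding pr_def
proof (rule RV.span_sum)
  fix l :: nat
  have "act (a [^] l) v \<in> RV.span Vg" using assms by (intro V_stable) auto
  moreover obtain c where "inverse ((z ^ i) ^ l) = ratfun_const c"
    using sf_inverse[OF subfld_KK sf_power[OF subfld_KK zi_K[of i], of l]] by auto
  ultimately have c: "act (a [^] l) v / (z ^ i) ^ l = ratfun_const c * act (a [^] l) v"
      and v: "act (a [^] l) v \<in> RV.span Vg" by (simp_all only: divide_inverse mult.commute)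
  show "act (a [^] l) v / (z ^ i) ^ l \<in> RV.span Vg"
    unfolding c by (rule RV.span_scale[OF v])
qed

text \<open>The exponent of \<open>\<theta>\<close> that measures the failure of
  \<open>\<sigma>\<close> and \<open>\<tau>^i\<close> to commute, see
  \<open>\<sigma>_\<tau>_pow\<close>.\<close>

definition "sn i = poly (Norm i) k"

lemma sn_Suc: "sn (Suc i) = sn i + k ^ i" "sn 0 = 0" "sn (Suc i) = 1 + k * sn i"
proof -
  show "sn (Suc i) = sn i + k ^ i" "sn 0 = 0" by (simp_all add: sn_def poly_Norm)
  show "sn (Suc i) = 1 + k * sn i"
    unfolding sn_def poly_Norm sum.lessThan_Suc_shift by (simp add: sum_distrib_left)
qed

lemma \<theta>_int_nat: "\<theta> [^] i = \<theta> [^] nat (i mod int (p ^ d))" for i :: int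
proof -
    have "\<theta> [^] (i - i mod int (p ^ d)) = \<one>" unfolding ord_\<theta> by (simp add: minus_mod_eq_mult_div)
    then have "\<theta> [^] i = \<theta> [^] (i mod int (p ^ d))"
      using int_pow_mult[OF mem(3), of "i - i mod int (p ^ d)" "i mod int (p ^ d)"] by simp
    also have "\<dots> = \<theta> [^] nat (i mod int (p ^ d))"
    proof -
      have "i mod int (p ^ d) \<ge> 0" using pp by simp
      then show ?thesis by (metis int_pow_int nat_0_le)
    qed
    finally show ?thesis .
qed

lemmas \<theta>_\<tau> = int_pow_swap[OF mem(3,2) conj_\<theta>]
lemmas \<theta>_\<tau>_pow = int_pow_swap_pow[OF mem(3,2) conj_\<theta>]

lemma \<sigma>_\<tau>_pow: "\<sigma> \<otimes> \<tau> [^] j = \<tau> [^] j \<otimes> \<sigma> \<otimes> \<theta> [^] sn j" for j :: nat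
proof (induction j)
  case (Suc j)
  have "\<sigma> \<otimes> \<tau> [^] Suc j = \<tau> [^] j \<otimes> \<sigma> \<otimes> (\<theta> [^] sn j \<otimes> \<tau>)" using Suc by (simp add: m_assoc[symmetric])
  also have "\<dots> = \<tau> [^] j \<otimes> (\<sigma> \<otimes> \<tau>) \<otimes> \<theta> [^] (k * sn j)" unfolding \<theta>_\<tau> by (simp add: m_assoc)
  also have "\<dots> = \<tau> [^] Suc j \<otimes> \<sigma> \<otimes> (\<theta> [^] (1::int) \<otimes> \<theta> [^] (k * sn j))" by (simp add: comm_st m_assoc int_pow_1)
  also have "\<theta> [^] (1::int) \<otimes> \<theta> [^] (k * sn j) = \<theta> [^] sn (Suc j)"
    by (simp only: int_pow_mult[OF mem(3), symmetric] sn_Suc(3))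
  finally show ?case .
qed (simp add: sn_Suc)

lemma \<tau>_commutes_iff: "\<sigma> \<otimes> \<tau> [^] j = \<tau> [^] j \<otimes> \<sigma> \<longleftrightarrow> int (p ^ d) dvd sn j" for j :: nat
proof -
  have "\<sigma> \<otimes> \<tau> [^] j = \<tau> [^] j \<otimes> \<sigma> \<longleftrightarrow> \<theta> [^] sn j = \<one>"
    unfolding \<sigma>_\<tau>_pow by (simp add: r_cancel_one)
  then show ?thesis by (simp add: ord_\<theta>)
qed

lemma sn_n: "int (p ^ d) dvd sn n" "\<not> int (p ^ d) dvd sn n'"
  using chain_good_Norm[OF p good] by (simp_all add: sn_def n_def n'_def)

text \<open>Otherwise \<open>M\<close> would divide \<open>n'\<close>, and
  \<open>\<tau>^n' = 1\<close> would commute with \<open>\<sigma>\<close>.\<close>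

lemma n_dvd_M: "n dvd M"
proof -
  have "\<not> m \<le> D"
  proof
    assume "m \<le> D"
    then have "M dvd n'" unfolding M_def n'_def by (rule le_imp_power_dvd)
    then obtain q where "n' = M * q" by blast
    then have "\<tau> [^] n' = \<one>" using exponent'[OF mem(2)] by (simp add: nat_pow_pow[symmetric])
    then show False using \<tau>_commutes_iff[of n'] sn_n(2) by simp
  qed
  then show ?thesis unfolding M_def n_def by (intro le_imp_power_dvd) simp
qed

lemma k_pow_n: "int (p ^ d) dvd k ^ n - 1"
  unfolding pow_minus_1 using sn_n(1) by (simp add: sn_def)

text \<open>The chain only tells that \<open>\<tau>^n'\<close> does not commute with
  \<open>\<sigma>\<close>. For \<open>0 < e < n\<close> the greatest common divisor of
  \<open>e\<close> and \<open>M\<close> is a power of \<open>p\<close> below \<open>n\<close>, hence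
  divides \<open>n'\<close>; so \<open>\<tau>^n'\<close> is a power of
  \<open>\<tau>^e\<close>.\<close>

lemma not_commute_below:
  assumes e: "0 < e" "e < n" shows "\<not> int (p ^ d) dvd sn e"
proof
  assume "int (p ^ d) dvd sn e"
  then have c: "\<sigma> \<otimes> \<tau> [^] e = \<tau> [^] e \<otimes> \<sigma>" using \<tau>_commutes_iff by simp
  obtain x y where xy: "e * x = M * y + gcd e M" using bezout_nat[of e M] e by auto
  have "gcd e M dvd p ^ m" by (simp add: M_def)
  then obtain f where f: "gcd e M = p ^ f" using p by (auto simp: divides_primepow_nat)
  have "p ^ f \<le> e" using f e by (metis gcd_le1_nat gr_implies_not0)
  then have "p ^ f < p ^ Suc D" using e by (simp add: n_def)
  then have "f \<le> D" using pp by (metis less_Suc_eq_le power_less_imp_less_exp)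
  then obtain q where q: "n' = gcd e M * q" unfolding n'_def f using le_imp_power_dvd by blast
  have cp: "\<sigma> \<otimes> (\<tau> [^] e) [^] (x::nat) = (\<tau> [^] e) [^] x \<otimes> \<sigma>" for x
  proof (induction x)
    case (Suc x)
    have "\<sigma> \<otimes> (\<tau> [^] e) [^] Suc x = (\<sigma> \<otimes> (\<tau> [^] e) [^] x) \<otimes> \<tau> [^] e" by (simp add: m_assoc)
    also have "\<dots> = (\<tau> [^] e) [^] x \<otimes> (\<sigma> \<otimes> \<tau> [^] e)" using Suc by (simp add: m_assoc)
    finally show ?case using c by (simp add: m_assoc)
  qed simp
  have "\<tau> [^] n' = (\<tau> [^] e) [^] (x * q)"
  proof -
    have "\<tau> [^] (e * x * q) = \<tau> [^] (M * (y * q) + n')" by (simp add: xy q distrib_right mult.assoc)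
    also have "\<dots> = \<tau> [^] n'" by (simp add: nat_pow_mult[symmetric] nat_pow_pow[symmetric] exponent'[OF mem(2)])
    finally show ?thesis by (simp add: nat_pow_pow mult.assoc)
  qed
  then show False using cp[of "x * q"] \<tau>_commutes_iff[of n'] sn_n(2) by simp
qed

end

section \<open>Sums of variables as vectors with a prescribed stabiliser\<close>

context noether
begin

definition sumX :: "'a set \<Rightarrow> ('a, 'k::field) ratfun" where "sumX A = (\<Sum>h\<in>A. ratfun_var h)"

lemma act_sumX:
  assumes "a \<in> carrier G" "A \<subseteq> carrier G"
  shows "group_act G a (sumX A :: ('a, 'k::field) ratfun) = sumX ((\<lambda>h. a \<otimes> h) ` A)"
proof -
  have "inj_on (\<lambda>h. a \<otimes> h) A" using assms by (intro inj_onI) (metis l_cancel subsetD)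
  then have "sumX ((\<lambda>h. a \<otimes> h) ` A) = (\<Sum>h\<in>A. ratfun_var (a \<otimes> h) :: ('a, 'k) ratfun)"
    by (simp add: sumX_def sum.reindex)
  also have "\<dots> = group_act G a (sumX A)"
    unfolding sumX_def fhom_sum[OF act_fhom[OF assms(1)]] by (rule sum.cong) (use assms in \<open>auto simp: act_var\<close>)
  finally show ?thesis ..
qed

lemma sumX_subset:
  assumes A: "A \<subseteq> carrier G" "B \<subseteq> carrier G" "sumX A = (sumX B :: ('a, 'k::field) ratfun)"
  shows "A \<subseteq> B"
proof
  fix g assume g: "g \<in> A"
  show "g \<in> B"
  proof (rule ccontr)
    assume gB: "g \<notin> B"
    have fA: "finite A" using A(1) fin by (rule finite_subset)
    have 1: "sumX A = ratfun_var g + (sumX (A - {g}) :: ('a, 'k) ratfun)"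
      unfolding sumX_def by (rule sum.remove[OF fA g])
    let ?E = "gen (KK \<union> ratfun_var ` (- {g})) :: ('a, 'k) ratfun set"
    have E: "sumX C \<in> ?E" if "g \<notin> C" for C
      unfolding sumX_def using that by (intro gen_intros gen_base) auto
    have "(ratfun_var g :: ('a, 'k) ratfun) = sumX B - sumX (A - {g})" using 1 A(3) by simp
    moreover have "sumX B - sumX (A - {g}) \<in> ?E" by (intro gen_intros E) (use gB in auto)
    ultimately have "alg_over ?E (ratfun_var g)" by (simp add: alg_over_self)
    then show False using ratfun_var_independent[of g, where 'k = 'k] by simp
  qed
qed

lemma act_sumX_subgroup:
  assumes H: "subgroup H G" and a: "a \<in> carrier G"
  shows "group_act G a (sumX H :: ('a, 'k::field) ratfun) = sumX H \<longleftrightarrow> a \<in> H"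
proof
  have HG: "H \<subseteq> carrier G" by (rule subgroup.subset[OF H])
  assume "group_act G a (sumX H :: ('a, 'k) ratfun) = sumX H"
  then have "sumX ((\<lambda>h. a \<otimes> h) ` H) = (sumX H :: ('a, 'k) ratfun)" by (simp add: act_sumX[OF a HG])
  then have "(\<lambda>h. a \<otimes> h) ` H \<subseteq> H" by (rule sumX_subset[rotated 2]) (use HG a in auto)
  then have "a \<otimes> \<one> \<in> H" using subgroup.one_closed[OF H] by blast
  then show "a \<in> H" using a by simp
next
  have HG: "H \<subseteq> carrier G" by (rule subgroup.subset[OF H])
  assume aH: "a \<in> H"
  have "(\<lambda>h. a \<otimes> h) ` H = H"
  proof (intro equalityI subsetI)
    fix h assume h: "h \<in> H"
    have "inv a \<otimes> h \<in> H" using aH h subgroup.m_inv_closed[OF H] subgroup.m_closed[OF H] by blast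
    moreover have "h = a \<otimes> (inv a \<otimes> h)" using a h HG by (simp add: m_assoc[symmetric] subsetD)
    ultimately show "h \<in> (\<lambda>h. a \<otimes> h) ` H" by blast
  qed (use aH subgroup.m_closed[OF H] in auto)
  then show "group_act G a (sumX H :: ('a, 'k) ratfun) = sumX H" by (simp add: act_sumX[OF a HG])
qed

lemma sumX_V: "A \<subseteq> carrier G \<Longrightarrow> sumX A \<in> RV.span (XX :: ('a, 'k::field) ratfun set)"
  unfolding sumX_def by (rule RV.span_sum) (auto intro: RV.span_base)

end

section \<open>The eigenvectors \<open>x0\<close>, \<open>s\<close> and \<open>Eig\<close>\<close>

context tame
begin

text \<open>A variable is projected to eigenspaces of \<open>\<theta>\<close>,
  \<open>\<sigma>\<close> and \<open>\<tau>^n\<close>, which commute pairwise. The power of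
  \<open>\<theta>\<close> with exponent \<open>p^(d-1)\<close> moves the variable, so the eigenvalue
  \<open>\<eta>\<close> can be taken of full order. That of \<open>\<tau>^n\<close> is given as an
  \<open>n\<close>-th power so that the translates of \<open>x0\<close> can be rescaled to have
  period \<open>n\<close>.\<close>

lemma exists_x0:
  "\<exists>x0 \<alpha> \<eta> lam. x0 \<in> RV.span Vg \<and> x0 \<noteq> 0 \<and> act \<sigma> x0 = \<alpha> * x0 \<and> act \<theta> x0 = \<eta> * x0 \<and>
    act (\<tau> [^] n) x0 = lam ^ n * x0 \<and> \<alpha> \<in> KF \<and> \<eta> \<in> KF \<and> lam \<in> KF \<and> \<alpha> ^ M = 1 \<and> \<eta> ^ M = 1 \<and> lam ^ M = 1 \<and>
    prim_root \<eta> (p ^ d)"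
proof -
  define v0 :: "('a, 'k) ratfun" where "v0 = ratfun_var \<one>"
  have v0: "v0 \<in> RV.span Vg" unfolding v0_def by (rule RV.span_base) auto
  obtain d' where d': "d = Suc d'" using d0 by (metis Suc_pred)
  have "\<theta> [^] (p ^ d') \<noteq> \<one>"
  proof
    assume "\<theta> [^] (p ^ d') = \<one>"
    then have "\<theta> [^] int (p ^ d') = \<one>" by (simp only: int_pow_int)
    then have "int (p ^ d) dvd int (p ^ d')" by (simp only: ord_\<theta>)
    then have "p ^ d dvd p ^ d'" by (simp only: int_dvd_int_iff)
    then have "p ^ d \<le> p ^ d'" using pp by (simp add: dvd_imp_le)
    then show False using d' pp by simp
  qed
  then have "act (\<theta> [^] (p ^ d')) v0 \<noteq> v0"
    using act_inj[of "\<theta> [^] (p ^ d')" \<one>, where 'k = 'k] by (auto simp: v0_def act_one)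
  from pr_moved[OF mem(3) this] obtain i1 where i1: "pr \<theta> (z ^ i1) v0 \<noteq> 0" "(z ^ i1) ^ (p ^ d') \<noteq> 1" by blast
  define \<eta> where "\<eta> = z ^ i1"
  define v1 where "v1 = pr \<theta> \<eta> v0"
  have \<eta>: "\<eta> \<in> KF" "\<eta> ^ M = 1" by (simp_all add: \<eta>_def zi_K zM)
  have v1: "v1 \<in> RV.span Vg" "v1 \<noteq> 0" "act \<theta> v1 = \<eta> * v1"
    using i1 pr_V[OF mem(3) v0] pr_eigen[OF mem(3) \<eta>] by (simp_all add: v1_def \<eta>_def)
  obtain i2 where i2: "pr \<sigma> (z ^ i2) v1 \<noteq> 0" using pr_nonzero[OF mem(1) v1(2)] by blast
  define \<alpha> where "\<alpha> = z ^ i2"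
  define v2 where "v2 = pr \<sigma> \<alpha> v1"
  have \<alpha>: "\<alpha> \<in> KF" "\<alpha> ^ M = 1" by (simp_all add: \<alpha>_def zi_K zM)
  have comm: "act b (act (a [^] (l::nat)) v) = act (a [^] l) (act b v)"
    if "a \<in> carrier G" "b \<in> carrier G" "a \<otimes> b = b \<otimes> a" for a b l v
  proof -
    have "b \<otimes> a [^] l = a [^] l \<otimes> b"
    proof (induction l)
      case (Suc l)
      have "b \<otimes> a [^] Suc l = (b \<otimes> a [^] l) \<otimes> a" using that by (simp add: m_assoc)
      also have "\<dots> = a [^] l \<otimes> (b \<otimes> a)" unfolding Suc using that by (simp add: m_assoc)
      also have "\<dots> = a [^] Suc l \<otimes> b" unfolding that(3)[symmetric] using that by (simp add: m_assoc)
      finally show ?case .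
    qed (use that in simp)
    then show ?thesis using that by (simp add: act_mult[symmetric])
  qed
  have v2: "v2 \<in> RV.span Vg" "v2 \<noteq> 0" "act \<sigma> v2 = \<alpha> * v2" "act \<theta> v2 = \<eta> * v2"
  proof -
    show "v2 \<in> RV.span Vg" "v2 \<noteq> 0" "act \<sigma> v2 = \<alpha> * v2"
      using i2 pr_V[OF mem(1) v1(1)] pr_eigen[OF mem(1) \<alpha>] by (simp_all add: v2_def \<alpha>_def)
    have "act \<theta> v2 = pr \<sigma> \<alpha> (act \<theta> v1)"
      unfolding v2_def by (rule pr_commute) (use \<alpha> comm[of \<sigma> \<theta>] comm_s\<theta> in auto)
    then show "act \<theta> v2 = \<eta> * v2" using v1(3) pr_scale[OF mem(1) \<eta>(1)] by (simp add: v2_def)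
  qed
  define t where "t = \<tau> [^] n"
  have t: "t \<in> carrier G" by (simp add: t_def)
  have ts: "t \<otimes> \<sigma> = \<sigma> \<otimes> t" using \<tau>_commutes_iff[of n] sn_n(1) by (simp add: t_def)
  have t\<theta>: "t \<otimes> \<theta> = \<theta> \<otimes> t"
  proof -
    have "\<theta> [^] (k ^ n - 1) = \<one>" using k_pow_n ord_\<theta> by blast
    then have "\<theta> [^] (k ^ n) = \<theta>"
      using int_pow_mult[OF mem(3), of "k ^ n - 1" 1] by simp
    then show ?thesis using \<theta>_\<tau>_pow[of 1 n] by (simp add: t_def)
  qed
  obtain i3 where i3: "i3 < M" "pr t (z ^ i3) v2 \<noteq> 0" using pr_nonzero[OF t v2(2)] by blast
  define \<mu> where "\<mu> = z ^ i3"
  define v3 where "v3 = pr t \<mu> v2"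
  have \<mu>: "\<mu> \<in> KF" "\<mu> ^ M = 1" by (simp_all add: \<mu>_def zi_K zM)
  have v3: "v3 \<in> RV.span Vg" "v3 \<noteq> 0" "act t v3 = \<mu> * v3" "act \<sigma> v3 = \<alpha> * v3" "act \<theta> v3 = \<eta> * v3"
  proof -
    show "v3 \<in> RV.span Vg" "v3 \<noteq> 0" "act t v3 = \<mu> * v3"
      using i3 pr_V[OF t v2(1)] pr_eigen[OF t \<mu>] by (simp_all add: v3_def \<mu>_def)
    have "act \<sigma> v3 = pr t \<mu> (act \<sigma> v2)"
      unfolding v3_def by (rule pr_commute) (use t \<mu> comm[of t \<sigma>] ts in auto)
    then show "act \<sigma> v3 = \<alpha> * v3" using v2(3) pr_scale[OF t \<alpha>(1)] by (simp add: v3_def)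
    have "act \<theta> v3 = pr t \<mu> (act \<theta> v2)"
      unfolding v3_def by (rule pr_commute) (use t \<mu> comm[of t \<theta>] t\<theta> in auto)
    then show "act \<theta> v3 = \<eta> * v3" using v2(4) pr_scale[OF t \<eta>(1)] by (simp add: v3_def)
  qed
  \<comment> \<open>Since \<open>(\<tau>^n)^q = 1\<close>, also \<open>\<mu>^q = 1\<close>. As a
    power of \<open>z\<close>, which has order \<open>n * q\<close>, \<open>\<mu>\<close> therefore
    has an exponent divisible by \<open>n\<close>, and its \<open>n\<close>-th root is again a power
    of \<open>z\<close>.\<close>
  obtain q where q: "M = n * q" using n_dvd_M by blast
  have "act (t [^] q) v3 = \<mu> ^ q * v3" by (rule act_pow_eigen[OF t \<mu>(1) v3(3)])
  moreover have "t [^] q = \<one>" using exponent'[OF mem(2)] by (simp add: t_def nat_pow_pow q)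
  ultimately have "\<mu> ^ q = 1" using v3(2) by (simp add: act_one)
  then have "z ^ (i3 * q) = 1" by (simp add: \<mu>_def power_mult)
  then have "M dvd i3 * q" using prim_root_dvd[OF z] by simp
  then have "n dvd i3" using q Mpos by simp
  then obtain i4 where i4: "i3 = n * i4" by blast
  have "act (\<tau> [^] n) v3 = (z ^ i4) ^ n * v3"
    using v3(3) by (simp add: t_def \<mu>_def i4 power_mult[symmetric] mult.commute)
  moreover have "prim_root \<eta> (p ^ d)"
  proof -
    have "\<theta> [^] (p ^ d) = \<one>" using ord_\<theta>[of "int (p ^ d)"] by (simp only: int_pow_int dvd_refl)
    then have "\<eta> ^ (p ^ d) * v3 = v3"
      using act_pow_eigen[OF mem(3) \<eta>(1) v3(5), of "p ^ d"] by (simp add: act_one)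
    then have e1: "\<eta> ^ (p ^ d) = 1" using v3(2) by simp
    obtain i where i: "prim_root \<eta> (p ^ i)" "i > d'"
      using prim_root_primepow[OF p e1, of d'] i1(2) by (auto simp: \<eta>_def)
    have "p ^ i dvd p ^ d" using prim_root_dvd[OF i(1)] e1 by blast
    then have "p ^ i \<le> p ^ d" using pp by (simp add: dvd_imp_le)
    then have "i \<le> d" using pp by (rule power_le_imp_le_exp[rotated])
    then have "i = d" using i(2) d' by simp
    then show ?thesis using i by simp
  qed
  ultimately show ?thesis using v3 \<alpha> \<eta> zi_K zM by blast
qed

text \<open>The sum \<open>u\<close> over the centraliser of \<open>\<sigma>\<close> has that
  centraliser as its stabiliser. This contains \<open>\<sigma>\<close> and \<open>\<theta>\<close>
  but not \<open>\<tau>^n'\<close>, so \<open>u\<close> has a component under \<open>\<tau>\<close>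
  whose eigenvalue \<open>\<xi>\<close> satisfies \<open>\<xi>^n' \<noteq> 1\<close>; the order of
  \<open>\<xi>\<close> is then a multiple of \<open>n\<close>. The component stays fixed by
  \<open>\<sigma>\<close> and \<open>\<theta>\<close>, because moving these past powers of
  \<open>\<tau>\<close> only brings in powers of \<open>\<theta>\<close>.\<close>

lemma exists_s:
  "\<exists>s \<xi> P. s \<in> RV.span Vg \<and> s \<noteq> 0 \<and> act \<sigma> s = s \<and> act \<theta> s = s \<and> act \<tau> s = \<xi> * s \<and> \<xi> \<in> KF \<and> prim_root \<xi> P \<and> n dvd P"
proof -
  define A where "A = {h \<in> carrier G. \<sigma> \<otimes> h = h \<otimes> \<sigma>}"
  have A: "subgroup A G"
  proof (rule subgroup.intro)
    show "x \<otimes> y \<in> A" if "x \<in> A" "y \<in> A" for x y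
    proof -
      have xy: "x \<in> carrier G" "y \<in> carrier G" "\<sigma> \<otimes> x = x \<otimes> \<sigma>" "\<sigma> \<otimes> y = y \<otimes> \<sigma>" using that by (auto simp: A_def)
      have "\<sigma> \<otimes> (x \<otimes> y) = (\<sigma> \<otimes> x) \<otimes> y" using xy(1,2) by (simp add: m_assoc)
      also have "\<dots> = x \<otimes> (\<sigma> \<otimes> y)" unfolding xy(3) using xy(1,2) by (simp add: m_assoc)
      also have "\<dots> = x \<otimes> y \<otimes> \<sigma>" unfolding xy(4) using xy(1,2) by (simp add: m_assoc)
      finally show ?thesis using xy by (simp add: A_def)
    qed
    show "inv x \<in> A" if "x \<in> A" for x
    proof -
      have x: "x \<in> carrier G" "\<sigma> \<otimes> x = x \<otimes> \<sigma>" using that by (auto simp: A_def)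
      have "inv x \<otimes> (\<sigma> \<otimes> x) \<otimes> inv x = \<sigma> \<otimes> inv x" unfolding x(2) using x(1) by (simp add: m_assoc[symmetric])
      moreover have "inv x \<otimes> (\<sigma> \<otimes> x) \<otimes> inv x = inv x \<otimes> \<sigma>" using x(1) by (simp add: m_assoc)
      ultimately show ?thesis using x by (simp add: A_def)
    qed
  qed (auto simp: A_def)
  have AG: "A \<subseteq> carrier G" by (auto simp: A_def)
  define u :: "('a, 'k) ratfun" where "u = sumX A"
  have u: "u \<in> RV.span Vg" unfolding u_def by (rule sumX_V[OF AG])
  have us: "act \<sigma> u = u" "act \<theta> u = u"
    using act_sumX_subgroup[OF A mem(1), where 'k = 'k] act_sumX_subgroup[OF A mem(3), where 'k = 'k]
    by (auto simp: u_def A_def comm_s\<theta>)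
  have "\<tau> [^] n' \<notin> A" using \<tau>_commutes_iff[of n'] sn_n(2) by (simp add: A_def)
  then have "act (\<tau> [^] n') u \<noteq> u"
    using act_sumX_subgroup[OF A, of "\<tau> [^] n'", where 'k = 'k] by (simp add: u_def)
  from pr_moved[OF mem(2) this] obtain i where i: "pr \<tau> (z ^ i) u \<noteq> 0" "(z ^ i) ^ n' \<noteq> 1" by blast
  define \<xi> where "\<xi> = z ^ i"
  define s where "s = pr \<tau> \<xi> u"
  obtain j where j: "prim_root \<xi> (p ^ j)" "j > D"
    using prim_root_primepow[OF p, of \<xi> m D] i(2) zM(2)[of i] by (auto simp: \<xi>_def M_def n'_def)
  have \<theta>u: "act (\<theta> [^] (e::int)) u = u" for e
  proof -
    have "act (\<theta> [^] (l::nat)) u = u" for l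
      using act_pow_eigen[OF mem(3), of 1 u l] us(2) sf_1[OF subfld_KK] by simp
    then show ?thesis by (subst \<theta>_int_nat)
  qed
  have 1: "act \<sigma> s = s"
  proof -
    have "act \<sigma> (act (\<tau> [^] l) u) = act (\<tau> [^] l) (act \<sigma> u)" for l :: nat
    proof -
      have "act \<sigma> (act (\<tau> [^] l) u) = act (\<tau> [^] l \<otimes> \<sigma> \<otimes> \<theta> [^] sn l) u"
        by (simp add: act_mult[symmetric] \<sigma>_\<tau>_pow)
      also have "\<dots> = act (\<tau> [^] l) (act \<sigma> (act (\<theta> [^] sn l) u))" by (simp add: act_mult)
      finally show ?thesis by (simp add: \<theta>u)
    qed
    then have "act \<sigma> s = pr \<tau> \<xi> (act \<sigma> u)"
      unfolding s_def by (intro pr_commute) (auto simp: \<xi>_def zi_K)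
    then show ?thesis by (simp add: us s_def)
  qed
  have 2: "act \<theta> s = s"
  proof -
    have "act \<theta> (act (\<tau> [^] l) u) = act (\<tau> [^] l) (act \<theta> u)" for l :: nat
    proof -
      have "act \<theta> (act (\<tau> [^] l) u) = act (\<tau> [^] l \<otimes> \<theta> [^] (k ^ l)) u"
        using \<theta>_\<tau>_pow[of 1 l] by (simp add: act_mult[symmetric])
      also have "\<dots> = act (\<tau> [^] l) (act (\<theta> [^] (k ^ l)) u)" by (simp add: act_mult)
      finally show ?thesis by (simp add: \<theta>u us)
    qed
    then have "act \<theta> s = pr \<tau> \<xi> (act \<theta> u)"
      unfolding s_def by (intro pr_commute) (auto simp: \<xi>_def zi_K)
    then show ?thesis by (simp add: us s_def)
  qed
  have 3: "act \<tau> s = \<xi> * s" unfolding s_def \<xi>_def by (rule pr_eigen[OF mem(2) zi_K zM(2)])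
  have 4: "s \<noteq> 0" "s \<in> RV.span Vg" "\<xi> \<in> KF"
    using i(1) pr_V[OF mem(2) u] zi_K by (simp_all add: s_def \<xi>_def)
  have 5: "n dvd p ^ j" unfolding n_def using j(2) by (intro le_imp_power_dvd) simp
  show ?thesis using 1 2 3 4 5 j(1) by blast
qed

text \<open>On vectors fixed by \<open>\<theta>\<close> the actions of \<open>\<sigma>\<close> and
  \<open>\<tau>\<close> commute, so the sum over the subgroup generated by \<open>\<theta>\<close>
  splits into joint eigenvectors. As its stabiliser is that subgroup, a group element fixing all of
  \<open>Eig\<close> is a power of \<open>\<theta>\<close>.\<close>

lemma exists_Eig:
  "\<exists>Eig. finite Eig \<and> Eig \<subseteq> RV.span Vg \<and> sumX (generate G {\<theta>}) \<in> RV.span Eig \<and>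
    (\<forall>l\<in>Eig. \<exists>a\<in>KF. \<exists>b\<in>KF. act \<sigma> l = a * l \<and> act \<tau> l = b * l)"
proof -
  define H where "H = generate G {\<theta>}"
  have H: "subgroup H G" unfolding H_def by (rule generate_is_subgroup) simp
  define u :: "('a, 'k) ratfun" where "u = sumX H"
  have u: "u \<in> RV.span Vg" unfolding u_def by (rule sumX_V[OF subgroup.subset[OF H]])
  have uh: "act \<theta> u = u"
    using act_sumX_subgroup[OF H mem(3), where 'k = 'k] by (simp add: u_def H_def generate.incl)
  define w where "w j = pr \<tau> (z ^ j) u" for j
  have wV: "w j \<in> RV.span Vg" for j unfolding w_def by (rule pr_V[OF mem(2) u])
  have w\<tau>: "act \<tau> (w j) = z ^ j * w j" for j unfolding w_def by (rule pr_eigen[OF mem(2) zi_K zM(2)])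
  have fixpow: "act (\<theta> [^] (e::int)) v = v" if v: "act \<theta> v = v" for e v
  proof -
    have "act (\<theta> [^] (l::nat)) v = v" for l
      using act_pow_eigen[OF mem(3), of 1 v l] v sf_1[OF subfld_KK] by simp
    then show ?thesis by (subst \<theta>_int_nat)
  qed
  have w\<theta>: "act \<theta> (w j) = w j" for j
  proof -
    have "act \<theta> (act (\<tau> [^] l) u) = act (\<tau> [^] l) (act \<theta> u)" for l :: nat
    proof -
      have "act \<theta> (act (\<tau> [^] l) u) = act (\<tau> [^] l \<otimes> \<theta> [^] (k ^ l)) u"
        using \<theta>_\<tau>_pow[of 1 l] by (simp add: act_mult[symmetric])
      also have "\<dots> = act (\<tau> [^] l) (act (\<theta> [^] (k ^ l)) u)" by (simp add: act_mult)
      finally show ?thesis by (simp add: fixpow[OF uh] uh)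
    qed
    then have "act \<theta> (w j) = pr \<tau> (z ^ j) (act \<theta> u)"
      unfolding w_def by (intro pr_commute) (auto simp: zi_K)
    then show ?thesis by (simp add: uh w_def)
  qed
  define Eig where "Eig = (\<lambda>(i, j). pr \<sigma> (z ^ i) (w j)) ` ({..<M} \<times> {..<M})"
  have "finite Eig" by (simp add: Eig_def)
  moreover have "Eig \<subseteq> RV.span Vg" using pr_V[OF mem(1) wV] by (auto simp: Eig_def)
  moreover have "u \<in> RV.span Eig"
  proof -
    obtain c where c: "inverse (of_nat M) = (ratfun_const c :: ('a, 'k) ratfun)"
      using sf_inverse[OF subfld_KK sf_of_nat[OF subfld_KK, of M]] by auto
    have wS: "w j \<in> RV.span Eig" if "j < M" for j
    proof -
      have "(\<Sum>i<M. pr \<sigma> (z ^ i) (w j)) \<in> RV.span Eig"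
        by (rule RV.span_sum, rule RV.span_base) (use that in \<open>auto simp: Eig_def\<close>)
      then have "ratfun_const c * (of_nat M * w j) \<in> RV.span Eig" unfolding pr_total[OF mem(1)] by (rule RV.span_scale)
      then show ?thesis using M0 by (simp add: c[symmetric] mult.assoc[symmetric])
    qed
    have "(\<Sum>j<M. w j) \<in> RV.span Eig" by (rule RV.span_sum) (use wS in auto)
    then have "ratfun_const c * (of_nat M * u) \<in> RV.span Eig"
      unfolding w_def pr_total[OF mem(2)] by (rule RV.span_scale)
    then show ?thesis using M0 by (simp add: c[symmetric] mult.assoc[symmetric])
  qed
  moreover have "\<exists>a\<in>KF. \<exists>b\<in>KF. act \<sigma> l = a * l \<and> act \<tau> l = b * l" if "l \<in> Eig" for l
  proof -
    obtain i j where l: "l = pr \<sigma> (z ^ i) (w j)" using \<open>l \<in> Eig\<close> by (auto simp: Eig_def)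
    have "act \<sigma> l = z ^ i * l" unfolding l by (rule pr_eigen[OF mem(1) zi_K zM(2)])
    moreover have "act \<tau> l = z ^ j * l"
    proof -
      have sl: "act \<theta> (act (\<sigma> [^] q) (w j)) = act (\<sigma> [^] q) (w j)" for q :: nat
      proof (induction q)
        case (Suc q)
        have e: "\<sigma> [^] Suc q = \<sigma> \<otimes> \<sigma> [^] q" by (metis mem(1) nat_pow_Suc2)
        have "act \<theta> (act (\<sigma> [^] Suc q) (w j)) = act (\<theta> \<otimes> \<sigma>) (act (\<sigma> [^] q) (w j))"
          unfolding e by (simp add: act_mult)
        also have "\<dots> = act \<sigma> (act \<theta> (act (\<sigma> [^] q) (w j)))" by (simp add: comm_s\<theta>[symmetric] act_mult)
        also have "\<dots> = act (\<sigma> [^] Suc q) (w j)" unfolding Suc e by (simp add: act_mult)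
        finally show ?case .
      qed (simp add: act_one w\<theta>)
      have "act \<tau> (act (\<sigma> [^] q) (w j)) = act (\<sigma> [^] q) (act \<tau> (w j))" for q :: nat
      proof (induction q)
        case (Suc q)
        have e: "\<sigma> [^] Suc q = \<sigma> \<otimes> \<sigma> [^] q" by (metis mem(1) nat_pow_Suc2)
        have "act \<sigma> (act \<tau> (act (\<sigma> [^] q) (w j))) = act (\<tau> \<otimes> \<sigma> \<otimes> \<theta>) (act (\<sigma> [^] q) (w j))"
          unfolding comm_st[symmetric] by (simp add: act_mult)
        also have "\<dots> = act \<tau> (act \<sigma> (act \<theta> (act (\<sigma> [^] q) (w j))))" by (simp add: act_mult)
        also have "\<dots> = act \<tau> (act (\<sigma> [^] Suc q) (w j))" unfolding sl e by (simp add: act_mult)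
        finally have "act \<tau> (act (\<sigma> [^] Suc q) (w j)) = act \<sigma> (act \<tau> (act (\<sigma> [^] q) (w j)))" by (rule sym)
        also have "\<dots> = act (\<sigma> [^] Suc q) (act \<tau> (w j))" unfolding Suc e by (simp add: act_mult)
        finally show ?case .
      qed (simp add: act_one)
      then have "act \<tau> l = pr \<sigma> (z ^ i) (act \<tau> (w j))"
        unfolding l by (intro pr_commute) (auto simp: zi_K)
      then show ?thesis unfolding w\<tau> l by (simp add: pr_scale[OF mem(1) zi_K])
    qed
    ultimately show ?thesis using zi_K by blast
  qed
  ultimately show ?thesis unfolding u_def H_def by blast
qed

end

section \<open>Rationality away from characteristic \<open>p\<close>\<close>

text \<open>That \<open>Z\<close> is not empty provides the nonzero invariant with which the lattice
  descent starts.\<close>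

lemma Fix_gen_semiinvariants:
  assumes \<Gamma>: "autgrp \<Gamma>" and c: "of_nat (card \<Gamma>) \<noteq> (0::'a::field)"
    and E: "subfld E" and st: "\<And>g y. g \<in> \<Gamma> \<Longrightarrow> y \<in> E \<Longrightarrow> g y \<in> E"
    and R: "finite R" "\<And>x. x \<in> R \<Longrightarrow> x \<noteq> 0" "\<And>x g. x \<in> R \<Longrightarrow> g \<in> \<Gamma> \<Longrightarrow> \<exists>a\<in>E. g x = a * (x::'a)"
  shows "\<exists>Z. finite Z \<and> card Z \<le> card R \<and> (R \<noteq> {} \<longrightarrow> Z \<noteq> {}) \<and> Z \<subseteq> gen (E \<union> R) \<and>
    (\<forall>w\<in>Z. w \<noteq> 0 \<and> (\<forall>g\<in>\<Gamma>. g w = w)) \<and> Fix \<Gamma> (gen (E \<union> R)) = gen (Fix \<Gamma> E \<union> Z)"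
  using R
proof (induction R)
  case empty
  have "gen (Fix \<Gamma> E) = Fix \<Gamma> E" by (rule gen_self[OF subfld_Fix[OF \<Gamma> E]])
  then show ?case using gen_self[OF E] by (intro exI[of _ "{}"]) auto
next
  case (insert x R)
  obtain Z where Z: "finite Z" "card Z \<le> card R" "Z \<subseteq> gen (E \<union> R)" "\<forall>w\<in>Z. w \<noteq> 0 \<and> (\<forall>g\<in>\<Gamma>. g w = w)"
    "Fix \<Gamma> (gen (E \<union> R)) = gen (Fix \<Gamma> E \<union> Z)"
    using insert.IH insert.prems by auto
  have sem: "\<exists>a\<in>gen (E \<union> R). g x = a * x" if "g \<in> \<Gamma>" for g
    using insert.prems(2)[of x g] that by (auto intro: gen_base)
  have st': "g y \<in> gen (E \<union> R)" if g: "g \<in> \<Gamma>" and y: "y \<in> gen (E \<union> R)" for g y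
  proof (rule fhom_gen[OF autgrp_facts(3)[OF \<Gamma> g] _ y])
    fix w assume "w \<in> E \<union> R"
    then show "g w \<in> gen (E \<union> R)"
    proof
      assume "w \<in> R"
      then obtain a where "a \<in> E" "g w = a * w" using insert.prems(2)[of w g] g by auto
      then show ?thesis using \<open>w \<in> R\<close> by (auto intro!: gen_intros intro: gen_base)
    qed (use st g in \<open>auto intro: gen_base\<close>)
  qed
  have x0: "x \<noteq> 0" using insert.prems by simp
  have "\<exists>z. z \<noteq> 0 \<and> z \<in> gen (insert x (gen (E \<union> R))) \<and> (\<forall>g\<in>\<Gamma>. g z = z) \<and>
      Fix \<Gamma> (gen (insert x (gen (E \<union> R)))) = gen (insert z (Fix \<Gamma> (gen (E \<union> R))))"
    by (rule Fix_gen_semiinvariant[OF \<Gamma> c gen_subfld _ x0]) (use st' sem in blast)+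
  then obtain z where z: "z \<noteq> 0" "z \<in> gen (insert x (gen (E \<union> R)))" "\<forall>g\<in>\<Gamma>. g z = z"
    "Fix \<Gamma> (gen (insert x (gen (E \<union> R)))) = gen (insert z (Fix \<Gamma> (gen (E \<union> R))))" by blast
  have e1: "gen (insert x (gen (E \<union> R))) = gen (E \<union> insert x R)"
    using gen_gen_Un[of "E \<union> R" "{x}"] by simp
  have e2: "gen (insert z (gen (Fix \<Gamma> E \<union> Z))) = gen (Fix \<Gamma> E \<union> insert z Z)"
    using gen_gen_Un[of "Fix \<Gamma> E \<union> Z" "{z}"] by simp
  have "gen (E \<union> R) \<subseteq> gen (E \<union> insert x R)" by (rule gen_mono) auto
  then have "insert z Z \<subseteq> gen (E \<union> insert x R)" using Z(3) z(2) unfolding e1 by blast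
  moreover have "Fix \<Gamma> (gen (E \<union> insert x R)) = gen (Fix \<Gamma> E \<union> insert z Z)"
    using z(4) unfolding Z(5) e1 e2 .
  moreover have "card (insert z Z) \<le> card (insert x R)"
    using Z(1,2) insert.hyps by (simp add: card_insert_if)
  ultimately show ?case using Z(1,4) z(1,3) by (intro exI[of _ "insert z Z"]) auto
qed

context tame
begin

lemma card_subgroup_nz: "subgroup H G \<Longrightarrow> of_nat (card (act ` H)) \<noteq> (0 :: ('a, 'k) ratfun)"
proof -
  assume H: "subgroup H G"
  have "card H dvd p ^ \<nu>"
    using lagrange[OF H] dvd_triv_right[of "card H" "card (rcosets H)"] by (simp add: Coset.order_def card)
  then obtain i where "card H = p ^ i" unfolding divides_primepow_nat[OF p] by blast
  then have "of_nat (card H) = (of_nat p :: ('a, 'k) ratfun) ^ i" by simp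
  then show ?thesis using l_p0 by (simp only: card_autgrp_sub[OF H] power_not_zero not_False_eq_True)
qed

theorem rational_tame: "purely_transcendental KK (noether_field G :: ('a, 'k) ratfun set)"
proof -
  obtain x0 \<alpha> \<eta> lam where x0: "x0 \<in> RV.span Vg" "x0 \<noteq> 0" "act \<sigma> x0 = \<alpha> * x0" "act \<theta> x0 = \<eta> * x0"
    "act (\<tau> [^] n) x0 = lam ^ n * x0" and K: "\<alpha> \<in> KF" "\<eta> \<in> KF" "lam \<in> KF" and
    M: "\<alpha> ^ M = 1" "\<eta> ^ M = 1" "lam ^ M = 1" and \<eta>: "prim_root \<eta> (p ^ d)"
    using exists_x0 by blast
  obtain s \<xi> P where s: "s \<in> RV.span Vg" "s \<noteq> 0" "act \<sigma> s = s" "act \<theta> s = s" "act \<tau> s = \<xi> * s"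
    and \<xi>: "\<xi> \<in> KF" "prim_root \<xi> P" "n dvd P" using exists_s by blast
  obtain Eig where Eig: "finite Eig" "Eig \<subseteq> RV.span Vg" "sumX (generate G {\<theta>}) \<in> RV.span Eig"
    "\<forall>l\<in>Eig. \<exists>a\<in>KF. \<exists>b\<in>KF. act \<sigma> l = a * l \<and> act \<tau> l = b * l" using exists_Eig by blast
  have lam0: "lam \<noteq> 0" using M(3) Mpos by (auto simp: power_0_left)
  have \<eta>0: "\<eta> \<noteq> 0" by (rule prim_root_nz[OF \<eta>])
  have \<alpha>0: "\<alpha> \<noteq> 0" using M(1) Mpos by (auto simp: power_0_left)
  have \<eta>N: "\<eta> ^ (p ^ d) = 1" using \<eta> by (simp add: primitive_root_of_unity_def)
  have \<eta>mod: "\<eta> powi e = \<eta> ^ nat (e mod int (p ^ d))" for e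
  proof -
    have pos: "e mod int (p ^ d) \<ge> 0" using pp by simp
    have "\<eta> powi e = \<eta> powi (int (p ^ d) * (e div int (p ^ d)) + e mod int (p ^ d))" by simp
    also have "\<dots> = (\<eta> powi int (p ^ d)) powi (e div int (p ^ d)) * \<eta> powi (e mod int (p ^ d))"
      using \<eta>0 by (simp only: power_int_add power_int_mult simp_thms)
    also have "\<eta> powi int (p ^ d) = 1" using \<eta>N by (simp only: power_int_of_nat)
    also have "\<eta> powi (e mod int (p ^ d)) = \<eta> ^ nat (e mod int (p ^ d))" using pos by (simp add: power_int_def)
    finally show ?thesis by simp
  qed
  have \<eta>iff: "\<eta> powi e = 1 \<longleftrightarrow> int (p ^ d) dvd e" for e
  proof -
    have pos: "e mod int (p ^ d) \<ge> 0" using pp by simp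
    have lt: "e mod int (p ^ d) < int (p ^ d)" using pp by simp
    have "\<eta> powi e = 1 \<longleftrightarrow> p ^ d dvd nat (e mod int (p ^ d))" unfolding \<eta>mod by (rule prim_root_dvd[OF \<eta>])
    also have "\<dots> \<longleftrightarrow> nat (e mod int (p ^ d)) = 0"
      using lt pos by (metis dvd_0_right dvd_imp_le gr0I linorder_not_le nat_less_iff)
    also have "\<dots> \<longleftrightarrow> int (p ^ d) dvd e" using pos by (simp add: dvd_eq_mod_eq_0)
    finally show ?thesis .
  qed
  have \<eta>K: "\<eta> powi e \<in> KF" for e using K(2) by (rule sf_powi[OF subfld_KK])
  have \<theta>x0: "act (\<theta> [^] (e::int)) x0 = \<eta> powi e * x0" for e
    unfolding \<eta>mod by (subst \<theta>_int_nat) (rule act_pow_eigen[OF mem(3) K(2) x0(4)])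

  \<comment> \<open>The rescaled translates of \<open>x0\<close>\<close>
  define x where "x i = act (\<tau> [^] i) x0 / lam ^ i" for i :: nat
  have x_0: "x 0 = x0" by (simp add: x_def act_one)
  have xn: "x n = x0" using x0(5) lam0 by (simp add: x_def)
  have xnz: "x i \<noteq> 0" for i using x0(2) lam0 by (simp add: x_def fhom_eq_0_iff[OF fh])
  have lamK: "act g (lam ^ i) = lam ^ i" if "g \<in> carrier G" for g i
    using K(3) that by (simp add: fhom_power[OF fh] act_K)
  have x\<tau>: "act \<tau> (x i) = lam * x (Suc i)" for i
  proof -
    have "\<tau> [^] Suc i = \<tau> \<otimes> \<tau> [^] i" by (metis mem(2) nat_pow_Suc2)
    then have "act (\<tau> [^] Suc i) x0 = act \<tau> (act (\<tau> [^] i) x0)" by (simp add: act_mult)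
    then show ?thesis using lam0 by (simp add: x_def fhom_divide[OF fh] lamK)
  qed
  have x\<sigma>: "act \<sigma> (x i) = (\<alpha> * \<eta> powi sn i) * x i" for i
  proof -
    have "act \<sigma> (act (\<tau> [^] i) x0) = act (\<tau> [^] i) (act \<sigma> (act (\<theta> [^] sn i) x0))"
      by (simp add: act_mult[symmetric] \<sigma>_\<tau>_pow m_assoc)
    also have "\<dots> = (\<alpha> * \<eta> powi sn i) * act (\<tau> [^] i) x0"
      using K(1) \<eta>K[of "sn i"] by (simp add: \<theta>x0 x0(3) fhom_mult[OF fh] act_K)
    finally show ?thesis using lamK[of \<sigma> i] by (simp add: x_def fhom_divide[OF fh])
  qed
  have x\<theta>: "act \<theta> (x i) = \<eta> powi (k ^ i) * x i" for i
  proof -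
    have "act \<theta> (act (\<tau> [^] i) x0) = act (\<tau> [^] i) (act (\<theta> [^] (k ^ i)) x0)"
      using \<theta>_\<tau>_pow[of 1 i] by (simp add: act_mult[symmetric])
    also have "\<dots> = \<eta> powi (k ^ i) * act (\<tau> [^] i) x0"
      using \<eta>K[of "k ^ i"] by (simp add: \<theta>x0 fhom_mult[OF fh] act_K)
    finally show ?thesis using lamK[of \<theta> i] by (simp add: x_def fhom_divide[OF fh])
  qed
  have xV: "x i \<in> RV.span Vg" for i
  proof -
    obtain c where c: "inverse (lam ^ i) = ratfun_const c"
      using sf_inverse[OF subfld_KK sf_power[OF subfld_KK K(3), of i]] by auto
    have e: "x i = ratfun_const c * act (\<tau> [^] i) x0" by (simp only: x_def divide_inverse c mult.commute)
    show ?thesis unfolding e by (rule RV.span_scale, rule V_stable) (use x0(1) in auto)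
  qed

  \<comment> \<open>Linear independence of the translates and \<open>s\<close>\<close>
  have sn_add: "sn (i + e) = sn i + k ^ i * sn e" for i e
    by (simp add: sn_def poly_Norm sum_lessThan_plus power_add sum_distrib_left)
  have kp: "\<not> int p dvd k"
  proof
    assume "int p dvd k"
    then have "int p dvd k - (k - 1)" using pk by (rule dvd_diff)
    then show False using pp by simp
  qed
  define c where "c i = \<alpha> * \<eta> powi sn i" for i
  have cK: "c i \<in> KF" for i unfolding c_def using K(1) \<eta>K by (intro sf_mult[OF subfld_KK])
  have cM: "c i ^ M = 1" for i
  proof -
    have "(\<eta> powi sn i) ^ M = (\<eta> ^ M) powi sn i" by (simp add: power_int_power' flip: power_int_of_nat power_int_mult) (simp add: mult.commute power_int_mult)
    then show ?thesis using M by (simp add: c_def power_mult_distrib)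
  qed
  \<comment> \<open>Equal eigenvalues of \<open>\<sigma>\<close> on two translates would make
    \<open>p^d\<close> divide \<open>sn e\<close> with \<open>0 < e < n\<close>; the factor
    \<open>k^i\<close> cancels because \<open>k\<close> is prime to \<open>p\<close>.\<close>
  have c_neq: "c i \<noteq> c j" if ij: "i < j" "j < n" for i j
  proof
    assume "c i = c j"
    then have "\<eta> powi sn i = \<eta> powi sn j" using \<alpha>0 by (simp add: c_def)
    moreover obtain e where e: "j = i + e" "0 < e" "e < n" using ij less_imp_add_positive[of i j] by auto
    ultimately have "\<eta> powi (k ^ i * sn e) = 1" using \<eta>0 by (simp add: sn_add power_int_add)
    then have "int (p ^ d) dvd k ^ i * sn e" by (simp only: \<eta>iff)
    moreover have "coprime (int (p ^ d)) (k ^ i)"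
      using kp coprime_prime_int[OF p, of k] by (simp add: coprime_commute)
    ultimately have "int (p ^ d) dvd sn e" by (simp add: coprime_dvd_mult_right_iff)
    then show False using not_commute_below[OF e(2,3)] by simp
  qed
  have notin: "v \<notin> RV.span S" if f: "klin f" and S: "\<And>u. u \<in> S \<Longrightarrow> f u = 0" and v: "f v \<noteq> 0"
    for f and v :: "('a, 'k) ratfun" and S
  proof
    assume "v \<in> RV.span S"
    then have "f v \<in> RV.span {}" by (rule klin_span[OF f, rotated]) (simp add: S)
    then show False using v by simp
  qed
  have xind: "RV.independent (x ` {..<j}) \<and> card (x ` {..<j}) = j" if "j \<le> n" for j
    using that
  proof (induction j)
    case 0 then show ?case by (simp add: RV.independent_empty)
  next
    case (Suc j)
    have "x j \<notin> RV.span (x ` {..<j})"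
    proof (rule notin[OF pr_klin[OF mem(1), of "c j"]])
      fix u assume "u \<in> x ` {..<j}"
      then obtain i where i: "i < j" "u = x i" by blast
      then have "c i \<noteq> c j" using c_neq[of i j] Suc.prems by simp
      then show "pr \<sigma> (c j) u = 0"
        using pr_of_eigen[OF mem(1) cK cM cM, of "x i" i j] x\<sigma>[of i] i by (simp add: c_def)
    next
      show "pr \<sigma> (c j) (x j) \<noteq> 0"
        using pr_of_eigen[OF mem(1) cK cM cM, of "x j" j j] x\<sigma>[of j] M0 xnz by (simp add: c_def)
    qed
    moreover from this have "x j \<notin> x ` {..<j}" by (rule contrapos_nn[OF _ RV.span_base])
    ultimately show ?case using Suc by (simp add: lessThan_Suc RV.independent_insertI)
  qed
  define Xs where "Xs = x ` {..<n}"
  have Xs: "RV.independent Xs" "card Xs = n" "finite Xs" using xind[of n] by (simp_all add: Xs_def)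
  \<comment> \<open>\<open>\<theta>\<close> fixes \<open>s\<close>, while its eigenvalue on each
    \<open>x i\<close> is not \<open>1\<close>.\<close>
  have sXs: "s \<notin> RV.span Xs"
  proof (rule notin[OF pr_klin[OF mem(3), of 1]])
    have one: "(1 :: ('a, 'k) ratfun) \<in> KF" by (rule sf_1[OF subfld_KK])
    show "pr \<theta> 1 s \<noteq> 0" using pr_of_eigen[OF mem(3) one, of 1 s] s(2,4) M0 by simp
    fix u assume "u \<in> Xs"
    then obtain i where i: "u = x i" by (auto simp: Xs_def)
    have "\<not> int (p ^ d) dvd k ^ i"
    proof
      assume "int (p ^ d) dvd k ^ i"
      moreover have "int p dvd int (p ^ d)" using d0 by simp
      ultimately have "int p dvd k ^ i" by (rule dvd_trans[rotated])
      then show False using kp p by (metis prime_dvd_power prime_nat_int_transfer)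
    qed
    then have "\<eta> powi (k ^ i) \<noteq> 1" by (simp only: \<eta>iff not_False_eq_True)
    moreover have "(\<eta> powi (k ^ i)) ^ M = 1"
      unfolding \<eta>mod by (simp add: power_mult[symmetric] mult.commute) (simp add: power_mult M)
    ultimately show "pr \<theta> 1 u = 0" using pr_of_eigen[OF mem(3) \<eta>K _ _ x\<theta>, of i 1] i by simp
  qed

  \<comment> \<open>A basis adapted to the eigenvectors\<close>
  define B0 where "B0 = insert s Xs"
  have sX: "s \<notin> Xs" using sXs by (rule contrapos_nn[OF _ RV.span_base])
  have B0: "RV.independent B0" "finite B0" "card B0 = n + 1" "B0 \<subseteq> RV.span Vg"
    unfolding B0_def using RV.independent_insertI[OF sXs Xs(1)] Xs sX s(1) xV by (auto simp: Xs_def)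
  \<comment> \<open>Extending inside \<open>B0 \<union> Eig\<close> makes the additional vectors
    \<open>R\<close> joint eigenvectors, while all of \<open>Eig\<close> stays in the span, as
    faithfulness requires.\<close>
  obtain B1 where B1: "B0 \<subseteq> B1" "B1 \<subseteq> B0 \<union> Eig" "RV.independent B1" "B0 \<union> Eig \<subseteq> RV.span B1"
    using RV.maximal_independent_subset_extend[of B0 "B0 \<union> Eig"] B0(1) by blast
  have B1V: "B1 \<subseteq> RV.span Vg" using B1(2) B0(4) Eig(2) by blast
  obtain B where B: "B1 \<subseteq> B" "B \<subseteq> RV.span Vg" "RV.independent B" "RV.span Vg \<subseteq> RV.span B"
    using RV.maximal_independent_subset_extend[OF B1V B1(3)] by blast
  have spB: "RV.span B = RV.span Vg" using B(2,4) by (metis RV.span_mono RV.span_span subset_antisym)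
  have finV: "finite Vg" using fin by simp
  have finB: "finite B" "card B \<le> card (carrier G)"
    using RV.independent_span_bound[OF finV B(3,2)] card_image_le[OF fin, of "ratfun_var :: 'a \<Rightarrow> ('a, 'k) ratfun"] by auto
  define R where "R = B1 - B0"
  define W where "W = B - B1"
  have B1_eq: "B1 = B0 \<union> R" using B1(1) by (auto simp: R_def)
  have fin1: "finite B1" "finite R" "finite W" using finB(1) B(1) finite_subset by (auto simp: R_def W_def)
  have cards: "card B = n + 1 + card R + card W"
  proof -
    have "card B = card B1 + card W" unfolding W_def using B(1) finB(1) fin1(1) by (simp add: card_Diff_subset card_mono)
    moreover have "card B1 = card B0 + card R" unfolding R_def using B1(1) fin1(1) B0(2) by (simp add: card_Diff_subset card_mono)
    ultimately show ?thesis using B0(3) by simp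
  qed
  have REig: "R \<subseteq> Eig" using B1(2) by (auto simp: R_def)
  have Rnz: "r \<noteq> 0" if "r \<in> R" for r
    using B1(3) that RV.dependent_zero by (auto simp: R_def)
  define L where "L = gen (KF \<union> B1)"
  have L: "subfld L" by (simp add: L_def)
  have LB: "KF \<subseteq> L" "B1 \<subseteq> L" by (auto simp: L_def intro: gen_base)
  have xL: "x i \<in> L" if "i < n" for i using that LB B1(1) by (auto simp: B0_def Xs_def)
  have L1: "act \<sigma> y \<in> L \<and> act \<tau> y \<in> L" if y: "y \<in> KF \<union> B1" for y
  proof -
    from y consider "y \<in> KF" | "y = s" | i where "i < n" "y = x i" | "y \<in> R"
      unfolding B1_eq B0_def Xs_def by blast
    then show ?thesis
    proof cases
      case 1 then show ?thesis using LB by (auto simp: act_K)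
    next
      case 2 then show ?thesis using s LB \<xi>(1) B1(1) by (auto simp: B0_def intro!: sf_mult[OF L])
    next
      case 3
      have "x (Suc i) \<in> L" using 3 xL[of "Suc i"] xL[of 0] xn x_0 npos(1) by (cases "Suc i = n") auto
      moreover have "c i \<in> L" "lam \<in> L" using cK[of i] K(3) LB by (rule_tac [!] subsetD) simp_all
      ultimately show ?thesis
        using sf_mult[OF L, of "c i" "x i"] sf_mult[OF L, of lam "x (Suc i)"] xL[of i] 3 x\<tau>[of i] x\<sigma>[of i] by (simp add: c_def)
    next
      case 4
      then obtain a b where "a \<in> KF" "b \<in> KF" "act \<sigma> y = a * y" "act \<tau> y = b * y" using Eig(4) REig by blast
      then show ?thesis using y LB by (auto intro!: sf_mult[OF L])
    qed
  qed
  have Lst: "act g y \<in> L" if "g \<in> carrier G" "y \<in> L" for g y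
  proof -
    have "\<forall>y\<in>L. act g y \<in> L" using that(1)
    proof (induction rule: gen_induct)
      case s show ?case unfolding L_def using fhom_gen[OF fh[OF mem(1)], of "KF \<union> B1" "KF \<union> B1"] L1 by (auto simp: L_def)
    next
      case t show ?case unfolding L_def using fhom_gen[OF fh[OF mem(2)], of "KF \<union> B1" "KF \<union> B1"] L1 by (auto simp: L_def)
    qed (simp_all add: act_one act_mult)
    then show ?thesis using that by blast
  qed

  \<comment> \<open>Faithfulness and the no-name lemma\<close>
  have faithful: "\<exists>c\<in>L. act g c \<noteq> c" if g: "g \<in> carrier G" "act g \<noteq> id" for g
  proof (rule ccontr)
    assume "\<not> ?thesis"
    then have fixL: "act g c = c" if "c \<in> L" for c using that by blast
    define H where "H = generate G {\<theta>}"
    have H: "subgroup H G" unfolding H_def by (rule generate_is_subgroup) simp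
    have "sumX H \<in> RV.span B1"
    proof -
      have "Eig \<subseteq> RV.span B1" using B1(4) by simp
      then have "RV.span Eig \<subseteq> RV.span B1" by (rule RV.span_minimal[OF _ RV.subspace_span])
      then show ?thesis using Eig(3) unfolding H_def by (rule subsetD)
    qed
    then have "sumX H \<in> L" unfolding L_def using span_subset_gen by blast
    then have "g \<in> H" using fixL act_sumX_subgroup[OF H g(1), where 'k = 'k] by blast
    then obtain e :: int where e: "g = \<theta> [^] e" unfolding H_def using generate_pow[OF mem(3)] by auto
    have "x 0 \<in> L" using xL npos by blast
    then have "\<eta> powi e * x0 = x0" using fixL \<theta>x0[of e] by (simp add: e x_0)
    then have "\<eta> powi e = 1" using x0(2) by simp
    then have "int (p ^ d) dvd e" by (simp only: \<eta>iff)
    then have "\<theta> [^] e = \<one>" by (simp only: ord_\<theta>)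
    then have "g = \<one>" using e by simp
    then show False using g(2) by (auto simp: act_one fun_eq_iff)
  qed
  have GGaut: "autgrp (act ` carrier G)" by (rule autgrp_GG)
  have cardGG: "of_nat (card (act ` carrier G)) \<noteq> (0 :: ('a, 'k) ratfun)" by (rule card_subgroup_nz[OF subgroup_self])
  have "\<exists>T. finite T \<and> card T \<le> card W \<and> (\<forall>t\<in>T. \<forall>g\<in>act ` carrier G. g t = t) \<and> gen (L \<union> W) = gen (L \<union> T)"
  proof (rule no_name_lemma[OF GGaut fin1(3) L])
    fix h w assume h: "h \<in> act ` carrier G" and w: "w \<in> W"
    then obtain g where g: "g \<in> carrier G" "h = act g" by blast
    have "act g w \<in> RV.span B" using V_stable[OF g(1)] w B(2) unfolding spB W_def by blast
    then show "h w \<in> affspan L W" unfolding g(2)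
    proof (induction rule: RV.span_induct_alt)
      case base then show ?case by (rule affspan_base[OF L sf_0[OF L]])
    next
      case (step a b y)
      have aL: "ratfun_const a \<in> L" using LB(1) by auto
      have "b \<in> affspan L W"
      proof (cases "b \<in> B1")
        case True then show ?thesis using LB(2) by (intro affspan_base[OF L]) auto
      next
        case False then show ?thesis using step(1) fin1(3) by (intro affspan_gen[OF L]) (auto simp: W_def)
      qed
      then show ?case using step aL by (intro affspan_add[OF L] affspan_mult[OF L]) auto
    qed
  qed (use Lst faithful in auto)
  then obtain T where T: "finite T" "card T \<le> card W" "\<forall>t\<in>T. \<forall>g\<in>act ` carrier G. g t = t" "gen (L \<union> W) = gen (L \<union> T)" by blast
  have Tf: "act g t = t" if "g \<in> carrier G" "t \<in> T" for g t using T(3) that by blast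
  define F where "F = gen (KF \<union> Vg)"
  have F1: "F = gen (KF \<union> B1 \<union> T)"
  proof -
    have "F = gen (KF \<union> B)" unfolding F_def by (rule gen_span_eq[OF spB[symmetric]])
    also have "KF \<union> B = KF \<union> B1 \<union> W" using B(1) by (auto simp: W_def)
    also have "gen (KF \<union> B1 \<union> W) = gen (L \<union> W)" by (simp only: L_def gen_gen_Un)
    also have "\<dots> = gen (KF \<union> B1 \<union> T)" unfolding T(4) by (simp only: L_def gen_gen_Un)
    finally show ?thesis .
  qed

  \<comment> \<open>Ratios of translates, with \<open>x0\<close> and \<open>R\<close> as
    semi-invariants over them\<close>
  define y where "y i = x (Suc i) / x i" for i
  have y\<tau>: "act \<tau> (y i) = y (Suc i)" for i
    using lam0 by (simp add: y_def fhom_divide[OF fh] x\<tau>)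
  have y\<sigma>: "act \<sigma> (y i) = \<eta> powi (k ^ i) * y i" for i
  proof -
    have "\<eta> powi sn (Suc i) / \<eta> powi sn i = \<eta> powi (k ^ i)" using \<eta>0 by (simp add: sn_Suc(1) power_int_add)
    moreover have "(\<alpha> * u * v) / (\<alpha> * u' * v') = (u / u') * (v / v')" for u u' v v'
      using \<alpha>0 by (simp add: mult.assoc)
    ultimately show ?thesis by (simp only: y_def fhom_divide[OF fh[OF mem(1)]] x\<sigma>)
  qed
  have ynz: "y i \<noteq> 0" for i using xnz by (simp add: y_def)
  have y_pow: "(act \<tau> ^^ i) (y 0) = y i" for i by (induction i) (simp_all add: y\<tau>)
  define E0 where "E0 = gen (KF \<union> range y \<union> {s} \<union> T)"
  have E0: "subfld E0" by (simp add: E0_def)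
  have E0b: "KF \<subseteq> E0" "y i \<in> E0" "s \<in> E0" "T \<subseteq> E0" for i by (auto simp: E0_def intro: gen_base)
  have E01: "act \<sigma> w \<in> E0 \<and> act \<tau> w \<in> E0" if w: "w \<in> KF \<union> range y \<union> {s} \<union> T" for w
  proof -
    from w consider "w \<in> KF" | i where "w = y i" | "w = s" | "w \<in> T" by blast
    then show ?thesis
    proof cases
      case 1 then show ?thesis using E0b by (auto simp: act_K)
    next
      case 2 then show ?thesis using E0b \<eta>K[of "k ^ i"] by (auto simp: y\<tau> y\<sigma> intro!: sf_mult[OF E0])
    next
      case 3 then show ?thesis using E0b s \<xi>(1) by (auto intro!: sf_mult[OF E0])
    next
      case 4 then show ?thesis using E0b Tf by auto
    qed
  qed
  have E0st: "act g w \<in> E0" if "g \<in> carrier G" "w \<in> E0" for g w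
  proof -
    have "\<forall>w\<in>E0. act g w \<in> E0" using that(1)
    proof (induction rule: gen_induct)
      case s show ?case using fhom_gen[OF fh[OF mem(1)], of "KF \<union> range y \<union> {s} \<union> T" "KF \<union> range y \<union> {s} \<union> T"] E01
        unfolding E0_def by blast
    next
      case t show ?case using fhom_gen[OF fh[OF mem(2)], of "KF \<union> range y \<union> {s} \<union> T" "KF \<union> range y \<union> {s} \<union> T"] E01
        unfolding E0_def by blast
    qed (simp_all add: act_one act_mult)
    then show ?thesis using that by blast
  qed
  \<comment> \<open>\<open>\<tau>\<close> multiplies \<open>x0\<close> by \<open>lam * y 0\<close>,
    which lies in \<open>E0\<close> though it is not a constant. This is why the coefficients are
    taken from \<open>E0\<close>.\<close>
  have semi: "\<exists>a\<in>E0. act g r = a * r" if g: "g \<in> carrier G" and r: "r \<in> insert x0 R" for g r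
    using g
  proof (induction rule: gen_induct)
    case one show ?case using sf_1[OF E0] by (auto simp: act_one intro!: bexI[of _ 1])
  next
    case (mult g h)
    then obtain a b where ab: "a \<in> E0" "b \<in> E0" "act g r = a * r" "act h r = b * r" by blast
    have "act (g \<otimes> h) r = (act g b * a) * r" using mult ab by (simp add: act_mult fhom_mult[OF fh])
    moreover have "act g b * a \<in> E0" using ab E0st[OF mult(1)] by (intro sf_mult[OF E0])
    ultimately show ?case by blast
  next
    case s
    show ?case
    proof (cases "r = x0")
      case True then show ?thesis using x0(3) K(1) E0b(1) by blast
    next
      case False then show ?thesis using r Eig(4) REig E0b(1) by blast
    qed
  next
    case t
    show ?case
    proof (cases "r = x0")
      case True
      have "act \<tau> x0 = (lam * y 0) * x0" using x\<tau>[of 0] x0(2) by (simp add: x_0 y_def)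
      moreover have "lam * y 0 \<in> E0" using K(3) E0b by (intro sf_mult[OF E0]) auto
      ultimately show ?thesis using True by blast
    next
      case False then show ?thesis using r Eig(4) REig E0b(1) by blast
    qed
  qed
  have F2: "gen (E0 \<union> insert x0 R) = F"
  proof -
    have "gen (E0 \<union> insert x0 R) = gen (KF \<union> range y \<union> {s} \<union> T \<union> insert x0 R)" by (simp only: E0_def gen_gen_Un)
    also have "\<dots> = gen (KF \<union> B1 \<union> T)"
    proof (rule gen_eqI)
      have xi: "x i \<in> gen (KF \<union> B1 \<union> T)" for i
      proof -
        have per: "x (i + n) = x i" for i
        proof -
          have "act (\<tau> [^] (i + n)) x0 = act (\<tau> [^] i) (act (\<tau> [^] n) x0)" by (simp add: act_mult[symmetric] nat_pow_mult)
          also have "\<dots> = lam ^ n * act (\<tau> [^] i) x0" by (simp add: x0(5) fhom_mult[OF fh] lamK)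
          finally show ?thesis using lam0 by (simp add: x_def power_add)
        qed
        have "x i = x (i mod n)"
        proof -
          have "x (j + q * n) = x j" for j q
            by (induction q) (simp_all add: per add.assoc[symmetric] add.commute[of n])
          from this[of "i mod n" "i div n"] show ?thesis by (simp only: mod_div_mult_eq)
        qed
        moreover have "x (i mod n) \<in> B1" using npos(1) B1(1) by (auto simp: B0_def Xs_def)
        ultimately show ?thesis by (auto intro: gen_base)
      qed
      have "y i \<in> gen (KF \<union> B1 \<union> T)" for i unfolding y_def using xi by (intro gen_intros)
      then show "KF \<union> range y \<union> {s} \<union> T \<union> insert x0 R \<subseteq> gen (KF \<union> B1 \<union> T)"
        using xi[of 0] B1(1) by (auto simp: x_0 R_def B0_def intro: gen_base)
      have xi: "x i \<in> gen (KF \<union> range y \<union> {s} \<union> T \<union> insert x0 R)" for i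
      proof (induction i)
        case (Suc i)
        have "x (Suc i) = y i * x i" using xnz by (simp add: y_def)
        then show ?case using Suc by (simp only:) (intro gen_intros, auto intro: gen_base)
      qed (auto simp: x_0 intro: gen_base)
      show "KF \<union> B1 \<union> T \<subseteq> gen (KF \<union> range y \<union> {s} \<union> T \<union> insert x0 R)"
        using xi unfolding B1_eq B0_def Xs_def by (auto intro: gen_base)
    qed
    finally show ?thesis by (simp only: F1)
  qed
  have "\<exists>Z. finite Z \<and> card Z \<le> card (insert x0 R) \<and> (insert x0 R \<noteq> {} \<longrightarrow> Z \<noteq> {}) \<and> Z \<subseteq> gen (E0 \<union> insert x0 R) \<and>
    (\<forall>w\<in>Z. w \<noteq> 0 \<and> (\<forall>g\<in>act ` carrier G. g w = w)) \<and>
    Fix (act ` carrier G) (gen (E0 \<union> insert x0 R)) = gen (Fix (act ` carrier G) E0 \<union> Z)"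
    by (rule Fix_gen_semiinvariants[OF GGaut cardGG E0]) (use E0st semi fin1(2) Rnz[of 0] x0(2) in auto)
  then obtain Z where Z: "finite Z" "card Z \<le> card (insert x0 R)" "Z \<noteq> {}" "Z \<subseteq> F"
    "\<forall>w\<in>Z. w \<noteq> 0 \<and> (\<forall>g\<in>act ` carrier G. g w = w)"
    "Fix (act ` carrier G) F = gen (Fix (act ` carrier G) E0 \<union> Z)" unfolding F2 by auto

  \<comment> \<open>The stock of invariants\<close>
  define T' where "T' = T \<union> Z"
  have T'f: "act g t = t" if "g \<in> carrier G" "t \<in> T'" for g t using Tf Z(5) that by (auto simp: T'_def)
  define N where "N = card (carrier G)"
  have cardT': "card T' + n \<le> N"
  proof -
    have "card T' \<le> card T + card Z" unfolding T'_def by (rule card_Un_le)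
    also have "card Z \<le> card R + 1" using Z(2) fin1(2) by (simp add: card_insert_if split: if_splits)
    finally show ?thesis using T(2) cards finB(2) by (simp add: N_def)
  qed
  obtain z1 where z1: "z1 \<in> Z" using Z(3) by blast
  have finT': "finite T'" using T(1) Z(1) by (simp add: T'_def)
  \<comment> \<open>What remains of \<open>card (carrier G)\<close> after the \<open>n\<close>
    generators accounted for by the lattice and \<open>s\<close>. \<open>T'\<close> may be smaller,
    so its enumeration \<open>t\<close> is padded with the nonzero invariant \<open>z1\<close>,
    which also comes first.\<close>
  define cc where "cc = N - n"
  have cc_pos: "card T' \<le> cc" "cc > 0"
  proof -
    show "card T' \<le> cc" using cardT' by (simp add: cc_def)
    moreover have "card T' > 0" using finT' z1 by (auto simp: T'_def card_gt_0_iff)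
    ultimately show "cc > 0" by simp
  qed
  obtain xs where xs: "set xs = T' - {z1}" "distinct xs" using finite_distinct_list[of "T' - {z1}"] finT' by blast
  have z1T: "z1 \<in> T'" using z1 by (simp add: T'_def)
  have lxs: "Suc (length xs) \<le> cc"
  proof -
    have "Suc (length xs) = card T'"
      using xs finT' z1T by (metis card_Suc_Diff1 distinct_card)
    then show ?thesis using cc_pos by simp
  qed
  define t where "t i = (if i < Suc (length xs) then (z1 # xs) ! i else z1)" for i
  have t_im: "t ` {..<cc} = T'"
  proof
    have "set (z1 # xs) = T'" using xs z1T by auto
    moreover have "t i \<in> set (z1 # xs)" for i unfolding t_def using nth_mem[of i "z1 # xs"] by auto
    ultimately show "t ` {..<cc} \<subseteq> T'" by blast
    show "T' \<subseteq> t ` {..<cc}"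
    proof
      fix w assume "w \<in> T'"
      then have "w \<in> set (z1 # xs)" using xs z1T by auto
      then obtain i where i: "i < length (z1 # xs)" "w = (z1 # xs) ! i" by (metis in_set_conv_nth)
      then have "t i = w" "i < cc" using lxs by (auto simp: t_def)
      then show "w \<in> t ` {..<cc}" by blast
    qed
  qed
  have t0: "t 0 \<noteq> 0" using z1 Z(5) by (simp add: t_def)
  define E1 where "E1 = gen (KF \<union> range y \<union> {s} \<union> T')"
  have E1_eq: "E1 = gen (E0 \<union> Z)" by (simp only: E1_def E0_def gen_gen_Un T'_def Un_assoc)
  have FixE1: "Fix (act ` carrier G) F = Fix (act ` carrier G) E1"
  proof
    have "gen (Fix (act ` carrier G) E0 \<union> Z) \<subseteq> Fix (act ` carrier G) E1"
      by (rule gen_least[OF subfld_Fix[OF GGaut]])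
        (use Z(5) in \<open>auto simp: Fix_def E1_eq intro: gen_base\<close>)
    then show "Fix (act ` carrier G) F \<subseteq> Fix (act ` carrier G) E1" unfolding Z(6) .
    have "E0 \<subseteq> F" unfolding F2[symmetric] by (auto intro: gen_base)
    then have "E1 \<subseteq> F" unfolding E1_eq using Z(4) by (intro gen_least) (auto simp: F_def)
    then show "Fix (act ` carrier G) E1 \<subseteq> Fix (act ` carrier G) F" by (auto simp: Fix_def)
  qed

  \<comment> \<open>The fixed field of \<open>\<sigma>\<close>\<close>
  define \<beta> where "\<beta> = pexp (act \<tau>) (y 0)"
  note ft = fh[OF mem(2)]
  have \<beta>0: "\<beta> f \<noteq> 0" for f unfolding \<beta>_def by (rule pexp_nz[OF ft ynz])
  have \<beta>\<sigma>: "act \<sigma> ((act \<tau> ^^ j) (\<beta> f)) = \<eta> powi (k ^ j * poly f k) * (act \<tau> ^^ j) (\<beta> f)" for j f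
  proof (induction f arbitrary: j)
    case 0
    show ?case by (simp add: \<beta>_def pexp_0[OF ft] fhom_1[OF fhom_funpow[OF ft]] fhom_1[OF fh])
  next
    case (pCons a f)
    have e: "(act \<tau> ^^ j) (\<beta> (pCons a f)) = (y j) powi a * (act \<tau> ^^ Suc j) (\<beta> f)"
      by (simp add: \<beta>_def pexp_pCons[OF ft] fhom_simps[OF fhom_funpow[OF ft]] y_pow funpow_swap1)
    have "act \<sigma> ((act \<tau> ^^ j) (\<beta> (pCons a f)))
       = (\<eta> powi (k ^ j) * y j) powi a * (\<eta> powi (k ^ Suc j * poly f k) * (act \<tau> ^^ Suc j) (\<beta> f))"
      unfolding e fhom_mult[OF fh[OF mem(1)]] fhom_powi[OF fh[OF mem(1)]] y\<sigma> pCons.IH ..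
    also have "(\<eta> powi (k ^ j) * y j) powi a = \<eta> powi (k ^ j * a) * y j powi a"
      by (simp only: power_int_mult_distrib power_int_mult)
    also have "\<eta> powi (k ^ j * a) * y j powi a * (\<eta> powi (k ^ Suc j * poly f k) * (act \<tau> ^^ Suc j) (\<beta> f))
       = (\<eta> powi (k ^ j * a) * \<eta> powi (k ^ Suc j * poly f k)) * (act \<tau> ^^ j) (\<beta> (pCons a f))"
      unfolding e by (simp only: mult_ac)
    also have "\<eta> powi (k ^ j * a) * \<eta> powi (k ^ Suc j * poly f k) = \<eta> powi (k ^ j * poly (pCons a f) k)"
      using \<eta>0 by (simp add: power_int_add[symmetric] algebra_simps)
    finally show ?case .
  qed
  have \<beta>\<sigma>': "act \<sigma> (\<beta> f) = \<eta> powi poly f k * \<beta> f" for f using \<beta>\<sigma>[of 0 f] by simp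
  have mm: "mulmod (act \<tau>) (int p ^ d) k \<beta>"
    unfolding mulmod_def using \<beta>0 by (simp add: \<beta>_def pexp_add[OF ft ynz] pexp_pCons[OF ft])
  have \<beta>N: "\<beta> (Norm i) = x i / x0" for i
  proof (induction i)
    case 0 then show ?case using x0(2) by (simp add: Norm_def \<beta>_def pexp_0[OF ft] x_0)
  next
    case (Suc i)
    have "\<beta> (Norm (Suc i)) = \<beta> (Norm i) * y i"
      by (simp add: Norm_def \<beta>_def pexp_add[OF ft ynz] pexp_monom[OF ft] y_pow)
    then show ?case using Suc xnz by (simp add: y_def)
  qed
  \<comment> \<open>This is the part of \<open>E1\<close> fixed by \<open>\<sigma>\<close>; the
    invariants of the group are then those of \<open>\<tau>\<close> in it.\<close>
  define Q where "Q = gen (KF \<union> \<beta> ` {f. int p ^ d dvd poly f k} \<union> {s} \<union> T')"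
  have Fix_eq: "Fix (act ` carrier G) E1 = {w \<in> Q. act \<tau> w = w}"
  proof (intro equalityI subsetI)
    fix w assume w: "w \<in> {w \<in> Q. act \<tau> w = w}"
    have "\<beta> f \<in> E1" for f
      unfolding \<beta>_def E1_def by (rule pexp_in_gen[OF ft]) (auto simp: y_pow intro: gen_base)
    then have "Q \<subseteq> E1" unfolding Q_def by (intro gen_least) (auto simp: E1_def intro: gen_base)
    moreover have "act \<sigma> w = w"
    proof (rule gen_fixed[OF fh[OF mem(1)], of "KF \<union> \<beta> ` {f. int p ^ d dvd poly f k} \<union> {s} \<union> T'"])
      fix v assume "v \<in> KF \<union> \<beta> ` {f. int p ^ d dvd poly f k} \<union> {s} \<union> T'"
      then consider "v \<in> KF" | f where "v = \<beta> f" "int p ^ d dvd poly f k" | "v = s" | "v \<in> T'" by blast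
      then show "act \<sigma> v = v"
        by cases (use s T'f \<eta>iff in \<open>auto simp: act_K \<beta>\<sigma>'\<close>)
    qed (use w in \<open>simp add: Q_def\<close>)
    ultimately show "w \<in> Fix (act ` carrier G) E1"
      using w act_fix_all[of w] by (auto simp: Fix_def)
  next
    fix w assume w: "w \<in> Fix (act ` carrier G) E1"
    define H where "H = generate G {\<sigma>}"
    have H: "subgroup H G" unfolding H_def by (rule generate_is_subgroup) simp
    have Hp: "h \<in> H \<Longrightarrow> \<exists>j::nat. h = \<sigma> [^] j" for h
      unfolding H_def using generate_pow_on_finite_carrier[OF fin mem(1)] by auto
    have HG: "H \<subseteq> carrier G" by (rule subgroup.subset[OF H])
    define E' where "E' = gen (KF \<union> {s} \<union> T')"
    have E': "subfld E'" by (simp add: E'_def)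
    have E'\<sigma>: "act \<sigma> e = e" if "e \<in> E'" for e
      by (rule gen_fixed[OF fh[OF mem(1)], of "KF \<union> {s} \<union> T'"]) (use that s T'f in \<open>auto simp: E'_def act_K\<close>)
    have one: "(1 :: ('a, 'k) ratfun) \<in> KF" by (rule sf_1[OF subfld_KK])
    have E'f: "act h e = e" if "h \<in> H" "e \<in> E'" for h e
      using Hp[OF that(1)] act_pow_eigen[OF mem(1) one, of e] E'\<sigma>[OF that(2)] by auto
    have \<chi>: "\<exists>c\<in>KF. act h (\<beta> f) = c * \<beta> f" if h: "h \<in> H" for h f
    proof -
      obtain j :: nat where j: "h = \<sigma> [^] j" using Hp[OF h] by blast
      show ?thesis unfolding j
        by (intro bexI[of _ "(\<eta> powi poly f k) ^ j"] act_pow_eigen[OF mem(1) \<eta>K \<beta>\<sigma>'] sf_power[OF subfld_KK \<eta>K])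
    qed
    \<comment> \<open>Powers of \<open>\<sigma>\<close> only scale these terms, so an orbit sum is a
      constant multiple of its term, and it can be nonzero only if \<open>\<sigma>\<close> fixes
      \<open>\<beta> f\<close>, that is, if \<open>p^d\<close> divides
      \<open>poly f k\<close>.\<close>
    define S where "S = {e * \<beta> f |e f. e \<in> E'}"
    have KE': "KF \<subseteq> E'" by (auto simp: E'_def intro: gen_base)
    have \<beta>00: "\<beta> 0 = 1" by (simp add: \<beta>_def pexp_0[OF ft])
    have E'S: "E' \<subseteq> S"
    proof
      fix e assume "e \<in> E'"
      moreover have "e = e * \<beta> 0" by (simp add: \<beta>00)
      ultimately show "e \<in> S" unfolding S_def by blast
    qed
    have yS: "y i \<in> S" for i
    proof -
      have "y i = 1 * \<beta> (Polynomial.monom 1 i)" by (simp add: \<beta>_def pexp_monom[OF ft] y_pow)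
      then show ?thesis unfolding S_def using sf_1[OF E'] by blast
    qed
    have "E1 \<subseteq> gen S" unfolding E1_def
      by (rule gen_mono) (use E'S yS in \<open>auto simp: E'_def intro: gen_base\<close>)
    then have "w \<in> gen S" using w by (auto simp: Fix_def)
    moreover have hw: "act h w = w" if "h \<in> H" for h using w HG that by (auto simp: Fix_def)
    ultimately have wg: "w \<in> gen (orbit_sum (act ` H) ` S)"
    proof (intro Fix_gen_mult_closed[OF autgrp_sub[OF H] card_subgroup_nz[OF H]])
      show "1 \<in> S" using E'S sf_1[OF E'] by blast
      fix u assume "u \<in> S"
      then obtain e f where u: "u = e * \<beta> f" "e \<in> E'" unfolding S_def by blast
      have "- u = (- e) * \<beta> f" using u by simp
      then show "- u \<in> S" unfolding S_def using sf_uminus[OF E' u(2)] by blast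
      { fix v assume "v \<in> S"
        then obtain e' f' where v: "v = e' * \<beta> f'" "e' \<in> E'" unfolding S_def by blast
        have "u * v = (e * e') * \<beta> (f + f')" unfolding u v by (simp add: \<beta>_def pexp_add[OF ft ynz])
        then show "u * v \<in> S" unfolding S_def using sf_mult[OF E' u(2) v(2)] by blast }
      fix g assume "g \<in> act ` H"
      then obtain h where h: "h \<in> H" "g = act h" by blast
      obtain c where c: "c \<in> KF" "act h (\<beta> f) = c * \<beta> f" using \<chi>[OF h(1)] by blast
      have "h \<in> carrier G" using h HG by blast
      then have "g u = (e * c) * \<beta> f" unfolding h(2) u(1) by (simp add: fhom_mult[OF fh] E'f[OF h(1) u(2)] c(2))
      moreover have "e * c \<in> E'" using u(2) c(1) KE' by (intro sf_mult[OF E']) auto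
      ultimately show "g u \<in> S" unfolding S_def by blast
    qed auto
    have "orbit_sum (act ` H) ` S \<subseteq> Q"
    proof
      fix m assume "m \<in> orbit_sum (act ` H) ` S"
      then obtain e f where m: "m = orbit_sum (act ` H) (e * \<beta> f)" "e \<in> E'" unfolding S_def by blast
      have "\<exists>c\<in>KF. g (e * \<beta> f) = c * (e * \<beta> f)" if "g \<in> act ` H" for g
      proof -
        obtain h where h: "h \<in> H" "g = act h" using \<open>g \<in> act ` H\<close> by blast
        obtain c where c: "c \<in> KF" "act h (\<beta> f) = c * \<beta> f" using \<chi>[OF h(1)] by blast
        have "h \<in> carrier G" using h HG by blast
        then show ?thesis using c h by (auto simp: fhom_mult[OF fh] E'f[OF h(1) m(2)] intro!: bexI[of _ c])
      qed
      then obtain \<chi> where \<chi>': "\<And>g. g \<in> act ` H \<Longrightarrow> \<chi> g \<in> KF \<and> g (e * \<beta> f) = \<chi> g * (e * \<beta> f)" by metis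
      define c where "c = (\<Sum>g\<in>act ` H. \<chi> g)"
      have cK: "c \<in> KF" unfolding c_def by (rule sf_sum[OF subfld_KK]) (use \<chi>' in blast)
      have mc: "m = c * (e * \<beta> f)"
        unfolding m(1) orbit_sum_def c_def sum_distrib_right by (rule sum.cong) (use \<chi>' in auto)
      have Q: "KF \<subseteq> Q" "E' \<subseteq> Q"
      proof -
        show "KF \<subseteq> Q" by (auto simp: Q_def intro: gen_base)
        show "E' \<subseteq> Q" unfolding E'_def Q_def by (rule gen_mono) auto
      qed
      show "m \<in> Q"
      proof (cases "m = 0")
        case True then show ?thesis by (simp add: Q_def gen_intros)
      next
        case False
        have "act \<sigma> m = m"
          unfolding m(1) by (rule fixed_orbit_sum[OF autgrp_sub[OF H]]) (auto simp: H_def generate.incl)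
        moreover have "act \<sigma> m = \<eta> powi poly f k * m"
          using cK by (simp add: mc fhom_mult[OF fh] act_K E'\<sigma>[OF m(2)] \<beta>\<sigma>' mult_ac)
        ultimately have "\<eta> powi poly f k = 1" using False by (metis mult_cancel_right1)
        then have "int p ^ d dvd poly f k" using \<eta>iff by simp
        then have "\<beta> f \<in> Q" by (auto simp: Q_def intro: gen_base)
        then show ?thesis using Q cK m(2) unfolding mc Q_def by (intro gen_intros) auto
      qed
    qed
    moreover have "subfld Q" by (simp add: Q_def)
    ultimately have "w \<in> Q" using wg gen_least[of Q "orbit_sum (act ` H) ` S"] by (meson subsetD)
    moreover have "act \<tau> w = w" using w by (auto simp: Fix_def)
    ultimately show "w \<in> {w \<in> Q. act \<tau> w = w}" by blast
  qed

  \<comment> \<open>The descent for \<open>\<tau>\<close>\<close>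
  have Ht: "subgroup (generate G {\<tau>}) G" by (rule generate_is_subgroup) simp
  have range: "act ` generate G {\<tau>} = range (\<lambda>i. act \<tau> ^^ i)"
  proof -
    have "act ` generate G {\<tau>} = range (\<lambda>i::nat. act (\<tau> [^] i))"
      using generate_pow_on_finite_carrier[OF fin mem(2)] by auto
    also have "\<dots> = range (\<lambda>i. act \<tau> ^^ i)" using act_pow[OF mem(2), where 'k = 'k] by (simp add: fun_eq_iff image_def)
    finally show ?thesis .
  qed
  interpret C: chain "act \<tau>" KF "act ` generate G {\<tau>}" p k \<xi> P s
    by unfold_locales
      (use ft subfld_KK p l_p0 pk autgrp_sub[OF Ht, where 'k = 'k] range card_subgroup_nz[OF Ht] \<xi> s in \<open>auto simp: act_K\<close>)
  \<comment> \<open>The group order is a power of \<open>p\<close> larger than \<open>n\<close>,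
    hence at least \<open>2 * n\<close>, so \<open>cc\<close> is at least \<open>n\<close>.\<close>
  have big: "p ^ Suc D \<le> p * cc"
  proof -
    have "n < N" using cardT' cc_pos(2) by (simp add: cc_def)
    then have "p ^ Suc D < p ^ \<nu>" by (simp add: n_def N_def card)
    then have "Suc D < \<nu>" using pp by (metis power_less_imp_less_exp)
    then have "p ^ Suc (Suc D) \<le> N"
      unfolding N_def card by (intro power_increasing) (use pp in auto)
    then have "p * n \<le> N" by (simp add: n_def)
    moreover have "2 * n \<le> p * n" using pp by simp
    ultimately have "2 * n \<le> N" by (rule le_trans[rotated])
    then have "n \<le> cc" by (simp add: cc_def)
    then have "n \<le> p * cc" using pp by (metis le_trans mult_le_mono1 nat_mult_1 less_imp_le)
    then show ?thesis by (simp add: n_def)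
  qed
  have tf: "act \<tau> (t e) = t e" if "e < cc" for e
    using t_im that T'f[OF mem(2)] by blast
  have bN: "\<beta> (Norm (p ^ Suc D)) = 1" using \<beta>N[of n] xn x0(2) by (simp add: n_def)
  obtain U where U: "finite U" "card U \<le> p ^ Suc D + cc"
    "{w \<in> gen (KF \<union> \<beta> ` {f. int p ^ d dvd poly f k} \<union> {s} \<union> t ` {..<cc}). act \<tau> w = w} = gen (KF \<union> U)"
    using C.chain[where t = t, OF good \<xi>(3)[unfolded n_def] mm bN tf t0 big] by blast
  have "Fix (act ` carrier G) F = gen (KF \<union> U)"
    unfolding FixE1 Fix_eq Q_def using U(3) unfolding t_im .
  moreover have "card U \<le> card (carrier G)"
    using U(2) cardT' by (simp add: cc_def N_def n_def)
  ultimately show ?thesis unfolding F_def using noether_rationalI[OF U(1)] by blast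
qed

end

section \<open>Central extensions\<close>

lemma prime_dvd_power_minus_self:
  fixes x :: int
  assumes p: "Factorial_Ring.prime (p::nat)"
  shows "int p dvd x ^ p - x"
proof -
  have p0: "p > 0" using p by (rule prime_gt_0_nat)
  have nat: "int p dvd int n ^ p - int n" for n :: nat
  proof (induction n)
    case 0 then show ?case using p0 by (simp add: power_0_left)
  next
    case (Suc n)
    let ?f = "\<lambda>i. of_nat (p choose i) * int n ^ i"
    have "int (Suc n) ^ p = (\<Sum>i\<le>p. ?f i)" using binomial_ring[of "int n" 1 p] by (simp add: add.commute)
    also have "\<dots> = (\<Sum>i\<in>{..p} - {0, p}. ?f i) + (\<Sum>i\<in>{0, p}. ?f i)"
      by (rule sum.subset_diff) auto
    also have "(\<Sum>i\<in>{0, p}. ?f i) = int n ^ p + 1" using p0 by simp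
    finally have "int (Suc n) ^ p - int (Suc n) = (\<Sum>i\<in>{..p} - {0, p}. ?f i) + (int n ^ p - int n)" by simp
    moreover have "int p dvd (\<Sum>i\<in>{..p} - {0, p}. ?f i)"
    proof (rule dvd_sum)
      fix i assume "i \<in> {..p} - {0, p}"
      then have "p dvd p choose i" by (intro dvd_choose_prime[OF _ _ _ p]) auto
      then show "int p dvd ?f i" by (intro dvd_mult2) simp
    qed
    ultimately show ?case using Suc by (simp only: dvd_add)
  qed
  define n where "n = nat (x mod int p)"
  have n: "int n = x mod int p" using p0 by (simp add: n_def)
  have "(x ^ p - x) mod int p = (int n ^ p - int n) mod int p"
    unfolding n by (rule mod_diff_cong) (simp_all add: power_mod)
  then show ?thesis using nat[of n] by (simp add: dvd_eq_mod_eq_0)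
qed

lemma prime_dvd_power_power_minus_self:
  "Factorial_Ring.prime (p::nat) \<Longrightarrow> int p dvd x ^ (p ^ i) - (x::int)"
proof (induction i)
  case (Suc i)
  have "x ^ (p ^ Suc i) - x = ((x ^ (p ^ i)) ^ p - x ^ (p ^ i)) + (x ^ (p ^ i) - x)"
    by (simp add: power_mult[symmetric] mult.commute)
  then show ?case
    using dvd_add[OF prime_dvd_power_minus_self[OF Suc.prems] Suc.IH[OF Suc.prems]] by (simp only:)
qed simp

lemma central_extension_order:
  assumes ce: "central_extension (integer_mod_group q) \<iota> E \<pi> G" and q: "q > 0" and fin: "finite (carrier G)"
  shows "finite (carrier E)" "card (carrier E) = card (carrier G) * q" "card (kernel E G \<pi>) = q"
proof -
  interpret group_hom E G \<pi>
    using ce unfolding central_extension_def group_hom_def group_hom_axioms_def epi_def by auto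
  have surj: "\<pi> ` carrier E = carrier G" using ce by (auto simp: central_extension_def epi_def)
  have "inj_on \<iota> (carrier (integer_mod_group q))" "\<iota> ` carrier (integer_mod_group q) = kernel E G \<pi>"
    using ce by (auto simp: central_extension_def mon_def)
  then have "card (kernel E G \<pi>) = card (carrier (integer_mod_group q))" by (metis card_image)
  then show c: "card (kernel E G \<pi>) = q" using q by (simp add: carrier_integer_mod_group)
  have "bij_betw (\<lambda>C. the_elem (\<pi> ` C)) (rcosets\<^bsub>E\<^esub> kernel E G \<pi>) (carrier G)"
    using FactGroup_iso_set[OF surj] by (simp add: iso_def FactGroup_def)
  then have r: "finite (rcosets\<^bsub>E\<^esub> kernel E G \<pi>)" "card (rcosets\<^bsub>E\<^esub> kernel E G \<pi>) = card (carrier G)"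
    using fin bij_betw_finite bij_betw_same_card by blast+
  have "finite C" if "C \<in> rcosets\<^bsub>E\<^esub> kernel E G \<pi>" for C
    using G.card_rcosets_equal[OF that subgroup.subset[OF subgroup_kernel]] c q by (simp add: card_ge_0_finite)
  then have "finite (\<Union>(rcosets\<^bsub>E\<^esub> kernel E G \<pi>))" using r by blast
  then show "finite (carrier E)" by (simp only: G.rcosets_part_G[OF subgroup_kernel])
  show "card (carrier E) = card (carrier G) * q"
    using G.lagrange[OF subgroup_kernel] r(2) c by (simp add: Coset.order_def)
qed

lemma (in group_hom) generate_lift:
  assumes S: "S \<subseteq> carrier G" and gen: "generate H (h ` S) = carrier H" and ker: "kernel G H h \<subseteq> generate G S"
  shows "generate G S = carrier G"
proof
  show "generate G S \<subseteq> carrier G" by (rule G.generate_incl[OF S])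
  show "carrier G \<subseteq> generate G S"
  proof
    fix g assume g: "g \<in> carrier G"
    then have "h g \<in> h ` generate G S" using gen generate_img[OF S] by auto
    then obtain s where s: "s \<in> generate G S" "h g = h s" by blast
    have sG: "s \<in> carrier G" using G.generate_in_carrier[OF S s(1)] .
    have "g \<otimes> inv s \<in> kernel G H h" using g sG s(2) by (simp add: kernel_def)
    then have "g \<otimes> inv s \<otimes> s \<in> generate G S" using ker s(1) generate.eng by fast
    then show "g \<in> generate G S" using g sG by (simp add: G.m_assoc)
  qed
qed

lemma (in group) commute_generate:
  assumes S: "S \<subseteq> carrier G" and a: "a \<in> carrier G" and c: "\<And>x. x \<in> S \<Longrightarrow> a \<otimes> x = x \<otimes> a"
    and y: "y \<in> generate G S"
  shows "a \<otimes> y = y \<otimes> a"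
  using y
proof induction
  case one then show ?case using a by simp
next
  case (incl h) then show ?case by (rule c)
next
  case (inv h)
  then have h: "h \<in> carrier G" "a \<otimes> h = h \<otimes> a" using S c by blast+
  have "a \<otimes> inv h = inv h \<otimes> (h \<otimes> a) \<otimes> inv h" using h(1) a by (simp add: m_assoc[symmetric])
  also have "\<dots> = inv h \<otimes> a" unfolding h(2)[symmetric] using h(1) a by (simp add: m_assoc)
  finally show ?case .
next
  case (eng g h)
  have "g \<in> carrier G" "h \<in> carrier G" using eng.hyps generate_in_carrier[OF S] by blast+
  then show ?case using a eng.IH by (metis m_assoc)
qed

lemma (in group) comm_group_generate_pair:
  assumes gen: "generate G {a, b} = carrier G" and ab: "a \<in> carrier G" "b \<in> carrier G" and c: "a \<otimes> b = b \<otimes> a"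
  shows "comm_group G"
proof (rule group_comm_groupI)
  have S: "{a, b} \<subseteq> carrier G" using ab by simp
  have 1: "x \<otimes> y = y \<otimes> x" if "x \<in> {a, b}" "y \<in> carrier G" for x y
  proof (rule commute_generate[OF S])
    show "x \<in> carrier G" "y \<in> generate G {a, b}" using that ab gen by auto
    fix w assume "w \<in> {a, b}"
    then show "x \<otimes> w = w \<otimes> x" using that(1) c c[symmetric] by blast
  qed
  fix x y assume xy: "x \<in> carrier G" "y \<in> carrier G"
  show "x \<otimes> y = y \<otimes> x"
    by (rule commute_generate[OF S xy(1)]) (use 1[OF _ xy(1)] xy(2) gen in \<open>metis+\<close>)
qed

lemma (in group) group_exponent_pow:
  assumes fin: "finite (carrier G)" and g: "g \<in> carrier G"
  shows "g [^] group_exponent G = \<one>"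
proof -
  have "0 < Coset.order G \<and> (\<forall>g\<in>carrier G. g [^] Coset.order G = \<one>)"
    using fin pow_order_eq_1 order_gt_0_iff_finite by blast
  then have "0 < group_exponent G \<and> (\<forall>g\<in>carrier G. g [^] group_exponent G = \<one>)"
    unfolding group_exponent_def by (rule LeastI)
  then show ?thesis using g by blast
qed

text \<open>\<open>w\<close> is the central error by which the relation
  \<open>inv t \<otimes> s \<otimes> t = s [^] k\<close> fails. Conjugation by \<open>t\<close>
  sends \<open>s\<close> to \<open>s^k w\<close> and fixes \<open>w\<close>, so it sends
  \<open>q = s^(k-1) w\<close> to \<open>(s^k w)^(k-1) w = s^(k(k-1)) w^k = q^k\<close>: the
  commutator obeys the untwisted relation again.\<close>

lemma (in group) commutator_of_twisted_conjugate:
  fixes k :: int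
  assumes s: "s \<in> carrier G" and t: "t \<in> carrier G" and w: "w \<in> carrier G"
    and central: "\<And>g. g \<in> carrier G \<Longrightarrow> w \<otimes> g = g \<otimes> w"
    and conj: "inv t \<otimes> s \<otimes> t = s [^] k \<otimes> w"
  defines "q \<equiv> s [^] (k - 1) \<otimes> w"
  shows "s \<otimes> t = t \<otimes> s \<otimes> q" "s \<otimes> q = q \<otimes> s" "q \<otimes> t = t \<otimes> q [^] k"
proof -
  have sq: "s \<otimes> q = s [^] k \<otimes> w"
  proof -
    have "s \<otimes> s [^] (k - 1) = s [^] (1 + (k - 1))" by (simp only: int_pow_mult[OF s] int_pow_1[OF s])
    then show ?thesis using s w by (simp add: q_def m_assoc[symmetric])
  qed
  have qG: "q \<in> carrier G" using s w by (simp add: q_def)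
  have "t \<otimes> s \<otimes> q = t \<otimes> (inv t \<otimes> s \<otimes> t)" using s t qG by (simp only: m_assoc sq conj)
  also have "\<dots> = s \<otimes> t" using s t by (simp add: m_assoc[symmetric])
  finally show "s \<otimes> t = t \<otimes> s \<otimes> q" by simp
  have "s [^] (k - 1) \<otimes> s = s [^] (k - 1 + 1)" by (simp only: int_pow_mult[OF s] int_pow_1[OF s])
  then have "q \<otimes> s = s [^] k \<otimes> w" using s w central[OF s] by (simp add: q_def m_assoc) (simp add: m_assoc[symmetric])
  then show "s \<otimes> q = q \<otimes> s" using sq by simp
  define c where "c g = inv t \<otimes> g \<otimes> t" for g
  have "c \<in> hom G G" using conj_hom[OF t] by (simp only: c_def[abs_def])
  then interpret c: group_hom G G c by unfold_locales
  have cs: "c s = s [^] k \<otimes> w" using conj by (simp add: c_def)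
  have "c q = (s [^] k \<otimes> w) [^] (k - 1) \<otimes> c w"
    using s w by (simp add: q_def c.hom_int_pow cs)
  also have "c w = w" using t w by (simp add: c_def m_assoc central) (simp add: m_assoc[symmetric])
  also have "(s [^] k \<otimes> w) [^] (k - 1) = s [^] (k * (k - 1)) \<otimes> w [^] (k - 1)"
    using s w central by (simp add: int_pow_mult_distrib int_pow_pow)
  also have "\<dots> \<otimes> w = s [^] (k * (k - 1)) \<otimes> (w [^] (k - 1) \<otimes> w)" using s w by (simp add: m_assoc)
  also have "w [^] (k - 1) \<otimes> w = w [^] (k - 1 + 1)" by (simp only: int_pow_mult[OF w] int_pow_1[OF w])
  also have "s [^] (k * (k - 1)) \<otimes> w [^] (k - 1 + 1) = q [^] k"
    using s w central by (simp add: q_def int_pow_mult_distrib int_pow_pow mult.commute)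
  finally have "t \<otimes> c q = t \<otimes> q [^] k" by simp
  then show "q \<otimes> t = t \<otimes> q [^] k" using t qG by (simp add: c_def m_assoc[symmetric])
qed

theorem theorem1p5:
  fixes G :: "('g, 'm) monoid_scheme"
    and Gt :: "('h, 'n) monoid_scheme"
    and \<sigma> \<tau> :: 'g
    and \<sigma>t \<tau>t :: 'h
    and \<iota> :: "int \<Rightarrow> 'h"
    and \<pi> :: "'h \<Rightarrow> 'g"
    and p a b c r t m e :: nat
    and \<epsilon> k :: int
  assumes "Factorial_Ring.prime p"
    and "metacyclic G"
    and "\<not> comm_group G"
    and "metacyclic_presentation p a b c k G \<sigma> \<tau>"
    and "group.ord G \<sigma> = p ^ a"
    and "Coset.order G = p ^ (a + b)"
    and "k = \<epsilon> + int p ^ r"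
    and "1 \<le> c" and "c \<le> a"
    and "r \<le> min b c"
    and "odd p \<Longrightarrow> \<epsilon> = 1"
    and "p = 2 \<Longrightarrow> \<epsilon> = 1 \<or> \<epsilon> = -1"
    and "central_extension (integer_mod_group (p ^ t)) \<iota> Gt \<pi> G"
    and "a \<ge> t" and "b \<ge> t"
    and "\<sigma>t \<in> carrier Gt" and "\<tau>t \<in> carrier Gt"
    and "\<pi> \<sigma>t = \<sigma>" and "\<pi> \<tau>t = \<tau>"
    and "group.ord Gt
           (\<sigma>t [^]\<^bsub>Gt\<^esub> (- k) \<otimes>\<^bsub>Gt\<^esub> inv\<^bsub>Gt\<^esub> \<tau>t \<otimes>\<^bsub>Gt\<^esub> \<sigma>t \<otimes>\<^bsub>Gt\<^esub> \<tau>t) = p ^ t"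
    and "p ^ m = group_exponent Gt"
    and "e = max m (r + t)"
    and "CHAR('k::field) = p \<or>
         (CHAR('k) \<noteq> p \<and> infinite (UNIV :: 'k set) \<and>
          (\<exists>z :: 'k. primitive_root_of_unity (p ^ e) z))"
  shows "purely_transcendental (range ratfun_const) (noether_field Gt :: ('h, 'k) ratfun set)"
proof -
  note p = assms(1)
  have pres: "group G" "\<sigma> \<in> carrier G" "\<tau> \<in> carrier G" "generate G {\<sigma>, \<tau>} = carrier G"
    "inv\<^bsub>G\<^esub> \<tau> \<otimes>\<^bsub>G\<^esub> \<sigma> \<otimes>\<^bsub>G\<^esub> \<tau> = \<sigma> [^]\<^bsub>G\<^esub> k"
    using assms(4) by (auto simp: metacyclic_presentation_def metacyclic_relations_def)
  note ce = assms(13)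
  interpret \<pi>: group_hom Gt G \<pi>
    using ce unfolding central_extension_def group_hom_def group_hom_axioms_def epi_def by auto
  have p0: "p > 0" using p by (rule prime_gt_0_nat)
  have cG: "card (carrier G) = p ^ (a + b)" using assms(6) by (simp add: Coset.order_def)
  then have finG: "finite (carrier G)" using p0 by (simp add: card_ge_0_finite)
  have pt: "p ^ t > 0" using p0 by simp
  note ord = central_extension_order[OF ce pt finG]
  have st: "\<sigma>t \<in> carrier Gt" "\<tau>t \<in> carrier Gt" using assms(16,17) .
  define w where "w = \<sigma>t [^]\<^bsub>Gt\<^esub> (- k) \<otimes>\<^bsub>Gt\<^esub> inv\<^bsub>Gt\<^esub> \<tau>t \<otimes>\<^bsub>Gt\<^esub> \<sigma>t \<otimes>\<^bsub>Gt\<^esub> \<tau>t"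
  have w: "w \<in> carrier Gt" using st by (simp add: w_def)
  have conj: "inv\<^bsub>Gt\<^esub> \<tau>t \<otimes>\<^bsub>Gt\<^esub> \<sigma>t \<otimes>\<^bsub>Gt\<^esub> \<tau>t = \<sigma>t [^]\<^bsub>Gt\<^esub> k \<otimes>\<^bsub>Gt\<^esub> w"
    using st by (simp add: w_def \<pi>.G.int_pow_neg \<pi>.G.m_assoc) (simp add: \<pi>.G.m_assoc[symmetric])
  have "\<pi> w = \<sigma> [^]\<^bsub>G\<^esub> (- k) \<otimes>\<^bsub>G\<^esub> (inv\<^bsub>G\<^esub> \<tau> \<otimes>\<^bsub>G\<^esub> \<sigma> \<otimes>\<^bsub>G\<^esub> \<tau>)"
    using st pres(2,3) assms(18,19) by (simp add: w_def \<pi>.hom_int_pow \<pi>.H.m_assoc)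
  also have "\<dots> = \<one>\<^bsub>G\<^esub>" unfolding pres(5) using pres(2) by (simp add: \<pi>.H.int_pow_neg)
  finally have wK: "w \<in> kernel Gt G \<pi>" using w by (simp add: kernel_def)
  then have "w \<in> group_center Gt" using ce by (auto simp: central_extension_def)
  then have central: "w \<otimes>\<^bsub>Gt\<^esub> g = g \<otimes>\<^bsub>Gt\<^esub> w" if "g \<in> carrier Gt" for g
    using that by (simp add: group_center_def)
  define \<theta> where "\<theta> = \<sigma>t [^]\<^bsub>Gt\<^esub> (k - 1) \<otimes>\<^bsub>Gt\<^esub> w"
  have \<theta>: "\<theta> \<in> carrier Gt" using st w by (simp add: \<theta>_def)
  note rel = \<pi>.G.commutator_of_twisted_conjugate[OF st w central conj, folded \<theta>_def]
  \<comment> \<open>The order hypothesis enters here: \<open>w\<close> and the kernel both have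
    order \<open>p^t\<close>. Since \<open>w\<close> is a word in \<open>\<sigma>t\<close> and
    \<open>\<tau>t\<close>, these two generate the kernel as well, and hence the whole
    extension.\<close>
  have genw: "generate Gt {w} = kernel Gt G \<pi>"
  proof (rule card_subset_eq)
    show "finite (kernel Gt G \<pi>)" using ord(3) pt by (simp add: card_ge_0_finite)
    show "generate Gt {w} \<subseteq> kernel Gt G \<pi>" using \<pi>.G.generate_subgroup_incl[OF _ \<pi>.subgroup_kernel] wK by blast
    show "card (generate Gt {w}) = card (kernel Gt G \<pi>)"
      using \<pi>.G.generate_pow_card[OF w] assms(20) ord(3) by (simp add: w_def)
  qed
  have gent: "generate Gt {\<sigma>t, \<tau>t} = carrier Gt"
  proof (rule \<pi>.generate_lift)
    show "{\<sigma>t, \<tau>t} \<subseteq> carrier Gt" using st by simp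
    then have sub: "subgroup (generate Gt {\<sigma>t, \<tau>t}) Gt" by (rule \<pi>.G.generate_is_subgroup)
    show "generate G (\<pi> ` {\<sigma>t, \<tau>t}) = carrier G" using assms(18,19) pres(4) by simp
    have "\<sigma>t \<in> generate Gt {\<sigma>t, \<tau>t}" "\<tau>t \<in> generate Gt {\<sigma>t, \<tau>t}" by (auto intro: generate.incl)
    then have "w \<in> generate Gt {\<sigma>t, \<tau>t}"
      unfolding w_def
      by (intro subgroup.m_closed[OF sub] subgroup.m_inv_closed[OF sub] \<pi>.G.subgroup_int_pow_closed[OF sub])
    then show "kernel Gt G \<pi> \<subseteq> generate Gt {\<sigma>t, \<tau>t}"
      unfolding genw[symmetric] using \<pi>.G.generate_subgroup_incl[OF _ sub] by blast
  qed
  have card: "card (carrier Gt) = p ^ (a + b + t)" using ord(2) by (simp add: cG power_add)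
  have exponent: "g [^]\<^bsub>Gt\<^esub> (p ^ m) = \<one>\<^bsub>Gt\<^esub>" if "g \<in> carrier Gt" for g
    using \<pi>.G.group_exponent_pow[OF ord(1) that] assms(21) by simp
  have cc: "cyclic_commutator Gt \<sigma>t \<tau>t \<theta> k p m (a + b + t)"
    by unfold_locales (use ord(1) st \<theta> gent rel p card exponent in auto)
  show ?thesis
  proof (cases "CHAR('k) = p")
    case True
    then show ?thesis by (rule cyclic_commutator.rational_char_p[OF cc])
  next
    case False
    then obtain z :: 'k where z: "primitive_root_of_unity (p ^ e) z" using assms(23) by blast
    have nz: "of_nat p \<noteq> (0 :: 'k)"
    proof
      assume "of_nat p = (0 :: 'k)"
      then have "CHAR('k) dvd p" by (simp add: of_nat_eq_0_iff_char_dvd)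
      then have "CHAR('k) = 1" using p False by (auto simp: prime_nat_iff)
      then show False using CHAR_not_1'[where 'a = 'k] by simp
    qed
    \<comment> \<open>The projections onto eigenspaces use a root of unity whose order is the
      exponent \<open>p^m\<close>; it is a power of \<open>z\<close> because
      \<open>m \<le> e\<close>.\<close>
    have "prim_root (z ^ (p ^ e div p ^ m)) (p ^ m)"
      by (rule prim_root_power) (use z assms(22) in \<open>simp_all add: primitive_root_of_unity_def le_imp_power_dvd\<close>)
    then obtain z0 :: 'k where z0: "prim_root z0 (p ^ m)" by blast
    have \<theta>1: "\<theta> \<noteq> \<one>\<^bsub>Gt\<^esub>"
    proof
      assume "\<theta> = \<one>\<^bsub>Gt\<^esub>"
      then have "\<sigma>t \<otimes>\<^bsub>Gt\<^esub> \<tau>t = \<tau>t \<otimes>\<^bsub>Gt\<^esub> \<sigma>t" using rel(1) st by simp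
      then have "\<pi> (\<sigma>t \<otimes>\<^bsub>Gt\<^esub> \<tau>t) = \<pi> (\<tau>t \<otimes>\<^bsub>Gt\<^esub> \<sigma>t)" by simp
      then have "\<sigma> \<otimes>\<^bsub>G\<^esub> \<tau> = \<tau> \<otimes>\<^bsub>G\<^esub> \<sigma>" using st assms(18,19) by simp
      then show False using \<pi>.H.comm_group_generate_pair[OF pres(4,2,3)] assms(3) by blast
    qed
    have "\<pi>.G.ord \<theta> dvd p ^ m" using exponent[OF \<theta>] \<theta> by (simp add: \<pi>.G.pow_eq_id)
    then obtain d where d: "\<pi>.G.ord \<theta> = p ^ d" unfolding divides_primepow_nat[OF p] by blast
    have ord_\<theta>: "\<theta> [^]\<^bsub>Gt\<^esub> i = \<one>\<^bsub>Gt\<^esub> \<longleftrightarrow> int (p ^ d) dvd i" for i :: int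
      by (simp only: \<pi>.G.int_pow_eq_id[OF \<theta>] d)
    have d0: "d > 0"
    proof (rule ccontr)
      assume "\<not> d > 0"
      then have "\<theta> [^]\<^bsub>Gt\<^esub> (1 :: int) = \<one>\<^bsub>Gt\<^esub>" using ord_\<theta>[of 1] by simp
      then show False using \<theta>1 \<theta> by (simp only: \<pi>.G.int_pow_1)
    qed
    \<comment> \<open>From \<open>\<tau>t^(p^m) = 1\<close> follows
      \<open>\<theta>^(k^(p^m)) = \<theta>\<close>, so \<open>k^(p^m)\<close> is \<open>1\<close>
      modulo \<open>p\<close>; by Fermat it is also \<open>k\<close> modulo
      \<open>p\<close>.\<close>
    have pk: "int p dvd k - 1"
    proof -
      have pow: "\<theta> \<otimes>\<^bsub>Gt\<^esub> \<tau>t [^]\<^bsub>Gt\<^esub> i = \<tau>t [^]\<^bsub>Gt\<^esub> i \<otimes>\<^bsub>Gt\<^esub> \<theta> [^]\<^bsub>Gt\<^esub> (k ^ i)" for i :: nat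
        using \<pi>.G.int_pow_swap_pow[OF \<theta> st(2) rel(3), of 1 i] \<theta> by simp
      have "\<theta> [^]\<^bsub>Gt\<^esub> (k ^ (p ^ m)) = \<theta>"
        using pow[of "p ^ m"] exponent[OF st(2)] \<theta> by simp
      then have "\<theta> [^]\<^bsub>Gt\<^esub> (k ^ (p ^ m) - 1) = \<one>\<^bsub>Gt\<^esub>"
        using \<theta> by (simp add: \<pi>.G.int_pow_diff)
      then have "int (p ^ d) dvd k ^ (p ^ m) - 1" by (simp only: ord_\<theta>)
      moreover have "int p dvd int (p ^ d)" using d0 by simp
      ultimately have "int p dvd k ^ (p ^ m) - 1" by (rule dvd_trans[rotated])
      from dvd_diff[OF this prime_dvd_power_power_minus_self[OF p, of k m]] show ?thesis by simp
    qed
    obtain D where D: "chain_good p k (Suc D) (int p ^ d)" using chain_good_exists[OF p pk d0] by blast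
    interpret cyclic_commutator Gt \<sigma>t \<tau>t \<theta> k p m "a + b + t" by (rule cc)
    interpret tame Gt \<sigma>t \<tau>t \<theta> k p m "a + b + t" z0 d D
      by unfold_locales (use z0 nz ord_\<theta> d0 pk D in auto)
    show ?thesis by (rule rational_tame)
  qed
qed

end
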